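(* Let $p,r\in L_2(0,1)$ be real-valued and let $T$ and $T_M$ be the operator pencils associated with $p$ and $r$ as described in the context. The following statements are equivalent: (i) The spectra of $T$ and $T_M$ almost interlace. (ii) A real number $\mu_*$ exists such that the operator $T_M(\mu_* )$ is negative.
   Context: For an absolutely continuous function $y$ on $[0,1]$ put $y^{[1]}:=y'-ry$. Define $\ell(y)=-\bigl(y^{[1]}\bigr)'-r y^{[1]}-r^2y$ on $\operatorname{dom}\ell=\{y\in AC[0,1]\mid y^{[1]}\in AC[0,1],\ \ell(y)\in L_2(0,1)\}$ (so $\ell(y)=-y''+qy$ with $q=r'\in W_2^{-1}(0,1)$ in the distributional sense). The operators $A$ and $A_M$ in $L_2(0,1)$ act by $y\mapsto\ell(y)$ on the domains $\operatorname{dom}A=\{y\in\operatorname{dom}\ell\mid y(0)=y(1)=0\}$ and $\operatorname{dom}A_M=\{y\in\operatorname{dom}\ell\mid y(0)=y^{[1]}(1)=0\}$. $B$ is the operator of multiplication by $2p$ in $L_2(0,1)$. The pencils are $T(\lambda)=\lambda^2I-\lambda B-A$ on $\operatorname{dom}A$ and $T_M(\lambda)=\lambda^2I-\lambda B-A_M$ on $\operatorname{dom}A_M$, $\lambda\in\mathbb{C}$. For a pencil $S$ (either $T$ or $T_M$): $\sigma(S)=\{\lambda\in\mathbb{C}\mid 0\in\sigma(S(\lambda))\}$; $\lambda$ is an eigenvalue if $S(\lambda)y_0=0$ for some nonzero $y_0\in\operatorname{dom}S$. Vectors $y_1,\dots,y_{m-1}\in\operatorname{dom}S$ are associated with $y_0$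 if $\sum_{k=0}^{j}\frac1{k!}S^{(k)}(\lambda)y_{j-k}=0$ for $j=1,\dots,m-1$ ($S^{(k)}$ is the $k$-th derivative in $\lambda$). The eigenvalues are geometrically simple ($\dim\ker S(\lambda)=1$), and an eigenvalue is (algebraically) simple if no eigenvector $y_0$ has an associated vector $y_1$. The spectra of $T$ and $T_M$ are said to almost interlace if they consist only of real and simple eigenvalues, which can be labelled in increasing order as $\lambda_n$, $n\in\mathbb{Z}^*:=\mathbb{Z}\setminus\{0\}$ (for $T$), and $\mu_n$, $n\in\mathbb{Z}$ (for $T_M$), so that $\mu_k<\lambda_k<\mu_{k+1}$ for every $k\in\mathbb{Z}^*$. *)

theory Defs
  imports "HOL-Analysis.Analysis"
begin

section \<open>The space $L_2(0,1)$\<close>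

text \<open>
  Elements of $L_2(0,1)$ are represented by square-integrable functions, and equality in
  $L_2(0,1)$ is equality almost everywhere on $(0,1)$.  Values outside $[0,1]$ are irrelevant.
\<close>

abbreviation leb01 :: "real measure" where
  "leb01 \<equiv> lebesgue_on {0<..<1}"

definition L2 :: "(real \<Rightarrow> 'a::{second_countable_topology,banach}) set" where
  "L2 = {f. f \<in> borel_measurable leb01 \<and> integrable leb01 (\<lambda>x. (norm (f x))\<^sup>2)}"

definition l2_eq :: "(real \<Rightarrow> complex) \<Rightarrow> (real \<Rightarrow> complex) \<Rightarrow> bool" where
  "l2_eq f g \<longleftrightarrow> (AE x in leb01. f x = g x)"

definition l2_inner :: "(real \<Rightarrow> complex) \<Rightarrow> (real \<Rightarrow> complex) \<Rightarrow> complex" where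
  "l2_inner f g = (LINT x|leb01. f x * cnj (g x))"

definition l2_norm :: "(real \<Rightarrow> complex) \<Rightarrow> real" where
  "l2_norm f = sqrt (LINT x|leb01. (norm (f x))\<^sup>2)"

section \<open>Operators in $L_2(0,1)$\<close>

text \<open>
  An (unbounded) operator is given by its domain \<open>D\<close> and its action \<open>L\<close>; only the values of
  \<open>L\<close> on \<open>D\<close> matter.
\<close>

type_synonym operator = "(real \<Rightarrow> complex) \<Rightarrow> real \<Rightarrow> complex"

definition op_resolvent_set :: "(real \<Rightarrow> complex) set \<Rightarrow> operator \<Rightarrow> complex set" where
  "op_resolvent_set D L = {z.
     (\<forall>y\<in>D. l2_eq (\<lambda>x. L y x - z * y x) (\<lambda>x. 0) \<longrightarrow> l2_eq y (\<lambda>x. 0)) \<and>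
     (\<forall>f\<in>L2. \<exists>y\<in>D. l2_eq (\<lambda>x. L y x - z * y x) f) \<and>
     (\<exists>C. \<forall>y\<in>D. l2_norm y \<le> C * l2_norm (\<lambda>x. L y x - z * y x))}"

definition op_spectrum :: "(real \<Rightarrow> complex) set \<Rightarrow> operator \<Rightarrow> complex set" where
  "op_spectrum D L = - op_resolvent_set D L"

definition negative_operator :: "(real \<Rightarrow> complex) set \<Rightarrow> operator \<Rightarrow> bool" where
  "negative_operator D L \<longleftrightarrow>
     (\<forall>y\<in>D. \<not> l2_eq y (\<lambda>x. 0) \<longrightarrow> l2_inner (L y) y \<in> \<real> \<and> Re (l2_inner (L y) y) < 0)"

section \<open>Operator pencils\<close>

text \<open>All operators of a pencil \<open>S\<close> have the same domain \<open>D\<close>.\<close>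

type_synonym pencil = "complex \<Rightarrow> operator"

definition pencil_spectrum :: "(real \<Rightarrow> complex) set \<Rightarrow> pencil \<Rightarrow> complex set" where
  "pencil_spectrum D S = {z. 0 \<in> op_spectrum D (S z)}"

definition pencil_eigenvector ::
    "(real \<Rightarrow> complex) set \<Rightarrow> pencil \<Rightarrow> complex \<Rightarrow> (real \<Rightarrow> complex) \<Rightarrow> bool" where
  "pencil_eigenvector D S z y \<longleftrightarrow>
     y \<in> D \<and> \<not> l2_eq y (\<lambda>x. 0) \<and> l2_eq (S z y) (\<lambda>x. 0)"

definition pencil_eigenvalue :: "(real \<Rightarrow> complex) set \<Rightarrow> pencil \<Rightarrow> complex \<Rightarrow> bool" where
  "pencil_eigenvalue D S z \<longleftrightarrow> (\<exists>y. pencil_eigenvector D S z y)"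

text \<open>The \<open>k\<close>-th derivative in the spectral parameter, taken pointwise in \<open>x\<close>.\<close>

definition pencil_deriv :: "nat \<Rightarrow> pencil \<Rightarrow> pencil" where
  "pencil_deriv k S z y = (\<lambda>x. (deriv ^^ k) (\<lambda>w. S w y x) z)"

text \<open>The vectors \<open>y 1, \<dots>, y (m - 1)\<close> are associated with \<open>y 0\<close>.\<close>

definition associated_vectors ::
    "(real \<Rightarrow> complex) set \<Rightarrow> pencil \<Rightarrow> complex \<Rightarrow> nat \<Rightarrow> (nat \<Rightarrow> real \<Rightarrow> complex) \<Rightarrow> bool" where
  "associated_vectors D S z m y \<longleftrightarrow>
     (\<forall>j\<in>{1..<m}. y j \<in> D \<and>
        l2_eq (\<lambda>x. \<Sum>k\<le>j. 1 / fact k * pencil_deriv k S z (y (j - k)) x) (\<lambda>x. 0))"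

definition pencil_simple_eigenvalue ::
    "(real \<Rightarrow> complex) set \<Rightarrow> pencil \<Rightarrow> complex \<Rightarrow> bool" where
  "pencil_simple_eigenvalue D S z \<longleftrightarrow>
     pencil_eigenvalue D S z \<and>
     \<not> (\<exists>y. pencil_eigenvector D S z (y 0) \<and> associated_vectors D S z 2 y)"

text \<open>The labels of the first pencil range over the nonzero integers (\<open>lam 0\<close> is unused).\<close>

definition almost_interlace ::
    "(real \<Rightarrow> complex) set \<Rightarrow> pencil \<Rightarrow> (real \<Rightarrow> complex) set \<Rightarrow> pencil \<Rightarrow> bool" where
  "almost_interlace D S D' S' \<longleftrightarrow>
     (\<forall>z\<in>pencil_spectrum D S. z \<in> \<real> \<and> pencil_simple_eigenvalue D S z) \<and>
     (\<forall>z\<in>pencil_spectrum D' S'. z \<in> \<real> \<and> pencil_simple_eigenvalue D' S' z) \<and>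
     (\<exists>lam mu :: int \<Rightarrow> real.
        strict_mono_on (- {0}) lam \<and> strict_mono mu \<and>
        pencil_spectrum D S = complex_of_real ` lam ` (- {0}) \<and>
        pencil_spectrum D' S' = complex_of_real ` range mu \<and>
        (\<forall>k. k \<noteq> 0 \<longrightarrow> mu k < lam k \<and> lam k < mu (k + 1)))"

section \<open>The differential expression and the pencils $T$ and $T_M$\<close>

text \<open>
  The usual $\varepsilon$-$\delta$ definition of absolute continuity; a division consists of
  finitely many non-overlapping intervals $[\mathrm{Inf}\,k, \mathrm{Sup}\,k]$.
\<close>

definition abs_continuous_on :: "real set \<Rightarrow> (real \<Rightarrow> complex) \<Rightarrow> bool" where
  "abs_continuous_on A f \<longleftrightarrow>
     (\<forall>\<epsilon>>0. \<exists>\<delta>>0. \<forall>d t. d division_of t \<and> t \<subseteq> A \<and> (\<Sum>k\<in>d. Sup k - Inf k) < \<delta>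
        \<longrightarrow> (\<Sum>k\<in>d. norm (f (Sup k) - f (Inf k))) < \<epsilon>)"

text \<open>
  $y^{[1]} = y' - ry$ is only determined almost everywhere.  \<open>is_quasi_deriv r y u\<close> says that \<open>u\<close>
  is an absolutely continuous representative; it is unique on $[0,1]$, so that the pointwise value
  $y^{[1]}(1)$ makes sense.
\<close>

definition is_quasi_deriv ::
    "(real \<Rightarrow> real) \<Rightarrow> (real \<Rightarrow> complex) \<Rightarrow> (real \<Rightarrow> complex) \<Rightarrow> bool" where
  "is_quasi_deriv r y u \<longleftrightarrow>
     abs_continuous_on {0..1} u \<and>
     (AE x in leb01. u x = vector_derivative y (at x) - complex_of_real (r x) * y x)"

definition quasi_deriv :: "(real \<Rightarrow> real) \<Rightarrow> (real \<Rightarrow> complex) \<Rightarrow> real \<Rightarrow> complex" where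
  "quasi_deriv r y = (SOME u. is_quasi_deriv r y u)"

definition ell :: "(real \<Rightarrow> real) \<Rightarrow> operator" where
  "ell r y = (\<lambda>x. - vector_derivative (quasi_deriv r y) (at x)
                   - complex_of_real (r x) * quasi_deriv r y x
                   - (complex_of_real (r x))\<^sup>2 * y x)"

definition dom_ell :: "(real \<Rightarrow> real) \<Rightarrow> (real \<Rightarrow> complex) set" where
  "dom_ell r = {y. abs_continuous_on {0..1} y \<and> (\<exists>u. is_quasi_deriv r y u) \<and> ell r y \<in> L2}"

definition dom_A :: "(real \<Rightarrow> real) \<Rightarrow> (real \<Rightarrow> complex) set" where
  "dom_A r = {y \<in> dom_ell r. y 0 = 0 \<and> y 1 = 0}"

definition dom_A_M :: "(real \<Rightarrow> real) \<Rightarrow> (real \<Rightarrow> complex) set" where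
  "dom_A_M r = {y \<in> dom_ell r. y 0 = 0 \<and> quasi_deriv r y 1 = 0}"

definition op_B :: "(real \<Rightarrow> real) \<Rightarrow> operator" where
  "op_B p y = (\<lambda>x. complex_of_real (2 * p x) * y x)"

text \<open>
  $\lambda^2 I - \lambda B - \ell$.  The pencils $T$ and $T_M$ are both given by this expression,
  on the domains \<open>dom_A r\<close> and \<open>dom_A_M r\<close>, respectively.
\<close>

definition energy_pencil :: "(real \<Rightarrow> real) \<Rightarrow> (real \<Rightarrow> real) \<Rightarrow> pencil" where
  "energy_pencil p r z y = (\<lambda>x. z\<^sup>2 * y x - z * op_B p y x - ell r y x)"

end

theory Submission
  imports Defs "HOL-Computational_Algebra.Fundamental_Theorem_Algebra" "HOL-Complex_Analysis.Great_Picard"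
begin

text \<open>
  Let \<open>s\<close> be the solution of \<open>T(z) s = 0\<close> with \<open>s(0) = 0\<close> and \<open>s\<^sup>[\<^sup>1\<^sup>](0) = 1\<close>.  The spectra of \<open>T\<close> and
  \<open>T\<^sub>M\<close> are the zeros of \<open>s(1)\<close> and of \<open>s\<^sup>[\<^sup>1\<^sup>](1)\<close> as functions of \<open>z\<close>, and a zero is a simple eigenvalue iff
  \<open>D(z) = \<integral> (2 z - 2 p) s\<^sup>2\<close> does not vanish there.  For real \<open>z\<close> consider the angle of the vector
  \<open>(s\<^sup>[\<^sup>1\<^sup>](1), s(1))\<close>, counted in quarter turns.  It tends to infinity for \<open>z \<rightarrow> \<plusminus>\<infinity>\<close>, and it crosses
  an integer upwards if \<open>D > 0\<close> and downwards if \<open>D < 0\<close>.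

  If \<open>T\<^sub>M(\<mu>)\<close> is negative, all eigenvalues are real and satisfy \<open>(z - \<mu>) D(z) > 0\<close>, so that on either side of
  \<open>\<mu>\<close> every level above the initial one is crossed exactly once, in increasing order.  Conversely, almost
  interlacing spectra force neighbouring crossings to have the same direction, which must be upwards, seen from a
  point \<open>\<mu>\<close> between \<open>\<mu>\<^sub>0\<close> and \<open>\<mu>\<^sub>1\<close>, because the angle is unbounded.  Hence \<open>(z - \<mu>) D(z) > 0\<close> for all eigenvalues
  of \<open>T\<^sub>M\<close>, and \<open>T\<^sub>M(\<mu>)\<close> is negative: otherwise a Pontryagin type argument would yield an eigenvalue of
  nonpositive type.
\<close>

subsection \<open>Differentiation of indefinite integrals\<close>

text \<open>Two obstacles shape the development. The data are rough: \<open>r^2\<close> is merely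
  integrable, while the domains use the epsilon-delta notion of absolute continuity and a
  quasi-derivative known only almost everywhere. Hence absolute continuity is shown to be equivalent
  to being an indefinite integral, and the equation is treated as a first-order system with
  integrable coefficients. The second obstacle is an eigenvalue of nonpositive type in infinite
  dimension. It is found by compression to finite-dimensional spaces, where the linearised pencil is
  symmetric for an indefinite form, and by a compactness limit. The same result takes the place of a
  density argument when negativity on the operator domain is extended to the form domain. The angle
  is unbounded at both ends because \<open>y\<close> is scaled by \<open>sqrt (1 + l^2)\<close>: the
  angle differs from that scale by a bounded amount. The absence of the label 0 for \<open>T\<close>
  also has a reason: where \<open>T_M\<close> is negative, the product of the two boundary values of
  the shooting solution is positive, so the nearest level on either side belongs to
  \<open>T_M\<close>.\<close>

lemma vitali_measure_comparison:
  fixes N :: "real measure" and c :: ennreal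
  assumes sets: "sets N = sets lebesgue" and G: "G \<in> sets lebesgue" "open G" and A: "A \<subseteq> G"
    and ivl: "\<And>x d. x \<in> A \<Longrightarrow> 0 < d \<Longrightarrow>
      \<exists>a b. a \<le> x \<and> x \<le> b \<and> a < b \<and> b - a < d \<and> c * ennreal (b - a) \<le> emeasure N {a..b}"
  obtains T where "T \<in> sets lebesgue" "A \<subseteq> T" "c * emeasure lebesgue T \<le> emeasure N G"
proof -
  \<comment> \<open>\<open>K\<close> collects the intervals on which \<open>N\<close> is at least
    \<open>c\<close> times the length. By Vitali a disjoint countable subfamily covers
    \<open>A\<close> up to a null set, and countable additivity adds up the inequalities.
    \<open>A\<close> may be non-measurable, hence the superset \<open>T\<close>.\<close>
  define K where "K = {(a, b). a < b \<and> {a..b} \<subseteq> G \<and> c * ennreal (b - a) \<le> emeasure N {a..b}}"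
  define m where "m = (\<lambda>(a::real, b). (a + b) / 2)"
  define r where "r = (\<lambda>(a::real, b). (b - a) / 2)"
  have cb: "cball (m i) (r i) = {fst i..snd i}" for i
    by (cases i) (simp add: m_def r_def cball_eq_atLeastAtMost field_simps)
  obtain C where C: "countable C" "C \<subseteq> K"
    "pairwise (\<lambda>i j. disjnt (cball (m i) (r i)) (cball (m j) (r j))) C"
    "negligible (A - (\<Union>i\<in>C. cball (m i) (r i)))"
  proof (rule Vitali_covering_theorem_cballs[of K r A m])
    show "0 < r i" if "i \<in> K" for i
      using that by (auto simp: K_def r_def)
    fix x d :: real assume x: "x \<in> A" and d: "0 < d"
    obtain e where e: "e > 0" "ball x e \<subseteq> G"
      using A G(2) x open_contains_ball by blast
    obtain a b where ab: "a \<le> x" "x \<le> b" "a < b" "b - a < min d e"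
      "c * ennreal (b - a) \<le> emeasure N {a..b}"
      using ivl[OF x, of "min d e"] d e by auto
    have "{a..b} \<subseteq> ball x e"
      using ab by (auto simp: dist_real_def)
    then have "(a, b) \<in> K"
      using ab e by (auto simp: K_def)
    then show "\<exists>i. i \<in> K \<and> x \<in> cball (m i) (r i) \<and> r i < d"
      using ab by (intro exI[of _ "(a, b)"]) (auto simp: cb, auto simp: r_def)
  qed
  define J where "J = (\<lambda>i::real \<times> real. {fst i..snd i})"
  have disj: "disjoint_family_on J C"
    using C(3) unfolding disjoint_family_on_def pairwise_def disjnt_def cb J_def by blast
  define T where "T = (A - (\<Union>i\<in>C. J i)) \<union> (\<Union>i\<in>C. J i)"
  have null: "A - (\<Union>i\<in>C. J i) \<in> null_sets lebesgue"
    using C(4) unfolding cb J_def by (simp add: negligible_iff_null_sets)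
  have UJ: "(\<Union>i\<in>C. J i) \<in> sets lebesgue"
    using C(1) by (intro sets.countable_UN') (auto simp: J_def)
  have "c * emeasure lebesgue T = c * emeasure lebesgue (\<Union>i\<in>C. J i)"
    unfolding T_def using emeasure_Un_null_set[OF UJ null] by (subst Un_commute) metis
  also have "\<dots> = c * (\<integral>\<^sup>+ i. emeasure lebesgue (J i) \<partial>count_space C)"
    by (subst emeasure_UN_countable) (use C disj in \<open>auto simp: J_def\<close>)
  also have "\<dots> = (\<integral>\<^sup>+ i. c * emeasure lebesgue (J i) \<partial>count_space C)"
    by (rule nn_integral_cmult[symmetric]) auto
  also have "\<dots> \<le> (\<integral>\<^sup>+ i. emeasure N (J i) \<partial>count_space C)"
    by (intro nn_integral_mono) (use C(2) in \<open>auto simp: J_def K_def less_imp_le\<close>)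
  also have "\<dots> = emeasure N (\<Union>i\<in>C. J i)"
    by (subst emeasure_UN_countable) (use C disj sets in \<open>auto simp: J_def\<close>)
  also have "\<dots> \<le> emeasure N G"
    using C(2) G sets by (intro emeasure_mono) (fastforce simp: J_def K_def)+
  moreover have "T \<in> sets lebesgue"
    unfolding T_def using null UJ by blast
  ultimately show thesis
    by (intro that[of T]) (auto simp: T_def)
qed

text \<open>Absolute continuity of the integral by truncation: the part of \<open>g\<close> above a
  height \<open>n\<close> has small integral, and the part below it contributes at most
  \<open>n\<close> times the measure of \<open>S\<close>.\<close>

lemma set_lintegral_small:
  fixes g :: "real \<Rightarrow> real"
  assumes g: "integrable lebesgue g" "\<And>x. 0 \<le> g x" and e: "e > 0"
  obtains d where "d > 0"
    "\<And>S. S \<in> sets lebesgue \<Longrightarrow> emeasure lebesgue S < ennreal d \<Longrightarrow>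
      emeasure (density lebesgue (\<lambda>x. ennreal (g x))) S < ennreal e"
proof -
  have lim: "(\<lambda>n. LINT x|lebesgue. g x - min (g x) (real n)) \<longlonglongrightarrow> (LINT x::real|lebesgue. 0)"
  proof (rule integral_dominated_convergence[where w = g])
    have [measurable]: "g \<in> borel_measurable lebesgue" using g by auto
    show "(\<lambda>x. g x - min (g x) (real n)) \<in> borel_measurable lebesgue" for n by measurable
    show "AE x in lebesgue. (\<lambda>n. g x - min (g x) (real n)) \<longlonglongrightarrow> 0"
    proof (intro AE_I2)
      fix x
      have "eventually (\<lambda>n. g x - min (g x) (real n) = 0) sequentially"
        using eventually_ge_at_top[of "nat \<lceil>g x\<rceil>"] by eventually_elim linarith
      then show "(\<lambda>n. g x - min (g x) (real n)) \<longlonglongrightarrow> 0"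
        by (rule tendsto_eventually)
    qed
  qed (use g in \<open>auto simp: min_def\<close>)
  then have "eventually (\<lambda>n. (LINT x|lebesgue. g x - min (g x) (real n)) < e / 2) sequentially"
    using e by (intro order_tendstoD(2)) auto
  then obtain n where n: "(LINT x|lebesgue. g x - min (g x) (real n)) < e / 2"
    by (auto simp: eventually_sequentially)
  have meas [measurable]: "g \<in> borel_measurable lebesgue"
    using g by auto
  have int: "integrable lebesgue (\<lambda>x. g x - min (g x) (real n))"
    by (rule Bochner_Integration.integrable_bound[OF g(1)]) (use g in \<open>auto simp: min_def\<close>)
  show thesis
  \<comment> \<open>With this bound on the measure the truncated part contributes at most
    \<open>e / 2\<close>; the summand 1 covers \<open>n = 0\<close>.\<close>
  proof (rule that[of "e / (2 * (real n + 1))"])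
    show "0 < e / (2 * (real n + 1))" using e by simp
    fix S :: "real set" assume S [measurable]: "S \<in> sets lebesgue"
      and small: "emeasure lebesgue S < ennreal (e / (2 * (real n + 1)))"
    have "emeasure (density lebesgue (\<lambda>x. ennreal (g x))) S
        = (\<integral>\<^sup>+ x. ennreal (g x) * indicator S x \<partial>lebesgue)"
      by (simp add: emeasure_density)
    also have "\<dots> \<le> (\<integral>\<^sup>+ x. ennreal (g x - min (g x) (real n)) + ennreal (real n) * indicator S x \<partial>lebesgue)"
      by (intro nn_integral_mono) (use g in \<open>auto simp: indicator_def min_def simp flip: ennreal_plus\<close>)
    also have "\<dots> = (\<integral>\<^sup>+ x. ennreal (g x - min (g x) (real n)) \<partial>lebesgue) + ennreal (real n) * emeasure lebesgue S"
      by (subst nn_integral_add) (auto simp: nn_integral_cmult)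
    also have "(\<integral>\<^sup>+ x. ennreal (g x - min (g x) (real n)) \<partial>lebesgue) = ennreal (LINT x|lebesgue. g x - min (g x) (real n))"
      by (rule nn_integral_eq_integral[OF int]) (auto simp: min_def)
    also have "\<dots> + ennreal (real n) * emeasure lebesgue S \<le>
        ennreal (LINT x|lebesgue. g x - min (g x) (real n)) + ennreal (e / 2)"
    proof (rule add_left_mono)
      have "ennreal (real n) * emeasure lebesgue S \<le> ennreal (real n) * ennreal (e / (2 * (real n + 1)))"
        using small by (intro mult_left_mono) auto
      also have "\<dots> = ennreal (real n * (e / (2 * (real n + 1))))"
        using e by (intro ennreal_mult[symmetric]) auto
      also have "\<dots> \<le> ennreal (e / 2)"
        using e by (intro ennreal_leI) (simp add: field_simps)
      finally show "ennreal (real n) * emeasure lebesgue S \<le> ennreal (e / 2)" .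
    qed
    also have "\<dots> = ennreal ((LINT x|lebesgue. g x - min (g x) (real n)) + e / 2)"
      using e by (intro ennreal_plus[symmetric] integral_nonneg_AE) (auto simp: min_def)
    also have "\<dots> < ennreal e"
      using n e by (intro ennreal_lessI) auto
    finally show "emeasure (density lebesgue (\<lambda>x. ennreal (g x))) S < ennreal e" .
  qed
qed

lemma emeasure_density_Icc:
  fixes g :: "real \<Rightarrow> real"
  assumes g: "integrable lebesgue g" "\<And>x. 0 \<le> g x"
  shows "emeasure (density lebesgue (\<lambda>x. ennreal (g x))) {a..b} = ennreal (integral {a..b} g)"
proof -
  have [measurable]: "g \<in> borel_measurable lebesgue"
    using g by auto
  have si: "set_integrable lebesgue {a..b} g"
    unfolding set_integrable_def using g by (intro integrable_mult_indicator) auto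
  have "emeasure (density lebesgue (\<lambda>x. ennreal (g x))) {a..b}
      = (\<integral>\<^sup>+ x. ennreal (indicator {a..b} x *\<^sub>R g x) \<partial>lebesgue)"
    by (subst emeasure_density) (auto intro!: nn_integral_cong simp: indicator_def)
  also have "\<dots> = ennreal (LINT x:{a..b}|lebesgue. g x)"
    unfolding set_lebesgue_integral_def
    using si g(2) unfolding set_integrable_def by (intro nn_integral_eq_integral) auto
  also have "(LINT x:{a..b}|lebesgue. g x) = integral {a..b} g"
    by (rule set_lebesgue_integral_eq_integral(2)[OF si])
  finally show ?thesis .
qed

text \<open>The zero set of \<open>g\<close> has mass 0 for the measure with density
  \<open>g\<close>, so it has open neighbourhoods \<open>G\<close> of arbitrarily small mass. Vitali
  comparison turns intervals of average at least \<open>t\<close> into \<open>t\<close> times an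
  outer measure, which is therefore arbitrarily small too.\<close>

lemma negligible_upper_density:
  fixes g :: "real \<Rightarrow> real"
  assumes g: "integrable lebesgue g" "\<And>x. 0 \<le> g x" and t: "t > 0"
  shows "negligible {x. g x = 0 \<and> (\<forall>d>0. \<exists>a b. a \<le> x \<and> x \<le> b \<and> a < b \<and> b - a < d \<and>
           t * (b - a) \<le> integral {a..b} g)}" (is "negligible ?A")
  unfolding negligible_outer_le
proof (intro allI impI)
  fix e :: real assume e: "e > 0"
  let ?N = "density lebesgue (\<lambda>x. ennreal (g x))"
  have [measurable]: "g \<in> borel_measurable lebesgue"
    using g by auto
  define E where "E = {x. g x = 0}"
  have E: "E \<in> sets lebesgue"
    using borel_measurable_vimage[of g lebesgue 0] by (simp add: E_def vimage_def)
  obtain d where d: "d > 0" "\<And>S. S \<in> sets lebesgue \<Longrightarrow> emeasure lebesgue S < ennreal d \<Longrightarrow>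
      emeasure ?N S < ennreal (t * e)"
    using set_lintegral_small[OF g, of "t * e"] e t by auto
  obtain G where G: "open G" "E \<subseteq> G" "G - E \<in> lmeasurable" "emeasure lebesgue (G - E) < ennreal d"
    using sets_lebesgue_outer_open[OF E d(1)] by blast
  have Gs: "G \<in> sets lebesgue" using G by auto
  have "emeasure ?N G = emeasure ?N E + emeasure ?N (G - E)"
    using G E Gs by (subst plus_emeasure) (auto intro: arg_cong[where f = "emeasure ?N"])
  also have "emeasure ?N E = 0"
    using E by (subst emeasure_density) (auto simp: E_def indicator_def nn_integral_0_iff_AE)
  finally have NG: "emeasure ?N G \<le> ennreal (t * e)"
    using d(2)[of "G - E"] G E Gs by (auto simp: less_imp_le)
  obtain T where T: "T \<in> sets lebesgue" "?A \<subseteq> T" "ennreal t * emeasure lebesgue T \<le> emeasure ?N G"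
  proof (rule vitali_measure_comparison[of ?N G ?A "ennreal t"])
    fix x d :: real assume x: "x \<in> ?A" and d: "0 < d"
    then obtain a b where ab: "a \<le> x" "x \<le> b" "a < b" "b - a < d" "t * (b - a) \<le> integral {a..b} g"
      by blast
    have "ennreal t * ennreal (b - a) = ennreal (t * (b - a))"
      using t ab by (simp add: ennreal_mult)
    also have "\<dots> \<le> emeasure ?N {a..b}"
      unfolding emeasure_density_Icc[OF g] using ab by (intro ennreal_leI)
    finally show "\<exists>a b. a \<le> x \<and> x \<le> b \<and> a < b \<and> b - a < d \<and>
        ennreal t * ennreal (b - a) \<le> emeasure ?N {a..b}"
      using ab by blast
  qed (use G Gs in \<open>auto simp: E_def\<close>)
  have "ennreal t * emeasure lebesgue T \<le> ennreal t * ennreal e"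
    using T(3) NG t e by (simp add: ennreal_mult)
  then have le: "emeasure lebesgue T \<le> ennreal e"
    using t by (subst (asm) ennreal_mult_le_mult_iff) auto
  then have "T \<in> lmeasurable"
    using T(1) by (intro fmeasurableI) (auto simp: order_le_less_trans)
  moreover have "measure lebesgue T \<le> e"
    using le e by (metis enn2real_leI less_imp_le measure_def)
  ultimately show "\<exists>T. ?A \<subseteq> T \<and> T \<in> lmeasurable \<and> measure lebesgue T \<le> e"
    using T(2) by blast
qed

text \<open>The upper half of Lebesgue's differentiation theorem. At a bad point take a rational
  \<open>q\<close> between \<open>f x\<close> and \<open>f x + e / 2\<close>: the positive part of
  \<open>f - q\<close> vanishes at \<open>x\<close>, yet has averages of at least a rational
  \<open>t\<close> on arbitrarily short intervals. Countably many pairs \<open>(q, t)\<close> cover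
  all bad points.\<close>

lemma negligible_upper_average:
  fixes f :: "real \<Rightarrow> real"
  assumes f: "f absolutely_integrable_on {0..1}"
  shows "negligible {x \<in> {0..1}. \<not> (\<forall>e>0. \<exists>d>0. \<forall>a b. 0 \<le> a \<and> a \<le> x \<and> x \<le> b \<and> b \<le> 1 \<and> a < b \<and> b - a < d \<longrightarrow>
           integral {a..b} f \<le> (f x + e) * (b - a))}" (is "negligible ?B")
proof -
  define g where "g = (\<lambda>q x. if x \<in> {0..1} then max 0 (f x - q) else 0)"
  define A where "A = (\<lambda>q t. {x. g q x = 0 \<and> (\<forall>d>0. \<exists>a b. a \<le> x \<and> x \<le> b \<and> a < b \<and> b - a < d \<and>
           t * (b - a) \<le> integral {a..b} (g q))})"
  have "(\<lambda>x. max 0 (f x - q)) absolutely_integrable_on {0..1}" for q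
    by (intro absolutely_integrable_max_1 set_integral_diff(1) f) auto
  then have gi: "integrable lebesgue (g q)" for q
    unfolding set_integrable_def g_def indicator_def
    by (rule Bochner_Integration.integrable_cong[THEN iffD1, rotated -1]) auto
  have neg: "negligible (\<Union>((\<lambda>(q, t). A q t) ` (\<rat> \<times> (\<rat> \<inter> {0<..}))))"
  proof (intro negligible_countable_Union countable_image countable_SIGMA countable_rat countable_Int1)
    fix S assume "S \<in> (\<lambda>(q, t). A q t) ` (\<rat> \<times> (\<rat> \<inter> {0<..}))"
    then obtain q t where "S = A q t" "t > 0" by auto
    then show "negligible S"
      unfolding A_def using negligible_upper_density[OF gi, of q t] by (simp add: g_def)
  qed
  show ?thesis
  proof (rule negligible_subset[OF neg], rule subsetI)
    fix x assume "x \<in> ?B"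
    then obtain e where x: "0 \<le> x" "x \<le> 1" and e: "e > 0"
      and bad: "\<And>d. d > 0 \<Longrightarrow> \<exists>a b. 0 \<le> a \<and> a \<le> x \<and> x \<le> b \<and> b \<le> 1 \<and> a < b \<and> b - a < d \<and>
           (f x + e) * (b - a) < integral {a..b} f"
      by (auto simp: not_le)
    obtain q where q: "q \<in> \<rat>" "f x < q" "q < f x + e / 2"
      using Rats_dense_in_real[of "f x" "f x + e / 2"] e by auto
    obtain t where t: "t \<in> \<rat>" "0 < t" "t < e / 2"
      using Rats_dense_in_real[of 0 "e / 2"] e by auto
    have "x \<in> A q t"
      unfolding A_def
    proof (intro CollectI conjI allI impI)
      show "g q x = 0" using q by (simp add: g_def)
      fix d :: real assume "d > 0"
      then obtain a b where ab: "0 \<le> a" "a \<le> x" "x \<le> b" "b \<le> 1" "a < b" "b - a < d"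
           "(f x + e) * (b - a) < integral {a..b} f"
        using bad by blast
      have fi: "f integrable_on {a..b}"
        using f ab by (intro integrable_on_subinterval[OF set_lebesgue_integral_eq_integral(1)]) auto
      have gi': "g q integrable_on {a..b}"
        using integrable_on_lebesgue[OF gi[of q]] integrable_on_subinterval by blast
      have "t * (b - a) \<le> (e / 2) * (b - a)"
        using t ab by (intro mult_right_mono) auto
      also have "\<dots> \<le> (f x + e - q) * (b - a)"
        using q ab by (intro mult_right_mono) auto
      also have "\<dots> \<le> integral {a..b} f - q * (b - a)"
        using ab by (simp add: algebra_simps)
      also have "\<dots> = integral {a..b} (\<lambda>x. f x - q)"
        using fi ab by (subst integral_diff) auto
      also have "\<dots> \<le> integral {a..b} (g q)"
        using fi ab by (intro integral_le gi' integrable_diff) (auto simp: g_def)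
      finally show "\<exists>a b. a \<le> x \<and> x \<le> b \<and> a < b \<and> b - a < d \<and> t * (b - a) \<le> integral {a..b} (g q)"
        using ab by blast
    qed
    then show "x \<in> (\<Union>((\<lambda>(q, t). A q t) ` (\<rat> \<times> (\<rat> \<inter> {0<..}))))"
      using q t by auto
  qed
qed

text \<open>The upper estimate for \<open>f\<close> and for \<open>- f\<close> bounds averages from
  both sides. Its intervals may have \<open>x\<close> as an end point, so they cover the difference
  quotients on either side.\<close>

lemma negligible_not_deriv_indefinite_integral_real:
  fixes f :: "real \<Rightarrow> real"
  assumes f: "f absolutely_integrable_on {0..1}"
  shows "negligible {x \<in> {0<..<1}. \<not> ((\<lambda>x. integral {0..x} f) has_real_derivative f x) (at x)}"
proof (rule negligible_subset[OF negligible_Un[OF negligible_upper_average[OF f]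
        negligible_upper_average[of "\<lambda>x. - f x"]]], goal_cases)
  case 1
  show ?case using f by (simp add: set_integrable_def)
next
  case 2
  show ?case
  proof (rule subsetI, rule ccontr)
    fix x assume x: "x \<in> {x \<in> {0<..<1}. \<not> ((\<lambda>x. integral {0..x} f) has_real_derivative f x) (at x)}"
      and "x \<notin> {x \<in> {0..1}. \<not> (\<forall>e>0. \<exists>d>0. \<forall>a b. 0 \<le> a \<and> a \<le> x \<and> x \<le> b \<and> b \<le> 1 \<and> a < b \<and> b - a < d \<longrightarrow>
             integral {a..b} f \<le> (f x + e) * (b - a))} \<union>
           {x \<in> {0..1}. \<not> (\<forall>e>0. \<exists>d>0. \<forall>a b. 0 \<le> a \<and> a \<le> x \<and> x \<le> b \<and> b \<le> 1 \<and> a < b \<and> b - a < d \<longrightarrow>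
             integral {a..b} (\<lambda>x. - f x) \<le> (- f x + e) * (b - a))}"
    moreover have "x \<in> {0..1}" using x by auto
    ultimately have up: "\<And>e. e > 0 \<Longrightarrow> \<exists>d>0. \<forall>a b. 0 \<le> a \<and> a \<le> x \<and> x \<le> b \<and> b \<le> 1 \<and> a < b \<and> b - a < d \<longrightarrow>
             integral {a..b} f \<le> (f x + e) * (b - a)"
      and lo: "\<And>e. e > 0 \<Longrightarrow> \<exists>d>0. \<forall>a b. 0 \<le> a \<and> a \<le> x \<and> x \<le> b \<and> b \<le> 1 \<and> a < b \<and> b - a < d \<longrightarrow>
             integral {a..b} (\<lambda>x. - f x) \<le> (- f x + e) * (b - a)"
      using \<open>x \<in> {0..1}\<close> by blast+
    have x01: "0 < x" "x < 1" using x by auto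
    have fi: "f integrable_on {0..c}" if "c \<le> 1" for c
      using f that by (intro integrable_on_subinterval[OF set_lebesgue_integral_eq_integral(1)]) auto
    have "((\<lambda>x. integral {0..x} f) has_derivative (\<lambda>h. h *\<^sub>R f x)) (at x)"
      unfolding has_derivative_at_alt
    proof (intro conjI allI impI)
      show "bounded_linear (\<lambda>h. h *\<^sub>R f x)" by (rule bounded_linear_scaleR_left)
      fix e :: real assume e: "e > 0"
      obtain d1 where d1: "d1 > 0" "\<And>a b. 0 \<le> a \<Longrightarrow> a \<le> x \<Longrightarrow> x \<le> b \<Longrightarrow> b \<le> 1 \<Longrightarrow> a < b \<Longrightarrow> b - a < d1 \<Longrightarrow>
             integral {a..b} f \<le> (f x + e) * (b - a)"
        using up[OF e] by blast
      obtain d2 where d2: "d2 > 0" "\<And>a b. 0 \<le> a \<Longrightarrow> a \<le> x \<Longrightarrow> x \<le> b \<Longrightarrow> b \<le> 1 \<Longrightarrow> a < b \<Longrightarrow> b - a < d2 \<Longrightarrow>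
             - integral {a..b} f \<le> (- f x + e) * (b - a)"
        using lo[OF e] by auto
      show "\<exists>d>0. \<forall>y. norm (y - x) < d \<longrightarrow>
          norm (integral {0..y} f - integral {0..x} f - (y - x) *\<^sub>R f x) \<le> e * norm (y - x)"
      proof (intro exI[of _ "min (min d1 d2) (min x (1 - x))"] conjI allI impI)
        show "0 < min (min d1 d2) (min x (1 - x))" using d1 d2 x01 by auto
        fix y assume "norm (y - x) < min (min d1 d2) (min x (1 - x))"
        then have y: "\<bar>y - x\<bar> < d1" "\<bar>y - x\<bar> < d2" "0 < y" "y < 1" by auto
        show "norm (integral {0..y} f - integral {0..x} f - (y - x) *\<^sub>R f x) \<le> e * norm (y - x)"
        proof (cases y x rule: linorder_cases)
          case less
          have "integral {0..y} f + integral {y..x} f = integral {0..x} f"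
            using less y x01 by (intro Henstock_Kurzweil_Integration.integral_combine fi) auto
          then show ?thesis
            using d1(2)[of y x] d2(2)[of y x] less y x01 by (auto simp: abs_le_iff algebra_simps)
        next
          case greater
          have "integral {0..x} f + integral {x..y} f = integral {0..y} f"
            using greater y x01 by (intro Henstock_Kurzweil_Integration.integral_combine fi) auto
          then show ?thesis
            using d1(2)[of x y] d2(2)[of x y] greater y x01 by (auto simp: abs_le_iff algebra_simps)
        qed simp
      qed
    qed
    then show False
      using x by (auto simp: has_field_derivative_def mult_commute_abs)
  qed
qed

subsection \<open>Absolutely continuous functions\<close>

text \<open>Indexed families instead of \<open>division_of\<close>: degenerate intervals may occur,
  so cutting a family down to a subinterval keeps the index set and changes only the end
  points.\<close>

definition ivl_family :: "'i set \<Rightarrow> ('i \<Rightarrow> real) \<Rightarrow> ('i \<Rightarrow> real) \<Rightarrow> real \<Rightarrow> real \<Rightarrow> bool" where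
  "ivl_family I a b l u \<longleftrightarrow> finite I \<and> (\<forall>i\<in>I. l \<le> a i \<and> a i \<le> b i \<and> b i \<le> u) \<and>
     disjoint_family_on (\<lambda>i. {a i<..<b i}) I"

definition ac_modulus :: "(real \<Rightarrow> real) \<Rightarrow> real \<Rightarrow> real \<Rightarrow> bool" where
  "ac_modulus g e d \<longleftrightarrow> (\<forall>(I::nat set) a b. ivl_family I a b 0 1 \<longrightarrow> (\<Sum>i\<in>I. b i - a i) < d \<longrightarrow>
     (\<Sum>i\<in>I. \<bar>g (b i) - g (a i)\<bar>) < e)"

lemma ac_modulusD:
  fixes I :: "'i set"
  assumes g: "ac_modulus g e d" and I: "ivl_family I a b 0 1" and len: "(\<Sum>i\<in>I. b i - a i) < d"
  shows "(\<Sum>i\<in>I. \<bar>g (b i) - g (a i)\<bar>) < e"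
proof -
  have "finite I" using I by (simp add: ivl_family_def)
  then obtain h :: "nat \<Rightarrow> 'i" and n where h: "bij_betw h {0..<n} I"
    using ex_bij_betw_nat_finite by blast
  have "ivl_family {0..<n} (a \<circ> h) (b \<circ> h) 0 1"
    unfolding ivl_family_def disjoint_family_on_def
  proof (intro conjI ballI impI)
    fix m k assume mk: "m \<in> {0..<n}" "k \<in> {0..<n}" "m \<noteq> k"
    then have "h m \<noteq> h k" "h m \<in> I" "h k \<in> I"
      using h by (auto simp: bij_betw_def inj_on_def)
    then show "{(a \<circ> h) m<..<(b \<circ> h) m} \<inter> {(a \<circ> h) k<..<(b \<circ> h) k} = {}"
      using I unfolding ivl_family_def disjoint_family_on_def comp_def by blast
  qed (use I h in \<open>auto simp: ivl_family_def bij_betw_def\<close>)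
  moreover have "(\<Sum>i\<in>{0..<n}. (b \<circ> h) i - (a \<circ> h) i) < d"
    using len sum.reindex_bij_betw[OF h, of "\<lambda>i. b i - a i"] by simp
  ultimately have "(\<Sum>i\<in>{0..<n}. \<bar>g ((b \<circ> h) i) - g ((a \<circ> h) i)\<bar>) < e"
    using g unfolding ac_modulus_def by blast
  then show ?thesis
    using sum.reindex_bij_betw[OF h, of "\<lambda>i. \<bar>g (b i) - g (a i)\<bar>"] by simp
qed

lemma abs_continuous_on_imp_ac_modulus:
  assumes f: "abs_continuous_on {0..1} f" and e: "e > 0"
  obtains d where "d > 0" "ac_modulus (\<lambda>x. Re (f x)) e d" "ac_modulus (\<lambda>x. Im (f x)) e d"
proof -
  obtain d where d: "d > 0" "\<And>D t. D division_of t \<Longrightarrow> t \<subseteq> {0..1} \<Longrightarrow> (\<Sum>k\<in>D. Sup k - Inf k) < d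
        \<Longrightarrow> (\<Sum>k\<in>D. norm (f (Sup k) - f (Inf k))) < e"
    using f e unfolding abs_continuous_on_def by metis
  have main: "(\<Sum>i\<in>I. norm (f (b i) - f (a i))) < e"
    if I: "ivl_family I a b 0 1" and len: "(\<Sum>i\<in>I. b i - a i) < d" for I :: "nat set" and a b
  proof -
    \<comment> \<open>A division is a set of intervals. Without the degenerate ones \<open>K\<close>
      is injective, so no summand gets lost; the discarded summands are 0.\<close>
    define J where "J = {i\<in>I. a i < b i}"
    define K where "K = (\<lambda>i. {a i..b i})"
    have fin: "finite I" "finite J" using I by (auto simp: J_def ivl_family_def)
    have bnd: "0 \<le> a i" "a i \<le> b i" "b i \<le> 1" if "i \<in> I" for i
      using I that by (auto simp: ivl_family_def)
    have dis: "{a i<..<b i} \<inter> {a j<..<b j} = {}" if "i \<in> I" "j \<in> I" "i \<noteq> j" for i j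
      using I that by (auto simp: ivl_family_def disjoint_family_on_def)
    have inj: "inj_on K J"
    proof (rule inj_onI, rule ccontr)
      fix i j assume ij: "i \<in> J" "j \<in> J" "K i = K j" "i \<noteq> j"
      then have "a i = a j" "b i = b j"
        by (auto simp: K_def J_def Icc_eq_Icc)
      then show False using dis[of i j] ij by (auto simp: J_def)
    qed
    have div: "(K ` J) division_of (\<Union>(K ` J))"
    proof (rule division_ofI)
      fix k1 k2 assume "k1 \<in> K ` J" "k2 \<in> K ` J" "k1 \<noteq> k2"
      then obtain i j where "i \<in> J" "j \<in> J" "k1 = K i" "k2 = K j" "i \<noteq> j" by auto
      then show "interior k1 \<inter> interior k2 = {}"
        using dis[of i j] by (simp add: K_def J_def interior_atLeastAtMost_real)
    qed (use fin in \<open>auto simp: K_def J_def\<close>)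
    have SI: "Sup (K i) = b i" "Inf (K i) = a i" if "i \<in> J" for i
      using that by (auto simp: K_def J_def)
    have *: "(\<Sum>k\<in>K ` J. h (Sup k) (Inf k)) = (\<Sum>i\<in>I. h (b i) (a i))"
      if "\<And>x. h x x = (0::real)" for h
    proof -
      have "(\<Sum>k\<in>K ` J. h (Sup k) (Inf k)) = (\<Sum>i\<in>J. h (b i) (a i))"
        by (subst sum.reindex[OF inj]) (auto simp: SI intro!: sum.cong)
      also have "\<dots> = (\<Sum>i\<in>I. h (b i) (a i))"
      proof (rule sum.mono_neutral_left)
        have "a i = b i" if "i \<in> I - J" for i
          using bnd[of i] that by (auto simp: J_def)
        then show "\<forall>i\<in>I - J. h (b i) (a i) = 0" using that by metis
      qed (use fin in \<open>auto simp: J_def\<close>)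
      finally show ?thesis .
    qed
    have "\<Union>(K ` J) \<subseteq> {0..1}"
      using bnd by (force simp: K_def J_def)
    from d(2)[OF div this] len *[of "\<lambda>x y. x - y"] *[of "\<lambda>x y. norm (f x - f y)"]
    show ?thesis by simp
  qed
  have "(\<Sum>i\<in>I. \<bar>Re (f (b i)) - Re (f (a i))\<bar>) \<le> (\<Sum>i\<in>I. norm (f (b i) - f (a i)))"
       "(\<Sum>i\<in>I. \<bar>Im (f (b i)) - Im (f (a i))\<bar>) \<le> (\<Sum>i\<in>I. norm (f (b i) - f (a i)))" for I :: "nat set" and a b
    by (intro sum_mono; metis abs_Re_le_cmod abs_Im_le_cmod minus_complex.sel)+
  then have "ac_modulus (\<lambda>x. Re (f x)) e d" "ac_modulus (\<lambda>x. Im (f x)) e d"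
    unfolding ac_modulus_def using le_less_trans[OF _ main] by blast+
  then show thesis
    using d(1) that by blast
qed

section \<open>Bounded variation and Jordan decomposition\<close>

lemma ivl_family_length_le:
  assumes "ivl_family I a b l u" "l \<le> u"
  shows "(\<Sum>i\<in>I. b i - a i) \<le> u - l"
proof -
  have "(\<Sum>i\<in>I. b i - a i) = (\<Sum>i\<in>I. measure lborel {a i<..<b i})"
    using assms by (intro sum.cong) (auto simp: ivl_family_def)
  also have "\<dots> = measure lborel (\<Union>i\<in>I. {a i<..<b i})"
    using assms by (intro measure_finite_Union[symmetric]) (auto simp: ivl_family_def)
  also have "\<dots> \<le> measure lborel {l..u}"
  proof (intro measure_mono_fmeasurable)
    show "(\<Union>i\<in>I. {a i<..<b i}) \<subseteq> {l..u}"
      using assms by (force simp: ivl_family_def)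
    show "(\<Union>i\<in>I. {a i<..<b i}) \<in> sets lborel"
      using assms by (intro sets.finite_UN) (auto simp: ivl_family_def)
    show "{l..u} \<in> fmeasurable lborel"
      using assms by (intro fmeasurableI) auto
  qed
  finally show ?thesis using assms by simp
qed

lemma ivl_family_mono: "ivl_family I a b l u \<Longrightarrow> u \<le> v \<Longrightarrow> ivl_family I a b l v"
  unfolding ivl_family_def by (meson order_trans)

definition clip :: "real \<Rightarrow> real \<Rightarrow> real \<Rightarrow> real" where
  "clip l u x = max l (min u x)"

lemma ivl_family_clipI:
  assumes "finite I" and ab: "\<And>i. i \<in> I \<Longrightarrow> a i \<le> b i"
    and dis: "disjoint_family_on (\<lambda>i. {a i<..<b i}) I" and "l \<le> u"
  shows "ivl_family I (\<lambda>i. clip l u (a i)) (\<lambda>i. clip l u (b i)) l u"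
  unfolding ivl_family_def disjoint_family_on_def
proof (intro conjI ballI impI)
  have sub: "{clip l u (a i)<..<clip l u (b i)} \<subseteq> {a i<..<b i}" for i
    by (auto simp: clip_def)
  fix i j assume "i \<in> I" "j \<in> I" "i \<noteq> j"
  then have "{a i<..<b i} \<inter> {a j<..<b j} = {}"
    using dis unfolding disjoint_family_on_def by blast
  then show "{clip l u (a i)<..<clip l u (b i)} \<inter> {clip l u (a j)<..<clip l u (b j)} = {}"
    using sub[of i] sub[of j] by blast
next
  fix i assume "i \<in> I"
  then have "a i \<le> b i" by (rule ab)
  then show "l \<le> clip l u (a i)" "clip l u (a i) \<le> clip l u (b i)" "clip l u (b i) \<le> u"
    using assms(4) by (auto simp: clip_def)
qed fact

lemma ivl_family_clip:
  assumes "ivl_family I a b l' u'" "l \<le> u"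
  shows "ivl_family I (\<lambda>i. clip l u (a i)) (\<lambda>i. clip l u (b i)) l u"
  using assms by (intro ivl_family_clipI) (auto simp: ivl_family_def)

text \<open>The summand for \<open>j\<close> is the increment of \<open>g\<close> over the part of
  the \<open>j\<close>-th grid cell to the left of \<open>x\<close>. Applied to both end points of
  an interval, the identity distributes the increment of \<open>g\<close> over the cells.\<close>

lemma sum_clip_telescope:
  fixes t :: "nat \<Rightarrow> real" and g :: "real \<Rightarrow> real"
  assumes "mono t" "t 0 \<le> x"
  shows "(\<Sum>j<m. g (clip (t j) (t (Suc j)) x) - g (t j)) = g (min x (t m)) - g (t 0)"
proof (induction m)
  case 0
  then show ?case using assms by (simp add: min_def)
next
  case (Suc m)
  have "t m \<le> t (Suc m)" using assms(1) by (simp add: mono_def)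
  then show ?case using Suc by (auto simp: clip_def min_def max_def)
qed

text \<open>On a grid with cells shorter than \<open>d\<close> each of the \<open>Suc n\<close>
  cells contributes at most 1. This makes the supremum in the positive variation finite.\<close>

lemma ivl_family_sum_bound:
  assumes g: "ac_modulus g 1 d" and d: "d > 0"
  obtains M where "\<And>(I::nat set) a b. ivl_family I a b 0 1 \<Longrightarrow> (\<Sum>i\<in>I. g (b i) - g (a i)) \<le> M"
proof -
  obtain n where n: "1 / real (Suc n) < d"
    using d nat_approx_posE by blast
  define t where "t = (\<lambda>j. real j / real (Suc n))"
  have mono: "mono t" by (auto simp: t_def mono_def divide_right_mono)
  have tl: "t (Suc j) - t j < d" for j
    using n by (simp add: t_def diff_divide_distrib[symmetric])
  have t0: "t 0 = 0" "t (Suc n) = 1" by (auto simp: t_def)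
  have bnd: "(\<Sum>i\<in>I. g (b i) - g (a i)) \<le> real (Suc n)" if I: "ivl_family I a b 0 1" for I :: "nat set" and a b
  proof -
    let ?c = "\<lambda>j. clip (t j) (t (Suc j))"
    have tel: "(\<Sum>j<Suc n. g (?c j x) - g (t j)) = g x - g 0" if "x \<in> {0..1}" for x
      using sum_clip_telescope[OF mono, of x g "Suc n"] that t0 by simp
    have "(\<Sum>i\<in>I. g (b i) - g (a i)) = (\<Sum>i\<in>I. \<Sum>j<Suc n. g (?c j (b i)) - g (?c j (a i)))"
    proof (rule sum.cong[OF refl])
      fix i assume "i \<in> I"
      then have "b i \<in> {0..1}" "a i \<in> {0..1}" using I by (force simp: ivl_family_def)+
      then have "g (b i) - g (a i) = (\<Sum>j<Suc n. g (?c j (b i)) - g (t j)) - (\<Sum>j<Suc n. g (?c j (a i)) - g (t j))"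
        by (subst (1 2) tel) auto
      then show "g (b i) - g (a i) = (\<Sum>j<Suc n. g (?c j (b i)) - g (?c j (a i)))"
        by (simp only: sum_subtractf[symmetric]) (simp del: sum.lessThan_Suc)
    qed
    also have "\<dots> = (\<Sum>j<Suc n. \<Sum>i\<in>I. g (?c j (b i)) - g (?c j (a i)))"
      by (rule sum.swap)
    also have "\<dots> \<le> (\<Sum>j<Suc n. 1)"
    proof (rule sum_mono)
      fix j assume j: "j \<in> {..<Suc n}"
      have tj: "t j \<le> t (Suc j)" "0 \<le> t j" "t (Suc j) \<le> 1"
        using monoD[OF mono, of j "Suc j"] monoD[OF mono, of 0 j] monoD[OF mono, of "Suc j" "Suc n"] t0 j by auto
      have fam: "ivl_family I (\<lambda>i. ?c j (a i)) (\<lambda>i. ?c j (b i)) (t j) (t (Suc j))"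
        by (rule ivl_family_clip[OF I tj(1)])
      have "ivl_family I (\<lambda>i. ?c j (a i)) (\<lambda>i. ?c j (b i)) 0 1"
        using fam tj unfolding ivl_family_def by force
      then have "(\<Sum>i\<in>I. \<bar>g (?c j (b i)) - g (?c j (a i))\<bar>) < 1"
        using ivl_family_length_le[OF fam tj(1)] tl[of j] by (intro ac_modulusD[OF g]) auto
      moreover have "(\<Sum>i\<in>I. g (?c j (b i)) - g (?c j (a i))) \<le> (\<Sum>i\<in>I. \<bar>g (?c j (b i)) - g (?c j (a i))\<bar>)"
        by (intro sum_mono) auto
      ultimately show "(\<Sum>i\<in>I. g (?c j (b i)) - g (?c j (a i))) \<le> 1" by linarith
    qed
    finally show ?thesis by simp
  qed
  then show thesis by (rule that)
qed

lemma clip_split: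
  fixes g :: "real \<Rightarrow> real"
  assumes "0 \<le> x" "x \<le> u" "0 \<le> c" "c \<le> u"
  shows "g (clip 0 c x) + g (clip c u x) = g x + g c"
  using assms by (cases "x \<le> c") (auto simp: clip_def)

definition pos_variation :: "(real \<Rightarrow> real) \<Rightarrow> real \<Rightarrow> real" where
  "pos_variation g x = Sup {s. \<exists>(I::nat set) a b. ivl_family I a b 0 x \<and> s = (\<Sum>i\<in>I. g (b i) - g (a i))}"

text \<open>The Jordan decomposition: \<open>pos_variation g\<close> and
  \<open>pos_variation g - g\<close> are nondecreasing, and the former inherits absolute continuity
  from \<open>g\<close>. This reduces the general case to monotone functions.\<close>

lemma pos_variation:
  assumes ac: "\<And>e. e > 0 \<Longrightarrow> \<exists>d>0. ac_modulus g e d"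
  shows pos_variation_mono: "\<And>x y. 0 \<le> x \<Longrightarrow> x \<le> y \<Longrightarrow> y \<le> 1 \<Longrightarrow> pos_variation g x \<le> pos_variation g y"
    and pos_variation_diff: "\<And>x y. 0 \<le> x \<Longrightarrow> x \<le> y \<Longrightarrow> y \<le> 1 \<Longrightarrow> g y - g x \<le> pos_variation g y - pos_variation g x"
    and pos_variation_ac: "\<And>e. e > 0 \<Longrightarrow> \<exists>d>0. ac_modulus (pos_variation g) e d"
proof -
  define V where "V = (\<lambda>x. {s. \<exists>(I::nat set) a b. ivl_family I a b 0 x \<and> s = (\<Sum>i\<in>I. g (b i) - g (a i))})"
  have pv: "pos_variation g x = Sup (V x)" for x
    by (simp add: pos_variation_def V_def)
  have Vmono: "V x \<subseteq> V y" if "x \<le> y" for x y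
    unfolding V_def using ivl_family_mono[OF _ that] by blast
  obtain d1 where "d1 > 0" "ac_modulus g 1 d1" using ac[of 1] by auto
  then obtain M where M: "\<And>(I::nat set) a b. ivl_family I a b 0 1 \<Longrightarrow> (\<Sum>i\<in>I. g (b i) - g (a i)) \<le> M"
    using ivl_family_sum_bound by blast
  have V1: "bdd_above (V 1)"
    unfolding bdd_above_def V_def using M by auto
  have bdd: "bdd_above (V x)" if "x \<le> 1" for x
    by (rule bdd_above_mono[OF V1 Vmono[OF that]])
  have zero: "0 \<in> V x" for x
  proof -
    have "ivl_family {} (\<lambda>i::nat. 0) (\<lambda>i. 0) 0 x \<and> 0 = (\<Sum>i\<in>({}::nat set). g 0 - g 0)"
      by (simp add: ivl_family_def disjoint_family_on_def)
    then show ?thesis unfolding V_def by (intro CollectI exI)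
  qed
  have upper: "s \<le> pos_variation g x" if "s \<in> V x" "x \<le> 1" for s x
    unfolding pv by (rule cSup_upper[OF that(1) bdd[OF that(2)]])
  have approx: "\<exists>s\<in>V x. pos_variation g x - e < s" if "e > 0" for x e
  proof -
    have "V x \<noteq> {}" "Sup (V x) - e < Sup (V x)" using that zero by auto
    from less_cSupD[OF this] show ?thesis unfolding pv by blast
  qed
  show "pos_variation g x \<le> pos_variation g y" if "0 \<le> x" "x \<le> y" "y \<le> 1" for x y
    unfolding pv using that(3) zero[of x] by (intro cSup_subset_mono bdd Vmono that(2)) blast+
  show "g y - g x \<le> pos_variation g y - pos_variation g x" if xy: "0 \<le> x" "x \<le> y" "y \<le> 1" for x y
  proof (rule field_le_epsilon)
    fix e :: real assume "e > 0"
    then obtain s where s: "s \<in> V x" "pos_variation g x - e < s" using approx by blast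
    then obtain I :: "nat set" and a b where I: "ivl_family I a b 0 x" "s = (\<Sum>i\<in>I. g (b i) - g (a i))"
      unfolding V_def by blast
    \<comment> \<open>A fresh index for the interval from \<open>x\<close> to \<open>y\<close>,
      which is appended to a nearly optimal family for \<open>x\<close>.\<close>
    obtain k where k: "k \<notin> I"
      using I ex_new_if_finite[of I] by (auto simp: ivl_family_def)
    have "ivl_family (insert k I) (a(k := x)) (b(k := y)) 0 y"
      unfolding ivl_family_def disjoint_family_on_def
    proof (intro conjI ballI impI)
      show "finite (insert k I)" using I by (simp add: ivl_family_def)
    next
      fix i assume "i \<in> insert k I"
      then show "0 \<le> (a(k := x)) i" "(a(k := x)) i \<le> (b(k := y)) i" "(b(k := y)) i \<le> y"
        using I(1) k xy by (auto simp: ivl_family_def)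
    next
      have below: "{(a(k := x)) i<..<(b(k := y)) i} \<subseteq> {..<x}" if "i \<in> I" for i
      proof -
        have "i \<noteq> k" "b i \<le> x" using I(1) k that by (auto simp: ivl_family_def)
        then show ?thesis by auto
      qed
      fix i j assume ij: "i \<in> insert k I" "j \<in> insert k I" "i \<noteq> j"
      consider "i \<in> I" "j \<in> I" | "i = k" "j \<in> I" | "i \<in> I" "j = k" using ij by auto
      then show "{(a(k := x)) i<..<(b(k := y)) i} \<inter> {(a(k := x)) j<..<(b(k := y)) j} = {}"
      proof cases
        case 1
        then have "{a i<..<b i} \<inter> {a j<..<b j} = {}"
          using I(1) ij(3) unfolding ivl_family_def disjoint_family_on_def by blast
        then show ?thesis using 1 k by (metis fun_upd_other)
      next
        case 2
        have "{(a(k := x)) i<..<(b(k := y)) i} \<inter> {..<x} = {}" using 2(1) by auto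
        then show ?thesis using below[OF 2(2)] by blast
      next
        case 3
        have "{(a(k := x)) j<..<(b(k := y)) j} \<inter> {..<x} = {}" using 3(2) by auto
        then show ?thesis using below[OF 3(1)] by blast
      qed
    qed
    moreover have "s + (g y - g x) = (\<Sum>i\<in>insert k I. g ((b(k := y)) i) - g ((a(k := x)) i))"
    proof -
      have "(\<Sum>i\<in>I. g (b i) - g (a i)) = (\<Sum>i\<in>I. g ((b(k := y)) i) - g ((a(k := x)) i))"
        using k by (intro sum.cong) auto
      then show ?thesis using I k by (simp add: ivl_family_def)
    qed
    ultimately have "s + (g y - g x) \<in> V y"
      unfolding V_def by blast
    then show "g y - g x \<le> pos_variation g y - pos_variation g x + e"
      using upper[of _ y] s xy by fastforce
  qed
  show "\<exists>d>0. ac_modulus (pos_variation g) e d" if e: "e > 0" for e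
  proof -
    obtain d where d: "d > 0" "ac_modulus g (e / 2) d" using ac[of "e / 2"] e by auto
    have key: "(\<Sum>j\<in>J. \<bar>pos_variation g (\<beta> j) - pos_variation g (\<alpha> j)\<bar>) \<le> e / 2"
      if J: "ivl_family J \<alpha> \<beta> 0 1" "(\<Sum>j\<in>J. \<beta> j - \<alpha> j) < d" for J :: "nat set" and \<alpha> \<beta>
    proof (rule field_le_epsilon)
      fix \<eta> :: real assume eta: "\<eta> > 0"
      \<comment> \<open>Each of the \<open>card J\<close> suprema is approximated up to
        \<open>\<eta>'\<close>, with a total error of at most \<open>\<eta>\<close>.\<close>
      define \<eta>' where "\<eta>' = \<eta> / (real (card J) + 1)"
      have eta': "\<eta>' > 0" using eta by (simp add: \<eta>'_def)
      have bnd: "0 \<le> \<alpha> j" "\<alpha> j \<le> \<beta> j" "\<beta> j \<le> 1" if "j \<in> J" for j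
        using J that by (auto simp: ivl_family_def)
      have "\<exists>I a b. ivl_family (I::nat set) a b 0 (\<beta> j) \<and> pos_variation g (\<beta> j) - \<eta>' < (\<Sum>i\<in>I. g (b i) - g (a i))" for j
        using approx[OF eta', of "\<beta> j"] unfolding V_def by blast
      then obtain I :: "nat \<Rightarrow> nat set" and a b where
        I: "\<And>j. ivl_family (I j) (a j) (b j) 0 (\<beta> j)"
           "\<And>j. pos_variation g (\<beta> j) - \<eta>' < (\<Sum>i\<in>I j. g (b j i) - g (a j i))"
        by metis
      define a' where "a' = (\<lambda>(j, i). clip (\<alpha> j) (\<beta> j) (a j i))"
      define b' where "b' = (\<lambda>(j, i). clip (\<alpha> j) (\<beta> j) (b j i))"
      have fam: "ivl_family (I j) (\<lambda>i. a' (j, i)) (\<lambda>i. b' (j, i)) (\<alpha> j) (\<beta> j)" if "j \<in> J" for j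
        unfolding a'_def b'_def using ivl_family_clip[OF I(1)[of j] bnd(2)[OF that]] by simp
      have finJ: "finite J" and finI: "finite (I j)" for j
        using J I by (auto simp: ivl_family_def)
      \<comment> \<open>A nearly optimal family for \<open>\<beta> j\<close> is split at
        \<open>\<alpha> j\<close>. Its left part is bounded by the variation up to
        \<open>\<alpha> j\<close>, so its right part carries the increase of the variation up to the
        error \<open>\<eta>'\<close>.\<close>
      have part: "pos_variation g (\<beta> j) - pos_variation g (\<alpha> j) - \<eta>' \<le> (\<Sum>i\<in>I j. g (b' (j, i)) - g (a' (j, i)))"
        if j: "j \<in> J" for j
      proof -
        have "ivl_family (I j) (\<lambda>i. clip 0 (\<alpha> j) (a j i)) (\<lambda>i. clip 0 (\<alpha> j) (b j i)) 0 (\<alpha> j)"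
          using ivl_family_clip[OF I(1)[of j] bnd(1)[OF j]] .
        then have "(\<Sum>i\<in>I j. g (clip 0 (\<alpha> j) (b j i)) - g (clip 0 (\<alpha> j) (a j i))) \<le> pos_variation g (\<alpha> j)"
          using bnd[OF j] by (intro upper) (auto simp: V_def)
        moreover have "(\<Sum>i\<in>I j. g (b j i) - g (a j i)) =
           (\<Sum>i\<in>I j. g (clip 0 (\<alpha> j) (b j i)) - g (clip 0 (\<alpha> j) (a j i))) + (\<Sum>i\<in>I j. g (b' (j, i)) - g (a' (j, i)))"
          unfolding sum.distrib[symmetric]
        proof (rule sum.cong[OF refl])
          fix i assume "i \<in> I j"
          then have "0 \<le> a j i" "a j i \<le> b j i" "b j i \<le> \<beta> j" using I(1)[of j] by (auto simp: ivl_family_def)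
          then show "g (b j i) - g (a j i) = g (clip 0 (\<alpha> j) (b j i)) - g (clip 0 (\<alpha> j) (a j i)) + (g (b' (j, i)) - g (a' (j, i)))"
            using bnd[OF j] clip_split[of "a j i" "\<beta> j" "\<alpha> j" g] clip_split[of "b j i" "\<beta> j" "\<alpha> j" g]
            by (simp add: a'_def b'_def)
        qed
        ultimately show ?thesis using I(2)[of j] by linarith
      qed
      \<comment> \<open>All right parts together form one admissible family of small total length,
        so the modulus of \<open>g\<close> needs to be applied only once.\<close>
      have fam': "ivl_family (Sigma J I) a' b' 0 1"
        unfolding ivl_family_def
      proof (intro conjI ballI)
        show "finite (Sigma J I)" using finJ finI by auto
        fix p assume "p \<in> Sigma J I"
        then obtain j i where p: "p = (j, i)" "j \<in> J" "i \<in> I j" by auto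
        then show "0 \<le> a' p" "a' p \<le> b' p" "b' p \<le> 1"
          using fam[of j] bnd[of j] unfolding ivl_family_def by (metis order_trans)+
      next
        show "disjoint_family_on (\<lambda>p. {a' p<..<b' p}) (Sigma J I)"
          unfolding disjoint_family_on_def
        proof (intro ballI impI)
          fix p q assume "p \<in> Sigma J I" "q \<in> Sigma J I" and ne: "p \<noteq> q"
          then obtain j i k l where p: "p = (j, i)" "j \<in> J" "i \<in> I j" and q: "q = (k, l)" "k \<in> J" "l \<in> I k"
            by auto
          show "{a' p<..<b' p} \<inter> {a' q<..<b' q} = {}"
          proof (cases "j = k")
            case True
            then have "i \<noteq> l" "l \<in> I j" using p q ne by auto
            then have "{a' (j, i)<..<b' (j, i)} \<inter> {a' (j, l)<..<b' (j, l)} = {}"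
              using fam[of j] p unfolding ivl_family_def disjoint_family_on_def by blast
            then show ?thesis using p q True by simp
          next
            case False
            have "{a' p<..<b' p} \<subseteq> {\<alpha> j<..<\<beta> j}" "{a' q<..<b' q} \<subseteq> {\<alpha> k<..<\<beta> k}"
              using fam[OF p(2)] fam[OF q(2)] p q by (auto simp: ivl_family_def)
            moreover have "{\<alpha> j<..<\<beta> j} \<inter> {\<alpha> k<..<\<beta> k} = {}"
              using J(1) p q False unfolding ivl_family_def disjoint_family_on_def by blast
            ultimately show ?thesis by blast
          qed
        qed
      qed
      have "(\<Sum>p\<in>Sigma J I. b' p - a' p) = (\<Sum>j\<in>J. \<Sum>i\<in>I j. b' (j, i) - a' (j, i))"
        using finJ finI by (simp add: sum.Sigma case_prod_unfold)
      also have "\<dots> \<le> (\<Sum>j\<in>J. \<beta> j - \<alpha> j)"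
        using fam bnd by (intro sum_mono ivl_family_length_le) auto
      finally have "(\<Sum>p\<in>Sigma J I. \<bar>g (b' p) - g (a' p)\<bar>) < e / 2"
        using J(2) by (intro ac_modulusD[OF d(2) fam']) auto
      moreover have "(\<Sum>p\<in>Sigma J I. g (b' p) - g (a' p)) \<le> (\<Sum>p\<in>Sigma J I. \<bar>g (b' p) - g (a' p)\<bar>)"
        by (intro sum_mono) auto
      ultimately have le: "(\<Sum>j\<in>J. \<Sum>i\<in>I j. g (b' (j, i)) - g (a' (j, i))) \<le> e / 2"
        using finJ finI by (simp add: sum.Sigma case_prod_unfold)
      have "(\<Sum>j\<in>J. \<bar>pos_variation g (\<beta> j) - pos_variation g (\<alpha> j)\<bar>)
          \<le> (\<Sum>j\<in>J. (\<Sum>i\<in>I j. g (b' (j, i)) - g (a' (j, i))) + \<eta>')"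
      proof (rule sum_mono)
        fix j assume j: "j \<in> J"
        have "pos_variation g (\<alpha> j) \<le> pos_variation g (\<beta> j)"
          unfolding pv using bnd[OF j] zero by (intro cSup_subset_mono bdd Vmono) auto
        then show "\<bar>pos_variation g (\<beta> j) - pos_variation g (\<alpha> j)\<bar> \<le> (\<Sum>i\<in>I j. g (b' (j, i)) - g (a' (j, i))) + \<eta>'"
          using part[OF j] by linarith
      qed
      also have "\<dots> \<le> e / 2 + real (card J) * \<eta>'"
        using le by (simp add: sum.distrib)
      also have "real (card J) * \<eta>' \<le> \<eta>"
        using eta by (simp add: \<eta>'_def field_simps)
      finally show "(\<Sum>j\<in>J. \<bar>pos_variation g (\<beta> j) - pos_variation g (\<alpha> j)\<bar>) \<le> e / 2 + \<eta>" by simp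
    qed
    have "e / 2 < e" using e by simp
    then have "ac_modulus (pos_variation g) e d"
      unfolding ac_modulus_def using le_less_trans[OF key] by blast
    then show ?thesis using d(1) by blast
  qed
qed

section \<open>Stieltjes measure and density of a monotone function\<close>

lemma open_intervals_length_less:
  assumes "finite I" and ab: "\<And>i. i \<in> I \<Longrightarrow> a i \<le> b i"
    and dis: "disjoint_family_on (\<lambda>i. {a i<..<b i}) I"
    and U: "\<And>i. i \<in> I \<Longrightarrow> {a i<..<b i} \<subseteq> U" "U \<in> sets lborel" "emeasure lborel U < ennreal d"
  shows "(\<Sum>i\<in>I. b i - a i) < d"
proof -
  have fm: "U \<in> fmeasurable lborel"
    using U by (intro fmeasurableI) (auto intro: less_trans)
  have "(\<Sum>i\<in>I. b i - a i) = (\<Sum>i\<in>I. measure lborel {a i<..<b i})"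
    using ab by (intro sum.cong) auto
  also have "\<dots> = measure lborel (\<Union>i\<in>I. {a i<..<b i})"
    using assms by (intro measure_finite_Union[symmetric]) auto
  also have "\<dots> \<le> measure lborel U"
    using U assms(1) by (intro measure_mono_fmeasurable[OF _ _ fm] UN_least sets.finite_UN) auto
  also have "\<dots> < d"
    using U(3) fm by (metis emeasure_eq_measure2 ennreal_less_iff measure_nonneg)
  finally show ?thesis .
qed

text \<open>The Stieltjes measure of \<open>F\<close> is absolutely continuous with respect to
  Lebesgue measure: the modulus of \<open>F\<close> controls finite unions of intervals, these
  exhaust open sets, and open sets approximate null sets from outside. The Radon-Nikodym density
  serves as \<open>g\<close>.\<close>

lemma mono_ac_indefinite_integral:
  fixes F :: "real \<Rightarrow> real"
  assumes mono: "\<And>x y. 0 \<le> x \<Longrightarrow> x \<le> y \<Longrightarrow> y \<le> 1 \<Longrightarrow> F x \<le> F y"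
    and ac: "\<And>e. e > 0 \<Longrightarrow> \<exists>d>0. ac_modulus F e d"
  obtains g where "g absolutely_integrable_on {0..1}"
    "\<And>x. x \<in> {0..1} \<Longrightarrow> F x - F 0 = integral {0..x} g"
proof -
  \<comment> \<open>Constant continuation beyond the unit interval gives a continuous monotone
    function on the whole line, to which \<open>interval_measure\<close> applies.\<close>
  define G where "G = (\<lambda>x. F (clip 0 1 x))"
  have clip01: "0 \<le> clip 0 1 x" "clip 0 1 x \<le> 1" for x by (auto simp: clip_def)
  have clip_id: "x \<in> {0..1} \<Longrightarrow> clip 0 1 x = x" for x by (auto simp: clip_def)
  have clip_mono: "x \<le> y \<Longrightarrow> clip 0 1 x \<le> clip 0 1 y" for x y by (auto simp: clip_def)
  have G_mono: "x \<le> y \<Longrightarrow> G x \<le> G y" for x y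
    unfolding G_def using clip01 clip_mono by (intro mono)
  have F_cont: "\<exists>d>0. \<forall>x y. 0 \<le> x \<longrightarrow> x \<le> y \<longrightarrow> y \<le> 1 \<longrightarrow> y - x < d \<longrightarrow> \<bar>F y - F x\<bar> < e" if e: "e > 0" for e
  proof -
    obtain d where d: "d > 0" "ac_modulus F e d" using ac[OF e] by blast
    have "\<bar>F y - F x\<bar> < e" if "0 \<le> x" "x \<le> y" "y \<le> 1" "y - x < d" for x y
      using ac_modulusD[OF d(2), of "{0::nat}" "\<lambda>_. x" "\<lambda>_. y"] that
      by (simp add: ivl_family_def disjoint_family_on_def)
    then show ?thesis using d by blast
  qed
  have G_cont: "continuous_on UNIV G"
    unfolding continuous_on_iff
  proof (intro ballI allI impI)
    fix x e :: real assume "e > 0"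
    then obtain d where d: "d > 0" "\<And>x y. 0 \<le> x \<Longrightarrow> x \<le> y \<Longrightarrow> y \<le> 1 \<Longrightarrow> y - x < d \<Longrightarrow> \<bar>F y - F x\<bar> < e"
      using F_cont by metis
    show "\<exists>d>0. \<forall>x'\<in>UNIV. dist x' x < d \<longrightarrow> dist (G x') (G x) < e"
    proof (intro exI[of _ d] conjI ballI impI d(1))
      fix x' assume x': "dist x' x < d"
      have le: "\<bar>clip 0 1 x' - clip 0 1 x\<bar> \<le> \<bar>x' - x\<bar>" by (auto simp: clip_def)
      show "dist (G x') (G x) < e"
      proof (cases "clip 0 1 x \<le> clip 0 1 x'")
        case True
        then show ?thesis
          using d(2)[OF clip01(1) True clip01(2)] le x' by (auto simp: G_def dist_real_def)
      next
        case False
        then show ?thesis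
          using d(2)[OF clip01(1) _ clip01(2), of x' x] le x' by (auto simp: G_def dist_real_def abs_minus_commute)
      qed
    qed
  qed
  have G_right: "continuous (at_right x) G" for x
    using G_cont by (metis continuous_on_eq_continuous_at continuous_at_imp_continuous_at_within open_UNIV UNIV_I)
  define N where "N = interval_measure G"
  have N_Icc: "emeasure N {a..b} = ennreal (G b - G a)" if "a \<le> b" for a b
    unfolding N_def by (rule emeasure_interval_measure_Icc[OF that G_mono G_cont])
  have N_sets [simp]: "sets N = sets borel" by (simp add: N_def)
  have small: "\<exists>d>0. \<forall>U. open U \<longrightarrow> emeasure lborel U < ennreal d \<longrightarrow> emeasure N U \<le> ennreal e" if e: "e > 0" for e
  proof -
    obtain d where d: "d > 0" "ac_modulus F e d" using ac[OF e] by blast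
    have "emeasure N U \<le> ennreal e" if U: "open U" "emeasure lborel U < ennreal d" for U
    proof (cases "U = {}")
      case False
      obtain \<D> where D: "countable \<D>" "\<D> \<subseteq> Pow U" "\<And>X. X \<in> \<D> \<Longrightarrow> \<exists>a b. X = cbox a b" "\<Union>\<D> = U"
        using open_countable_Union_open_cbox[OF U(1)] by blast
      have ne: "\<D> \<noteq> {}" using D(4) False by auto
      define X where "X = from_nat_into \<D>"
      have X: "X n \<in> \<D>" for n unfolding X_def by (rule from_nat_into[OF ne])
      define A where "A = (\<lambda>n. \<Union>(X ` {..<n}))"
      have AU: "A n \<subseteq> U" for n using X D(2) by (auto simp: A_def)
      have "(\<Union>n. A n) = U"
        using range_from_nat_into[OF ne D(1)] D(4) unfolding A_def X_def[symmetric]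
        by (force simp: X_def[symmetric])
      moreover have "incseq A" by (force simp: A_def incseq_def)
      moreover have Xs: "X n \<in> sets borel" for n using D(3)[OF X[of n]] by auto
      then have As: "A n \<in> sets borel" for n unfolding A_def by (intro sets.finite_Union) auto
      ultimately have sup: "emeasure N U = (SUP n. emeasure N (A n))"
        using SUP_emeasure_incseq[of A N] by (metis N_sets image_subsetI)
      have "emeasure N (A n) \<le> ennreal e" for n
      proof -
        \<comment> \<open>The boxes may overlap; the lengths of the intervals in a division of their
          union add up to less than \<open>d\<close>.\<close>
        obtain p where p: "p division_of A n"
          using elementary_unions_intervals[of "X ` {..<n}"] D(3) X unfolding A_def by blast
        have fin: "finite p" using p by blast
        have k: "\<exists>a b. a \<le> b \<and> k = {a..b}" if "k \<in> p" for k
          using division_ofD(3,4)[OF p that] by (metis atLeastatMost_empty_iff box_real(2))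
        then have k': "Inf k \<le> Sup k" "k = {Inf k..Sup k}" if "k \<in> p" for k
          using that by (metis cInf_atLeastAtMost cSup_atLeastAtMost)+
        have ks: "k \<in> sets borel" if "k \<in> p" for k
          using k[OF that] by auto
        have int: "interior k = {Inf k<..<Sup k}" if "k \<in> p" for k
          using k'(2)[OF that] by (metis interior_atLeastAtMost_real)
        have dis: "disjoint_family_on (\<lambda>k. {Inf k<..<Sup k}) p"
          unfolding disjoint_family_on_def using division_ofD(5)[OF p] int by metis
        have len: "(\<Sum>k\<in>p. Sup k - Inf k) < d"
        proof (rule open_intervals_length_less[OF fin _ dis _ _ U(2)])
          fix k assume kp: "k \<in> p"
          show "{Inf k<..<Sup k} \<subseteq> U"
            using int[OF kp] interior_subset[of k] division_ofD(2)[OF p kp] AU[of n] by blast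
        qed (use k'(1) U in auto)
        have fam: "ivl_family p (\<lambda>k. clip 0 1 (Inf k)) (\<lambda>k. clip 0 1 (Sup k)) 0 1"
          by (rule ivl_family_clipI[OF fin _ dis]) (use k'(1) in auto)
        have "clip 0 1 (Sup k) - clip 0 1 (Inf k) \<le> Sup k - Inf k" if "k \<in> p" for k
          using k'(1)[OF that] by (auto simp: clip_def)
        then have "(\<Sum>k\<in>p. clip 0 1 (Sup k) - clip 0 1 (Inf k)) \<le> (\<Sum>k\<in>p. Sup k - Inf k)"
          by (rule sum_mono)
        also note len
        finally have le: "(\<Sum>k\<in>p. \<bar>G (Sup k) - G (Inf k)\<bar>) < e"
          unfolding G_def by (rule ac_modulusD[OF d(2) fam])
        have "emeasure N (A n) = emeasure N (\<Union>((\<lambda>k. k) ` p))"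
          using division_ofD(6)[OF p] by simp
        also have "\<dots> \<le> (\<Sum>k\<in>p. emeasure N k)"
          using emeasure_subadditive_finite[OF fin, of "\<lambda>k. k" N] ks by (simp add: subset_eq)
        also have "\<dots> = (\<Sum>k\<in>p. ennreal (G (Sup k) - G (Inf k)))"
        proof (rule sum.cong[OF refl])
          fix k assume "k \<in> p"
          then have "emeasure N {Inf k..Sup k} = ennreal (G (Sup k) - G (Inf k))" "{Inf k..Sup k} = k"
            using N_Icc[OF k'(1)] k'(2) by blast+
          then show "emeasure N k = ennreal (G (Sup k) - G (Inf k))" by metis
        qed
        also have "\<dots> = ennreal (\<Sum>k\<in>p. G (Sup k) - G (Inf k))"
          using k'(1) G_mono by (intro sum_ennreal) auto
        also have "\<dots> \<le> ennreal e"
        proof (rule ennreal_leI)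
          have "(\<Sum>k\<in>p. G (Sup k) - G (Inf k)) \<le> (\<Sum>k\<in>p. \<bar>G (Sup k) - G (Inf k)\<bar>)"
            by (intro sum_mono) auto
          then show "(\<Sum>k\<in>p. G (Sup k) - G (Inf k)) \<le> e" using le by linarith
        qed
        finally show ?thesis .
      qed
      then show ?thesis unfolding sup by (rule SUP_least)
    qed auto
    then show ?thesis using d by blast
  qed
  have "absolutely_continuous lborel N"
    unfolding absolutely_continuous_def
  proof
    fix S :: "real set" assume S: "S \<in> null_sets lborel"
    have "emeasure N S \<le> 0 + ennreal e" if e: "0 < e" for e
    proof -
      obtain d where d: "d > 0" "\<And>U. open U \<Longrightarrow> emeasure lborel U < ennreal d \<Longrightarrow> emeasure N U \<le> ennreal e"
        using small[OF e] by blast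
      have "S \<in> sets lebesgue" using S by auto
      then obtain T where T: "open T" "S \<subseteq> T" "T - S \<in> lmeasurable" "emeasure lebesgue (T - S) < ennreal d"
        using sets_lebesgue_outer_open[OF _ d(1)] by blast
      have "emeasure lborel T = emeasure lborel (T - S)"
        using S T(1) by (intro emeasure_Diff_null_set[symmetric]) auto
      also have "\<dots> = emeasure lebesgue (T - S)"
      proof -
        have "T - S \<in> sets lborel" using S T(1) by auto
        then show ?thesis by simp
      qed
      also have "\<dots> < ennreal d" by (rule T(4))
      finally have "emeasure N T \<le> ennreal e" using d T by blast
      moreover have "emeasure N S \<le> emeasure N T" using T by (intro emeasure_mono) auto
      ultimately show ?thesis by simp
    qed
    then have "emeasure N S \<le> 0" by (rule ennreal_le_epsilon)
    moreover have "S \<in> sets N" using S by auto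
    ultimately show "S \<in> null_sets N" by (intro null_setsI) auto
  qed
  then obtain f where f: "f \<in> borel_measurable lborel" "density lborel f = N"
    using sigma_finite_measure.Radon_Nikodym[OF sigma_finite_lborel, of N] by auto
  define g where "g = (\<lambda>x. enn2real (f x))"
  have [measurable]: "f \<in> borel_measurable borel" using f by simp
  have Nf: "(\<integral>\<^sup>+x. f x * indicator {0..c} x \<partial>lborel) = ennreal (G c - G 0)" if "0 \<le> c" for c
    using N_Icc[OF that] f emeasure_density[of f lborel "{0..c}"] by simp
  have fin: "AE x in lborel. f x * indicator {0..1} x \<noteq> \<infinity>"
    by (rule nn_integral_PInf_AE) (use Nf[of 1] in auto)
  have gf: "(\<integral>\<^sup>+x. ennreal (indicator {0..c} x *\<^sub>R g x) \<partial>lborel) = ennreal (G c - G 0)" if "0 \<le> c" "c \<le> 1" for c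
  proof -
    have "(\<integral>\<^sup>+x. ennreal (indicator {0..c} x *\<^sub>R g x) \<partial>lborel) = (\<integral>\<^sup>+x. f x * indicator {0..c} x \<partial>lborel)"
    proof (rule nn_integral_cong_AE, use fin in eventually_elim)
      fix x assume "f x * indicator {0..1} x \<noteq> \<infinity>"
      then show "ennreal (indicator {0..c} x *\<^sub>R g x) = f x * indicator {0..c} x"
        using that by (auto simp: indicator_def g_def less_top)
    qed
    then show ?thesis using Nf[OF that(1)] by simp
  qed
  have int: "integrable lborel (\<lambda>x. indicator {0..c} x *\<^sub>R g x)"
    and eq: "(LINT x|lborel. indicator {0..c} x *\<^sub>R g x) = G c - G 0" if "0 \<le> c" "c \<le> 1" for c
  proof -
    have hs: "has_bochner_integral lborel (\<lambda>x. indicator {0..c} x *\<^sub>R g x) (G c - G 0)"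
      by (rule has_bochner_integral_nn_integral) (use gf[OF that] G_mono that in \<open>auto simp: g_def\<close>)
    then show "integrable lborel (\<lambda>x. indicator {0..c} x *\<^sub>R g x)"
      "(LINT x|lborel. indicator {0..c} x *\<^sub>R g x) = G c - G 0"
      by (auto simp: has_bochner_integral_iff)
  qed
  show thesis
  proof (rule that)
    show ai: "g absolutely_integrable_on {0..1}"
      unfolding set_integrable_def using int[of 1] by (intro integrable_completion[THEN iffD2]) auto
    fix x :: real assume x: "x \<in> {0..1}"
    then have ai': "g absolutely_integrable_on {0..x}"
      by (intro set_integrable_subset[OF ai]) auto
    have "integral {0..x} g = (LINT t|lborel. indicator {0..x} t *\<^sub>R g t)"
      using set_lebesgue_integral_eq_integral(2)[OF ai'] int[of x] x
      by (simp add: set_lebesgue_integral_def integral_completion)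
    also have "\<dots> = G x - G 0" using eq x by simp
    also have "\<dots> = F x - F 0" using x by (simp add: G_def clip_id)
    finally show "F x - F 0 = integral {0..x} g" ..
  qed
qed

text \<open>\<open>F\<close> is the difference of \<open>P\<close> and \<open>P - F\<close>, both
  monotone and absolutely continuous, so their densities are subtracted.\<close>

lemma ac_modulus_indefinite_integral:
  fixes F :: "real \<Rightarrow> real"
  assumes ac: "\<And>e. e > 0 \<Longrightarrow> \<exists>d>0. ac_modulus F e d"
  obtains g where "g absolutely_integrable_on {0..1}"
    "\<And>x. x \<in> {0..1} \<Longrightarrow> F x - F 0 = integral {0..x} g"
proof -
  define P where "P = pos_variation F"
  obtain p where p: "p absolutely_integrable_on {0..1}" "\<And>x. x \<in> {0..1} \<Longrightarrow> P x - P 0 = integral {0..x} p"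
    unfolding P_def
    by (rule mono_ac_indefinite_integral[of "pos_variation F"]) (use pos_variation_mono[OF ac] pos_variation_ac[OF ac] in auto)
  have Mac: "\<exists>d>0. ac_modulus (\<lambda>x. P x - F x) e d" if e: "e > 0" for e
  proof -
    obtain d1 where d1: "d1 > 0" "ac_modulus P (e / 2) d1"
      using pos_variation_ac[OF ac, of "e / 2"] e unfolding P_def by auto
    obtain d2 where d2: "d2 > 0" "ac_modulus F (e / 2) d2"
      using ac[of "e / 2"] e by auto
    have "ac_modulus (\<lambda>x. P x - F x) e (min d1 d2)"
      unfolding ac_modulus_def
    proof (intro allI impI)
      fix I :: "nat set" and a b assume I: "ivl_family I a b 0 1" and len: "(\<Sum>i\<in>I. b i - a i) < min d1 d2"
      have "(\<Sum>i\<in>I. \<bar>P (b i) - F (b i) - (P (a i) - F (a i))\<bar>)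
          \<le> (\<Sum>i\<in>I. \<bar>P (b i) - P (a i)\<bar> + \<bar>F (b i) - F (a i)\<bar>)"
        by (intro sum_mono) auto
      also have "\<dots> < e / 2 + e / 2"
        unfolding sum.distrib using I len by (intro add_strict_mono ac_modulusD[OF d1(2)] ac_modulusD[OF d2(2)]) auto
      finally show "(\<Sum>i\<in>I. \<bar>P (b i) - F (b i) - (P (a i) - F (a i))\<bar>) < e" by simp
    qed
    then show ?thesis using d1 d2 by (metis min_less_iff_conj)
  qed
  obtain n where n: "n absolutely_integrable_on {0..1}"
    "\<And>x. x \<in> {0..1} \<Longrightarrow> P x - F x - (P 0 - F 0) = integral {0..x} n"
  proof (rule mono_ac_indefinite_integral[of "\<lambda>x. P x - F x"])
    fix x y :: real assume "0 \<le> x" "x \<le> y" "y \<le> 1"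
    then show "P x - F x \<le> P y - F y"
      using pos_variation_diff[OF ac, of x y] unfolding P_def by auto
  qed (use Mac in auto)
  show thesis
  proof (rule that[of "\<lambda>x. p x - n x"])
    show "(\<lambda>x. p x - n x) absolutely_integrable_on {0..1}"
      by (rule set_integral_diff(1)[OF p(1) n(1)])
    fix x :: real assume x: "x \<in> {0..1}"
    have "p integrable_on {0..x}" "n integrable_on {0..x}"
      using p(1) n(1) x by (auto intro!: integrable_on_subinterval[OF set_lebesgue_integral_eq_integral(1)])
    then show "F x - F 0 = integral {0..x} (\<lambda>x. p x - n x)"
      using p(2)[OF x] n(2)[OF x] by (simp add: Henstock_Kurzweil_Integration.integral_diff)
  qed
qed

text \<open>The working form of absolute continuity. The density \<open>f\<close> is a parameter
  because it is determined only almost everywhere; \<open>F\<close> is constrained on the closed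
  unit interval alone. The differential equations below are all stated in this form.\<close>

definition indef_int :: "(real \<Rightarrow> complex) \<Rightarrow> (real \<Rightarrow> complex) \<Rightarrow> bool" where
  "indef_int f F \<longleftrightarrow> f absolutely_integrable_on {0..1} \<and> (\<forall>x\<in>{0..1}. F x = F 0 + integral {0..x} f)"

section \<open>Integrals and almost everywhere statements on the unit interval\<close>

lemma AE_leb01_iff: "(AE x in leb01. P x) \<longleftrightarrow> negligible {x \<in> {0<..<1}. \<not> P x}"
proof -
  have "(AE x in leb01. P x) \<longleftrightarrow> (AE x in lebesgue. x \<in> {0<..<1} \<longrightarrow> P x)"
    by (subst AE_restrict_space_iff) auto
  also have "\<dots> \<longleftrightarrow> {x. \<not> (x \<in> {0<..<1} \<longrightarrow> P x)} \<in> null_sets lebesgue"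
    by (subst completion.AE_iff_null_sets) simp
  also have "{x. \<not> (x \<in> {0<..<1} \<longrightarrow> P x)} = {x \<in> {0<..<1}. \<not> P x}" by auto
  finally show ?thesis by (simp add: negligible_iff_null_sets)
qed

lemma AE_leb01_negligible:
  assumes "AE x in leb01. P x"
  obtains N where "negligible N" "\<And>x. x \<in> {0..1} - N \<Longrightarrow> P x"
proof (rule that[of "{x \<in> {0<..<1}. \<not> P x} \<union> {0, 1}"])
  show "negligible ({x \<in> {0<..<1}. \<not> P x} \<union> {0, 1})"
    using assms by (simp add: AE_leb01_iff)
qed auto

lemma absolutely_integrable_cong_AE:
  fixes f g :: "real \<Rightarrow> 'a::euclidean_space"
  assumes "f absolutely_integrable_on {0..1}" "AE x in leb01. g x = f x"
  shows "g absolutely_integrable_on {0..1}"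
proof -
  obtain N where N: "negligible N" "\<And>x. x \<in> {0..1} - N \<Longrightarrow> g x = f x"
    using AE_leb01_negligible[OF assms(2)] by metis
  show ?thesis by (rule absolutely_integrable_spike[OF assms(1) N])
qed

lemma integral_cong_AE01:
  fixes f g :: "real \<Rightarrow> 'a::euclidean_space"
  assumes "AE x in leb01. g x = f x" "S \<subseteq> {0..1}"
  shows "integral S g = integral S f"
proof -
  obtain N where N: "negligible N" "\<And>x. x \<in> {0..1} - N \<Longrightarrow> g x = f x"
    using AE_leb01_negligible[OF assms(1)] by metis
  show ?thesis by (rule integral_spike[OF N(1)]) (use N(2) assms(2) in auto)
qed

lemma absolutely_integrable_01_iff:
  fixes f :: "real \<Rightarrow> 'a::euclidean_space"
  shows "f absolutely_integrable_on {0..1} \<longleftrightarrow> integrable leb01 f"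
proof -
  have "f absolutely_integrable_on {0..1} \<longleftrightarrow> f absolutely_integrable_on {0<..<1}"
    by (rule absolutely_integrable_spike_set_eq) (auto intro: negligible_subset[of "{0,1}"])
  also have "\<dots> \<longleftrightarrow> integrable leb01 f"
    by (simp add: set_integrable_def integrable_restrict_space)
  finally show ?thesis .
qed

lemma integral_01_eq:
  fixes f :: "real \<Rightarrow> 'a::euclidean_space"
  assumes "f absolutely_integrable_on {0..1}"
  shows "(LINT x|leb01. f x) = integral {0..1} f"
proof -
  have "(LINT x|leb01. f x) = integral {0<..<1} f"
    using assms by (intro lebesgue_integral_eq_integral) (auto simp: absolutely_integrable_01_iff)
  also have "\<dots> = integral {0..1} f"
    by (rule integral_spike_set) (auto intro: negligible_subset[of "{0,1}"])
  finally show ?thesis .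
qed

lemma absolutely_integrable_01_subinterval:
  fixes f :: "real \<Rightarrow> 'a::euclidean_space"
  assumes "f absolutely_integrable_on {0..1}" "0 \<le> a" "b \<le> 1"
  shows "f absolutely_integrable_on {a..b}"
  by (rule set_integrable_subset[OF assms(1)]) (use assms in auto)

lemma integrable_01_subinterval:
  fixes f :: "real \<Rightarrow> 'a::euclidean_space"
  assumes "f absolutely_integrable_on {0..1}" "0 \<le> a" "b \<le> 1"
  shows "f integrable_on {a..b}"
  using absolutely_integrable_01_subinterval[OF assms] by (rule set_lebesgue_integral_eq_integral(1))

lemma indef_int_absolutely_integrable: "indef_int f F \<Longrightarrow> f absolutely_integrable_on {0..1}"
  by (simp only: indef_int_def)

lemma indef_intD: "indef_int f F \<Longrightarrow> x \<in> {0..1} \<Longrightarrow> F x = F 0 + integral {0..x} f"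
  by (simp only: indef_int_def)

lemma indef_intI:
  assumes "f absolutely_integrable_on {0..1}" "\<And>x. x \<in> {0..1} \<Longrightarrow> F x = F 0 + integral {0..x} f"
  shows "indef_int f F"
  using assms unfolding indef_int_def by blast

lemma indef_int_integral:
  assumes "indef_int f F" "0 \<le> a" "a \<le> b" "b \<le> 1"
  shows "integral {a..b} f = F b - F a"
proof -
  have "integral {0..a} f + integral {a..b} f = integral {0..b} f"
    using assms by (intro Henstock_Kurzweil_Integration.integral_combine integrable_01_subinterval
        indef_int_absolutely_integrable) auto
  moreover have "F b = F 0 + integral {0..b} f" "F a = F 0 + integral {0..a} f"
    using assms by (auto intro!: indef_intD[OF assms(1)])
  ultimately show ?thesis by (simp add: algebra_simps)
qed

lemma indef_int_norm_diff_le: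
  assumes "indef_int f F" "0 \<le> a" "a \<le> b" "b \<le> 1"
  shows "norm (F b - F a) \<le> integral {a..b} (\<lambda>x. norm (f x))"
  unfolding indef_int_integral[OF assms, symmetric]
  using assms(2-) absolutely_integrable_01_subinterval[OF indef_int_absolutely_integrable[OF assms(1)], of a b]
  by (intro integral_norm_bound_integral) (auto simp: absolutely_integrable_on_def)

lemma indef_int_continuous:
  assumes "indef_int f F"
  shows "continuous_on {0..1} F"
proof -
  have "f integrable_on {0..1}"
    using integrable_01_subinterval[OF indef_int_absolutely_integrable[OF assms], of 0 1] by simp
  then have "continuous_on {0..1} (\<lambda>x. F 0 + integral {0..x} f)"
    by (intro continuous_intros indefinite_integral_continuous_1)
  then show ?thesis
    by (rule continuous_on_eq) (rule indef_intD[OF assms, symmetric])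
qed

lemma indef_int_deriv:
  assumes F: "indef_int f F"
  shows "AE x in leb01. (F has_vector_derivative f x) (at x)"
proof -
  have ai: "(\<lambda>x. f x \<bullet> b) absolutely_integrable_on {0..1}" for b
    by (rule absolutely_integrable_component[OF indef_int_absolutely_integrable[OF F]])
  have "negligible (\<Union>b\<in>Basis. {x \<in> {0<..<1}. \<not> ((\<lambda>x. integral {0..x} (\<lambda>x. f x \<bullet> b)) has_real_derivative f x \<bullet> b) (at x)})"
    by (intro negligible_Union finite_imageI) (use negligible_not_deriv_indefinite_integral_real[OF ai] in auto)
  note neg = this
  show ?thesis unfolding AE_leb01_iff
  proof (rule negligible_subset[OF neg], intro subsetI, rule ccontr)
    fix x assume x: "x \<in> {x \<in> {0<..<1}. \<not> (F has_vector_derivative f x) (at x)}"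
      and "x \<notin> (\<Union>b\<in>Basis. {x \<in> {0<..<1}. \<not> ((\<lambda>x. integral {0..x} (\<lambda>x. f x \<bullet> b)) has_real_derivative f x \<bullet> b) (at x)})"
    then have d: "((\<lambda>x. integral {0..x} (\<lambda>x. f x \<bullet> b)) has_real_derivative f x \<bullet> b) (at x)" if "b \<in> Basis" for b
      using that by blast
    have "((\<lambda>y. F y \<bullet> b) has_derivative (\<lambda>h. (h *\<^sub>R f x) \<bullet> b)) (at x)" if b: "b \<in> Basis" for b
    proof -
      have "((\<lambda>y. F 0 \<bullet> b + integral {0..y} (\<lambda>x. f x \<bullet> b)) has_real_derivative f x \<bullet> b) (at x)"
        using d[OF b] by (auto intro!: derivative_eq_intros)
      then have "((\<lambda>y. F y \<bullet> b) has_real_derivative f x \<bullet> b) (at x)"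
      proof (rule has_field_derivative_transform_within_open[where S = "{0<..<1}"])
        fix y :: real assume y: "y \<in> {0<..<1}"
        then have "F y = F 0 + integral {0..y} f" by (intro indef_intD[OF F]) auto
        moreover have "integral {0..y} f \<bullet> b = integral {0..y} (\<lambda>x. f x \<bullet> b)"
          using integrable_01_subinterval[OF indef_int_absolutely_integrable[OF F], of 0 y] y
          by (intro integral_component_eq[symmetric]) auto
        ultimately show "F 0 \<bullet> b + integral {0..y} (\<lambda>x. f x \<bullet> b) = F y \<bullet> b"
          by (simp add: inner_add_left)
      qed (use x in auto)
      then show ?thesis
        by (simp add: has_field_derivative_def mult_commute_abs)
    qed
    then have "(F has_derivative (\<lambda>h. h *\<^sub>R f x)) (at x)"
      by (subst has_derivative_componentwise_within) blast
    then show False using x by (simp add: has_vector_derivative_def)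
  qed
qed

lemma indef_int_unique:
  assumes "indef_int f F" "indef_int g F"
  shows "AE x in leb01. f x = g x"
  using indef_int_deriv[OF assms(1)] indef_int_deriv[OF assms(2)]
  by eventually_elim (rule vector_derivative_unique_at)

lemma indef_int_cong_AE:
  assumes F: "indef_int f F" and "AE x in leb01. g x = f x" and "\<And>x. x \<in> {0..1} \<Longrightarrow> G x = F x"
  shows "indef_int g G"
proof (rule indef_intI)
  show "g absolutely_integrable_on {0..1}"
    by (rule absolutely_integrable_cong_AE[OF indef_int_absolutely_integrable[OF F] assms(2)])
  fix x :: real assume x: "x \<in> {0..1}"
  have "integral {0..x} g = integral {0..x} f"
    by (rule integral_cong_AE01[OF assms(2)]) (use x in auto)
  then show "G x = G 0 + integral {0..x} g"
    using indef_intD[OF F x] assms(3)[OF x] assms(3)[of 0] by simp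
qed

text \<open>The sum of the increments over a division is bounded by the mass, for the density
  \<open>h\<close>, of a finite union of open intervals, and absolute continuity of the integral
  makes this mass small.\<close>

lemma abs_continuous_on_dominated:
  assumes h: "h absolutely_integrable_on {0..1}" and nn: "\<And>x. x \<in> {0..1} \<Longrightarrow> 0 \<le> (h x :: real)"
    and H: "\<And>a b. 0 \<le> a \<Longrightarrow> a \<le> b \<Longrightarrow> b \<le> 1 \<Longrightarrow> norm (H b - H a) \<le> integral {a..b} h"
  shows "abs_continuous_on {0..1} H"
  unfolding abs_continuous_on_def
proof (intro allI impI)
  fix e :: real assume e: "e > 0"
  define g where "g = (\<lambda>x. indicator {0..1} x *\<^sub>R h x)"
  have g: "integrable lebesgue g" "\<And>x. 0 \<le> g x"
    using h nn by (auto simp: g_def set_integrable_def indicator_def)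
  have gh: "integral {a..b} g = integral {a..b} h" if "0 \<le> a" "b \<le> 1" for a b
    using that by (intro integral_cong) (auto simp: g_def)
  have [measurable]: "g \<in> borel_measurable lebesgue" using g by auto
  let ?N = "density lebesgue (\<lambda>x. ennreal (g x))"
  obtain d where d: "d > 0" "\<And>S. S \<in> sets lebesgue \<Longrightarrow> emeasure lebesgue S < ennreal d \<Longrightarrow>
      emeasure ?N S < ennreal e"
    using set_lintegral_small[OF g e] by blast
  have "(\<Sum>k\<in>D. norm (H (Sup k) - H (Inf k))) < e"
    if D: "D division_of t" and t: "t \<subseteq> {0..1}" and len: "(\<Sum>k\<in>D. Sup k - Inf k) < d" for D t
  proof -
    have fin: "finite D" using D by blast
    have k: "Inf k \<le> Sup k" "{Inf k..Sup k} = k" "0 \<le> Inf k" "Sup k \<le> 1" if kD: "k \<in> D" for k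
    proof -
      obtain a b where ab: "a \<le> b" "k = {a..b}"
        using division_ofD(3)[OF D kD] division_ofD(4)[OF D kD] by (metis atLeastatMost_empty_iff box_real(2))
      then have "Inf k = a" "Sup k = b" by simp_all
      moreover have "a \<in> {0..1}" "b \<in> {0..1}"
      proof -
        have "k \<subseteq> {0..1}" using division_ofD(2)[OF D kD] t by blast
        moreover have "a \<in> k" "b \<in> k" using ab by auto
        ultimately show "a \<in> {0..1}" "b \<in> {0..1}" by blast+
      qed
      ultimately show "Inf k \<le> Sup k" "{Inf k..Sup k} = k" "0 \<le> Inf k" "Sup k \<le> 1"
        using ab by auto
    qed
    define T where "T = (\<Union>k\<in>D. {Inf k<..<Sup k})"
    have T: "T \<in> sets lebesgue"
      unfolding T_def using fin by (intro sets.finite_UN) auto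
    have int: "interior k = {Inf k<..<Sup k}" if "k \<in> D" for k
      using k(2)[OF that] interior_atLeastAtMost_real by metis
    have dis: "disjoint_family_on (\<lambda>k. {Inf k<..<Sup k}) D"
      unfolding disjoint_family_on_def using division_ofD(5)[OF D] int by metis
    have "emeasure lebesgue T = (\<Sum>k\<in>D. emeasure lebesgue {Inf k<..<Sup k})"
      unfolding T_def using fin dis by (intro sum_emeasure[symmetric]) auto
    also have "\<dots> = (\<Sum>k\<in>D. ennreal (Sup k - Inf k))"
      using k(1) by (intro sum.cong refl) simp
    also have "\<dots> = ennreal (\<Sum>k\<in>D. Sup k - Inf k)"
      using k(1) by (intro sum_ennreal) simp
    also have "\<dots> < ennreal d"
      using len d by (intro ennreal_lessI) auto
    finally have NT: "emeasure ?N T < ennreal e" using d(2)[OF T] by blast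
    have "ennreal (\<Sum>k\<in>D. norm (H (Sup k) - H (Inf k))) \<le> ennreal (\<Sum>k\<in>D. integral {Inf k..Sup k} g)"
      using H k(1) k(3) k(4) gh by (intro ennreal_leI sum_mono) simp
    also have "\<dots> = (\<Sum>k\<in>D. ennreal (integral {Inf k..Sup k} g))"
      using g(2) by (intro sum_ennreal[symmetric] Henstock_Kurzweil_Integration.integral_nonneg)
        (auto intro!: integrable_on_subinterval[OF integrable_on_lebesgue[OF g(1)]])
    also have "\<dots> = (\<Sum>k\<in>D. emeasure ?N {Inf k..Sup k})"
      by (simp only: emeasure_density_Icc[OF g])
    also have "\<dots> = (\<Sum>k\<in>D. emeasure ?N {Inf k<..<Sup k})"
    proof (rule sum.cong[OF refl])
      fix k assume kD: "k \<in> D"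
      have "{Inf k, Sup k} \<in> null_sets lebesgue"
        using negligible_iff_null_sets[of "{Inf k, Sup k}"] by simp
      then have "{Inf k, Sup k} \<in> null_sets ?N"
        using absolutely_continuousI_density[of "\<lambda>x. ennreal (g x)" lebesgue]
        by (auto simp: absolutely_continuous_def)
      then have "emeasure ?N ({Inf k<..<Sup k} \<union> {Inf k, Sup k}) = emeasure ?N {Inf k<..<Sup k}"
        by (intro emeasure_Un_null_set) auto
      moreover have "{Inf k..Sup k} = {Inf k<..<Sup k} \<union> {Inf k, Sup k}"
        using k(1)[OF kD] by auto
      ultimately show "emeasure ?N {Inf k..Sup k} = emeasure ?N {Inf k<..<Sup k}"
        by metis
    qed
    also have "\<dots> = emeasure ?N T"
      unfolding T_def using fin dis by (intro sum_emeasure) auto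
    also note NT
    finally show ?thesis
      using e by (simp add: ennreal_less_iff sum_nonneg)
  qed
  then show "\<exists>d>0. \<forall>D t. D division_of t \<and> t \<subseteq> {0..1} \<and> (\<Sum>k\<in>D. Sup k - Inf k) < d
        \<longrightarrow> (\<Sum>k\<in>D. norm (H (Sup k) - H (Inf k))) < e"
    using d(1) by blast
qed

lemma abs_continuous_on_imp_indef_int:
  assumes "abs_continuous_on {0..1} F"
  obtains f where "indef_int f F"
proof -
  obtain g where g: "g absolutely_integrable_on {0..1}" "\<And>x. x \<in> {0..1} \<Longrightarrow> Re (F x) - Re (F 0) = integral {0..x} g"
    by (rule ac_modulus_indefinite_integral[of "\<lambda>x. Re (F x)"])
      (use abs_continuous_on_imp_ac_modulus[OF assms] in blast)+
  obtain h where h: "h absolutely_integrable_on {0..1}" "\<And>x. x \<in> {0..1} \<Longrightarrow> Im (F x) - Im (F 0) = integral {0..x} h"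
    by (rule ac_modulus_indefinite_integral[of "\<lambda>x. Im (F x)"])
      (use abs_continuous_on_imp_ac_modulus[OF assms] in blast)+
  show thesis
  proof (rule that[of "\<lambda>x. Complex (g x) (h x)"], rule indef_intI)
    show ai: "(\<lambda>x. Complex (g x) (h x)) absolutely_integrable_on {0..1}"
      by (rule absolutely_integrable_componentwise) (use g h in \<open>auto simp: Basis_complex_def\<close>)
    fix x :: real assume x: "x \<in> {0..1}"
    have "(\<lambda>x. Complex (g x) (h x)) integrable_on {0..x}"
      using integrable_01_subinterval[OF ai] x by auto
    from integral_component_eq[OF this, of 1] integral_component_eq[OF this, of \<i>]
    show "F x = F 0 + integral {0..x} (\<lambda>x. Complex (g x) (h x))"
      using g(2)[OF x] h(2)[OF x] by (intro complex_eqI) auto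
  qed
qed

lemma indef_int_imp_abs_continuous_on:
  assumes "indef_int f F"
  shows "abs_continuous_on {0..1} F"
proof (rule abs_continuous_on_dominated)
  show "(\<lambda>x. norm (f x)) absolutely_integrable_on {0..1}"
    using absolutely_integrable_norm[OF indef_int_absolutely_integrable[OF assms]] by (simp add: o_def)
qed (use indef_int_norm_diff_le[OF assms] in auto)

text \<open>Domination yields absolute continuity and hence some density; the almost everywhere
  derivative identifies it with \<open>k\<close>. Products and exponentials are handled this way, by
  an increment estimate and the pointwise rule of differentiation.\<close>

lemma indef_intI_dominated:
  assumes "h absolutely_integrable_on {0..1}" "\<And>x. x \<in> {0..1} \<Longrightarrow> 0 \<le> (h x :: real)"
    and "\<And>a b. 0 \<le> a \<Longrightarrow> a \<le> b \<Longrightarrow> b \<le> 1 \<Longrightarrow> norm (H b - H a) \<le> integral {a..b} h"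
    and H': "AE x in leb01. (H has_vector_derivative k x) (at x)"
  shows "indef_int k H"
proof -
  obtain f where f: "indef_int f H"
    using abs_continuous_on_imp_indef_int[OF abs_continuous_on_dominated[OF assms(1-3)]] .
  have "AE x in leb01. k x = f x"
    using H' indef_int_deriv[OF f] by eventually_elim (rule vector_derivative_unique_at)
  from indef_int_cong_AE[OF f this] show ?thesis by simp
qed

section \<open>Calculus rules for indefinite integrals\<close>

lemma indef_int_bounded:
  assumes "indef_int f F"
  obtains M where "M \<ge> 0" "\<And>x. x \<in> {0..1} \<Longrightarrow> norm (F x) \<le> M"
proof -
  have "bounded (F ` {0..1})"
    using compact_continuous_image[OF indef_int_continuous[OF assms]] compact_imp_bounded by blast
  then obtain M where M: "\<And>x. x \<in> {0..1} \<Longrightarrow> norm (F x) \<le> M" unfolding bounded_iff by blast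
  have "0 \<le> M" using M[of 0] norm_ge_zero[of "F 0"] by (meson atLeastAtMost_iff order_refl order_trans zero_le_one)
  then show thesis using that M by blast
qed

lemma indef_int_mult:
  assumes F: "indef_int f F" and G: "indef_int g G"
  shows "indef_int (\<lambda>x. F x * g x + f x * G x) (\<lambda>x. F x * G x)"
proof -
  obtain M where M: "M \<ge> 0" "\<And>x. x \<in> {0..1} \<Longrightarrow> norm (F x) \<le> M" using indef_int_bounded[OF F] by blast
  obtain L where L: "L \<ge> 0" "\<And>x. x \<in> {0..1} \<Longrightarrow> norm (G x) \<le> L" using indef_int_bounded[OF G] by blast
  have nf: "(\<lambda>x. norm (f x)) absolutely_integrable_on {0..1}" and ng: "(\<lambda>x. norm (g x)) absolutely_integrable_on {0..1}"
    using absolutely_integrable_norm[OF indef_int_absolutely_integrable[OF F]]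
      absolutely_integrable_norm[OF indef_int_absolutely_integrable[OF G]] by (simp_all add: o_def)
  show ?thesis
  proof (rule indef_intI_dominated[where h = "\<lambda>x. M * norm (g x) + L * norm (f x)"])
    show "(\<lambda>x. M * norm (g x) + L * norm (f x)) absolutely_integrable_on {0..1}"
      using nf ng by (intro set_integral_add set_integrable_mult_right)
    show "AE x in leb01. ((\<lambda>x. F x * G x) has_vector_derivative F x * g x + f x * G x) (at x)"
      using indef_int_deriv[OF F] indef_int_deriv[OF G] by eventually_elim (rule has_vector_derivative_mult)
    fix a b :: real assume ab: "0 \<le> a" "a \<le> b" "b \<le> 1"
    have i: "(\<lambda>x. norm (f x)) integrable_on {a..b}" "(\<lambda>x. norm (g x)) integrable_on {a..b}"
      using integrable_01_subinterval[OF nf] integrable_01_subinterval[OF ng] ab by auto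
    have "F b * G b - F a * G a = F b * (G b - G a) + (F b - F a) * G a"
      by (simp add: algebra_simps)
    then have "norm (F b * G b - F a * G a) \<le> norm (F b) * norm (G b - G a) + norm (F b - F a) * norm (G a)"
      by (metis norm_triangle_ineq norm_mult)
    also have "\<dots> \<le> M * integral {a..b} (\<lambda>x. norm (g x)) + integral {a..b} (\<lambda>x. norm (f x)) * L"
      using M L ab indef_int_norm_diff_le[OF F ab] indef_int_norm_diff_le[OF G ab]
      by (intro add_mono mult_mono) (auto intro: order_trans[OF norm_ge_zero])
    also have "\<dots> = integral {a..b} (\<lambda>x. M * norm (g x) + L * norm (f x))"
      using integrable_on_cmult_left[OF i(1), of L] integrable_on_cmult_left[OF i(2), of M]
      by (subst integral_add) (auto simp: mult.commute)
    finally show "norm (F b * G b - F a * G a) \<le> integral {a..b} (\<lambda>x. M * norm (g x) + L * norm (f x))" .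
  qed (use M L in auto)
qed

lemma norm_exp_diff_le:
  fixes z w :: complex
  assumes "norm z \<le> M" "norm w \<le> M"
  shows "norm (exp z - exp w) \<le> exp M * norm (z - w)"
proof (rule field_differentiable_bound[of "cball 0 M" exp exp])
  fix z :: complex assume "z \<in> cball 0 M"
  then show "norm (exp z) \<le> exp M"
    using complex_Re_le_cmod[of z] by (simp add: norm_exp_eq_Re)
qed (use assms in \<open>auto intro!: derivative_eq_intros\<close>)

lemma indef_int_exp:
  assumes F: "indef_int f F"
  shows "indef_int (\<lambda>x. f x * exp (F x)) (\<lambda>x. exp (F x))"
proof -
  obtain M where M: "M \<ge> 0" "\<And>x. x \<in> {0..1} \<Longrightarrow> norm (F x) \<le> M" using indef_int_bounded[OF F] by blast
  have nf: "(\<lambda>x. norm (f x)) absolutely_integrable_on {0..1}"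
    using absolutely_integrable_norm[OF indef_int_absolutely_integrable[OF F]] by (simp add: o_def)
  show ?thesis
  proof (rule indef_intI_dominated[where h = "\<lambda>x. exp M * norm (f x)"])
    show "(\<lambda>x. exp M * norm (f x)) absolutely_integrable_on {0..1}"
      using nf by (intro set_integrable_mult_right)
    show "AE x in leb01. ((\<lambda>x. exp (F x)) has_vector_derivative f x * exp (F x)) (at x)"
      using indef_int_deriv[OF F]
    proof eventually_elim
      case (elim x)
      have "(exp has_field_derivative exp (F x)) (at (F x))" by (rule DERIV_exp)
      from field_vector_diff_chain_at[OF elim this] show ?case by (simp add: o_def)
    qed
    fix a b :: real assume ab: "0 \<le> a" "a \<le> b" "b \<le> 1"
    have "norm (exp (F b) - exp (F a)) \<le> exp M * norm (F b - F a)"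
      using M ab by (intro norm_exp_diff_le) auto
    also have "\<dots> \<le> exp M * integral {a..b} (\<lambda>x. norm (f x))"
      using indef_int_norm_diff_le[OF F ab] by (intro mult_left_mono) auto
    finally show "norm (exp (F b) - exp (F a)) \<le> integral {a..b} (\<lambda>x. exp M * norm (f x))" by simp
  qed auto
qed

lemma indef_int_const: "indef_int (\<lambda>x. 0) (\<lambda>x. c)"
  by (simp add: indef_int_def)

lemma indef_int_add:
  assumes F: "indef_int f F" and G: "indef_int g G"
  shows "indef_int (\<lambda>x. f x + g x) (\<lambda>x. F x + G x)"
proof (rule indef_intI)
  show "(\<lambda>x. f x + g x) absolutely_integrable_on {0..1}"
    using F G by (intro set_integral_add indef_int_absolutely_integrable)
  fix x :: real assume x: "x \<in> {0..1}"
  have "integral {0..x} (\<lambda>x. f x + g x) = integral {0..x} f + integral {0..x} g"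
    using x integrable_01_subinterval[OF indef_int_absolutely_integrable[OF F], of 0 x]
      integrable_01_subinterval[OF indef_int_absolutely_integrable[OF G], of 0 x]
    by (intro Henstock_Kurzweil_Integration.integral_add) auto
  then show "F x + G x = F 0 + G 0 + integral {0..x} (\<lambda>x. f x + g x)"
    using indef_intD[OF F x] indef_intD[OF G x] by simp
qed

lemma indef_int_cmult:
  assumes F: "indef_int f F"
  shows "indef_int (\<lambda>x. c * f x) (\<lambda>x. c * F x)"
  using indef_int_mult[OF indef_int_const[of c] F] by simp

lemma indef_int_diff:
  assumes F: "indef_int f F" and G: "indef_int g G"
  shows "indef_int (\<lambda>x. f x - g x) (\<lambda>x. F x - G x)"
  using indef_int_add[OF F indef_int_cmult[OF G, of "-1"]] by simp

lemma indef_int_integral_01: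
  assumes "f absolutely_integrable_on {0..1}"
  shows "indef_int f (\<lambda>x. integral {0..x} f)"
  by (rule indef_intI[OF assms]) simp

lemma indef_int_zero_const:
  assumes "indef_int f F" "AE x in leb01. f x = 0" "x \<in> {0..1}"
  shows "F x = F 0"
  using indef_intD[OF assms(1,3)] integral_cong_AE01[OF assms(2), of "{0..x}"] assms(3) by simp

lemma indef_int_cnj:
  assumes F: "indef_int f F"
  shows "indef_int (\<lambda>x. cnj (f x)) (\<lambda>x. cnj (F x))"
proof (rule indef_intI)
  show "(\<lambda>x. cnj (f x)) absolutely_integrable_on {0..1}"
    using absolutely_integrable_linear[OF indef_int_absolutely_integrable[OF F] bounded_linear_cnj] by (simp add: o_def)
  fix x :: real assume x: "x \<in> {0..1}"
  have "integral {0..x} (cnj \<circ> f) = cnj (integral {0..x} f)"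
    using x integrable_01_subinterval[OF indef_int_absolutely_integrable[OF F], of 0 x]
    by (intro integral_linear bounded_linear_cnj) auto
  then show "cnj (F x) = cnj (F 0) + integral {0..x} (\<lambda>x. cnj (f x))"
    using arg_cong[OF indef_intD[OF F x], of cnj] by (simp add: o_def)
qed

subsection \<open>The quasi-differential system\<close>

lemma absolutely_integrable_continuous_mult:
  fixes f g :: "real \<Rightarrow> complex"
  assumes "f absolutely_integrable_on {0..1}" "continuous_on {0..1} g"
  shows "(\<lambda>x. f x * g x) absolutely_integrable_on {0..1}"
proof -
  have "(\<lambda>x. g x * f x) absolutely_integrable_on {0..1}"
  proof (rule absolutely_integrable_bounded_measurable_product[where h = "(*)", OF _ _ _ _ assms(1)])
    show "bilinear ((*) :: complex \<Rightarrow> complex \<Rightarrow> complex)" by (rule bilinear_times)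
    show "g \<in> borel_measurable (lebesgue_on {0..1})"
      using assms(2) by (intro continuous_imp_measurable_on_sets_lebesgue) auto
    show "bounded (g ` {0..1})"
      using compact_continuous_image[OF assms(2)] compact_imp_bounded by blast
  qed auto
  then show ?thesis by (simp add: mult.commute)
qed

lemma absolutely_integrable_continuous_mult_real:
  fixes f g :: "real \<Rightarrow> real"
  assumes "f absolutely_integrable_on {0..1}" "continuous_on {0..1} g"
  shows "(\<lambda>x. f x * g x) absolutely_integrable_on {0..1}"
proof -
  have "(\<lambda>x. g x * f x) absolutely_integrable_on {0..1}"
  proof (rule absolutely_integrable_bounded_measurable_product_real[OF _ _ _ assms(1)])
    show "g \<in> borel_measurable (lebesgue_on {0..1})"
      using assms(2) by (intro continuous_imp_measurable_on_sets_lebesgue) auto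
    show "bounded (g ` {0..1})"
      using compact_continuous_image[OF assms(2)] compact_imp_bounded by blast
  qed auto
  then show ?thesis by (simp add: mult.commute)
qed

lemma absolutely_integrable_of_real:
  fixes f :: "real \<Rightarrow> real"
  assumes "f absolutely_integrable_on S"
  shows "(\<lambda>x. complex_of_real (f x)) absolutely_integrable_on S"
  using absolutely_integrable_linear[OF assms bounded_linear_of_real] by (simp add: o_def)

lemma integral_of_real:
  fixes f :: "real \<Rightarrow> real"
  assumes "f integrable_on S"
  shows "integral S (\<lambda>x. complex_of_real (f x)) = complex_of_real (integral S f)"
  using integral_linear[OF assms bounded_linear_of_real] by (simp add: o_def)

lemma integral_nonneg_01:
  fixes f :: "real \<Rightarrow> real"
  assumes "f absolutely_integrable_on {0..1}" "\<And>x. x \<in> {0..1} \<Longrightarrow> 0 \<le> f x" "0 \<le> a" "b \<le> 1"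
  shows "0 \<le> integral {a..b} f"
  using integrable_01_subinterval[OF assms(1,3,4)] assms by (intro Henstock_Kurzweil_Integration.integral_nonneg) auto

lemma integral_le_01:
  fixes f g :: "real \<Rightarrow> real"
  assumes "f absolutely_integrable_on {0..1}" "g absolutely_integrable_on {0..1}"
    "\<And>x. x \<in> {0..1} \<Longrightarrow> f x \<le> g x" "0 \<le> a" "b \<le> 1"
  shows "integral {a..b} f \<le> integral {a..b} g"
  using integrable_01_subinterval[OF assms(1,4,5)] integrable_01_subinterval[OF assms(2,4,5)] assms
  by (intro integral_le) auto

lemma norm_integral_le_01:
  fixes f :: "real \<Rightarrow> 'a::euclidean_space"
  assumes "f absolutely_integrable_on {0..1}" "g absolutely_integrable_on {0..1}"
    "\<And>x. x \<in> {0..1} \<Longrightarrow> norm (f x) \<le> g x" "0 \<le> a" "b \<le> 1"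
  shows "norm (integral {a..b} f) \<le> integral {a..b} g"
  using integrable_01_subinterval[OF assms(1,4,5)] integrable_01_subinterval[OF assms(2,4,5)] assms
  by (intro integral_norm_bound_integral) auto

text \<open>The weight \<open>exp (2 * \<integral>a)\<close> makes the Picard operator of a linear system with
  coefficients bounded by \<open>a\<close> a contraction with constant 1/2.\<close>

lemma exp_weight:
  fixes a :: "real \<Rightarrow> real"
  assumes a: "a absolutely_integrable_on {0..1}" and a0: "\<forall>x\<in>{0..1}. 0 \<le> a x"
  defines "W \<equiv> (\<lambda>x. exp (2 * integral {0..x} a))"
  shows "continuous_on {0..1} W"
    and "\<And>x. x \<in> {0..1} \<Longrightarrow> 1 \<le> W x"
    and "\<And>x. x \<in> {0..1} \<Longrightarrow> W x \<le> W 1"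
    and "\<And>x. x \<in> {0..1} \<Longrightarrow> integral {0..x} (\<lambda>t. a t * W t) \<le> W x / 2"
proof -
  have cont: "continuous_on {0..1} (\<lambda>x. integral {0..x} a)"
    using integrable_01_subinterval[OF a, of 0 1] by (intro indefinite_integral_continuous_1) auto
  then show W: "continuous_on {0..1} W" unfolding W_def by (intro continuous_intros)
  show "1 \<le> W x" if "x \<in> {0..1}" for x
    unfolding W_def using integral_nonneg_01[OF a, of 0 x] a0 that by simp
  show "W x \<le> W 1" if "x \<in> {0..1}" for x
  proof -
    have "integral {0..x} a \<le> integral {0..1} a"
      using a a0 that integrable_01_subinterval[OF a, of 0 x] integrable_01_subinterval[OF a, of 0 1]
      by (intro integral_subset_le) auto
    then show ?thesis by (simp add: W_def)
  qed
  have cW: "complex_of_real (W x) = exp (2 * complex_of_real (integral {0..x} a))" for x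
    by (simp add: W_def exp_of_real[symmetric])
  have cI: "indef_int (\<lambda>x. complex_of_real (a x)) (\<lambda>x. complex_of_real (integral {0..x} a))"
    by (rule indef_intI)
       (use absolutely_integrable_of_real[OF a] integral_of_real integrable_01_subinterval[OF a] in auto)
  have iW: "indef_int (\<lambda>x. 2 * complex_of_real (a x) * complex_of_real (W x)) (\<lambda>x. complex_of_real (W x))"
    unfolding cW by (rule indef_int_exp[OF indef_int_cmult[OF cI]])
  have aW: "(\<lambda>t. a t * W t) absolutely_integrable_on {0..1}"
    by (rule absolutely_integrable_continuous_mult_real[OF a W])
  show "integral {0..x} (\<lambda>t. a t * W t) \<le> W x / 2" if x: "x \<in> {0..1}" for x
  proof -
    have int: "(\<lambda>t. a t * W t) integrable_on {0..x}"
      using integrable_01_subinterval[OF aW] x by auto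
    have "complex_of_real (W x) = complex_of_real (W 0) + integral {0..x} (\<lambda>x. complex_of_real (2 * (a x * W x)))"
      using indef_intD[OF iW x] by (simp add: mult.assoc)
    also have "integral {0..x} (\<lambda>x. complex_of_real (2 * (a x * W x))) = complex_of_real (integral {0..x} (\<lambda>x. 2 * (a x * W x)))"
      using integrable_on_cmult_left[OF int, of 2] by (intro integral_of_real) simp
    also have "integral {0..x} (\<lambda>x. 2 * (a x * W x)) = 2 * integral {0..x} (\<lambda>x. a x * W x)"
      by simp
    finally have "W x = 1 + 2 * integral {0..x} (\<lambda>x. a x * W x)"
      unfolding of_real_add[symmetric] of_real_eq_iff by (simp add: W_def)
    then show ?thesis by simp
  qed
qed

text \<open>Gronwall by a weighted maximum: if \<open>N\<close> is the maximum of
  \<open>\<phi> / W\<close>, the property of the weight \<open>W\<close> turns the integral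
  inequality into \<open>N \<le> c + N / 2\<close>. This explains the two factors 2 in the
  bound.\<close>

lemma integral_gronwall:
  fixes a \<phi> :: "real \<Rightarrow> real"
  assumes a: "a absolutely_integrable_on {0..1}" "\<And>x. x \<in> {0..1} \<Longrightarrow> 0 \<le> a x"
    and phi: "continuous_on {0..1} \<phi>" "\<And>x. x \<in> {0..1} \<Longrightarrow> 0 \<le> \<phi> x"
    and le: "\<And>x. x \<in> {0..1} \<Longrightarrow> \<phi> x \<le> c + integral {0..x} (\<lambda>t. a t * \<phi> t)"
    and x: "x \<in> {0..1}"
  shows "\<phi> x \<le> 2 * c * exp (2 * integral {0..1} a)"
proof -
  define W where "W = (\<lambda>x. exp (2 * integral {0..x} a))"
  have a0: "\<forall>x\<in>{0..1}. 0 \<le> a x" using a(2) by blast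
  have W: "continuous_on {0..1} W" "\<And>x. x \<in> {0..1} \<Longrightarrow> 1 \<le> W x" "\<And>x. x \<in> {0..1} \<Longrightarrow> W x \<le> W 1"
    "\<And>x. x \<in> {0..1} \<Longrightarrow> integral {0..x} (\<lambda>t. a t * W t) \<le> W x / 2"
    unfolding W_def using exp_weight[OF a(1) a0] by blast+
  have Wpos: "0 < W x" for x by (simp add: W_def)
  have contq: "continuous_on {0..1} (\<lambda>x. \<phi> x / W x)"
    using phi(1) W(1) Wpos by (intro continuous_intros) (auto simp: less_imp_neq[symmetric])
  obtain m where m: "m \<in> {0..1}" "\<And>y. y \<in> {0..1} \<Longrightarrow> \<phi> y / W y \<le> \<phi> m / W m"
    using continuous_attains_sup[OF compact_Icc _ contq] by fastforce
  define N where "N = \<phi> m / W m"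
  have N: "\<phi> y \<le> N * W y" if "y \<in> {0..1}" for y
    using m(2)[OF that] Wpos[of y] by (simp add: N_def field_simps)
  have N0: "0 \<le> N" using phi(2)[OF m(1)] Wpos[of m] by (simp add: N_def)
  have ai1: "(\<lambda>t. a t * \<phi> t) absolutely_integrable_on {0..1}"
    by (rule absolutely_integrable_continuous_mult_real[OF a(1) phi(1)])
  have ai2: "(\<lambda>t. a t * W t) absolutely_integrable_on {0..1}"
    by (rule absolutely_integrable_continuous_mult_real[OF a(1) W(1)])
  have c0: "0 \<le> c" using le[of 0] phi(2)[of 0] by simp
  have "\<phi> m \<le> c + integral {0..m} (\<lambda>t. a t * \<phi> t)" by (rule le[OF m(1)])
  also have "integral {0..m} (\<lambda>t. a t * \<phi> t) \<le> integral {0..m} (\<lambda>t. N * (a t * W t))"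
  proof (rule integral_le_01[OF ai1])
    show "(\<lambda>t. N * (a t * W t)) absolutely_integrable_on {0..1}"
      using ai2 by (intro set_integrable_mult_right)
    fix t :: real assume t: "t \<in> {0..1}"
    show "a t * \<phi> t \<le> N * (a t * W t)"
      using mult_left_mono[OF N[OF t] a(2)[OF t]] by (simp add: mult_ac)
  qed (use m in auto)
  also have "\<dots> = N * integral {0..m} (\<lambda>t. a t * W t)" by simp
  also have "\<dots> \<le> N * (W m / 2)"
    using W(4)[OF m(1)] N0 by (rule mult_left_mono)
  finally have "\<phi> m \<le> c * W m + N * (W m / 2)"
    using mult_left_mono[OF W(2)[OF m(1)] c0] by simp
  then have "N \<le> c + N / 2"
    using Wpos[of m] by (simp add: N_def field_simps)
  then have "N \<le> 2 * c" by simp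
  then have "N * W x \<le> 2 * c * W 1"
    using W(3)[OF x] c0 Wpos[of x] by (intro mult_mono) (auto simp: less_imp_le)
  then show ?thesis using N[OF x] by (simp add: W_def)
qed

text \<open>Picard iteration for a Lipschitz constant that is merely integrable in \<open>t\<close>.
  Consecutive iterates differ by at most \<open>C * (1/2) ^ n * W x\<close>, so they converge
  uniformly on the whole interval without subdividing it.\<close>

lemma caratheodory_existence:
  fixes L :: "real \<Rightarrow> 'b::euclidean_space \<Rightarrow> 'b"
  assumes a: "a absolutely_integrable_on {0..1}" "\<And>x. x \<in> {0..1} \<Longrightarrow> 0 \<le> a x"
    and int: "\<And>Z. continuous_on {0..1} Z \<Longrightarrow> (\<lambda>t. L t (Z t)) absolutely_integrable_on {0..1}"
    and lip: "\<And>t z z'. t \<in> {0..1} \<Longrightarrow> norm (L t z - L t z') \<le> a t * norm (z - z')"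
  obtains Z where "continuous_on {0..1} Z" "\<And>x. x \<in> {0..1} \<Longrightarrow> Z x = z0 + integral {0..x} (\<lambda>t. L t (Z t))"
proof -
  define W where "W = (\<lambda>x. exp (2 * integral {0..x} a))"
  have a0: "\<forall>x\<in>{0..1}. 0 \<le> a x" using a(2) by blast
  have W: "continuous_on {0..1} W" "\<And>x. x \<in> {0..1} \<Longrightarrow> 1 \<le> W x" "\<And>x. x \<in> {0..1} \<Longrightarrow> W x \<le> W 1"
    "\<And>x. x \<in> {0..1} \<Longrightarrow> integral {0..x} (\<lambda>t. a t * W t) \<le> W x / 2"
    unfolding W_def using exp_weight[OF a(1) a0] by blast+
  define P where "P = (\<lambda>Z x. z0 + integral {0..x} (\<lambda>t. L t (Z t)))"
  define X where "X = (\<lambda>n. (P ^^ n) (\<lambda>x. 0))"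
  have P_cont: "continuous_on {0..1} (P Z)" if "continuous_on {0..1} Z" for Z
    unfolding P_def using integrable_01_subinterval[OF int[OF that], of 0 1]
    by (intro continuous_intros indefinite_integral_continuous_1) auto
  have X_Suc: "X (Suc n) = P (X n)" for n by (simp add: X_def)
  have X_cont: "continuous_on {0..1} (X n)" for n
  proof (induction n)
    case 0 show ?case by (simp add: X_def)
  next
    case (Suc n) then show ?case unfolding X_Suc by (rule P_cont)
  qed
  have P_diff: "norm (P Z x - P Z' x) \<le> integral {0..x} (\<lambda>t. a t * norm (Z t - Z' t))"
    if Z: "continuous_on {0..1} Z" "continuous_on {0..1} Z'" and x: "x \<in> {0..1}" for Z Z' x
  proof -
    have i: "(\<lambda>t. L t (Z t)) integrable_on {0..x}" "(\<lambda>t. L t (Z' t)) integrable_on {0..x}"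
      using integrable_01_subinterval[OF int[OF Z(1)]] integrable_01_subinterval[OF int[OF Z(2)]] x by auto
    have "P Z x - P Z' x = integral {0..x} (\<lambda>t. L t (Z t) - L t (Z' t))"
      unfolding P_def using i by (simp add: Henstock_Kurzweil_Integration.integral_diff)
    also have "norm \<dots> \<le> integral {0..x} (\<lambda>t. a t * norm (Z t - Z' t))"
    proof (rule norm_integral_le_01)
      show "(\<lambda>t. L t (Z t) - L t (Z' t)) absolutely_integrable_on {0..1}"
        by (rule set_integral_diff(1)[OF int[OF Z(1)] int[OF Z(2)]])
      show "(\<lambda>t. a t * norm (Z t - Z' t)) absolutely_integrable_on {0..1}"
        by (intro absolutely_integrable_continuous_mult_real a(1) continuous_intros Z)
    qed (use x lip in auto)
    finally show ?thesis .
  qed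
  have "bounded ((\<lambda>x. X 1 x - X 0 x) ` {0..1})"
    by (intro compact_imp_bounded compact_continuous_image continuous_intros X_cont) auto
  then obtain C where C: "\<And>x. x \<in> {0..1} \<Longrightarrow> norm (X 1 x - X 0 x) \<le> C"
    unfolding bounded_iff by blast
  have C0: "0 \<le> C" using order_trans[OF norm_ge_zero C[of 0]] by simp
  have aW: "(\<lambda>t. a t * W t) absolutely_integrable_on {0..1}"
    by (rule absolutely_integrable_continuous_mult_real[OF a(1) W(1)])
  have step: "norm (X (Suc n) x - X n x) \<le> C * (1/2) ^ n * W x" if "x \<in> {0..1}" for n x
    using that
  proof (induction n arbitrary: x)
    case 0
    have "C * 1 \<le> C * W x" using W(2)[OF 0] C0 by (rule mult_left_mono)
    then show ?case using C[OF 0] by simp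
  next
    case (Suc n)
    have "norm (X (Suc (Suc n)) x - X (Suc n) x) \<le> integral {0..x} (\<lambda>t. a t * norm (X (Suc n) t - X n t))"
      using P_diff[OF X_cont X_cont Suc.prems, of "Suc n" n] by (simp only: X_Suc)
    also have "\<dots> \<le> integral {0..x} (\<lambda>t. C * (1/2) ^ n * (a t * W t))"
    proof (rule integral_le_01)
      show "(\<lambda>t. a t * norm (X (Suc n) t - X n t)) absolutely_integrable_on {0..1}"
        by (intro absolutely_integrable_continuous_mult_real a(1) continuous_intros X_cont)
      show "(\<lambda>t. C * (1/2) ^ n * (a t * W t)) absolutely_integrable_on {0..1}"
        using aW by (intro set_integrable_mult_right)
      fix t :: real assume t: "t \<in> {0..1}"
      show "a t * norm (X (Suc n) t - X n t) \<le> C * (1/2) ^ n * (a t * W t)"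
        using mult_left_mono[OF Suc.IH[OF t] a(2)[OF t]] by (simp add: mult_ac)
    qed (use Suc.prems in auto)
    also have "\<dots> = C * (1/2) ^ n * integral {0..x} (\<lambda>t. a t * W t)" by simp
    also have "\<dots> \<le> C * (1/2) ^ n * (W x / 2)"
      using W(4)[OF Suc.prems] C0 by (intro mult_left_mono) auto
    finally show ?case by simp
  qed
  have "uniform_limit {0..1} (\<lambda>n x. \<Sum>i<n. X (Suc i) x - X i x) (\<lambda>x. \<Sum>i. X (Suc i) x - X i x) sequentially"
  proof (rule Weierstrass_m_test)
    show "norm (X (Suc n) x - X n x) \<le> C * (1/2) ^ n * W 1" if "x \<in> {0..1}" for n x
      using step[OF that, of n] mult_left_mono[OF W(3)[OF that], of "C * (1/2) ^ n"] C0 by force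
    show "summable (\<lambda>n. C * (1/2) ^ n * W 1)"
      by (intro summable_mult summable_mult2 summable_geometric) auto
  qed
  moreover have "(\<Sum>i<n. X (Suc i) x - X i x) = X n x" for n x
    by (subst sum_lessThan_telescope) (simp add: X_def)
  ultimately obtain Z where ul: "uniform_limit {0..1} X Z sequentially"
    by auto
  have Z_cont: "continuous_on {0..1} Z"
    by (rule uniform_limit_theorem[OF _ ul]) (auto simp: X_cont)
  have "Z x = P Z x" if x: "x \<in> {0..1}" for x
  proof (rule LIMSEQ_unique)
    show "(\<lambda>n. X (Suc n) x) \<longlonglongrightarrow> Z x"
      by (rule LIMSEQ_Suc[OF tendsto_uniform_limitI[OF ul x]])
    show "(\<lambda>n. X (Suc n) x) \<longlonglongrightarrow> P Z x"
    proof (rule LIMSEQ_I)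
      fix e :: real assume e: "e > 0"
      define I where "I = integral {0..1} a"
      have I0: "0 \<le> I" unfolding I_def using integral_nonneg_01[OF a] by auto
      then have "0 < e / (I + 1)" using e by simp
      then obtain n0 where n0: "\<And>n y. n \<ge> n0 \<Longrightarrow> y \<in> {0..1} \<Longrightarrow> dist (X n y) (Z y) < e / (I + 1)"
        using ul unfolding uniform_limit_sequentially_iff by metis
      have "norm (X (Suc n) x - P Z x) < e" if "n \<ge> n0" for n
      proof -
        have "norm (X (Suc n) x - P Z x) \<le> integral {0..x} (\<lambda>t. a t * norm (X n t - Z t))"
          unfolding X_Suc by (rule P_diff[OF X_cont Z_cont x])
        also have "\<dots> \<le> integral {0..x} (\<lambda>t. e / (I + 1) * a t)"
        proof (rule integral_le_01)
          show "(\<lambda>t. a t * norm (X n t - Z t)) absolutely_integrable_on {0..1}"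
            by (intro absolutely_integrable_continuous_mult_real a(1) continuous_intros X_cont Z_cont)
          show "(\<lambda>t. e / (I + 1) * a t) absolutely_integrable_on {0..1}"
            using a(1) by (intro set_integrable_mult_right)
          fix t :: real assume t: "t \<in> {0..1}"
          have "norm (X n t - Z t) \<le> e / (I + 1)" using n0[OF that t] by (simp add: dist_norm)
          then show "a t * norm (X n t - Z t) \<le> e / (I + 1) * a t"
            using mult_left_mono[OF _ a(2)[OF t]] by (metis mult.commute)
        qed (use x in auto)
        also have "\<dots> = e / (I + 1) * integral {0..x} a" by simp
        also have "integral {0..x} a \<le> I"
          unfolding I_def using a x integrable_01_subinterval[OF a(1), of 0 x] integrable_01_subinterval[OF a(1), of 0 1]
          by (intro integral_subset_le) auto
        then have "e / (I + 1) * integral {0..x} a \<le> e / (I + 1) * I"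
          using e I0 by (intro mult_left_mono) auto
        also have "\<dots> < e" using e I0 by (simp add: field_simps)
        finally show ?thesis .
      qed
      then show "\<exists>no. \<forall>n\<ge>no. norm (X (Suc n) x - P Z x) < e" by blast
    qed
  qed
  then show thesis using that[OF Z_cont] unfolding P_def by blast
qed

text \<open>The equation as a system: \<open>u\<close> is the quasi-derivative, with
  \<open>y' = r y + u\<close> and \<open>u' = - r u - w y + f\<close>. For \<open>w = r^2\<close> it
  expresses \<open>- ell r y = f\<close>; for the potential \<open>pot p r z\<close> introduced
  below it expresses \<open>T(z) y = f\<close>.\<close>

definition qsol :: "(real \<Rightarrow> real) \<Rightarrow> (real \<Rightarrow> complex) \<Rightarrow> (real \<Rightarrow> complex) \<Rightarrow>
    (real \<Rightarrow> complex) \<Rightarrow> (real \<Rightarrow> complex) \<Rightarrow> bool" where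
  "qsol r w f y u \<longleftrightarrow> indef_int (\<lambda>x. complex_of_real (r x) * y x + u x) y \<and>
     indef_int (\<lambda>x. - complex_of_real (r x) * u x - w x * y x + f x) u"

lemma qsol_exists:
  assumes r: "r absolutely_integrable_on {0..1}" and w: "w absolutely_integrable_on {0..1}"
    and f: "f absolutely_integrable_on {0..1}"
  obtains y u where "qsol r w f y u" "y 0 = y0" "u 0 = u0"
proof -
  \<comment> \<open>A Lipschitz constant of the system: \<open>\<bar>r t\<bar>\<close> for each of
    the two diagonal entries, \<open>norm (w t)\<close> and 1 for the other two.\<close>
  define a where "a = (\<lambda>t. 2 * \<bar>r t\<bar> + norm (w t) + 1)"
  define L where "L = (\<lambda>t (z :: complex \<times> complex). (complex_of_real (r t) * fst z + snd z,
      - complex_of_real (r t) * snd z - w t * fst z + f t))"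
  note rc = absolutely_integrable_of_real[OF r]
  have a: "a absolutely_integrable_on {0..1}"
    unfolding a_def using absolutely_integrable_norm[OF w] absolutely_integrable_norm[OF r]
    by (intro set_integral_add set_integrable_mult_right) (auto simp: o_def)
  have a0: "0 \<le> a x" for x by (simp add: a_def)
  have int1: "(\<lambda>t. complex_of_real (r t) * fst (Z t) + snd (Z t)) absolutely_integrable_on {0..1}" (is ?A)
    and int2: "(\<lambda>t. - complex_of_real (r t) * snd (Z t) - w t * fst (Z t) + f t) absolutely_integrable_on {0..1}" (is ?B)
    if Z: "continuous_on {0..1} Z" for Z :: "real \<Rightarrow> complex \<times> complex"
  proof -
    have c: "continuous_on {0..1} (\<lambda>t. fst (Z t))" "continuous_on {0..1} (\<lambda>t. snd (Z t))"
      using continuous_on_fst[OF Z] continuous_on_snd[OF Z] .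
    show ?A
      by (intro set_integral_add absolutely_integrable_continuous_mult rc absolutely_integrable_continuous_real c)
    have "(\<lambda>t. - (complex_of_real (r t) * snd (Z t)) - w t * fst (Z t) + f t) absolutely_integrable_on {0..1}"
      using absolutely_integrable_continuous_mult[OF rc c(2)] absolutely_integrable_continuous_mult[OF w c(1)]
      by (intro set_integral_add set_integral_diff f) (auto simp: set_integrable_def)
    then show ?B by simp
  qed
  have intL: "(\<lambda>t. L t (Z t)) absolutely_integrable_on {0..1}" if "continuous_on {0..1} Z" for Z
    proof (rule absolutely_integrable_componentwise)
      fix b :: "complex \<times> complex" assume "b \<in> Basis"
      have eq: "(\<lambda>t. L t (Z t) \<bullet> b) = (\<lambda>t. (complex_of_real (r t) * fst (Z t) + snd (Z t)) \<bullet> fst b +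
          (- complex_of_real (r t) * snd (Z t) - w t * fst (Z t) + f t) \<bullet> snd b)"
        by (auto simp: L_def inner_prod_def)
      show "(\<lambda>t. L t (Z t) \<bullet> b) absolutely_integrable_on {0..1}"
        unfolding eq by (intro set_integral_add absolutely_integrable_component int1 int2 that)
  qed
  obtain Z where Z: "continuous_on {0..1} Z" "\<And>x. x \<in> {0..1} \<Longrightarrow> Z x = (y0, u0) + integral {0..x} (\<lambda>t. L t (Z t))"
  proof (rule caratheodory_existence[OF a _ intL, where ?z0.0 = "(y0, u0)"])
    fix t :: real and z z' :: "complex \<times> complex"
    have "L t z - L t z' = (complex_of_real (r t) * fst (z - z') + snd (z - z'),
        - complex_of_real (r t) * snd (z - z') - w t * fst (z - z'))"
      by (simp add: L_def algebra_simps)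
    also have "norm \<dots> \<le> norm (complex_of_real (r t) * fst (z - z') + snd (z - z')) +
        norm (- complex_of_real (r t) * snd (z - z') - w t * fst (z - z'))"
      by (rule norm_Pair_le)
    also have "\<dots> \<le> (\<bar>r t\<bar> * norm (fst (z - z')) + norm (snd (z - z'))) +
        (\<bar>r t\<bar> * norm (snd (z - z')) + norm (w t) * norm (fst (z - z')))"
      by (intro add_mono order_trans[OF norm_triangle_ineq] order_trans[OF norm_triangle_ineq4])
         (simp_all only: norm_mult norm_of_real norm_minus_cancel real_norm_def abs_minus_cancel order_refl)
    also have "\<dots> \<le> (\<bar>r t\<bar> * norm (z - z') + norm (z - z')) +
        (\<bar>r t\<bar> * norm (z - z') + norm (w t) * norm (z - z'))"
      by (intro add_mono mult_left_mono norm_fst_le[of "fst (z - z')" "snd (z - z')", unfolded prod.collapse]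
          norm_snd_le[of "snd (z - z')" "fst (z - z')", unfolded prod.collapse]) auto
    also have "\<dots> = a t * norm (z - z')" by (simp add: a_def algebra_simps)
    finally show "norm (L t z - L t z') \<le> a t * norm (z - z')" .
  qed (use a0 in auto)
  show thesis
  proof (rule that[of "\<lambda>x. fst (Z x)" "\<lambda>x. snd (Z x)"])
    have Z0: "Z 0 = (y0, u0)" using Z(2)[of 0] by simp
    then show "fst (Z 0) = y0" "snd (Z 0) = u0" by simp_all
    have L: "(\<lambda>t. L t (Z t)) integrable_on {0..x}" if "x \<in> {0..1}" for x
    proof -
      have "(\<lambda>t. L t (Z t)) absolutely_integrable_on {0..1}" by (rule intL[OF Z(1)])
      then show ?thesis using integrable_01_subinterval[of "\<lambda>t. L t (Z t)" 0 x] that by simp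
    qed
    show "qsol r w f (\<lambda>x. fst (Z x)) (\<lambda>x. snd (Z x))"
      unfolding qsol_def
    proof (intro conjI indef_intI int1 int2 Z(1))
      fix x :: real assume x: "x \<in> {0..1}"
      show "fst (Z x) = fst (Z 0) + integral {0..x} (\<lambda>t. complex_of_real (r t) * fst (Z t) + snd (Z t))"
        using arg_cong[OF Z(2)[OF x], of fst] integral_linear[OF L[OF x] bounded_linear_fst] Z0
        by (simp add: L_def o_def)
      show "snd (Z x) = snd (Z 0) + integral {0..x} (\<lambda>t. - complex_of_real (r t) * snd (Z t) - w t * fst (Z t) + f t)"
        using arg_cong[OF Z(2)[OF x], of snd] integral_linear[OF L[OF x] bounded_linear_snd] Z0
        by (simp add: L_def o_def)
    qed
  qed
qed

section \<open>A priori bound, uniqueness and Wronskian identities\<close>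

lemma
  assumes "qsol r w f y u"
  shows qsol_y: "indef_int (\<lambda>x. complex_of_real (r x) * y x + u x) y"
    and qsol_u: "indef_int (\<lambda>x. - complex_of_real (r x) * u x - w x * y x + f x) u"
    and qsol_cont_y: "continuous_on {0..1} y" and qsol_cont_u: "continuous_on {0..1} u"
  using assms indef_int_continuous by (auto simp: qsol_def)

text \<open>Gronwall's inequality for \<open>norm (y x) + norm (u x)\<close>. It is the source of
  uniqueness, of the resolvent estimate and of the Lipschitz dependence on the spectral
  parameter.\<close>

lemma qsol_bound:
  assumes r: "r absolutely_integrable_on {0..1}" and w: "w absolutely_integrable_on {0..1}"
    and f: "f absolutely_integrable_on {0..1}" and q: "qsol r w f y u" and x: "x \<in> {0..1}"
  shows "norm (y x) + norm (u x) \<le> 2 * (norm (y 0) + norm (u 0) + integral {0..1} (\<lambda>t. norm (f t))) *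
    exp (2 * integral {0..1} (\<lambda>t. 2 * \<bar>r t\<bar> + norm (w t) + 1))"
proof -
  note Y = qsol_y[OF q] and U = qsol_u[OF q]
  define a where "a = (\<lambda>t. 2 * \<bar>r t\<bar> + norm (w t) + 1)"
  have nf: "(\<lambda>t. norm (f t)) absolutely_integrable_on {0..1}"
    using absolutely_integrable_norm[OF f] by (simp add: o_def)
  have a: "a absolutely_integrable_on {0..1}"
    unfolding a_def using absolutely_integrable_norm[OF w] absolutely_integrable_norm[OF r]
    by (intro set_integral_add set_integrable_mult_right) (auto simp: o_def)
  define c where "c = norm (y 0) + norm (u 0) + integral {0..1} (\<lambda>t. norm (f t))"
  define \<phi> where "\<phi> = (\<lambda>x. norm (y x) + norm (u x))"
  have cphi: "continuous_on {0..1} \<phi>"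
    unfolding \<phi>_def by (intro continuous_intros qsol_cont_y[OF q] qsol_cont_u[OF q])
  have aphi: "(\<lambda>t. a t * \<phi> t) absolutely_integrable_on {0..1}"
    by (rule absolutely_integrable_continuous_mult_real[OF a cphi])
  have "\<phi> x \<le> 2 * c * exp (2 * integral {0..1} a)"
  proof (rule integral_gronwall[OF a _ cphi _ _ x])
    fix x :: real assume x: "x \<in> {0..1}"
    have n1: "(\<lambda>t. norm (complex_of_real (r t) * y t + u t)) absolutely_integrable_on {0..1}"
      using absolutely_integrable_norm[OF indef_int_absolutely_integrable[OF Y]] by (simp add: o_def)
    have n2: "(\<lambda>t. norm (- complex_of_real (r t) * u t - w t * y t + f t)) absolutely_integrable_on {0..1}"
      using absolutely_integrable_norm[OF indef_int_absolutely_integrable[OF U]] by (simp add: o_def)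
    have "norm (y x) \<le> norm (y 0) + norm (y x - y 0)" "norm (u x) \<le> norm (u 0) + norm (u x - u 0)"
      using norm_triangle_ineq[of "y 0" "y x - y 0"] norm_triangle_ineq[of "u 0" "u x - u 0"] by simp_all
    moreover have "norm (y x - y 0) \<le> integral {0..x} (\<lambda>t. norm (complex_of_real (r t) * y t + u t))"
      using indef_int_norm_diff_le[OF Y, of 0 x] x by simp
    moreover have "norm (u x - u 0) \<le> integral {0..x} (\<lambda>t. norm (- complex_of_real (r t) * u t - w t * y t + f t))"
      using indef_int_norm_diff_le[OF U, of 0 x] x by simp
    moreover have "integral {0..x} (\<lambda>t. norm (complex_of_real (r t) * y t + u t)) +
          integral {0..x} (\<lambda>t. norm (- complex_of_real (r t) * u t - w t * y t + f t)) =
        integral {0..x} (\<lambda>t. norm (complex_of_real (r t) * y t + u t) +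
          norm (- complex_of_real (r t) * u t - w t * y t + f t))"
      using x integrable_01_subinterval[OF n1, of 0 x] integrable_01_subinterval[OF n2, of 0 x]
      by (intro Henstock_Kurzweil_Integration.integral_add[symmetric]) auto
    moreover have "\<dots> \<le> integral {0..x} (\<lambda>t. a t * \<phi> t + norm (f t))"
    proof (rule integral_le_01)
      show "(\<lambda>t. norm (complex_of_real (r t) * y t + u t) + norm (- complex_of_real (r t) * u t - w t * y t + f t))
          absolutely_integrable_on {0..1}"
        by (rule set_integral_add(1)[OF n1 n2])
      show "(\<lambda>t. a t * \<phi> t + norm (f t)) absolutely_integrable_on {0..1}"
        by (rule set_integral_add(1)[OF aphi nf])
      fix t :: real
      have "norm (complex_of_real (r t) * y t + u t) \<le> \<bar>r t\<bar> * norm (y t) + norm (u t)"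
        using norm_triangle_ineq[of "complex_of_real (r t) * y t" "u t"] by (simp add: norm_mult)
      moreover have "norm (- complex_of_real (r t) * u t - w t * y t + f t) \<le>
          \<bar>r t\<bar> * norm (u t) + norm (w t) * norm (y t) + norm (f t)"
        using norm_triangle_ineq[of "- complex_of_real (r t) * u t - w t * y t" "f t"]
          norm_triangle_ineq4[of "- complex_of_real (r t) * u t" "w t * y t"] by (simp add: norm_mult)
      moreover have "a t * \<phi> t = 2 * \<bar>r t\<bar> * norm (y t) + norm (w t) * norm (y t) + norm (y t)
          + 2 * \<bar>r t\<bar> * norm (u t) + norm (w t) * norm (u t) + norm (u t)"
        by (simp add: a_def \<phi>_def algebra_simps)
      moreover have "0 \<le> \<bar>r t\<bar> * norm (y t)" "0 \<le> \<bar>r t\<bar> * norm (u t)" "0 \<le> norm (w t) * norm (u t)" "0 \<le> norm (y t)"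
        by simp_all
      ultimately show "norm (complex_of_real (r t) * y t + u t) + norm (- complex_of_real (r t) * u t - w t * y t + f t)
          \<le> a t * \<phi> t + norm (f t)"
        by linarith
    qed (use x in auto)
    moreover have "integral {0..x} (\<lambda>t. a t * \<phi> t + norm (f t)) =
        integral {0..x} (\<lambda>t. a t * \<phi> t) + integral {0..x} (\<lambda>t. norm (f t))"
      using x integrable_01_subinterval[OF aphi, of 0 x] integrable_01_subinterval[OF nf, of 0 x]
      by (intro Henstock_Kurzweil_Integration.integral_add) auto
    moreover have "integral {0..x} (\<lambda>t. norm (f t)) \<le> integral {0..1} (\<lambda>t. norm (f t))"
      using x integrable_01_subinterval[OF nf, of 0 x] integrable_01_subinterval[OF nf, of 0 1]
      by (intro integral_subset_le) auto
    ultimately show "\<phi> x \<le> c + integral {0..x} (\<lambda>t. a t * \<phi> t)"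
      unfolding \<phi>_def c_def by linarith
  qed (auto simp: a_def \<phi>_def)
  then show ?thesis by (simp add: \<phi>_def c_def a_def)
qed

lemma qsol_lincomb:
  assumes q1: "qsol r w f1 y1 u1" and q2: "qsol r w f2 y2 u2"
  shows "qsol r w (\<lambda>x. c * f1 x + d * f2 x) (\<lambda>x. c * y1 x + d * y2 x) (\<lambda>x. c * u1 x + d * u2 x)"
proof -
  have "indef_int (\<lambda>x. c * (complex_of_real (r x) * y1 x + u1 x) + d * (complex_of_real (r x) * y2 x + u2 x))
      (\<lambda>x. c * y1 x + d * y2 x)"
    by (intro indef_int_add indef_int_cmult qsol_y[OF q1] qsol_y[OF q2])
  moreover have "indef_int (\<lambda>x. c * (- complex_of_real (r x) * u1 x - w x * y1 x + f1 x) + d * (- complex_of_real (r x) * u2 x - w x * y2 x + f2 x))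
      (\<lambda>x. c * u1 x + d * u2 x)"
    by (intro indef_int_add indef_int_cmult qsol_u[OF q1] qsol_u[OF q2])
  ultimately show ?thesis unfolding qsol_def by (simp add: algebra_simps)
qed

text \<open>Moves a change of the coefficient \<open>w\<close> into the inhomogeneity, so that
  solutions for different spectral parameters can be compared within one system.\<close>

lemma qsol_change_w:
  assumes "qsol r w f y u"
  shows "qsol r w' (\<lambda>x. f x + (w' x - w x) * y x) y u"
  using assms unfolding qsol_def by (simp add: algebra_simps)

lemma qsol_cong_AE:
  assumes "qsol r w f y u" "AE x in leb01. f' x = f x"
  shows "qsol r w f' y u"
  unfolding qsol_def
proof
  show "indef_int (\<lambda>x. complex_of_real (r x) * y x + u x) y" by (rule qsol_y[OF assms(1)])
  show "indef_int (\<lambda>x. - complex_of_real (r x) * u x - w x * y x + f' x) u"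
    by (rule indef_int_cong_AE[OF qsol_u[OF assms(1)]]) (use assms(2) in auto)
qed

lemma qsol_zero:
  assumes r: "r absolutely_integrable_on {0..1}" and w: "w absolutely_integrable_on {0..1}"
    and q: "qsol r w (\<lambda>x. 0) y u" "y 0 = 0" "u 0 = 0" and x: "x \<in> {0..1}"
  shows "y x = 0" "u x = 0"
proof -
  have "norm (y x) + norm (u x) \<le> 0"
    using qsol_bound[OF r w _ q(1) x] q(2,3) by (simp add: set_integrable_def)
  then show "y x = 0" "u x = 0"
    using norm_ge_zero[of "y x"] norm_ge_zero[of "u x"] by (smt (verit) norm_eq_zero)+
qed

lemma qsol_unique:
  assumes r: "r absolutely_integrable_on {0..1}" and w: "w absolutely_integrable_on {0..1}"
    and q: "qsol r w f y u" "qsol r w f y' u'" "y 0 = y' 0" "u 0 = u' 0" and x: "x \<in> {0..1}"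
  shows "y x = y' x" "u x = u' x"
proof -
  have "qsol r w (\<lambda>x. 0) (\<lambda>x. y x - y' x) (\<lambda>x. u x - u' x)"
    using qsol_lincomb[OF q(1,2), of 1 "-1"] by simp
  from qsol_zero[OF r w this _ _ x] show "y x = y' x" "u x = u' x"
    using q by simp_all
qed

lemma qsol_cnj:
  assumes q: "qsol r w f y u"
  shows "qsol r (\<lambda>x. cnj (w x)) (\<lambda>x. cnj (f x)) (\<lambda>x. cnj (y x)) (\<lambda>x. cnj (u x))"
  using indef_int_cnj[OF qsol_y[OF q]] indef_int_cnj[OF qsol_u[OF q]] unfolding qsol_def by simp

text \<open>The Lagrange identity. The terms with \<open>r\<close> cancel because \<open>r\<close>
  enters the two equations with opposite signs; only the difference of the coefficients and the
  inhomogeneities survive.\<close>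

lemma qsol_wronskian:
  assumes q1: "qsol r w1 f1 y1 u1" and q2: "qsol r w2 f2 y2 u2"
  shows "indef_int (\<lambda>x. (w2 x - w1 x) * (y1 x * y2 x) + f1 x * y2 x - f2 x * y1 x) (\<lambda>x. u1 x * y2 x - y1 x * u2 x)"
proof -
  have "(\<lambda>x. (w2 x - w1 x) * (y1 x * y2 x) + f1 x * y2 x - f2 x * y1 x) =
    (\<lambda>x. (u1 x * (complex_of_real (r x) * y2 x + u2 x) + (- complex_of_real (r x) * u1 x - w1 x * y1 x + f1 x) * y2 x)
      - (y1 x * (- complex_of_real (r x) * u2 x - w2 x * y2 x + f2 x) + (complex_of_real (r x) * y1 x + u1 x) * u2 x))"
    by (simp add: algebra_simps)
  then show ?thesis
    using indef_int_diff[OF indef_int_mult[OF qsol_u[OF q1] qsol_y[OF q2]] indef_int_mult[OF qsol_y[OF q1] qsol_u[OF q2]]]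
    by simp
qed

text \<open>The derivative of \<open>u * cnj y\<close> is the density of the quadratic form plus the
  inhomogeneity. Integrated, it relates the form to boundary values without any second
  derivative.\<close>

lemma qsol_energy:
  assumes q: "qsol r w f y u"
  shows "indef_int (\<lambda>x. u x * cnj (u x) - w x * (y x * cnj (y x)) + f x * cnj (y x)) (\<lambda>x. u x * cnj (y x))"
proof -
  have "(\<lambda>x. u x * cnj (u x) - w x * (y x * cnj (y x)) + f x * cnj (y x)) =
    (\<lambda>x. u x * cnj (complex_of_real (r x) * y x + u x) + (- complex_of_real (r x) * u x - w x * y x + f x) * cnj (y x))"
    by (simp add: algebra_simps)
  then show ?thesis
    using indef_int_mult[OF qsol_u[OF q] indef_int_cnj[OF qsol_y[OF q]]] by simp
qed

lemma qsol_nonvanishing: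
  assumes r: "r absolutely_integrable_on {0..1}" and w: "w absolutely_integrable_on {0..1}"
    and q: "qsol r w (\<lambda>x. 0) y u" "y 0 \<noteq> 0 \<or> u 0 \<noteq> 0" and x: "x \<in> {0..1}"
  shows "y x \<noteq> 0 \<or> u x \<noteq> 0"
proof -
  have z: "(\<lambda>x. 0 :: complex) absolutely_integrable_on {0..1}" by (simp add: set_integrable_def)
  \<comment> \<open>With these initial values the Wronskian, which is constant, equals
    \<open>norm (u 0) ^ 2 + norm (y 0) ^ 2\<close>; a common zero of \<open>y\<close> and
    \<open>u\<close> would make it vanish.\<close>
  obtain y' u' where q': "qsol r w (\<lambda>x. 0) y' u'" "y' 0 = cnj (u 0)" "u' 0 = - cnj (y 0)"
    using qsol_exists[OF r w z] by metis
  have "indef_int (\<lambda>x. 0) (\<lambda>x. u x * y' x - y x * u' x)"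
    using qsol_wronskian[OF q(1) q'(1)] by simp
  from indef_int_zero_const[OF this _ x]
  have "u x * y' x - y x * u' x = u 0 * cnj (u 0) + y 0 * cnj (y 0)"
    by (simp add: q')
  also have "\<dots> = complex_of_real ((norm (u 0))\<^sup>2 + (norm (y 0))\<^sup>2)"
    by (simp only: of_real_add complex_norm_square)
  also have "\<dots> \<noteq> 0"
    unfolding of_real_eq_0_iff using q(2) by (auto simp: sum_power2_eq_zero_iff)
  finally show ?thesis by auto
qed

subsection \<open>Domains of the operators\<close>

lemma L2_absolutely_integrable:
  fixes f :: "real \<Rightarrow> 'a::euclidean_space"
  assumes "f \<in> L2"
  shows "f absolutely_integrable_on {0..1}" "(\<lambda>x. (norm (f x))\<^sup>2) absolutely_integrable_on {0..1}"
proof -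
  have m: "f \<in> borel_measurable leb01" and i: "integrable leb01 (\<lambda>x. (norm (f x))\<^sup>2)"
    using assms by (auto simp: L2_def)
  have one: "integrable leb01 (\<lambda>x. 1 :: real)"
    using absolutely_integrable_01_iff[of "\<lambda>x. 1 :: real"] absolutely_integrable_continuous_real[of 0 1 "\<lambda>x. 1 :: real"]
    by simp
  have "integrable leb01 f"
  proof (rule Bochner_Integration.integrable_bound[OF Bochner_Integration.integrable_add[OF one i] m], intro AE_I2)
    fix x
    have "norm (f x) \<le> 1 + (norm (f x))\<^sup>2"
      using zero_le_power2[of "norm (f x) - 1/2"] by (simp add: power2_diff power_divide)
    then show "norm (f x) \<le> norm (1 + (norm (f x))\<^sup>2)" by simp
  qed
  then show "f absolutely_integrable_on {0..1}" by (simp add: absolutely_integrable_01_iff)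
  show "(\<lambda>x. (norm (f x))\<^sup>2) absolutely_integrable_on {0..1}"
    using i by (simp add: absolutely_integrable_01_iff)
qed

lemma L2I:
  fixes f :: "real \<Rightarrow> 'a::euclidean_space"
  assumes "f absolutely_integrable_on {0..1}" "(\<lambda>x. (norm (f x))\<^sup>2) absolutely_integrable_on {0..1}"
  shows "f \<in> L2"
  using assms unfolding L2_def absolutely_integrable_01_iff by auto

lemma absolutely_integrable_dominated:
  fixes f :: "real \<Rightarrow> 'a::euclidean_space"
  assumes "f \<in> borel_measurable leb01" "h absolutely_integrable_on {0..1}" "\<And>x. norm (f x) \<le> h x"
  shows "f absolutely_integrable_on {0..1}"
  unfolding absolutely_integrable_01_iff
proof (rule Bochner_Integration.integrable_bound)
  show "integrable leb01 h" using assms(2) by (simp add: absolutely_integrable_01_iff)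
  show "AE x in leb01. norm (f x) \<le> norm (h x)"
    using order_trans[OF assms(3) abs_ge_self] by simp
qed fact

lemma measurable_leb01:
  fixes f :: "real \<Rightarrow> 'a::euclidean_space"
  shows "f absolutely_integrable_on {0..1} \<Longrightarrow> f \<in> borel_measurable leb01"
  by (simp add: absolutely_integrable_01_iff)

lemma L2_mult_absolutely_integrable:
  fixes f g :: "real \<Rightarrow> 'a::{euclidean_space, real_normed_algebra}"
  assumes f: "f \<in> L2" and g: "g \<in> L2"
  shows "(\<lambda>x. f x * g x) absolutely_integrable_on {0..1}"
proof (rule absolutely_integrable_dominated)
  show "(\<lambda>x. f x * g x) \<in> borel_measurable leb01"
    using f g by (auto simp: L2_def)
  show "(\<lambda>x. (norm (f x))\<^sup>2 + (norm (g x))\<^sup>2) absolutely_integrable_on {0..1}"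
    using L2_absolutely_integrable(2)[OF f] L2_absolutely_integrable(2)[OF g] by (rule set_integral_add(1))
  fix x
  have "norm (f x * g x) \<le> norm (f x) * norm (g x)" by (rule norm_mult_ineq)
  also have "\<dots> \<le> (norm (f x))\<^sup>2 + (norm (g x))\<^sup>2"
    using sum_squares_bound[of "norm (f x)" "norm (g x)"] mult_nonneg_nonneg[OF norm_ge_zero[of "f x"] norm_ge_zero[of "g x"]]
    by linarith
  finally show "norm (f x * g x) \<le> (norm (f x))\<^sup>2 + (norm (g x))\<^sup>2" .
qed

lemma L2_add:
  fixes f g :: "real \<Rightarrow> 'a::euclidean_space"
  assumes f: "f \<in> L2" and g: "g \<in> L2"
  shows "(\<lambda>x. f x + g x) \<in> L2"
proof (rule L2I)
  show ai: "(\<lambda>x. f x + g x) absolutely_integrable_on {0..1}"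
    using L2_absolutely_integrable(1)[OF f] L2_absolutely_integrable(1)[OF g] by (rule set_integral_add(1))
  show "(\<lambda>x. (norm (f x + g x))\<^sup>2) absolutely_integrable_on {0..1}"
  proof (rule absolutely_integrable_dominated)
    show "(\<lambda>x. (norm (f x + g x))\<^sup>2) \<in> borel_measurable leb01"
      using measurable_leb01[OF ai] by measurable
    show "(\<lambda>x. 2 * (norm (f x))\<^sup>2 + 2 * (norm (g x))\<^sup>2) absolutely_integrable_on {0..1}"
      using L2_absolutely_integrable(2)[OF f] L2_absolutely_integrable(2)[OF g]
      by (intro set_integral_add set_integrable_mult_right)
    fix x
    have "(norm (f x + g x))\<^sup>2 \<le> (norm (f x) + norm (g x))\<^sup>2"
      by (intro power_mono norm_triangle_ineq) auto
    also have "\<dots> \<le> 2 * (norm (f x))\<^sup>2 + 2 * (norm (g x))\<^sup>2"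
      using sum_squares_bound[of "norm (f x)" "norm (g x)"] by (simp add: power2_sum)
    finally show "norm ((norm (f x + g x))\<^sup>2) \<le> 2 * (norm (f x))\<^sup>2 + 2 * (norm (g x))\<^sup>2" by simp
  qed
qed

lemma L2_mult_continuous:
  fixes f g :: "real \<Rightarrow> complex"
  assumes f: "f \<in> L2" and g: "continuous_on {0..1} g"
  shows "(\<lambda>x. f x * g x) \<in> L2"
proof (rule L2I)
  show "(\<lambda>x. f x * g x) absolutely_integrable_on {0..1}"
    by (rule absolutely_integrable_continuous_mult[OF L2_absolutely_integrable(1)[OF f] g])
  have "(\<lambda>x. (norm (f x))\<^sup>2 * (norm (g x))\<^sup>2) absolutely_integrable_on {0..1}"
    by (intro absolutely_integrable_continuous_mult_real L2_absolutely_integrable(2)[OF f] continuous_intros g)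
  then show "(\<lambda>x. (norm (f x * g x))\<^sup>2) absolutely_integrable_on {0..1}"
    by (simp add: norm_mult power_mult_distrib)
qed

lemma L2_continuous:
  fixes f :: "real \<Rightarrow> complex"
  assumes "continuous_on {0..1} f"
  shows "f \<in> L2"
  by (intro L2I absolutely_integrable_continuous_real continuous_intros assms)

lemma L2_cmult:
  fixes f :: "real \<Rightarrow> complex"
  assumes "f \<in> L2"
  shows "(\<lambda>x. c * f x) \<in> L2"
  using L2_mult_continuous[OF assms continuous_on_const[of _ c]] by (simp add: mult.commute)

lemma L2_of_real:
  fixes f :: "real \<Rightarrow> real"
  assumes "f \<in> L2"
  shows "(\<lambda>x. complex_of_real (f x)) \<in> L2"
  using L2_absolutely_integrable[OF assms] by (intro L2I absolutely_integrable_of_real) simp_all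

lemma L2_cong_AE:
  fixes f g :: "real \<Rightarrow> 'a::euclidean_space"
  assumes f: "f \<in> L2" and ae: "AE x in leb01. g x = f x"
  shows "g \<in> L2"
proof (rule L2I)
  show "g absolutely_integrable_on {0..1}"
    by (rule absolutely_integrable_cong_AE[OF L2_absolutely_integrable(1)[OF f] ae])
  show "(\<lambda>x. (norm (g x))\<^sup>2) absolutely_integrable_on {0..1}"
    by (rule absolutely_integrable_cong_AE[OF L2_absolutely_integrable(2)[OF f]]) (use ae in \<open>eventually_elim, simp\<close>)
qed

lemma l2_norm_eq:
  assumes "f \<in> L2"
  shows "l2_norm f = sqrt (integral {0..1} (\<lambda>x. (norm (f x))\<^sup>2))"
  unfolding l2_norm_def using integral_01_eq[OF L2_absolutely_integrable(2)[OF assms]] by simp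

text \<open>Cauchy-Schwarz against the constant 1. The factor \<open>sqrt (b - a)\<close> is what
  makes the Galerkin approximations equicontinuous later on.\<close>

lemma integral_norm_le_sqrt:
  fixes f :: "real \<Rightarrow> complex"
  assumes f: "f \<in> L2" and ab: "0 \<le> a" "a \<le> b" "b \<le> 1"
  shows "integral {a..b} (\<lambda>x. norm (f x)) \<le> sqrt (b - a) * sqrt (integral {0..1} (\<lambda>x. (norm (f x))\<^sup>2))"
proof (cases "a = b")
  case False
  define m where "m = integral {a..b} (\<lambda>x. norm (f x))"
  define s where "s = integral {a..b} (\<lambda>x. (norm (f x))\<^sup>2)"
  have nf: "(\<lambda>x. norm (f x)) absolutely_integrable_on {0..1}"
    using absolutely_integrable_norm[OF L2_absolutely_integrable(1)[OF f]] by (simp add: o_def)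
  note nf2 = L2_absolutely_integrable(2)[OF f]
  have i1: "(\<lambda>x. norm (f x)) integrable_on {a..b}" using integrable_01_subinterval[OF nf] ab by auto
  have i2: "(\<lambda>x. (norm (f x))\<^sup>2) integrable_on {a..b}" using integrable_01_subinterval[OF nf2] ab by auto
  \<comment> \<open>\<open>c\<close> is the mean value of \<open>norm f\<close>; expanding the
    integral of \<open>(norm f - c) ^ 2\<close> yields the inequality.\<close>
  define c where "c = m / (b - a)"
  have cm: "c * (b - a) = m" using False ab by (simp add: c_def)
  have "0 \<le> integral {a..b} (\<lambda>x. ((norm (f x))\<^sup>2 - 2 * c * norm (f x)) + c\<^sup>2)"
  proof (rule Henstock_Kurzweil_Integration.integral_nonneg)
    show "(\<lambda>x. ((norm (f x))\<^sup>2 - 2 * c * norm (f x)) + c\<^sup>2) integrable_on {a..b}"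
      using i2 integrable_on_cmult_left[OF i1, of "2 * c"]
      by (intro integrable_add integrable_diff) auto
    show "0 \<le> (norm (f x))\<^sup>2 - 2 * c * norm (f x) + c\<^sup>2" for x
      using zero_le_power2[of "norm (f x) - c"] by (simp add: power2_diff mult_ac)
  qed
  also have "\<dots> = s - 2 * c * m + c\<^sup>2 * (b - a)"
  proof -
    have "integral {a..b} (\<lambda>x. ((norm (f x))\<^sup>2 - 2 * c * norm (f x)) + c\<^sup>2)
      = integral {a..b} (\<lambda>x. (norm (f x))\<^sup>2 - 2 * c * norm (f x)) + integral {a..b} (\<lambda>x. c\<^sup>2)"
      using i2 integrable_on_cmult_left[OF i1, of "2 * c"] by (intro Henstock_Kurzweil_Integration.integral_add integrable_diff) auto
    also have "integral {a..b} (\<lambda>x. (norm (f x))\<^sup>2 - 2 * c * norm (f x)) = s - integral {a..b} (\<lambda>x. 2 * c * norm (f x))"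
      unfolding s_def using i2 integrable_on_cmult_left[OF i1, of "2 * c"] by (intro Henstock_Kurzweil_Integration.integral_diff) auto
    finally show ?thesis using ab by (simp add: m_def)
  qed
  also have "\<dots> = s - c * m"
    using cm by (simp add: power2_eq_square mult.assoc)
  finally have "c * m \<le> s" by simp
  then have "m\<^sup>2 \<le> (b - a) * s"
    using False ab by (simp add: c_def field_simps power2_eq_square)
  also have "\<dots> \<le> (b - a) * integral {0..1} (\<lambda>x. (norm (f x))\<^sup>2)"
    unfolding s_def using ab i2 integrable_01_subinterval[OF nf2, of 0 1]
    by (intro mult_left_mono integral_subset_le) auto
  finally show ?thesis
    unfolding m_def real_sqrt_mult[symmetric] by (rule real_le_rsqrt)
qed simp

lemma continuous_AE_zero:
  fixes f :: "real \<Rightarrow> complex"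
  assumes cont: "continuous_on {0..1} f" and ae: "AE x in leb01. f x = 0" and x: "x \<in> {0..1}"
  shows "f x = 0"
proof -
  have "open {x \<in> {0<..<1}. f x \<in> - {0}}"
  proof -
    have "continuous_on {0<..<1} f"
      by (rule continuous_on_subset[OF cont]) auto
    then have "open ({0<..<1} \<inter> f -` (- {0}))"
      by (rule continuous_open_preimage) auto
    moreover have "{0<..<1} \<inter> f -` (- {0}) = {x \<in> {0<..<1}. f x \<in> - {0}}" by auto
    ultimately show ?thesis by simp
  qed
  moreover have "negligible {x \<in> {0<..<1}. f x \<in> - {0}}"
    using ae by (simp add: AE_leb01_iff)
  ultimately have "{x \<in> {0<..<1}. f x \<in> - {0}} = {}"
    using open_not_negligible by blast
  then have "\<And>x. x \<in> {0<..<1} \<Longrightarrow> f x = 0" by auto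
  moreover have "closure {0<..<1::real} = {0..1}" by simp
  ultimately show ?thesis
    using continuous_constant_on_closure[of "{0<..<1}" f 0 x] cont x by simp
qed

lemma continuous_AE_eq:
  fixes f g :: "real \<Rightarrow> complex"
  assumes "continuous_on {0..1} f" "continuous_on {0..1} g" "AE x in leb01. f x = g x" "x \<in> {0..1}"
  shows "f x = g x"
  using continuous_AE_zero[of "\<lambda>x. f x - g x" x] assms by (auto intro: continuous_intros)

text \<open>\<open>quasi_deriv\<close> is a choice, and \<open>ell\<close> differentiates the chosen
  function. Two absolutely continuous representatives agree almost everywhere, hence by continuity
  on the closed interval, so the choice is harmless and boundary values can be read off from
  \<open>u\<close>.\<close>

lemma qsol_in_dom_ell:
  assumes q: "qsol r (\<lambda>x. (complex_of_real (r x))\<^sup>2) f y u" and f: "f \<in> L2"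
  shows "y \<in> dom_ell r" "AE x in leb01. ell r y x = - f x"
    "\<And>x. x \<in> {0..1} \<Longrightarrow> quasi_deriv r y x = u x"
proof -
  note Y = qsol_y[OF q] and U = qsol_u[OF q]
  have u: "is_quasi_deriv r y u"
    unfolding is_quasi_deriv_def
  proof
    show "abs_continuous_on {0..1} u" by (rule indef_int_imp_abs_continuous_on[OF U])
    show "AE x in leb01. u x = vector_derivative y (at x) - complex_of_real (r x) * y x"
      using indef_int_deriv[OF Y] by eventually_elim (simp add: vector_derivative_at)
  qed
  then have v: "is_quasi_deriv r y (quasi_deriv r y)"
    unfolding quasi_deriv_def by (rule someI[of "is_quasi_deriv r y"])
  have vc: "continuous_on {0..1} (quasi_deriv r y)"
    using v abs_continuous_on_imp_indef_int indef_int_continuous unfolding is_quasi_deriv_def by metis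
  have "AE x in leb01. quasi_deriv r y x = vector_derivative y (at x) - complex_of_real (r x) * y x"
    using v by (simp add: is_quasi_deriv_def)
  moreover have "AE x in leb01. u x = vector_derivative y (at x) - complex_of_real (r x) * y x"
    using u by (simp add: is_quasi_deriv_def)
  ultimately have "AE x in leb01. quasi_deriv r y x = u x"
    by eventually_elim simp
  then show eq: "\<And>x. x \<in> {0..1} \<Longrightarrow> quasi_deriv r y x = u x"
    by (rule continuous_AE_eq[OF vc qsol_cont_u[OF q]])
  have "AE x in leb01. x \<in> {0<..<1}"
    by (intro AE_I2) simp
  then show ae: "AE x in leb01. ell r y x = - f x"
    using indef_int_deriv[OF U]
  proof eventually_elim
    case (elim x)
    have "(quasi_deriv r y has_vector_derivative - complex_of_real (r x) * u x - (complex_of_real (r x))\<^sup>2 * y x + f x) (at x)"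
      by (rule has_vector_derivative_transform_within_open[OF elim(2) open_greaterThanLessThan elim(1)]) (simp add: eq)
    then have "vector_derivative (quasi_deriv r y) (at x) = - complex_of_real (r x) * u x - (complex_of_real (r x))\<^sup>2 * y x + f x"
      by (rule vector_derivative_at)
    then show ?case using elim(1) by (simp add: ell_def eq)
  qed
  have "(\<lambda>x. - f x) \<in> L2" using L2_cmult[OF f, of "-1"] by simp
  from L2_cong_AE[OF this ae] show "y \<in> dom_ell r"
    using u indef_int_imp_abs_continuous_on[OF Y] by (auto simp: dom_ell_def)
qed

lemma dom_ell_qsol:
  assumes y: "y \<in> dom_ell r"
  shows "qsol r (\<lambda>x. (complex_of_real (r x))\<^sup>2) (\<lambda>x. - ell r y x) y (quasi_deriv r y)"
proof -
  define u where "u = quasi_deriv r y"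
  have u: "is_quasi_deriv r y u"
    using y someI_ex[of "is_quasi_deriv r y"] unfolding u_def quasi_deriv_def dom_ell_def by blast
  obtain g where g: "indef_int g y"
    using y abs_continuous_on_imp_indef_int unfolding dom_ell_def by blast
  obtain h where h: "indef_int h u"
    using u abs_continuous_on_imp_indef_int unfolding is_quasi_deriv_def by blast
  have "AE x in leb01. u x = vector_derivative y (at x) - complex_of_real (r x) * y x"
    using u by (simp add: is_quasi_deriv_def)
  then have "AE x in leb01. complex_of_real (r x) * y x + u x = g x"
    using indef_int_deriv[OF g] by eventually_elim (simp add: vector_derivative_at)
  then have "indef_int (\<lambda>x. complex_of_real (r x) * y x + u x) y"
    by (rule indef_int_cong_AE[OF g]) simp
  moreover have "AE x in leb01. - complex_of_real (r x) * u x - (complex_of_real (r x))\<^sup>2 * y x + - ell r y x = h x"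
    using indef_int_deriv[OF h] by eventually_elim (simp add: vector_derivative_at ell_def u_def[symmetric])
  then have "indef_int (\<lambda>x. - complex_of_real (r x) * u x - (complex_of_real (r x))\<^sup>2 * y x + - ell r y x) u"
    by (rule indef_int_cong_AE[OF h]) simp
  ultimately show ?thesis unfolding qsol_def u_def by blast
qed

definition pot :: "(real \<Rightarrow> real) \<Rightarrow> (real \<Rightarrow> real) \<Rightarrow> complex \<Rightarrow> real \<Rightarrow> complex" where
  "pot p r z x = (complex_of_real (r x))\<^sup>2 + z\<^sup>2 - 2 * z * complex_of_real (p x)"

lemma pot_absolutely_integrable:
  assumes p: "p \<in> L2" and r: "r \<in> L2"
  shows "pot p r z absolutely_integrable_on {0..1}"
proof -
  have "(\<lambda>x. complex_of_real ((r x)\<^sup>2)) absolutely_integrable_on {0..1}"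
    using L2_absolutely_integrable(2)[OF r] by (intro absolutely_integrable_of_real) simp
  moreover have "(\<lambda>x::real. z\<^sup>2) absolutely_integrable_on {0..1}"
    by (rule absolutely_integrable_continuous_real[OF continuous_on_const])
  moreover have "(\<lambda>x. 2 * z * complex_of_real (p x)) absolutely_integrable_on {0..1}"
    by (intro set_integrable_mult_right absolutely_integrable_of_real L2_absolutely_integrable(1)[OF p])
  ultimately show ?thesis
    unfolding pot_def[abs_def] by (intro set_integral_diff(1) set_integral_add(1)) simp_all
qed

lemma pencil_factor_L2:
  assumes p: "p \<in> L2" and y: "continuous_on {0..1} y"
  shows "(\<lambda>x. (z\<^sup>2 - 2 * z * complex_of_real (p x)) * y x) \<in> L2"
proof -
  have "(\<lambda>x. z\<^sup>2 + (-2 * z) * complex_of_real (p x)) \<in> L2"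
    by (intro L2_add L2_continuous continuous_intros L2_cmult L2_of_real p)
  from L2_mult_continuous[OF this y] show ?thesis by simp
qed

lemma qsol_pot_in_dom_ell:
  assumes p: "p \<in> L2" and q: "qsol r (pot p r z) f y u" and f: "f \<in> L2"
  shows "y \<in> dom_ell r" "AE x in leb01. energy_pencil p r z y x = f x"
    "\<And>x. x \<in> {0..1} \<Longrightarrow> quasi_deriv r y x = u x"
proof -
  \<comment> \<open>The terms of the pencil are moved to the right-hand side, where they are
    square-integrable because \<open>y\<close> is continuous. The product \<open>r^2 y\<close> is in
    general only integrable and stays in the coefficient.\<close>
  define g where "g = (\<lambda>x. f x + (-1) * ((z\<^sup>2 - 2 * z * complex_of_real (p x)) * y x))"
  have "qsol r (\<lambda>x. (complex_of_real (r x))\<^sup>2) g y u"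
    using qsol_change_w[OF q, of "\<lambda>x. (complex_of_real (r x))\<^sup>2"]
    unfolding g_def pot_def by (simp add: algebra_simps)
  moreover have "g \<in> L2"
    unfolding g_def by (intro L2_add f L2_cmult pencil_factor_L2 p qsol_cont_y[OF q])
  ultimately have *: "y \<in> dom_ell r" "AE x in leb01. ell r y x = - g x"
    "\<And>x. x \<in> {0..1} \<Longrightarrow> quasi_deriv r y x = u x"
    by (rule qsol_in_dom_ell)+
  then show "y \<in> dom_ell r" "\<And>x. x \<in> {0..1} \<Longrightarrow> quasi_deriv r y x = u x" by blast+
  show "AE x in leb01. energy_pencil p r z y x = f x"
    using *(2) by eventually_elim (simp add: energy_pencil_def op_B_def g_def algebra_simps)
qed

lemma dom_ell_qsol_pot:
  assumes y: "y \<in> dom_ell r" and f: "AE x in leb01. energy_pencil p r z y x = f x"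
  shows "qsol r (pot p r z) f y (quasi_deriv r y)"
proof -
  have "qsol r (pot p r z) (\<lambda>x. - ell r y x + (pot p r z x - (complex_of_real (r x))\<^sup>2) * y x) y (quasi_deriv r y)"
    by (rule qsol_change_w[OF dom_ell_qsol[OF y]])
  then show ?thesis
    by (rule qsol_cong_AE)
       (use f in \<open>eventually_elim, simp add: energy_pencil_def op_B_def pot_def algebra_simps\<close>)
qed

lemma dom_ell_pencil_L2:
  assumes p: "p \<in> L2" and y: "y \<in> dom_ell r"
  shows "energy_pencil p r z y \<in> L2"
proof -
  have "ell r y \<in> L2" using y by (simp add: dom_ell_def)
  then have "(\<lambda>x. (z\<^sup>2 - 2 * z * complex_of_real (p x)) * y x + (-1) * ell r y x) \<in> L2"
    using qsol_cont_y[OF dom_ell_qsol[OF y]] by (intro L2_add pencil_factor_L2 L2_cmult p)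
  moreover have "energy_pencil p r z y = (\<lambda>x. (z\<^sup>2 - 2 * z * complex_of_real (p x)) * y x + (-1) * ell r y x)"
    by (auto simp: energy_pencil_def op_B_def algebra_simps)
  ultimately show ?thesis by simp
qed

text \<open>The flag selects the Dirichlet condition (\<open>True\<close>) or the condition
  \<open>y\<^sup>[\<^sup>1\<^sup>](1) = 0\<close> (\<open>False\<close>) at the right end point.\<close>

definition bdry :: "bool \<Rightarrow> (real \<Rightarrow> complex) \<Rightarrow> (real \<Rightarrow> complex) \<Rightarrow> complex" where
  "bdry b y u = (if b then y 1 else u 1)"

definition dom_bc :: "(real \<Rightarrow> real) \<Rightarrow> bool \<Rightarrow> (real \<Rightarrow> complex) set" where
  "dom_bc r b = {y \<in> dom_ell r. y 0 = 0 \<and> bdry b y (quasi_deriv r y) = 0}"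

lemma dom_A_eq: "dom_A r = dom_bc r True" and dom_A_M_eq: "dom_A_M r = dom_bc r False"
  by (auto simp: dom_A_def dom_A_M_def dom_bc_def bdry_def)

subsection \<open>Quadratic pencils of Hermitian matrices\<close>

text \<open>Elimination of the last coordinate: a vector with a nonzero entry there serves as pivot
  and is subtracted from the others. Applied to the iterates of an operator, the relation gives an
  annihilating polynomial.\<close>

lemma exists_linear_relation:
  fixes v :: "nat \<Rightarrow> nat \<Rightarrow> complex"
  shows "\<exists>c. (\<exists>k\<le>N. c k \<noteq> 0) \<and> (\<forall>i<N. (\<Sum>k\<le>N. c k * v k i) = 0)"
proof (induction N arbitrary: v)
  case 0
  then show ?case by (intro exI[of _ "\<lambda>_. 1"]) auto
next
  case (Suc N)
  show ?case
  proof (cases "\<exists>j\<le>Suc N. v j N \<noteq> 0")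
    case False
    obtain c where c: "\<exists>k\<le>N. c k \<noteq> 0" "\<And>i. i < N \<Longrightarrow> (\<Sum>k\<le>N. c k * v k i) = 0"
      using Suc.IH[of v] by blast
    define d where "d = c(Suc N := 0)"
    have eq: "(\<Sum>k\<le>Suc N. d k * v k i) = (\<Sum>k\<le>N. c k * v k i)" for i
      by (simp add: d_def)
    have "(\<Sum>k\<le>Suc N. d k * v k i) = 0" if "i < Suc N" for i
    proof (cases "i = N")
      case True
      then show ?thesis using False by (intro sum.neutral) auto
    next
      case False
      then show ?thesis unfolding eq using c(2) that by simp
    qed
    moreover have "\<exists>k\<le>Suc N. d k \<noteq> 0"
    proof -
      obtain k where "k \<le> N" "c k \<noteq> 0" using c(1) by blast
      then have "k \<le> Suc N \<and> d k \<noteq> 0" by (simp add: d_def)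
      then show ?thesis ..
    qed
    ultimately show ?thesis by blast
  next
    case True
    then obtain j where j: "j \<le> Suc N" "v j N \<noteq> 0" by blast
    \<comment> \<open>\<open>\<sigma>\<close> enumerates the indices up to \<open>Suc N\<close> with
      the pivot \<open>j\<close> left out.\<close>
    define \<sigma> where "\<sigma> = (\<lambda>k. if k < j then k else Suc k)"
    have inj: "inj_on \<sigma> {..N}" by (auto simp: \<sigma>_def inj_on_def)
    have img: "\<sigma> ` {..N} = {..Suc N} - {j}"
    proof (intro set_eqI iffI)
      fix x assume x: "x \<in> {..Suc N} - {j}"
      show "x \<in> \<sigma> ` {..N}"
      proof (cases "x < j")
        case True then show ?thesis using j by (intro image_eqI[of _ _ x]) (auto simp: \<sigma>_def)
      next
        case False then show ?thesis using x by (intro image_eqI[of _ _ "x - 1"]) (auto simp: \<sigma>_def)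
      qed
    qed (auto simp: \<sigma>_def split: if_splits)
    define t where "t = (\<lambda>k. v (\<sigma> k) N / v j N)"
    obtain c where c: "\<exists>k\<le>N. c k \<noteq> 0" "\<And>i. i < N \<Longrightarrow> (\<Sum>k\<le>N. c k * (v (\<sigma> k) i - t k * v j i)) = 0"
      using Suc.IH[of "\<lambda>k i. v (\<sigma> k) i - t k * v j i"] by blast
    define d where "d = (\<lambda>k. if k = j then - (\<Sum>l\<le>N. c l * t l) else c (the_inv_into {..N} \<sigma> k))"
    have d: "d (\<sigma> k) = c k" if "k \<le> N" for k
    proof -
      have "\<sigma> k \<noteq> j" by (auto simp: \<sigma>_def)
      then show ?thesis using the_inv_into_f_f[OF inj, of k] that by (simp add: d_def)
    qed
    have "(\<Sum>k\<le>Suc N. d k * v k i) = (\<Sum>k\<le>N. c k * (v (\<sigma> k) i - t k * v j i))" for i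
    proof -
      have "(\<Sum>k\<le>Suc N. d k * v k i) = d j * v j i + (\<Sum>k\<in>{..Suc N} - {j}. d k * v k i)"
        using j by (intro sum.remove) auto
      also have "(\<Sum>k\<in>{..Suc N} - {j}. d k * v k i) = (\<Sum>k\<le>N. d (\<sigma> k) * v (\<sigma> k) i)"
        unfolding img[symmetric] by (subst sum.reindex[OF inj]) simp
      also have "\<dots> = (\<Sum>k\<le>N. c k * v (\<sigma> k) i)"
        by (intro sum.cong) (auto simp: d)
      also have "d j * v j i = - (\<Sum>k\<le>N. c k * (t k * v j i))"
        by (simp add: d_def sum_distrib_right mult.assoc)
      finally show ?thesis by (simp add: right_diff_distrib sum_subtractf)
    qed
    moreover have "(\<Sum>k\<le>N. c k * (v (\<sigma> k) N - t k * v j N)) = 0"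
      using j by (intro sum.neutral) (auto simp: t_def)
    ultimately have "(\<Sum>k\<le>Suc N. d k * v k i) = 0" if "i < Suc N" for i
      using c(2) that by (cases "i = N") auto
    moreover have "\<exists>k\<le>Suc N. d k \<noteq> 0"
    proof -
      obtain k where "k \<le> N" "c k \<noteq> 0" using c(1) by blast
      then have "\<sigma> k \<le> Suc N \<and> d (\<sigma> k) \<noteq> 0" using d[of k] by (simp add: \<sigma>_def)
      then show ?thesis ..
    qed
    ultimately show ?thesis by blast
  qed
qed

fun shifted_prod :: "((nat \<Rightarrow> complex) \<Rightarrow> nat \<Rightarrow> complex) \<Rightarrow> complex list \<Rightarrow> (nat \<Rightarrow> complex) \<Rightarrow> nat \<Rightarrow> complex" where
  "shifted_prod M [] w = w"
| "shifted_prod M (a # as) w = (\<lambda>i. M (shifted_prod M as w) i - a * shifted_prod M as w i)"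

text \<open>Links the expanded form of a polynomial in \<open>M\<close>, which linear dependence
  provides, with the product of its linear factors, which the induction on eigenvectors
  consumes.\<close>

lemma poly_op_shifted_prod:
  fixes M :: "(nat \<Rightarrow> complex) \<Rightarrow> nat \<Rightarrow> complex"
  assumes lin: "\<And>x a y. M (\<lambda>i. x i - a * y i) = (\<lambda>i. M x i - a * M y i)"
  shows "(\<Sum>k\<le>length as. coeff (\<Prod>a\<leftarrow>as. [:- a, 1:]) k * (M ^^ k) w i) = shifted_prod M as w i"
proof (induction as arbitrary: i)
  case Nil
  then show ?case by simp
next
  case (Cons a as)
  have M0: "M (\<lambda>i. 0) = (\<lambda>i. 0)"
    using lin[of "\<lambda>i. 0" 1 "\<lambda>i. 0"] by simp
  have add: "M (\<lambda>i. x i + y i) = (\<lambda>i. M x i + M y i)" for x y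
    using lin[of x "-1" y] by simp
  have scale: "M (\<lambda>i. c * y i) = (\<lambda>i. c * M y i)" for c y
    using lin[of "\<lambda>i. 0" "-c" y] M0 by simp
  have Msum: "M (\<lambda>i. \<Sum>k\<le>n. c k * (M ^^ k) w i) = (\<lambda>i. \<Sum>k\<le>n. c k * (M ^^ Suc k) w i)" for c n
  proof (induction n)
    case 0 then show ?case by (simp add: scale)
  next
    case (Suc n)
    show ?case unfolding sum.atMost_Suc add Suc scale by simp
  qed
  define q where "q = (\<Prod>a\<leftarrow>as. [:- a, 1:])"
  have degq: "coeff q (Suc (length as)) = 0"
  proof -
    have "q \<noteq> 0 \<and> degree q = length as"
      unfolding q_def by (induction as) (auto simp: degree_mult_eq simp del: mult_pCons_left)
    then show ?thesis by (simp add: coeff_eq_0)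
  qed
  have "(\<Sum>k\<le>Suc (length as). coeff ([:- a, 1:] * q) k * (M ^^ k) w i)
      = (\<Sum>k\<le>Suc (length as). coeff (pCons 0 q) k * (M ^^ k) w i) - a * (\<Sum>k\<le>Suc (length as). coeff q k * (M ^^ k) w i)"
    by (simp add: sum_subtractf[symmetric] sum_distrib_left algebra_simps del: sum.atMost_Suc)
  also have "(\<Sum>k\<le>Suc (length as). coeff (pCons 0 q) k * (M ^^ k) w i) = (\<Sum>k\<le>length as. coeff q k * (M ^^ Suc k) w i)"
    by (subst sum.atMost_Suc_shift) simp
  also have "\<dots> = M (\<lambda>i. \<Sum>k\<le>length as. coeff q k * (M ^^ k) w i) i"
    by (subst Msum) simp
  also have "(\<lambda>i. \<Sum>k\<le>length as. coeff q k * (M ^^ k) w i) = shifted_prod M as w"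
    using Cons.IH by (auto simp: q_def)
  also have "(\<Sum>k\<le>Suc (length as). coeff q k * (M ^^ k) w i) = (\<Sum>k\<le>length as. coeff q k * (M ^^ k) w i)"
    using degq by simp
  also have "\<dots> = shifted_prod M as w i"
    using Cons.IH by (simp add: q_def)
  finally show ?case by (simp add: q_def)
qed

text \<open>An operator that is symmetric for an indefinite Hermitian form has an eigenvector of
  nonpositive type, unless the form is positive definite (finite-dimensional case of
  Pontryagin's theorem): if all eigenvectors are of positive type, split them off one by one.\<close>

lemma positive_type_induct:
  fixes M :: "(nat \<Rightarrow> complex) \<Rightarrow> nat \<Rightarrow> complex" and ip :: "(nat \<Rightarrow> complex) \<Rightarrow> (nat \<Rightarrow> complex) \<Rightarrow> complex"
  assumes lin: "\<And>x a y. M (\<lambda>i. x i - a * y i) = (\<lambda>i. M x i - a * M y i)"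
    and ip_lin: "\<And>x a y z. ip (\<lambda>i. x i - a * y i) z = ip x z - a * ip y z"
    and herm: "\<And>x y. ip y x = cnj (ip x y)"
    and sym: "\<And>x y. ip (M x) y = ip x (M y)"
    and closed: "\<And>x a y. V x \<Longrightarrow> V y \<Longrightarrow> V (\<lambda>i. x i - a * y i)" "\<And>x. V x \<Longrightarrow> V (M x)"
    and pos: "\<And>x a. V x \<Longrightarrow> x \<noteq> (\<lambda>i. 0) \<Longrightarrow> M x = (\<lambda>i. a * x i) \<Longrightarrow> 0 < Re (ip x x)"
  shows "V w \<Longrightarrow> w \<noteq> (\<lambda>i. 0) \<Longrightarrow> shifted_prod M as w = (\<lambda>i. 0) \<Longrightarrow> 0 < Re (ip w w)"
proof (induction as arbitrary: w)
  case Nil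
  then show ?case by simp
next
  case (Cons a as)
  define v where "v = shifted_prod M as w"
  show ?case
  proof (cases "v = (\<lambda>i. 0)")
    case True
    then show ?thesis using Cons by (simp add: v_def)
  next
    case False
    have ipr: "ip z (\<lambda>i. x i - a * y i) = ip z x - cnj a * ip z y" for x y z a
      using arg_cong[OF ip_lin[of x a y z], of cnj] herm[of z x] herm[of z y] herm[of z "\<lambda>i. x i - a * y i"] by simp
    have ip0: "ip (\<lambda>i. 0) z = 0" for z
      using ip_lin[of "\<lambda>i. 0" 1 "\<lambda>i. 0" z] by simp
    have scale: "ip (\<lambda>i. c * y i) z = c * ip y z" for c y z
      using ip_lin[of "\<lambda>i. 0" "-c" y z] ip0 by simp
    have scaler: "ip z (\<lambda>i. c * y i) = cnj c * ip z y" for c y z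
      using arg_cong[OF scale[of c y z], of cnj] herm[of z y] herm[of z "\<lambda>i. c * y i"] by simp
    have Vp: "V (shifted_prod M bs x)" if "V x" for bs x
      using that by (induction bs) (auto intro: closed)
    have V: "V v" unfolding v_def using Cons.prems(1) by (rule Vp)
    have "(\<lambda>i. M v i - a * v i) = (\<lambda>i. 0)" using Cons.prems(3) by (simp add: v_def)
    then have Mv: "M v = (\<lambda>i. a * v i)" by (simp add: fun_eq_iff)
    define G where "G = Re (ip v v)"
    have G: "0 < G" unfolding G_def by (rule pos[OF V False Mv])
    have ipv: "ip v v = complex_of_real G"
      using herm[of v v] by (simp add: G_def complex_eq_iff)
    have "a * complex_of_real G = cnj a * complex_of_real G"
      using sym[of v v] by (simp add: Mv scale scaler ipv)
    \<comment> \<open>Symmetry and \<open>G > 0\<close> force a real eigenvalue; this lets a factor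
      \<open>M - b\<close> act on the component along \<open>v\<close> as the number
      \<open>a - b\<close>.\<close>
    then have a_real: "cnj a = a" using G by simp
    define q where "q = (\<Prod>b\<leftarrow>as. a - b)"
    have adj: "ip (shifted_prod M bs x) v = (\<Prod>b\<leftarrow>bs. a - b) * ip x v" for bs x
    proof (induction bs)
      case (Cons b bs)
      have "ip (M (shifted_prod M bs x)) v = a * ip (shifted_prod M bs x) v"
        by (simp add: sym Mv scaler a_real)
      then show ?case using Cons by (simp add: ip_lin algebra_simps)
    qed simp
    have on_v: "shifted_prod M bs v = (\<lambda>i. (\<Prod>b\<leftarrow>bs. a - b) * v i)" for bs
    proof (induction bs)
      case (Cons b bs)
      have Mc: "M (\<lambda>i. c * v i) = (\<lambda>i. c * (a * v i))" for c
        using lin[of "\<lambda>i. 0" "-c" v] lin[of "\<lambda>i. 0" 1 "\<lambda>i. 0"] Mv by (simp add: fun_eq_iff)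
      show ?case unfolding shifted_prod.simps Cons.IH Mc by (simp add: algebra_simps)
    qed simp
    have prod_lin: "shifted_prod M bs (\<lambda>i. x i - c * y i) = (\<lambda>i. shifted_prod M bs x i - c * shifted_prod M bs y i)" for bs x y c
      by (induction bs) (auto simp: lin algebra_simps)
    \<comment> \<open>Splits \<open>w\<close> into \<open>c * v\<close> and a remainder
      \<open>w'\<close> that is orthogonal to \<open>v\<close> for the form.\<close>
    define c where "c = ip w v / complex_of_real G"
    define w' where "w' = (\<lambda>i. w i - c * v i)"
    have Vw': "V w'" unfolding w'_def by (intro closed Cons.prems V)
    have orth: "ip w' v = 0"
    proof -
      have "ip w' v = ip w v - c * complex_of_real G"
        unfolding w'_def ip_lin ipv ..
      then show ?thesis using G by (simp add: c_def)
    qed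
    have pw': "shifted_prod M as w' = (\<lambda>i. (1 - c * q) * v i)"
      unfolding w'_def prod_lin on_v v_def[symmetric] q_def by (simp add: algebra_simps)
    \<comment> \<open>The remaining factors map \<open>w'\<close> to a multiple of \<open>v\<close>
      that is also orthogonal to \<open>v\<close>. As \<open>v\<close> has positive type, this
      multiple is 0, so the shorter list annihilates \<open>w'\<close>.\<close>
    have "(1 - c * q) * complex_of_real G = 0"
      using adj[of as w'] orth by (simp add: pw' scale ipv)
    then have "1 - c * q = 0" using G by simp
    then have w'0: "shifted_prod M as w' = (\<lambda>i. 0)" by (simp add: pw')
    have "w = (\<lambda>i. w' i - (-c) * v i)" by (simp add: w'_def)
    then have "ip w w = ip (\<lambda>i. w' i - (-c) * v i) (\<lambda>i. w' i - (-c) * v i)" by metis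
    also have "\<dots> = ip w' w' + c * cnj c * complex_of_real G"
      unfolding ip_lin ipr ipv using orth herm[of v w'] by (simp add: algebra_simps)
    also have "\<dots> = ip w' w' + complex_of_real ((norm c)\<^sup>2 * G)"
      by (simp add: complex_norm_square[symmetric])
    finally have eq: "Re (ip w w) = Re (ip w' w') + (norm c)\<^sup>2 * G" by simp
    show ?thesis
    proof (cases "w' = (\<lambda>i. 0)")
      case True
      then have "c \<noteq> 0" using Cons.prems(2) by (auto simp: w'_def fun_eq_iff)
      then show ?thesis using eq True ip0 G by simp
    next
      case False
      from Cons.IH[OF Vw' this w'0] show ?thesis using eq G by (simp add: add_pos_nonneg)
    qed
  qed
qed

text \<open>The \<open>N + 1\<close> vectors \<open>(M ^^ k) w\<close> are linearly dependent, so a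
  nonzero polynomial in \<open>M\<close> annihilates \<open>w\<close>. It splits into linear factors
  over the complex numbers; if all eigenvectors had positive type, the induction over these factors
  would make \<open>w\<close> positive as well.\<close>

lemma nonpositive_type_eigenvector:
  fixes M :: "(nat \<Rightarrow> complex) \<Rightarrow> nat \<Rightarrow> complex" and ip :: "(nat \<Rightarrow> complex) \<Rightarrow> (nat \<Rightarrow> complex) \<Rightarrow> complex"
  assumes lin: "\<And>x a y. M (\<lambda>i. x i - a * y i) = (\<lambda>i. M x i - a * M y i)"
    and ip_lin: "\<And>x a y z. ip (\<lambda>i. x i - a * y i) z = ip x z - a * ip y z"
    and herm: "\<And>x y. ip y x = cnj (ip x y)"
    and sym: "\<And>x y. ip (M x) y = ip x (M y)"
    and fin: "\<And>x i. N \<le> i \<Longrightarrow> M x i = 0"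
    and w: "\<And>i. N \<le> i \<Longrightarrow> w i = 0" "w \<noteq> (\<lambda>i. 0)" "Re (ip w w) \<le> 0"
  obtains x a where "\<forall>i\<ge>N. x i = 0" "x \<noteq> (\<lambda>i. 0)" "M x = (\<lambda>i. a * x i)" "Re (ip x x) \<le> 0"
proof -
  have "\<exists>x a. (\<forall>i\<ge>N. x i = 0) \<and> x \<noteq> (\<lambda>i. 0) \<and> M x = (\<lambda>i. a * x i) \<and> Re (ip x x) \<le> 0"
  proof (rule ccontr)
    assume no: "\<not> ?thesis"
    define V where "V = (\<lambda>x :: nat \<Rightarrow> complex. \<forall>i\<ge>N. x i = 0)"
    have pos: "0 < Re (ip x x)" if "V x" "x \<noteq> (\<lambda>i. 0)" "M x = (\<lambda>i. a * x i)" for x a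
      using that no unfolding V_def by (meson not_less)
    have Vw: "V w" using w(1) by (simp add: V_def)
    obtain c where c: "\<exists>k\<le>N. c k \<noteq> 0" "\<And>i. i < N \<Longrightarrow> (\<Sum>k\<le>N. c k * (M ^^ k) w i) = 0"
      using exists_linear_relation[of N "\<lambda>k. (M ^^ k) w"] by blast
    have c': "(\<Sum>k\<le>N. c k * (M ^^ k) w i) = 0" for i
    proof (cases "i < N")
      case False
      then have "(M ^^ k) w i = 0" for k using fin w(1) by (cases k) auto
      then show ?thesis by simp
    qed (rule c(2))
    define P where "P = (\<Sum>k\<le>N. monom (c k) k)"
    have coeffP: "coeff P k = (if k \<le> N then c k else 0)" for k
      by (simp add: P_def coeff_sum)
    obtain as where as: "smult (lead_coeff P) (\<Prod>a\<leftarrow>as. [:- a, 1:]) = P" "length as = degree P"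
    proof -
      obtain as where as: "mset as = proots P" using ex_mset by blast
      have "(\<Prod>x\<in>#proots P. [:- x, 1:]) = (\<Prod>x\<leftarrow>as. [:- x, 1:])"
        by (subst prod_mset_prod_list[symmetric]) (simp add: as)
      moreover have "length as = degree P"
        using size_proots_complex[of P] as by (metis size_mset)
      ultimately show thesis
        using that complex_poly_decompose_multiset[of P] by simp
    qed
    have P0: "lead_coeff P \<noteq> 0"
      using c(1) coeffP by (metis leading_coeff_0_iff coeff_0)
    have deg: "degree P \<le> N"
      by (intro degree_le) (simp add: coeffP)
    have "shifted_prod M as w i = 0" for i
    proof -
      have "0 = (\<Sum>k\<le>N. coeff P k * (M ^^ k) w i)"
        using c'[of i] by (simp add: coeffP)
      also have "\<dots> = (\<Sum>k\<le>degree P. coeff P k * (M ^^ k) w i)"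
        using deg by (intro sum.mono_neutral_right) (auto simp: coeff_eq_0)
      also have "\<dots> = (\<Sum>k\<le>length as. lead_coeff P * (coeff (\<Prod>a\<leftarrow>as. [:- a, 1:]) k * (M ^^ k) w i))"
        unfolding as(2) by (subst (1) as(1)[symmetric]) (simp add: mult.assoc)
      also have "\<dots> = lead_coeff P * shifted_prod M as w i"
        unfolding sum_distrib_left[symmetric] by (simp only: poly_op_shifted_prod[OF lin])
      finally show ?thesis using P0 by simp
    qed
    then have sp: "shifted_prod M as w = (\<lambda>i. 0)" by auto
    have "0 < Re (ip w w)"
      by (rule positive_type_induct[where V = V and M = M and ip = ip and as = as, OF lin ip_lin herm sym _ _ pos Vw w(2) sp])
        (auto simp: V_def fin)
    then show False using w(3) by simp
  qed
  then show thesis using that by blast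
qed

text \<open>For Hermitian matrices \<open>b\<close> and \<open>q\<close> the quadratic pencil \<open>\<delta>\<^sup>2 - \<delta> b - q\<close> is linearised by
  \<open>(x, y) \<mapsto> (y, q x + b y)\<close>, which is symmetric for the form \<open>q(x, x) + |y|\<^sup>2\<close>.\<close>

lemma quadratic_pencil_nonpositive_eigenvector:
  fixes b q :: "nat \<Rightarrow> nat \<Rightarrow> complex" and c :: "nat \<Rightarrow> complex"
  assumes b: "\<And>i j. b j i = cnj (b i j)" and q: "\<And>i j. q j i = cnj (q i j)"
    and c: "i0 < m" "c i0 \<noteq> 0" "Re (\<Sum>i<m. \<Sum>j<m. q i j * c j * cnj (c i)) \<le> 0"
  obtains \<delta> x where "\<exists>i<m. x i \<noteq> 0"
    "\<forall>i<m. \<delta>\<^sup>2 * x i - \<delta> * (\<Sum>j<m. b i j * x j) - (\<Sum>j<m. q i j * x j) = 0"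
    "Re (\<Sum>i<m. \<Sum>j<m. q i j * x j * cnj (x i)) + (norm \<delta>)\<^sup>2 * (\<Sum>i<m. (norm (x i))\<^sup>2) \<le> 0"
proof -
  \<comment> \<open>Coordinates below \<open>m\<close> hold the first component, those from
    \<open>m\<close> up to \<open>2 * m\<close> the second, and all others are 0.\<close>
  define M where "M = (\<lambda>x i. if i < m then x (m + i) else if i < 2 * m then
     (\<Sum>j<m. q (i - m) j * x j) + (\<Sum>j<m. b (i - m) j * x (m + j)) else (0 :: complex))"
  define ip where "ip = (\<lambda>x y. (\<Sum>i<m. \<Sum>j<m. q i j * x j * cnj (y i)) + (\<Sum>i<m. x (m + i) * cnj (y (m + i))) :: complex)"
  have Mlow: "M x i = x (m + i)" if "i < m" for x i using that by (simp add: M_def)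
  have Mhigh: "M x (m + i) = (\<Sum>j<m. q i j * x j) + (\<Sum>j<m. b i j * x (m + j))" if "i < m" for x i
    using that by (simp add: M_def)
  have herm_sum: "(\<Sum>i<m. \<Sum>j<m. g i j * x j * cnj (y i)) = cnj (\<Sum>i<m. \<Sum>j<m. g i j * y j * cnj (x i))"
    if "\<And>i j. g j i = cnj (g i j)" for g :: "nat \<Rightarrow> nat \<Rightarrow> complex" and x y
  proof -
    have "cnj (\<Sum>i<m. \<Sum>j<m. g i j * y j * cnj (x i)) = (\<Sum>i<m. \<Sum>j<m. g j i * x i * cnj (y j))"
      by (simp add: that[symmetric] mult_ac)
    also have "\<dots> = (\<Sum>i<m. \<Sum>j<m. g i j * x j * cnj (y i))" by (rule sum.swap)
    finally show ?thesis by simp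
  qed
  \<comment> \<open>The pair \<open>(c, 0)\<close> has the form value \<open>q(c, c)\<close>, so it
    is the nonpositive vector required by the eigenvector lemma.\<close>
  define w where "w = (\<lambda>i. if i < m then c i else 0)"
  obtain x a where x: "\<forall>i\<ge>2 * m. x i = 0" "x \<noteq> (\<lambda>i. 0)" "M x = (\<lambda>i. a * x i)" "Re (ip x x) \<le> 0"
  proof (rule nonpositive_type_eigenvector[of M ip "2 * m" w])
    show "M (\<lambda>i. x i - a * y i) = (\<lambda>i. M x i - a * M y i)" for x y a
      by (auto simp: M_def fun_eq_iff algebra_simps sum_subtractf sum_distrib_left)
    show "ip (\<lambda>i. x i - a * y i) z = ip x z - a * ip y z" for x y z a
      by (simp add: ip_def algebra_simps sum_subtractf sum_distrib_left)
    show "ip y x = cnj (ip x y)" for x y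
      unfolding ip_def using herm_sum[of q, OF q, of y x] by (simp add: mult.commute)
    show "ip (M x) y = ip x (M y)" for x y
    proof -
      have "ip (M x) y = (\<Sum>i<m. \<Sum>j<m. q i j * x (m + j) * cnj (y i)) +
          (\<Sum>i<m. \<Sum>j<m. q i j * x j * cnj (y (m + i))) + (\<Sum>i<m. \<Sum>j<m. b i j * x (m + j) * cnj (y (m + i)))"
        by (simp add: ip_def Mlow Mhigh distrib_right sum.distrib sum_distrib_right)
      also have "(\<Sum>i<m. \<Sum>j<m. q i j * x (m + j) * cnj (y i)) = (\<Sum>i<m. x (m + i) * cnj (\<Sum>j<m. q i j * y j))"
        using herm_sum[of q, OF q, of "\<lambda>j. x (m + j)" y] by (simp add: sum_distrib_left mult_ac)
      also have "(\<Sum>i<m. \<Sum>j<m. b i j * x (m + j) * cnj (y (m + i))) = (\<Sum>i<m. x (m + i) * cnj (\<Sum>j<m. b i j * y (m + j)))"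
        using herm_sum[of b, OF b, of "\<lambda>j. x (m + j)" "\<lambda>j. y (m + j)"] by (simp add: sum_distrib_left mult_ac)
      also have "(\<Sum>i<m. x (m + i) * cnj (\<Sum>j<m. q i j * y j)) + (\<Sum>i<m. \<Sum>j<m. q i j * x j * cnj (y (m + i))) +
          (\<Sum>i<m. x (m + i) * cnj (\<Sum>j<m. b i j * y (m + j))) = ip x (M y)"
        by (simp add: ip_def Mlow Mhigh distrib_left sum.distrib)
      finally show ?thesis .
    qed
    show "M x i = 0" if "2 * m \<le> i" for x i using that by (simp add: M_def)
    show "w i = 0" if "2 * m \<le> i" for i using that by (simp add: w_def)
    show "w \<noteq> (\<lambda>i. 0)" using c by (auto simp: w_def fun_eq_iff)
    show "Re (ip w w) \<le> 0" using c(3) by (simp add: ip_def w_def)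
  qed
  have high: "x (m + i) = a * x i" if "i < m" for i
    using fun_cong[OF x(3), of i] that by (simp add: Mlow)
  have eq: "a * (a * x i) = (\<Sum>j<m. q i j * x j) + a * (\<Sum>j<m. b i j * x j)" if "i < m" for i
    using fun_cong[OF x(3), of "m + i"] that by (simp add: Mhigh high sum_distrib_left mult_ac)
  have "\<exists>i<m. x i \<noteq> 0"
  proof (rule ccontr)
    assume "\<not> ?thesis"
    then have low0: "x i = 0" if "i < m" for i using that by blast
    have "x i = 0" for i
    proof (cases "i < 2 * m")
      case True
      then show ?thesis using low0[of i] high[of "i - m"] low0[of "i - m"] by (cases "i < m") auto
    qed (use x(1) in simp)
    then show False using x(2) by auto
  qed
  moreover have "a\<^sup>2 * x i - a * (\<Sum>j<m. b i j * x j) - (\<Sum>j<m. q i j * x j) = 0" if "i < m" for i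
    using eq[OF that] by (simp add: power2_eq_square mult.assoc)
  moreover have "Re (\<Sum>i<m. \<Sum>j<m. q i j * x j * cnj (x i)) + (norm a)\<^sup>2 * (\<Sum>i<m. (norm (x i))\<^sup>2) \<le> 0"
  proof -
    have "Re (x (m + i) * cnj (x (m + i))) = (norm a)\<^sup>2 * (norm (x i))\<^sup>2" if "i < m" for i
    proof -
      have "x (m + i) * cnj (x (m + i)) = complex_of_real ((norm a)\<^sup>2 * (norm (x i))\<^sup>2)"
        unfolding complex_norm_square[symmetric] high[OF that] by (simp add: norm_mult power_mult_distrib)
      then show ?thesis by simp
    qed
    then show ?thesis using x(4) by (simp add: ip_def Re_sum sum_distrib_left)
  qed
  ultimately show thesis using that by blast
qed

subsection \<open>Shooting solution and spectrum\<close>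

definition shot :: "(real \<Rightarrow> real) \<Rightarrow> (real \<Rightarrow> real) \<Rightarrow> complex \<Rightarrow> (real \<Rightarrow> complex) \<times> (real \<Rightarrow> complex)" where
  "shot p r z = (SOME (y, u). qsol r (pot p r z) (\<lambda>x. 0) y u \<and> y 0 = 0 \<and> u 0 = 1)"

locale pencil_data =
  fixes p r :: "real \<Rightarrow> real"
  assumes p_L2: "p \<in> L2" and r_L2: "r \<in> L2"
begin

abbreviation "w \<equiv> pot p r"
abbreviation "T \<equiv> energy_pencil p r"
definition "sy z = fst (shot p r z)"
definition "su z = snd (shot p r z)"

lemmas r_int = L2_absolutely_integrable(1)[OF r_L2]
lemmas p_int = L2_absolutely_integrable(1)[OF p_L2]
lemmas w_int = pot_absolutely_integrable[OF p_L2 r_L2]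

lemma zero_int: "(\<lambda>x::real. 0 :: complex) absolutely_integrable_on {0..1}"
  by (simp add: set_integrable_def)

lemma zero_L2: "(\<lambda>x::real. 0 :: complex) \<in> L2"
  by (rule L2_continuous) auto

lemma qsol_pot_exists:
  assumes "f absolutely_integrable_on {0..1}"
  obtains y u where "qsol r (w z) f y u" "y 0 = y0" "u 0 = u0"
  using qsol_exists[OF r_int w_int[of z] assms, of y0 u0] .

lemma shot: "qsol r (w z) (\<lambda>x. 0) (sy z) (su z)" "sy z 0 = 0" "su z 0 = 1"
proof -
  obtain y u where "qsol r (w z) (\<lambda>x. 0) y u" "y 0 = 0" "u 0 = 1"
    by (rule qsol_pot_exists[OF zero_int, of z 0 1])
  then have "\<exists>a. case a of (y, u) \<Rightarrow> qsol r (w z) (\<lambda>x. 0) y u \<and> y 0 = 0 \<and> u 0 = 1"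
    by (intro exI[of _ "(y, u)"]) simp
  from someI_ex[OF this] show "qsol r (w z) (\<lambda>x. 0) (sy z) (su z)" "sy z 0 = 0" "su z 0 = 1"
    unfolding sy_def su_def shot_def by (auto simp: case_prod_unfold)
qed

lemma shot_unique:
  assumes "qsol r (w z) (\<lambda>x. 0) y u" "y 0 = 0" "x \<in> {0..1}"
  shows "y x = u 0 * sy z x" "u x = u 0 * su z x"
proof -
  have "qsol r (w z) (\<lambda>x. 0) (\<lambda>x. u 0 * sy z x) (\<lambda>x. u 0 * su z x)"
    using qsol_lincomb[OF shot(1)[of z] shot(1)[of z], where c = "u 0" and d = 0] by simp
  from qsol_unique[OF r_int w_int assms(1) this _ _ assms(3)]
  show "y x = u 0 * sy z x" "u x = u 0 * su z x"
    using assms shot by auto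
qed

lemma shot_nonvanishing: "x \<in> {0..1} \<Longrightarrow> sy z x \<noteq> 0 \<or> su z x \<noteq> 0"
  by (rule qsol_nonvanishing[OF r_int w_int shot(1)]) (use shot in auto)

lemma shot_nonzero: "\<not> l2_eq (sy z) (\<lambda>x. 0)"
proof
  assume "l2_eq (sy z) (\<lambda>x. 0)"
  then have ae: "AE x in leb01. sy z x = 0" by (simp add: l2_eq_def)
  have z: "sy z x = 0" if "x \<in> {0..1}" for x
    by (rule continuous_AE_zero[OF qsol_cont_y[OF shot(1)] ae that])
  have "indef_int (\<lambda>x. complex_of_real (r x) * sy z x + su z x) (\<lambda>x. 0)"
    by (rule indef_int_cong_AE[OF qsol_y[OF shot(1)]]) (use z in auto)
  from indef_int_unique[OF this indef_int_const[of 0]] ae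
  have "AE x in leb01. su z x = 0" by eventually_elim simp
  then have "su z 0 = 0"
    by (rule continuous_AE_zero[OF qsol_cont_u[OF shot(1)]]) simp
  then show False using shot by simp
qed

lemma dom_bcI:
  assumes q: "qsol r (w z) f y u" and f: "f \<in> L2" and "y 0 = 0" "bdry b y u = 0"
  shows "y \<in> dom_bc r b" "AE x in leb01. T z y x = f x" "\<And>x. x \<in> {0..1} \<Longrightarrow> quasi_deriv r y x = u x"
  using qsol_pot_in_dom_ell[OF p_L2 q f] assms by (auto simp: dom_bc_def bdry_def)

lemma dom_bcD:
  assumes "y \<in> dom_bc r b" "AE x in leb01. T z y x = f x"
  shows "qsol r (w z) f y (quasi_deriv r y)" "y 0 = 0" "bdry b y (quasi_deriv r y) = 0"
  using assms dom_ell_qsol_pot[of y r p z f] by (auto simp: dom_bc_def)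

text \<open>The condition at 0 leaves only the value of \<open>u\<close> at 0 free, so every
  solution is a multiple of the shooting solution. Geometric simplicity of the eigenvalues is built
  in here.\<close>

lemma kernel_shot:
  assumes y: "y \<in> dom_bc r b" "l2_eq (T z y) (\<lambda>x. 0)"
  shows "bdry b (sy z) (su z) = 0 \<or> (\<forall>x\<in>{0..1}. y x = 0)"
    and "\<exists>c. \<forall>x\<in>{0..1}. y x = c * sy z x \<and> quasi_deriv r y x = c * su z x"
proof -
  define u where "u = quasi_deriv r y"
  have ae: "AE x in leb01. T z y x = (\<lambda>x. 0) x" using y(2) by (simp add: l2_eq_def)
  have q: "qsol r (w z) (\<lambda>x. 0) y u" "y 0 = 0" "bdry b y u = 0"
    unfolding u_def using dom_bcD[OF y(1) ae] by blast+
  have *: "y x = u 0 * sy z x" "u x = u 0 * su z x" if "x \<in> {0..1}" for x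
    using shot_unique[OF q(1) q(2) that] by blast+
  then show "\<exists>c. \<forall>x\<in>{0..1}. y x = c * sy z x \<and> quasi_deriv r y x = c * su z x" unfolding u_def by blast
  have "bdry b y u = u 0 * bdry b (sy z) (su z)"
    unfolding bdry_def using *[of 1] by simp
  then have "u 0 = 0 \<or> bdry b (sy z) (su z) = 0" using q(3) by simp
  then show "bdry b (sy z) (su z) = 0 \<or> (\<forall>x\<in>{0..1}. y x = 0)"
  proof
    assume "u 0 = 0"
    then have "\<forall>x\<in>{0..1}. y x = 0" using *(1) by simp
    then show ?thesis ..
  qed simp
qed

lemma eigenvalue_shot:
  assumes "bdry b (sy z) (su z) = 0"
  shows "pencil_eigenvector (dom_bc r b) T z (sy z)"
proof -
  have s: "sy z \<in> dom_bc r b" "AE x in leb01. T z (sy z) x = 0"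
    using dom_bcI[OF shot(1) zero_L2 shot(2) assms] by blast+
  then show ?thesis using shot_nonzero by (simp add: pencil_eigenvector_def l2_eq_def)
qed

lemma l2_eq_zeroI: "(\<And>x. x \<in> {0..1} \<Longrightarrow> y x = 0) \<Longrightarrow> l2_eq y (\<lambda>x. 0)"
  unfolding l2_eq_def by (intro AE_I2) simp

lemma l2_norm_le:
  assumes y: "continuous_on {0..1} y" and M: "\<And>x. x \<in> {0..1} \<Longrightarrow> norm (y x) \<le> M"
  shows "l2_norm y \<le> M"
proof -
  have M0: "0 \<le> M" using order_trans[OF norm_ge_zero M[of 0]] by simp
  have "integral {0..1} (\<lambda>x. (norm (y x))\<^sup>2) \<le> integral {0..1} (\<lambda>x::real. M\<^sup>2)"
  proof (rule integral_le_01)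
    show "(norm (y x))\<^sup>2 \<le> M\<^sup>2" if "x \<in> {0..1}" for x
      using M[OF that] by (intro power_mono) auto
    show "(\<lambda>x. (norm (y x))\<^sup>2) absolutely_integrable_on {0..1}"
      by (rule absolutely_integrable_continuous_real[OF continuous_on_power[OF continuous_on_norm[OF y]]])
    show "(\<lambda>x::real. M\<^sup>2) absolutely_integrable_on {0..1}"
      by (rule absolutely_integrable_continuous_real[OF continuous_on_const])
  qed auto
  then show ?thesis
    unfolding l2_norm_eq[OF L2_continuous[OF y]] using M0 by (intro real_le_lsqrt) auto
qed

lemma particular_bound:
  obtains C where "0 \<le> C"
    "\<And>f y u x. f \<in> L2 \<Longrightarrow> qsol r (w z) f y u \<Longrightarrow> y 0 = 0 \<Longrightarrow> u 0 = 0 \<Longrightarrow> x \<in> {0..1} \<Longrightarrow>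
      norm (y x) + norm (u x) \<le> C * l2_norm f"
proof -
  define C where "C = 2 * exp (2 * integral {0..1} (\<lambda>t. 2 * \<bar>r t\<bar> + norm (w z t) + 1))"
  have "norm (y x) + norm (u x) \<le> C * l2_norm f"
    if f: "f \<in> L2" and q: "qsol r (w z) f y u" "y 0 = 0" "u 0 = 0" and x: "x \<in> {0..1}" for f y u x
  proof -
    have "norm (y x) + norm (u x) \<le> C * integral {0..1} (\<lambda>t. norm (f t))"
      using qsol_bound[OF r_int w_int L2_absolutely_integrable(1)[OF f] q(1) x] q by (simp add: C_def mult_ac)
    also have "\<dots> \<le> C * l2_norm f"
      using integral_norm_le_sqrt[OF f, of 0 1] by (intro mult_left_mono) (auto simp: l2_norm_eq[OF f] C_def)
    finally show ?thesis .
  qed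
  moreover have "0 \<le> C" by (simp add: C_def)
  ultimately show thesis using that by blast
qed

text \<open>A particular solution with zero initial data is corrected by a multiple of the shooting
  solution so as to meet the condition at 1. The factor has a fixed nonzero denominator, so the same
  decomposition bounds the inverse.\<close>

lemma resolvent:
  assumes nz: "bdry b (sy z) (su z) \<noteq> 0"
  shows "0 \<in> op_resolvent_set (dom_bc r b) (T z)"
  unfolding op_resolvent_set_def
proof (intro CollectI conjI ballI impI)
  fix y assume "y \<in> dom_bc r b" "l2_eq (\<lambda>x. T z y x - 0 * y x) (\<lambda>x. 0)"
  then have "l2_eq (T z y) (\<lambda>x. 0)" by (simp add: l2_eq_def)
  from kernel_shot(1)[OF \<open>y \<in> dom_bc r b\<close> this] nz show "l2_eq y (\<lambda>x. 0)"
    by (intro l2_eq_zeroI) blast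
next
  fix f :: "real \<Rightarrow> complex" assume f: "f \<in> L2"
  obtain y u where q: "qsol r (w z) f y u" "y 0 = 0" "u 0 = 0"
    by (rule qsol_pot_exists[OF L2_absolutely_integrable(1)[OF f], of z 0 0])
  define c where "c = - bdry b y u / bdry b (sy z) (su z)"
  have q': "qsol r (w z) f (\<lambda>x. y x + c * sy z x) (\<lambda>x. u x + c * su z x)"
    using qsol_lincomb[OF q(1) shot(1)[of z], where c = 1 and d = c] by simp
  have bd: "bdry b (\<lambda>x. y x + c * sy z x) (\<lambda>x. u x + c * su z x) = 0"
    using nz by (simp add: bdry_def c_def split: if_splits)
  have "y 0 + c * sy z 0 = 0" using q shot by simp
  from dom_bcI(1,2)[OF q' f this bd]
  show "\<exists>y\<in>dom_bc r b. l2_eq (\<lambda>x. T z y x - 0 * y x) f"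
    unfolding l2_eq_def by (intro bexI[of _ "\<lambda>x. y x + c * sy z x"]) auto
next
  obtain C where C: "0 \<le> C" "\<And>f y u x. f \<in> L2 \<Longrightarrow> qsol r (w z) f y u \<Longrightarrow> y 0 = 0 \<Longrightarrow> u 0 = 0 \<Longrightarrow> x \<in> {0..1} \<Longrightarrow>
      norm (y x) + norm (u x) \<le> C * l2_norm f" using particular_bound by blast
  obtain M where M: "0 \<le> M" "\<And>x. x \<in> {0..1} \<Longrightarrow> norm (sy z x) \<le> M"
    using indef_int_bounded[OF qsol_y[OF shot(1)]] by blast
  define K where "K = C + C / norm (bdry b (sy z) (su z)) * M"
  show "\<exists>C. \<forall>y\<in>dom_bc r b. l2_norm y \<le> C * l2_norm (\<lambda>x. T z y x - 0 * y x)"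
  proof (intro exI[of _ K] ballI)
    fix y assume y: "y \<in> dom_bc r b"
    define f where "f = T z y"
    have f: "f \<in> L2" unfolding f_def using y by (intro dom_ell_pencil_L2 p_L2) (simp add: dom_bc_def)
    have ae: "AE x in leb01. T z y x = f x" by (simp add: f_def)
    define u where "u = quasi_deriv r y"
    have q: "qsol r (w z) f y u" "y 0 = 0" "bdry b y u = 0"
      unfolding u_def by (rule dom_bcD[OF y ae])+
    obtain y' u' where q': "qsol r (w z) f y' u'" "y' 0 = 0" "u' 0 = 0"
      by (rule qsol_pot_exists[OF L2_absolutely_integrable(1)[OF f], of z 0 0])
    have "qsol r (w z) (\<lambda>x. 0) (\<lambda>x. y x - y' x) (\<lambda>x. u x - u' x)"
      using qsol_lincomb[OF q(1) q'(1), where c = 1 and d = "-1"] by simp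
    from shot_unique[OF this] have *: "y x - y' x = u 0 * sy z x" "u x - u' x = u 0 * su z x" if "x \<in> {0..1}" for x
      using q q' that by auto
    have bd: "norm (bdry b y' u') \<le> C * l2_norm f"
      using C(2)[OF f q', of 1] norm_ge_zero[of "y' 1"] norm_ge_zero[of "u' 1"]
      by (cases b) (auto simp: bdry_def simp del: norm_ge_zero)
    have "bdry b y u - bdry b y' u' = u 0 * bdry b (sy z) (su z)"
      using *[of 1] by (simp add: bdry_def)
    then have "u 0 = - bdry b y' u' / bdry b (sy z) (su z)"
      using nz q(3) by (simp add: field_simps)
    then have u0: "norm (u 0) \<le> C * l2_norm f / norm (bdry b (sy z) (su z))"
      using bd by (simp add: norm_divide divide_right_mono)
    have "l2_norm y \<le> K * l2_norm f"
    proof (rule l2_norm_le[OF qsol_cont_y[OF q(1)]])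
      fix x :: real assume x: "x \<in> {0..1}"
      have "norm (y x) \<le> norm (y' x) + norm (u 0) * norm (sy z x)"
        using *(1)[OF x] norm_triangle_ineq[of "y' x" "u 0 * sy z x"] by (simp add: norm_mult algebra_simps)
      also have "\<dots> \<le> C * l2_norm f + C * l2_norm f / norm (bdry b (sy z) (su z)) * M"
      proof (intro add_mono mult_mono)
        show "norm (y' x) \<le> C * l2_norm f" using C(2)[OF f q' x] norm_ge_zero[of "u' x"] by linarith
      qed (use u0 M(2)[OF x] order_trans[OF norm_ge_zero u0] in auto)
      also have "\<dots> = K * l2_norm f" by (simp add: K_def algebra_simps)
      finally show "norm (y x) \<le> K * l2_norm f" .
    qed
    then show "l2_norm y \<le> K * l2_norm (\<lambda>x. T z y x - 0 * y x)" by (simp add: f_def)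
  qed
qed

lemma spectrum_eq: "pencil_spectrum (dom_bc r b) T = {z. bdry b (sy z) (su z) = 0}"
proof (intro set_eqI iffI; clarsimp simp: pencil_spectrum_def op_spectrum_def)
  fix z assume "0 \<notin> op_resolvent_set (dom_bc r b) (T z)"
  then show "bdry b (sy z) (su z) = 0" using resolvent by blast
next
  fix z assume z: "bdry b (sy z) (su z) = 0" "0 \<in> op_resolvent_set (dom_bc r b) (T z)"
  from eigenvalue_shot[OF z(1)]
  have "sy z \<in> dom_bc r b" "\<not> l2_eq (sy z) (\<lambda>x. 0)" "l2_eq (\<lambda>x. T z (sy z) x - 0 * sy z x) (\<lambda>x. 0)"
    by (auto simp: pencil_eigenvector_def)
  then show False using z(2) unfolding op_resolvent_set_def by blast
qed

text \<open>By Fredholm's alternative an eigenvalue \<open>z\<close> has an associated vector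
  iff \<open>\<integral> (2 z - 2 p) s\<^sup>2 = 0\<close> for the eigenfunction \<open>s\<close>.\<close>

definition "Dz z = integral {0..1} (\<lambda>x. (2 * z - 2 * complex_of_real (p x)) * (sy z x)\<^sup>2)"

lemma pencil_deriv_1:
  "pencil_deriv 1 T z y = (\<lambda>x. (2 * z - 2 * complex_of_real (p x)) * y x)"
proof
  fix x
  have "((\<lambda>w. T w y x) has_field_derivative (2 * z - 2 * complex_of_real (p x)) * y x) (at z)"
    unfolding energy_pencil_def op_B_def by (auto intro!: derivative_eq_intros simp: algebra_simps)
  then show "pencil_deriv 1 T z y x = (2 * z - 2 * complex_of_real (p x)) * y x"
    by (simp add: pencil_deriv_def DERIV_imp_deriv)
qed

lemma associated_2_iff:
  "associated_vectors D T z 2 y \<longleftrightarrow>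
     y 1 \<in> D \<and> (AE x in leb01. T z (y 1) x = - ((2 * z - 2 * complex_of_real (p x)) * y 0 x))"
proof -
  have "(\<Sum>k\<le>Suc 0. 1 / fact k * pencil_deriv k T z (y (1 - k)) x) =
      T z (y 1) x + (2 * z - 2 * complex_of_real (p x)) * y 0 x" for x
    using fun_cong[OF pencil_deriv_1[of z "y 0"], of x] by (simp add: pencil_deriv_def)
  moreover have "{1..<2} = {Suc 0}" by auto
  ultimately show ?thesis
    unfolding associated_vectors_def l2_eq_def by (simp add: add_eq_0_iff2)
qed

lemma deriv_factor_L2:
  assumes "continuous_on {0..1} y"
  shows "(\<lambda>x. (2 * z - 2 * complex_of_real (p x)) * y x) \<in> L2"
proof -
  have "(\<lambda>x. 2 * z + (-2) * complex_of_real (p x)) \<in> L2"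
    by (intro L2_add L2_continuous continuous_intros L2_cmult L2_of_real p_L2)
  from L2_mult_continuous[OF this assms] show ?thesis by simp
qed

text \<open>The equation for an associated vector is solved with zero initial data. If
  \<open>Dz z = 0\<close>, the Wronskian with the shooting solution vanishes at 1, and this forces
  the boundary condition, since \<open>sy z 1\<close> and \<open>su z 1\<close> are not both
  0.\<close>

lemma simple_imp_Dz_nonzero:
  assumes simple: "pencil_simple_eigenvalue (dom_bc r b) T z" and bd: "bdry b (sy z) (su z) = 0"
  shows "Dz z \<noteq> 0"
proof
  assume D0: "Dz z = 0"
  define f where "f = (\<lambda>x. - ((2 * z - 2 * complex_of_real (p x)) * sy z x))"
  have f: "f \<in> L2"
    using L2_cmult[OF deriv_factor_L2[OF qsol_cont_y[OF shot(1)], of z z], of "-1"] by (simp add: f_def)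
  obtain y u where q: "qsol r (w z) f y u" "y 0 = 0" "u 0 = 0"
    by (rule qsol_pot_exists[OF L2_absolutely_integrable(1)[OF f], of z 0 0])
  have "indef_int (\<lambda>x. - ((2 * z - 2 * complex_of_real (p x)) * (sy z x)\<^sup>2)) (\<lambda>x. u x * sy z x - y x * su z x)"
    using qsol_wronskian[OF q(1) shot(1)[of z]] by (simp add: f_def power2_eq_square mult.assoc)
  from indef_int_integral[OF this, of 0 1] have "u 1 * sy z 1 - y 1 * su z 1 = 0"
    using D0 q shot by (simp add: Dz_def)
  then have "bdry b y u = 0"
    using bd shot_nonvanishing[of 1 z] by (cases b) (auto simp: bdry_def)
  from dom_bcI[OF q(1) f q(2) this] have y: "y \<in> dom_bc r b" "AE x in leb01. T z y x = f x" by blast+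
  define Y where "Y = (\<lambda>n::nat. if n = 0 then sy z else y)"
  have "associated_vectors (dom_bc r b) T z 2 Y"
    unfolding associated_2_iff using y by (simp add: Y_def f_def)
  moreover have "pencil_eigenvector (dom_bc r b) T z (Y 0)"
    using eigenvalue_shot[OF bd] by (simp add: Y_def)
  ultimately show False using simple unfolding pencil_simple_eigenvalue_def by blast
qed

text \<open>The Wronskian of an associated vector with the shooting solution vanishes at both ends
  because they satisfy the same boundary conditions; the integral of its derivative is a nonzero
  multiple of \<open>Dz z\<close>.\<close>

lemma Dz_nonzero_imp_simple:
  assumes bd: "bdry b (sy z) (su z) = 0" and D: "Dz z \<noteq> 0"
  shows "pencil_simple_eigenvalue (dom_bc r b) T z"
  unfolding pencil_simple_eigenvalue_def
proof (intro conjI notI)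
  show "pencil_eigenvalue (dom_bc r b) T z"
    using eigenvalue_shot[OF bd] unfolding pencil_eigenvalue_def by blast
  assume "\<exists>y. pencil_eigenvector (dom_bc r b) T z (y 0) \<and> associated_vectors (dom_bc r b) T z 2 y"
  then obtain y :: "nat \<Rightarrow> real \<Rightarrow> complex" where y: "pencil_eigenvector (dom_bc r b) T z (y 0)" "y 1 \<in> dom_bc r b"
    "AE x in leb01. T z (y 1) x = - ((2 * z - 2 * complex_of_real (p x)) * y 0 x)"
    unfolding associated_2_iff by blast
  then have y0: "y 0 \<in> dom_bc r b" "l2_eq (T z (y 0)) (\<lambda>x. 0)" "\<not> l2_eq (y 0) (\<lambda>x. 0)"
    by (auto simp: pencil_eigenvector_def)
  obtain c where c: "\<And>x. x \<in> {0..1} \<Longrightarrow> y 0 x = c * sy z x" using kernel_shot(2)[OF y0(1,2)] by blast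
  have c0: "c \<noteq> 0" using y0(3) c l2_eq_zeroI[of "y 0"] by force
  define u where "u = quasi_deriv r (y 1)"
  note q = dom_bcD[OF y(2,3), folded u_def]
  have "indef_int (\<lambda>x. - ((2 * z - 2 * complex_of_real (p x)) * y 0 x * sy z x)) (\<lambda>x. u x * sy z x - y 1 x * su z x)"
    using qsol_wronskian[OF q(1) shot(1)[of z]] by simp
  from indef_int_integral[OF this, of 0 1]
  have "integral {0..1} (\<lambda>x. - ((2 * z - 2 * complex_of_real (p x)) * y 0 x * sy z x)) = u 1 * sy z 1 - y 1 1 * su z 1"
    using q(2) shot by simp
  also have "\<dots> = 0" using q(3) bd by (cases b) (auto simp: bdry_def)
  also have "integral {0..1} (\<lambda>x. - ((2 * z - 2 * complex_of_real (p x)) * y 0 x * sy z x)) =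
      integral {0..1} (\<lambda>x. - c * ((2 * z - 2 * complex_of_real (p x)) * (sy z x)\<^sup>2))"
    by (rule integral_cong) (simp add: c power2_eq_square)
  also have "\<dots> = - c * Dz z" by (simp add: Dz_def)
  finally show False using c0 D by simp
qed

end

subsection \<open>Eigenvalues of nonpositive type\<close>

text \<open>Abstract setting of the Galerkin method. \<open>S\<close> is only semidefinite; instead
  of passing to a quotient space, the axiom \<open>null\<close> makes the null vectors of
  \<open>S\<close> invisible to all three forms.\<close>

locale sesquilinear_forms =
  fixes E :: "('a \<Rightarrow> complex) set" and S B Q :: "('a \<Rightarrow> complex) \<Rightarrow> ('a \<Rightarrow> complex) \<Rightarrow> complex"
  assumes E_add: "x \<in> E \<Longrightarrow> y \<in> E \<Longrightarrow> (\<lambda>t. x t + c * y t) \<in> E"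
    and S_add: "x \<in> E \<Longrightarrow> y \<in> E \<Longrightarrow> z \<in> E \<Longrightarrow> S (\<lambda>t. x t + c * y t) z = S x z + c * S y z"
    and B_add: "x \<in> E \<Longrightarrow> y \<in> E \<Longrightarrow> z \<in> E \<Longrightarrow> B (\<lambda>t. x t + c * y t) z = B x z + c * B y z"
    and Q_add: "x \<in> E \<Longrightarrow> y \<in> E \<Longrightarrow> z \<in> E \<Longrightarrow> Q (\<lambda>t. x t + c * y t) z = Q x z + c * Q y z"
    and S_herm: "S y x = cnj (S x y)" and B_herm: "B y x = cnj (B x y)" and Q_herm: "Q y x = cnj (Q x y)"
    and S_nonneg: "x \<in> E \<Longrightarrow> 0 \<le> Re (S x x)"
    and null: "x \<in> E \<Longrightarrow> S x x = 0 \<Longrightarrow> z \<in> E \<Longrightarrow> S x z = 0 \<and> B x z = 0 \<and> Q x z = 0"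
begin

definition lc :: "(nat \<Rightarrow> complex) \<Rightarrow> (nat \<Rightarrow> 'a \<Rightarrow> complex) \<Rightarrow> nat \<Rightarrow> 'a \<Rightarrow> complex" where
  "lc c e m = (\<lambda>t. \<Sum>j<m. c j * e j t)"

lemma lc_Suc: "lc c e (Suc m) = (\<lambda>t. lc c e m t + c m * e m t)"
  by (simp add: lc_def)

lemma zero_in_E: "x \<in> E \<Longrightarrow> (\<lambda>t. 0) \<in> E"
  using E_add[of x x "-1"] by simp

lemma lc_in_E:
  assumes "x \<in> E" "\<And>j. j < m \<Longrightarrow> e j \<in> E"
  shows "lc c e m \<in> E"
  using assms(2)
proof (induction m)
  case 0
  then show ?case using zero_in_E[OF assms(1)] by (simp add: lc_def)
next
  case (Suc m)
  then show ?case unfolding lc_Suc by (intro E_add) auto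
qed

lemma form_lc:
  assumes F: "F = S \<or> F = B \<or> F = Q" and e: "\<And>j. j < m \<Longrightarrow> e j \<in> E" and z: "z \<in> E"
  shows "F (lc c e m) z = (\<Sum>j<m. c j * F (e j) z)" and "F z (lc c e m) = (\<Sum>j<m. cnj (c j) * F z (e j))"
proof -
  have herm: "F y x = cnj (F x y)" for x y
    using F S_herm B_herm Q_herm by blast
  have add: "F (\<lambda>t. x t + c * y t) z = F x z + c * F y z" if "x \<in> E" "y \<in> E" "z \<in> E" for x y z c
    using F S_add[OF that] B_add[OF that] Q_add[OF that] by blast
  show 1: "F (lc c e m) z = (\<Sum>j<m. c j * F (e j) z)"
    using e
  proof (induction m)
    case 0
    have "F (\<lambda>t. z t + (-1) * z t) z = F z z + (-1) * F z z" by (rule add[OF z z z])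
    then show ?case by (simp add: lc_def)
  next
    case (Suc m)
    then show ?case unfolding lc_Suc by (subst add) (auto intro!: lc_in_E[OF z] z)
  qed
  show "F z (lc c e m) = (\<Sum>j<m. cnj (c j) * F z (e j))"
    unfolding herm[of z "lc c e m"] 1 cnj_sum complex_cnj_mult
    by (intro sum.cong refl arg_cong2[where f = "(*)"] herm[symmetric])
qed

lemma form_diff:
  assumes F: "F = S \<or> F = B \<or> F = Q" and xyz: "x \<in> E" "y \<in> E" "z \<in> E"
    and null0: "S (\<lambda>t. x t + (-1) * y t) (\<lambda>t. x t + (-1) * y t) = 0"
  shows "F x z = F y z" "F z x = F z y"
proof -
  have add: "F (\<lambda>t. x t + (-1) * y t) z = F x z + (-1) * F y z"
    using F S_add[OF xyz] B_add[OF xyz] Q_add[OF xyz] by blast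
  have "F (\<lambda>t. x t + (-1) * y t) z = 0"
    using null[OF E_add[OF xyz(1,2)] null0 xyz(3)] F by blast
  then show eq: "F x z = F y z" using add by simp
  have herm: "F y x = cnj (F x y)" for x y
    using F S_herm B_herm Q_herm by blast
  show "F z x = F z y" using eq herm[of z x] herm[of z y] by simp
qed

text \<open>A vector whose remainder \<open>\<rho>\<close> is null for \<open>S\<close> adds no
  basis element. The span therefore reproduces each \<open>h k\<close> up to a null vector, which
  the forms do not see.\<close>

lemma gram_schmidt:
  fixes h :: "nat \<Rightarrow> 'a \<Rightarrow> complex" and n :: nat
  assumes h: "\<And>k. h k \<in> E"
  shows "\<exists>m e. (\<forall>j<m. e j \<in> E) \<and> (\<forall>i<m. \<forall>j<m. S (e i) (e j) = (if i = j then 1 else 0)) \<and>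
    (\<forall>k<n. \<exists>c. S (\<lambda>t. h k t + (-1) * lc c e m t) (\<lambda>t. h k t + (-1) * lc c e m t) = 0)"
proof (induction n)
  case 0
  then show ?case by (intro exI[of _ 0]) auto
next
  case (Suc n)
  then obtain m e where e: "\<And>j. j < m \<Longrightarrow> e j \<in> E"
    and on: "\<And>i j. i < m \<Longrightarrow> j < m \<Longrightarrow> S (e i) (e j) = (if i = j then 1 else 0)"
    and sp: "\<And>k. k < n \<Longrightarrow> \<exists>c. S (\<lambda>t. h k t + (-1) * lc c e m t) (\<lambda>t. h k t + (-1) * lc c e m t) = 0"
    by blast
  define c where "c = (\<lambda>j. S (h n) (e j))"
  define \<rho> where "\<rho> = (\<lambda>t. h n t + (-1) * lc c e m t)"
  have lcE: "lc c e m \<in> E" by (rule lc_in_E[OF h e])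
  have \<rho>E: "\<rho> \<in> E" unfolding \<rho>_def by (rule E_add[OF h lcE])
  show ?case
  proof (cases "S \<rho> \<rho> = 0")
    case True
    have "\<exists>c. S (\<lambda>t. h k t + (-1) * lc c e m t) (\<lambda>t. h k t + (-1) * lc c e m t) = 0" if "k < Suc n" for k
    proof (cases "k = n")
      case True
      then show ?thesis using \<open>S \<rho> \<rho> = 0\<close> unfolding \<rho>_def by blast
    qed (use sp that in simp)
    then show ?thesis using e on by blast
  next
    case False
    define N where "N = Re (S \<rho> \<rho>)"
    have SN: "S \<rho> \<rho> = complex_of_real N"
      using S_herm[of \<rho> \<rho>] by (simp add: N_def complex_eq_iff)
    have "N \<noteq> 0" using False SN by auto
    moreover have "0 \<le> N" unfolding N_def by (rule S_nonneg[OF \<rho>E])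
    ultimately have N0: "N > 0" by simp
    define s where "s = complex_of_real (1 / sqrt N)"
    define e' where "e' = e(m := (\<lambda>t. (\<lambda>t. 0) t + s * \<rho> t))"
    have zE: "(\<lambda>t. 0) \<in> E" by (rule zero_in_E[OF \<rho>E])
    have e'E: "e' j \<in> E" if "j < Suc m" for j
      using that e E_add[OF zE \<rho>E, of s] by (cases "j = m") (auto simp: e'_def)
    have S0: "S (\<lambda>t. 0) z = 0" if "z \<in> E" for z
      using S_add[OF that that that, of "-1"] by simp
    have Ss: "S (\<lambda>t. (\<lambda>t. 0) t + s * \<rho> t) z = s * S \<rho> z" if "z \<in> E" for z
      using S_add[OF zE \<rho>E that] S0[OF that] by simp
    have orth: "S \<rho> (e i) = 0" if "i < m" for i
    proof -
      have "S \<rho> (e i) = S (h n) (e i) + (-1) * S (lc c e m) (e i)"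
        unfolding \<rho>_def by (rule S_add[OF h lcE e[OF that]])
      also have "S (lc c e m) (e i) = (\<Sum>j<m. c j * S (e j) (e i))"
        by (rule form_lc(1)[OF _ e e[OF that]]) auto
      also have "\<dots> = (\<Sum>j<m. if j = i then c i else 0)"
        using on that by (intro sum.cong) auto
      also have "\<dots> = c i" using that by simp
      finally show ?thesis by (simp add: c_def)
    qed
    have em: "e' m = (\<lambda>t. (\<lambda>t. 0) t + s * \<rho> t)" and ej: "j < m \<Longrightarrow> e' j = e j" for j
      by (auto simp: e'_def)
    have o1: "S (e' m) (e' j) = 0" if "j < m" for j
      unfolding em ej[OF that] Ss[OF e[OF that]] orth[OF that] by simp
    have o2: "S (e' m) (e' m) = 1"
    proof -
      have "S (e' m) (e' m) = s * S \<rho> (e' m)"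
        unfolding em by (rule Ss[OF E_add[OF zE \<rho>E]])
      also have "S \<rho> (e' m) = cnj (S (e' m) \<rho>)" by (rule S_herm)
      also have "S (e' m) \<rho> = s * S \<rho> \<rho>" unfolding em by (rule Ss[OF \<rho>E])
      also have "s * cnj (s * S \<rho> \<rho>) = complex_of_real ((1 / sqrt N) * (1 / sqrt N) * N)"
        unfolding s_def SN of_real_mult complex_cnj_mult complex_cnj_complex_of_real by (simp only: mult.assoc)
      also have "(1 / sqrt N) * (1 / sqrt N) * N = 1" using N0 by simp
      finally show ?thesis by simp
    qed
    have "S (e' i) (e' j) = (if i = j then 1 else 0)" if "i < Suc m" "j < Suc m" for i j
    proof -
      consider "i = m" "j = m" | "i = m" "j < m" | "i < m" "j = m" | "i < m" "j < m" using \<open>i < Suc m\<close> \<open>j < Suc m\<close> by linarith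
      then show ?thesis
      proof cases
        case 3
        then show ?thesis using o1[of i] S_herm[of "e' i" "e' m"] by simp
      qed (use o1 o2 on ej in auto)
    qed
    moreover have "\<exists>c. S (\<lambda>t. h k t + (-1) * lc c e' (Suc m) t) (\<lambda>t. h k t + (-1) * lc c e' (Suc m) t) = 0"
      if k: "k < Suc n" for k
    proof -
      have lc': "lc (d(m := x)) e' (Suc m) = (\<lambda>t. lc d e m t + x * (s * \<rho> t))" for d x
        unfolding lc_Suc em by (auto simp: lc_def ej intro!: sum.cong)
      show ?thesis
      proof (cases "k = n")
        case True
        have "complex_of_real (sqrt N) * s = 1" using N0 by (simp add: s_def)
        then have "(\<lambda>t. h k t + (-1) * lc (c(m := complex_of_real (sqrt N))) e' (Suc m) t) = (\<lambda>t. 0)"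
          unfolding lc' True \<rho>_def by (simp add: mult.assoc[symmetric])
        then show ?thesis using S0[OF zE] by (intro exI[of _ "c(m := complex_of_real (sqrt N))"]) simp
      next
        case False
        then obtain d where "S (\<lambda>t. h k t + (-1) * lc d e m t) (\<lambda>t. h k t + (-1) * lc d e m t) = 0"
          using sp k by force
        then show ?thesis by (intro exI[of _ "d(m := 0)"]) (simp add: lc')
      qed
    qed
    ultimately show ?thesis using e'E by blast
  qed
qed

text \<open>Compression to the span of finitely many \<open>h k\<close> gives Hermitian matrices.
  The span contains \<open>h 0\<close> up to a null vector, so the compressed form still takes a
  nonpositive value and the result on matrix pencils applies.\<close>

lemma galerkin_eigenvector:
  fixes h :: "nat \<Rightarrow> 'a \<Rightarrow> complex" and n :: nat
  assumes h: "\<And>k. h k \<in> E" and h0: "S (h 0) (h 0) \<noteq> 0" "Re (Q (h 0) (h 0)) \<le> 0"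
  obtains P \<delta> where "P \<in> E" "S P P \<noteq> 0"
    "\<And>k. k < n \<Longrightarrow> \<delta>\<^sup>2 * S P (h k) - \<delta> * B P (h k) - Q P (h k) = 0"
    "\<delta>\<^sup>2 * S P P - \<delta> * B P P - Q P P = 0" "Re (Q P P) + (norm \<delta>)\<^sup>2 * Re (S P P) \<le> 0"
proof -
  obtain m e where e: "\<And>j. j < m \<Longrightarrow> e j \<in> E"
    and on: "\<And>i j. i < m \<Longrightarrow> j < m \<Longrightarrow> S (e i) (e j) = (if i = j then 1 else 0)"
    and sp: "\<And>k. k < Suc n \<Longrightarrow> \<exists>c. S (\<lambda>t. h k t + (-1) * lc c e m t) (\<lambda>t. h k t + (-1) * lc c e m t) = 0"
    using gram_schmidt[where h = h and n = "Suc n", OF h] by blast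
  have lcE: "lc c e m \<in> E" for c by (rule lc_in_E[OF h e])
  obtain c where c: "S (\<lambda>t. h 0 t + (-1) * lc c e m t) (\<lambda>t. h 0 t + (-1) * lc c e m t) = 0"
    using sp[of 0] by auto
  have eq0: "F (h 0) (h 0) = F (lc c e m) (lc c e m)" if "F = S \<or> F = B \<or> F = Q" for F
    using form_diff[OF that h lcE h c] form_diff[OF that h lcE lcE c] by metis
  have quad: "F (lc c e m) (lc c e m) = (\<Sum>i<m. \<Sum>j<m. F (e j) (e i) * c j * cnj (c i))" if F: "F = S \<or> F = B \<or> F = Q" for F c
  proof -
    have "F (lc c e m) (lc c e m) = (\<Sum>i<m. cnj (c i) * F (lc c e m) (e i))"
      by (rule form_lc(2)[OF F e lcE])
    also have "\<dots> = (\<Sum>i<m. cnj (c i) * (\<Sum>j<m. c j * F (e j) (e i)))"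
    proof (rule sum.cong[OF refl])
      fix i assume "i \<in> {..<m}"
      then have "e i \<in> E" using e by simp
      from form_lc(1)[where m = m and c = c, OF F e this]
      show "cnj (c i) * F (lc c e m) (e i) = cnj (c i) * (\<Sum>j<m. c j * F (e j) (e i))" by simp
    qed
    finally show ?thesis by (simp add: sum_distrib_left mult_ac)
  qed
  have "\<exists>i0<m. c i0 \<noteq> 0"
  proof (rule ccontr)
    assume "\<not> ?thesis"
    then have "S (lc c e m) (lc c e m) = 0"
      unfolding quad[of S, OF disjI1[OF refl]] by (intro sum.neutral ballI) simp
    then show False using h0(1) eq0[of S] by simp
  qed
  then obtain i0 where i0: "i0 < m" "c i0 \<noteq> 0" by blast
  have "Re (\<Sum>i<m. \<Sum>j<m. Q (e j) (e i) * c j * cnj (c i)) \<le> 0"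
    using h0(2) eq0[of Q] quad[of Q c] by simp
  note Qle = this
  \<comment> \<open>In an orthonormal basis \<open>S\<close> becomes the identity matrix. The row
    index \<open>i\<close> belongs to the second argument, in which the forms are conjugate
    linear.\<close>
  obtain \<delta> x where x: "\<exists>i<m. x i \<noteq> 0"
    "\<forall>i<m. \<delta>\<^sup>2 * x i - \<delta> * (\<Sum>j<m. B (e j) (e i) * x j) - (\<Sum>j<m. Q (e j) (e i) * x j) = 0"
    "Re (\<Sum>i<m. \<Sum>j<m. Q (e j) (e i) * x j * cnj (x i)) + (norm \<delta>)\<^sup>2 * (\<Sum>i<m. (norm (x i))\<^sup>2) \<le> 0"
    by (rule quadratic_pencil_nonpositive_eigenvector[where b = "\<lambda>i j. B (e j) (e i)" and q = "\<lambda>i j. Q (e j) (e i)",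
          OF B_herm Q_herm i0 Qle])
  define P where "P = lc x e m"
  have PE: "P \<in> E" unfolding P_def by (rule lcE)
  have SPe: "S P (e i) = x i" if "i < m" for i
  proof -
    have "S P (e i) = (\<Sum>j<m. x j * S (e j) (e i))"
      unfolding P_def by (rule form_lc(1)[OF _ e e[OF that]]) auto
    also have "\<dots> = (\<Sum>j<m. if j = i then x i else 0)"
      using on that by (intro sum.cong) auto
    finally show ?thesis using that by simp
  qed
  have SPP: "S P P = complex_of_real (\<Sum>i<m. (norm (x i))\<^sup>2)"
  proof -
    have "S P (lc x e m) = (\<Sum>i<m. cnj (x i) * S P (e i))"
      by (rule form_lc(2)[OF _ e PE]) auto
    then have "S P P = (\<Sum>i<m. cnj (x i) * S P (e i))" by (simp only: P_def[symmetric])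
    also have "\<dots> = (\<Sum>i<m. complex_of_real ((norm (x i))\<^sup>2))"
      by (intro sum.cong refl) (simp only: SPe complex_norm_square mult.commute lessThan_iff)
    finally show ?thesis by simp
  qed
  have basis: "\<delta>\<^sup>2 * S P (e i) - \<delta> * B P (e i) - Q P (e i) = 0" if "i < m" for i
  proof -
    have "B P (e i) = (\<Sum>j<m. B (e j) (e i) * x j)" "Q P (e i) = (\<Sum>j<m. Q (e j) (e i) * x j)"
      unfolding P_def using form_lc(1)[of B m e "e i" x] form_lc(1)[of Q m e "e i" x] e that by (auto simp: mult.commute)
    then show ?thesis using x(2) that SPe[OF that] by simp
  qed
  have lcs: "\<delta>\<^sup>2 * S P (lc d e m) - \<delta> * B P (lc d e m) - Q P (lc d e m) = 0" for d
  proof -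
    have "\<delta>\<^sup>2 * S P (lc d e m) - \<delta> * B P (lc d e m) - Q P (lc d e m)
      = (\<Sum>i<m. cnj (d i) * (\<delta>\<^sup>2 * S P (e i) - \<delta> * B P (e i) - Q P (e i)))"
      using form_lc(2)[of S m e P d] form_lc(2)[of B m e P d] form_lc(2)[of Q m e P d] e PE
      by (simp add: right_diff_distrib sum_subtractf sum_distrib_left mult_ac)
    also have "\<dots> = 0" using basis by (intro sum.neutral) auto
    finally show ?thesis .
  qed
  show thesis
  proof (rule that[OF PE])
    show "S P P \<noteq> 0"
    proof -
      obtain i where "i < m" "x i \<noteq> 0" using x(1) by blast
      then have "0 < (\<Sum>i<m. (norm (x i))\<^sup>2)" by (intro sum_pos2[of _ i]) auto
      then show ?thesis unfolding SPP of_real_eq_0_iff by simp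
    qed
    show "\<delta>\<^sup>2 * S P (h k) - \<delta> * B P (h k) - Q P (h k) = 0" if "k < n" for k
    proof -
      have "k < Suc n" using that by simp
      from sp[OF this] obtain d where d: "S (\<lambda>t. h k t + (-1) * lc d e m t) (\<lambda>t. h k t + (-1) * lc d e m t) = 0"
        by (elim exE)
      have "S P (h k) = S P (lc d e m)" "B P (h k) = B P (lc d e m)" "Q P (h k) = Q P (lc d e m)"
        by (rule form_diff(2)[OF _ h lcE PE d], simp)+
      then show ?thesis using lcs by simp
    qed
    show "\<delta>\<^sup>2 * S P P - \<delta> * B P P - Q P P = 0" using lcs[of x] by (simp add: P_def)
    have "Q P P = (\<Sum>i<m. \<Sum>j<m. Q (e j) (e i) * x j * cnj (x i))"
      unfolding P_def by (rule quad) auto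
    then show "Re (Q P P) + (norm \<delta>)\<^sup>2 * Re (S P P) \<le> 0" using x(3) SPP by simp
  qed
qed

end

section \<open>Form domain, integrating factor and test functions\<close>

lemma indef_int_weighted_limit:
  fixes g :: "nat \<Rightarrow> real \<Rightarrow> complex"
  assumes a: "a absolutely_integrable_on {0..1}" and g: "\<And>n. continuous_on {0..1} (g n)" "continuous_on {0..1} G"
    and ul: "uniform_limit {0..1} g G sequentially" and cd: "0 \<le> c" "d \<le> 1"
  shows "(\<lambda>n. integral {c..d} (\<lambda>x. a x * g n x)) \<longlonglongrightarrow> integral {c..d} (\<lambda>x. a x * G x)"
proof (rule LIMSEQ_I)
  fix e :: real assume e: "e > 0"
  have na: "(\<lambda>x. norm (a x)) absolutely_integrable_on {0..1}"
    using absolutely_integrable_norm[OF a] by (simp add: o_def)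
  define I where "I = integral {c..d} (\<lambda>x. norm (a x))"
  have I0: "0 \<le> I" unfolding I_def using integral_nonneg_01[OF na _ cd] by simp
  have "0 < e / (I + 1)" using e I0 by simp
  then obtain N where N: "\<And>n x. n \<ge> N \<Longrightarrow> x \<in> {0..1} \<Longrightarrow> dist (g n x) (G x) < e / (I + 1)"
    using ul unfolding uniform_limit_sequentially_iff by metis
  have "norm (integral {c..d} (\<lambda>x. a x * g n x) - integral {c..d} (\<lambda>x. a x * G x)) < e" if n: "n \<ge> N" for n
  proof -
    have i1: "(\<lambda>x. a x * g n x) absolutely_integrable_on {0..1}" and i2: "(\<lambda>x. a x * G x) absolutely_integrable_on {0..1}"
      by (rule absolutely_integrable_continuous_mult[OF a]; rule g)+
    have "integral {c..d} (\<lambda>x. a x * g n x) - integral {c..d} (\<lambda>x. a x * G x) = integral {c..d} (\<lambda>x. a x * g n x - a x * G x)"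
      using integrable_01_subinterval[OF i1 cd] integrable_01_subinterval[OF i2 cd]
      by (simp add: Henstock_Kurzweil_Integration.integral_diff)
    also have "norm \<dots> \<le> integral {c..d} (\<lambda>x. e / (I + 1) * norm (a x))"
    proof (rule norm_integral_le_01[OF set_integral_diff(1)[OF i1 i2] _ _ cd])
      show "(\<lambda>x. e / (I + 1) * norm (a x)) absolutely_integrable_on {0..1}"
        using na by (intro set_integrable_mult_right)
      fix x :: real assume x: "x \<in> {0..1}"
      have "norm (a x * g n x - a x * G x) = norm (g n x - G x) * norm (a x)"
        by (simp add: right_diff_distrib[symmetric] norm_mult)
      also have "\<dots> \<le> e / (I + 1) * norm (a x)"
        using N[OF n x] by (intro mult_right_mono) (auto simp: dist_norm)
      finally show "norm (a x * g n x - a x * G x) \<le> e / (I + 1) * norm (a x)" .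
    qed
    also have "\<dots> = e / (I + 1) * I" by (simp add: I_def)
    also have "\<dots> < e" using e I0 by (simp add: field_simps)
    finally show ?thesis .
  qed
  then show "\<exists>no. \<forall>n\<ge>no. norm (integral {c..d} (\<lambda>x. a x * g n x) - integral {c..d} (\<lambda>x. a x * G x)) < e"
    by blast
qed

context pencil_data
begin

text \<open>The form domain of \<open>A\<^sub>M\<close>, where \<open>u\<close> stands for \<open>y' - r y\<close>.\<close>

definition form_pair :: "(real \<Rightarrow> complex) \<Rightarrow> (real \<Rightarrow> complex) \<Rightarrow> bool" where
  "form_pair y u \<longleftrightarrow> u \<in> L2 \<and> y 0 = 0 \<and> indef_int (\<lambda>x. complex_of_real (r x) * y x + u x) y"

text \<open>The integrating factors \<open>eR\<close> and \<open>eM\<close> of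
  \<open>y' = r y + u\<close>: the product \<open>eM * y\<close> has the derivative
  \<open>eM * u\<close>, in which \<open>r\<close> no longer multiplies \<open>y\<close>.\<close>

definition "Rr x = integral {0..x} r"
definition "eR x = exp (complex_of_real (Rr x))"
definition "eM x = exp (- complex_of_real (Rr x))"

lemma eR_eM: "eR x * eM x = 1" "eM x * eR x = 1"
  by (simp_all add: eR_def eM_def exp_minus_inverse mult.commute)

lemma indef_int_Rr: "indef_int (\<lambda>x. complex_of_real (r x)) (\<lambda>x. complex_of_real (Rr x))"
proof (rule indef_intI[OF absolutely_integrable_of_real[OF r_int]])
  fix x :: real assume "x \<in> {0..1}"
  then show "complex_of_real (Rr x) = complex_of_real (Rr 0) + integral {0..x} (\<lambda>x. complex_of_real (r x))"
    using integral_of_real[OF integrable_01_subinterval[OF r_int, of 0 x]] by (simp add: Rr_def)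
qed

lemma indef_int_eR: "indef_int (\<lambda>x. complex_of_real (r x) * eR x) eR"
  using indef_int_exp[OF indef_int_Rr] by (simp add: eR_def[abs_def])

lemma indef_int_eM: "indef_int (\<lambda>x. - complex_of_real (r x) * eM x) eM"
  using indef_int_exp[OF indef_int_cmult[OF indef_int_Rr, of "-1"]] by (simp add: eM_def[abs_def])

lemmas eR_cont = indef_int_continuous[OF indef_int_eR]
lemmas eM_cont = indef_int_continuous[OF indef_int_eM]

lemma form_pair_y_cont: "form_pair y u \<Longrightarrow> continuous_on {0..1} y"
  unfolding form_pair_def by (blast intro: indef_int_continuous)

lemma form_pair_eM:
  assumes "form_pair y u"
  shows "indef_int (\<lambda>x. u x * eM x) (\<lambda>x. eM x * y x)"
proof -
  have "indef_int (\<lambda>x. eM x * (complex_of_real (r x) * y x + u x) + (- complex_of_real (r x) * eM x) * y x) (\<lambda>x. eM x * y x)"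
    using assms unfolding form_pair_def by (intro indef_int_mult indef_int_eM) blast
  then show ?thesis by (simp add: algebra_simps)
qed

lemma form_pair_add:
  assumes "form_pair y u" "form_pair y' u'"
  shows "form_pair (\<lambda>x. y x + c * y' x) (\<lambda>x. u x + c * u' x)"
proof -
  have "indef_int (\<lambda>x. (complex_of_real (r x) * y x + u x) + c * (complex_of_real (r x) * y' x + u' x)) (\<lambda>x. y x + c * y' x)"
    using assms unfolding form_pair_def by (intro indef_int_add indef_int_cmult) blast+
  then have "indef_int (\<lambda>x. complex_of_real (r x) * (y x + c * y' x) + (u x + c * u' x)) (\<lambda>x. y x + c * y' x)"
    by (simp add: algebra_simps)
  moreover have "(\<lambda>x. u x + c * u' x) \<in> L2"
    using assms unfolding form_pair_def by (intro L2_add L2_cmult) blast+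
  ultimately show ?thesis using assms by (simp add: form_pair_def)
qed

lemma form_pair_zero_u:
  assumes "form_pair y u" "\<And>x. x \<in> {0..1} \<Longrightarrow> y x = 0"
  shows "AE x in leb01. u x = 0"
proof -
  have "indef_int (\<lambda>x. complex_of_real (r x) * y x + u x) (\<lambda>x. 0)"
  proof (rule indef_int_cong_AE)
    show "indef_int (\<lambda>x. complex_of_real (r x) * y x + u x) y"
      using assms(1) by (simp add: form_pair_def)
  qed (use assms(2) in simp_all)
  from indef_int_unique[OF this indef_int_const[of 0]]
  have "AE x in leb01. complex_of_real (r x) * y x + u x = 0" .
  moreover have "AE x in leb01. y x = 0" using assms(2) by (intro AE_I2) auto
  ultimately show ?thesis by eventually_elim simp
qed

text \<open>Once the integrating factor is removed, increments depend on \<open>u\<close> alone, and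
  Cauchy-Schwarz gives a Hoelder bound with exponent 1/2. The constant \<open>M\<close> depends only
  on \<open>r\<close>.\<close>

lemma form_pair_bounds:
  obtains M where "0 < M" "\<And>x. x \<in> {0..1} \<Longrightarrow> norm (eR x) \<le> M"
    "\<And>y u a b. form_pair y u \<Longrightarrow> 0 \<le> a \<Longrightarrow> a \<le> b \<Longrightarrow> b \<le> 1 \<Longrightarrow>
       norm (eM b * y b - eM a * y a) \<le> M * sqrt (b - a) * sqrt (integral {0..1} (\<lambda>x. (norm (u x))\<^sup>2))"
proof -
  obtain M1 where M1: "M1 \<ge> 0" "\<And>x. x \<in> {0..1} \<Longrightarrow> norm (eR x) \<le> M1" using indef_int_bounded[OF indef_int_eR] by blast
  obtain M2 where M2: "M2 \<ge> 0" "\<And>x. x \<in> {0..1} \<Longrightarrow> norm (eM x) \<le> M2" using indef_int_bounded[OF indef_int_eM] by blast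
  define M where "M = max M1 M2 + 1"
  have bnd: "norm (eM b * y b - eM a * y a) \<le> M * sqrt (b - a) * sqrt (integral {0..1} (\<lambda>x. (norm (u x))\<^sup>2))"
    if fp: "form_pair y u" and ab: "0 \<le> a" "a \<le> b" "b \<le> 1" for y u a b
  proof -
    have u: "u \<in> L2" using fp by (simp add: form_pair_def)
    have nu: "(\<lambda>x. norm (u x)) absolutely_integrable_on {0..1}"
      using absolutely_integrable_norm[OF L2_absolutely_integrable(1)[OF u]] by (simp add: o_def)
    note I = form_pair_eM[OF fp]
    have nue: "(\<lambda>x. norm (u x * eM x)) absolutely_integrable_on {0..1}"
      using absolutely_integrable_norm[OF indef_int_absolutely_integrable[OF I]] by (simp add: o_def)
    have "norm (eM b * y b - eM a * y a) \<le> integral {a..b} (\<lambda>x. norm (u x * eM x))"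
      by (rule indef_int_norm_diff_le[OF I ab])
    also have "\<dots> \<le> integral {a..b} (\<lambda>x. M * norm (u x))"
    proof (rule integral_le_01[OF nue])
      show "(\<lambda>x. M * norm (u x)) absolutely_integrable_on {0..1}" using nu by (intro set_integrable_mult_right)
      fix x :: real assume "x \<in> {0..1}"
      then have "norm (eM x) \<le> M" using M2(2)[of x] by (simp add: M_def)
      then show "norm (u x * eM x) \<le> M * norm (u x)"
        using mult_right_mono[of "norm (eM x)" M "norm (u x)"] by (simp add: norm_mult mult.commute)
    qed (use ab in auto)
    also have "\<dots> = M * integral {a..b} (\<lambda>x. norm (u x))" by simp
    also have "\<dots> \<le> M * (sqrt (b - a) * sqrt (integral {0..1} (\<lambda>x. (norm (u x))\<^sup>2)))"
      using integral_norm_le_sqrt[OF u ab] M1(1) by (intro mult_left_mono) (auto simp: M_def)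
    finally show ?thesis by (simp add: mult.assoc)
  qed
  have "0 < M" using M1(1) by (simp add: M_def)
  moreover have "norm (eR x) \<le> M" if "x \<in> {0..1}" for x using M1(2)[OF that] by (simp add: M_def)
  ultimately show thesis using that bnd by blast
qed

definition "Em x = integral {0..x} eM"

lemma indef_int_Em: "indef_int eM Em"
  unfolding Em_def[abs_def] by (rule indef_int_integral_01[OF absolutely_integrable_continuous_real[OF eM_cont]])

lemma indef_int_step:
  assumes a: "a \<in> {0..1}" and F: "indef_int f F"
  shows "indef_int (\<lambda>x. if x \<le> a then f x else 0) (\<lambda>x. F (min x a))"
proof (rule indef_intI)
  have "(\<lambda>x. if x \<in> {0..a} then f x else 0) absolutely_integrable_on UNIV"
    using absolutely_integrable_01_subinterval[OF indef_int_absolutely_integrable[OF F], of 0 a] a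
    by (subst absolutely_integrable_restrict_UNIV) auto
  then have "(\<lambda>x. if x \<in> {0..a} then f x else 0) absolutely_integrable_on {0..1}"
    by (rule set_integrable_subset) auto
  then show ai: "(\<lambda>x. if x \<le> a then f x else 0) absolutely_integrable_on {0..1}"
    by (rule absolutely_integrable_spike[OF _ negligible_empty]) auto
  fix x :: real assume x: "x \<in> {0..1}"
  have "integral {0..x} (\<lambda>x. if x \<le> a then f x else 0) = integral {0..min x a} f"
  proof (cases "x \<le> a")
    case True
    then show ?thesis by (auto simp: min_def intro!: integral_cong)
  next
    case False
    have "integral {0..a} (\<lambda>x. if x \<le> a then f x else 0) + integral {a..x} (\<lambda>x. if x \<le> a then f x else 0)
        = integral {0..x} (\<lambda>x. if x \<le> a then f x else 0)"
      using False a x integrable_01_subinterval[OF ai, of 0 x]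
      by (intro Henstock_Kurzweil_Integration.integral_combine) auto
    moreover have "integral {a..x} (\<lambda>x. if x \<le> a then f x else 0) = integral {a..x} (\<lambda>x. 0)"
      by (rule integral_spike[of "{a}"]) auto
    moreover have "integral {0..a} (\<lambda>x. if x \<le> a then f x else 0) = integral {0..a} f"
      by (rule integral_cong) auto
    ultimately show ?thesis using False by (simp add: min_def)
  qed
  then show "F (min x a) = F (min 0 a) + integral {0..x} (\<lambda>x. if x \<le> a then f x else 0)"
    using indef_intD[OF F, of "min x a"] a x by (simp add: min_def split: if_splits)
qed

text \<open>The element of the form domain whose quasi-derivative is the indicator function of the
  interval from 0 to \<open>a\<close>. Integrating \<open>u\<close> against that quasi-derivative
  gives \<open>integral {0..a} u\<close>, so such tests determine \<open>u\<close>.\<close>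

definition "hat a x = eR x * Em (min x a)"
definition "ind a x = (if x \<le> a then 1 else 0 :: complex)"

lemma form_pair_hat:
  assumes a: "a \<in> {0..1}"
  shows "form_pair (hat a) (ind a)"
  unfolding form_pair_def
proof (intro conjI)
  have "indef_int (\<lambda>x. if x \<le> a then 1 else 0) (\<lambda>x. complex_of_real (min x a))"
    by (rule indef_int_step[OF a]) (rule indef_intI, auto intro!: absolutely_integrable_continuous_real simp: scaleR_conv_of_real)
  from indef_int_absolutely_integrable[OF this]
  have ai: "ind a absolutely_integrable_on {0..1}" by (simp add: ind_def[abs_def])
  have "(\<lambda>x. norm (ind a x)) absolutely_integrable_on {0..1}"
    using absolutely_integrable_norm[OF ai] by (simp add: o_def)
  moreover have "(\<lambda>x. norm (ind a x)) = (\<lambda>x. (norm (ind a x))\<^sup>2)" by (auto simp: ind_def)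
  ultimately show "ind a \<in> L2" using ai by (intro L2I) simp_all
  show "hat a 0 = 0" using a by (simp add: hat_def Em_def)
  have "indef_int (\<lambda>x. eR x * (if x \<le> a then eM x else 0) + complex_of_real (r x) * eR x * Em (min x a)) (\<lambda>x. eR x * Em (min x a))"
    by (rule indef_int_mult[OF indef_int_eR indef_int_step[OF a indef_int_Em]])
  moreover have "(\<lambda>x. eR x * (if x \<le> a then eM x else 0) + complex_of_real (r x) * eR x * Em (min x a)) =
      (\<lambda>x. complex_of_real (r x) * hat a x + ind a x)"
    by (auto simp: hat_def ind_def eR_eM)
  ultimately show "indef_int (\<lambda>x. complex_of_real (r x) * hat a x + ind a x) (hat a)"
    by (simp add: hat_def[abs_def])
qed

text \<open>Testing the weak formulation with the functions \<open>hat a\<close> identifies the quasi-derivative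
  of a weak solution: it is \<open>v\<close> below.\<close>

lemma hat_test:
  assumes g: "g absolutely_integrable_on {0..1}" and y: "continuous_on {0..1} y"
  defines "v \<equiv> (\<lambda>t. eM t * (integral {0..1} (\<lambda>x. g x * y x * eR x) - integral {0..t} (\<lambda>x. g x * y x * eR x)))"
  shows "a \<in> {0..1} \<Longrightarrow> integral {0..a} v = integral {0..1} (\<lambda>x. g x * y x * hat a x)"
    and "indef_int (\<lambda>x. - complex_of_real (r x) * v x - g x * y x) v" and "v 1 = 0"
proof -
  have gye: "(\<lambda>x. g x * y x * eR x) absolutely_integrable_on {0..1}"
    by (intro absolutely_integrable_continuous_mult g y eR_cont)
  define H where "H = (\<lambda>t. integral {0..1} (\<lambda>x. g x * y x * eR x) - integral {0..t} (\<lambda>x. g x * y x * eR x))"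
  have H: "indef_int (\<lambda>x. - (g x * y x * eR x)) H"
    using indef_int_diff[OF indef_int_const indef_int_integral_01[OF gye]] unfolding H_def by simp
  have v: "v = (\<lambda>t. eM t * H t)" by (simp add: v_def H_def)
  have "indef_int (\<lambda>x. eM x * (- (g x * y x * eR x)) + (- complex_of_real (r x) * eM x) * H x) v"
    unfolding v by (rule indef_int_mult[OF indef_int_eM H])
  moreover have "eM x * (- (g x * y x * eR x)) + (- complex_of_real (r x) * eM x) * H x = - complex_of_real (r x) * v x - g x * y x" for x
  proof -
    have "eM x * (- (g x * y x * eR x)) = - (eM x * eR x) * (g x * y x)" by (simp only: mult_ac mult_minus_left mult_minus_right)
    then show ?thesis unfolding v eR_eM by simp
  qed
  ultimately show "indef_int (\<lambda>x. - complex_of_real (r x) * v x - g x * y x) v" by simp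
  show "v 1 = 0" by (simp add: v_def)
  show "integral {0..a} v = integral {0..1} (\<lambda>x. g x * y x * hat a x)" if a: "a \<in> {0..1}"
  proof -
    \<comment> \<open>Integration by parts; \<open>H\<close> vanishes at 1 and \<open>Em\<close> at
      0, so that no boundary term remains.\<close>
    have "indef_int (\<lambda>x. H x * (if x \<le> a then eM x else 0) + - (g x * y x * eR x) * Em (min x a)) (\<lambda>x. H x * Em (min x a))"
      by (rule indef_int_mult[OF H indef_int_step[OF a indef_int_Em]])
    moreover have "(\<lambda>x. H x * (if x \<le> a then eM x else 0) + - (g x * y x * eR x) * Em (min x a)) =
        (\<lambda>x. (if x \<le> a then v x else 0) - g x * y x * hat a x)"
      by (auto simp: v hat_def)
    ultimately have P: "indef_int (\<lambda>x. (if x \<le> a then v x else 0) - g x * y x * hat a x) (\<lambda>x. H x * Em (min x a))"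
      by simp
    have vc: "continuous_on {0..1} v"
      unfolding v by (intro continuous_intros eM_cont indef_int_continuous[OF H])
    have sv: "indef_int (\<lambda>x. if x \<le> a then v x else 0) (\<lambda>x. integral {0..min x a} v)"
      by (rule indef_int_step[OF a indef_int_integral_01[OF absolutely_integrable_continuous_real[OF vc]]])
    have gyh: "(\<lambda>x. g x * y x * hat a x) absolutely_integrable_on {0..1}"
      by (intro absolutely_integrable_continuous_mult g y form_pair_y_cont[OF form_pair_hat[OF a]])
    have "integral {0..1} (\<lambda>x. (if x \<le> a then v x else 0) - g x * y x * hat a x) = H 1 * Em (min 1 a) - H 0 * Em (min 0 a)"
      using indef_int_integral[OF P, of 0 1] by simp
    also have "\<dots> = 0" using a by (simp add: H_def Em_def)
    also have "integral {0..1} (\<lambda>x. (if x \<le> a then v x else 0) - g x * y x * hat a x) =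
        integral {0..1} (\<lambda>x. if x \<le> a then v x else 0) - integral {0..1} (\<lambda>x. g x * y x * hat a x)"
      using integrable_01_subinterval[OF indef_int_absolutely_integrable[OF sv], of 0 1] integrable_01_subinterval[OF gyh, of 0 1]
      by (intro Henstock_Kurzweil_Integration.integral_diff) auto
    also have "integral {0..1} (\<lambda>x. if x \<le> a then v x else 0) = integral {0..a} v"
    proof -
      have "min 1 a = a" "min 0 a = 0" using a by auto
      then show ?thesis using indef_int_integral[OF sv, of 0 1] by simp
    qed
    finally show ?thesis by simp
  qed
qed

end

section \<open>The forms of the pencil and their Galerkin approximation\<close>

lemma L2_cnj:
  assumes "f \<in> L2"
  shows "(\<lambda>x. cnj (f x)) \<in> L2"
proof (rule L2I)
  show "(\<lambda>x. cnj (f x)) absolutely_integrable_on {0..1}"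
    using absolutely_integrable_linear[OF L2_absolutely_integrable(1)[OF assms] bounded_linear_cnj] by (simp add: o_def)
qed (use L2_absolutely_integrable(2)[OF assms] in simp)

lemma integral_add_01:
  fixes f g :: "real \<Rightarrow> complex"
  assumes "f absolutely_integrable_on {0..1}" "g absolutely_integrable_on {0..1}"
  shows "integral {0..1} (\<lambda>x. f x + g x) = integral {0..1} f + integral {0..1} g"
  using integrable_01_subinterval[OF assms(1), of 0 1] integrable_01_subinterval[OF assms(2), of 0 1]
  by (intro Henstock_Kurzweil_Integration.integral_add) auto

lemma integral_diff_01:
  fixes f g :: "real \<Rightarrow> complex"
  assumes "f absolutely_integrable_on {0..1}" "g absolutely_integrable_on {0..1}"
  shows "integral {0..1} (\<lambda>x. f x - g x) = integral {0..1} f - integral {0..1} g"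
  using integrable_01_subinterval[OF assms(1), of 0 1] integrable_01_subinterval[OF assms(2), of 0 1]
  by (intro Henstock_Kurzweil_Integration.integral_diff) auto

lemma integral_add_cmult_01:
  fixes f g :: "real \<Rightarrow> complex"
  assumes "f absolutely_integrable_on {0..1}" "g absolutely_integrable_on {0..1}"
  shows "integral {0..1} (\<lambda>x. f x + c * g x) = integral {0..1} f + c * integral {0..1} g"
  using assms by (subst integral_add_01) (auto intro: set_integrable_mult_right)

lemma integral_norm_square:
  fixes f :: "real \<Rightarrow> complex"
  assumes "f \<in> L2"
  shows "integral {0..1} (\<lambda>x. f x * cnj (f x)) = complex_of_real (integral {0..1} (\<lambda>x. (norm (f x))\<^sup>2))"
  unfolding complex_norm_square[symmetric]
  by (rule integral_of_real[OF integrable_01_subinterval[OF L2_absolutely_integrable(2)[OF assms]]]) auto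

lemma integral_norm_square_zero:
  fixes f :: "real \<Rightarrow> complex"
  assumes f: "continuous_on {0..1} f" and z: "integral {0..1} (\<lambda>x. (norm (f x))\<^sup>2) = 0" and x: "x \<in> {0..1}"
  shows "f x = 0"
proof -
  have "continuous_on {0..1} (\<lambda>x. (norm (f x))\<^sup>2)" by (rule continuous_on_power[OF continuous_on_norm[OF f]])
  from integral_eq_0_iff[OF this] z have "\<forall>x\<in>{0..1}. (norm (f x))\<^sup>2 = 0" by simp
  then show ?thesis using x by simp
qed

context pencil_data
begin

text \<open>The linear coefficient of the pencil expanded around \<open>mu\<close>: in powers of
  \<open>\<delta>\<close> the parameter \<open>mu + \<delta>\<close> adds
  \<open>\<delta>^2 - \<delta> * rho mu\<close> to the potential.\<close>

definition "rho mu x = complex_of_real (2 * (p x - mu))"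

lemma rho_int: "rho mu absolutely_integrable_on {0..1}"
proof -
  have "(\<lambda>x. 2 * (p x - mu)) absolutely_integrable_on {0..1}"
    by (intro set_integrable_mult_right set_integral_diff(1) p_int absolutely_integrable_continuous_real continuous_on_const)
  then show ?thesis unfolding rho_def[abs_def] by (rule absolutely_integrable_of_real)
qed

lemma w_shift: "w (complex_of_real mu + \<delta>) x = w (complex_of_real mu) x + \<delta>\<^sup>2 - \<delta> * rho mu x"
  by (simp add: pot_def rho_def power2_eq_square algebra_simps)

text \<open>A pair \<open>(y, u)\<close> is coded as one function on pairs, with \<open>True\<close>
  for \<open>y\<close> and \<open>False\<close> for \<open>u\<close>, because the abstract setting
  deals with scalar functions. \<open>formQ mu\<close> is the form of
  \<open>- T(mu)\<close>.\<close>

definition "formS f g = integral {0..1} (\<lambda>x::real. f (x, True) * cnj (g (x, True)))"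
definition "formB mu f g = integral {0..1} (\<lambda>x. rho mu x * (f (x, True) * cnj (g (x, True))))"
definition "formQ mu f g = integral {0..1} (\<lambda>x. f (x, False) * cnj (g (x, False)) -
  w (complex_of_real mu) x * (f (x, True) * cnj (g (x, True))))"
definition "form_space = {f. form_pair (\<lambda>x. f (x, True)) (\<lambda>x. f (x, False))}"

lemma form_ints:
  assumes "form_pair y u" "form_pair y' u'"
  shows "(\<lambda>x. y x * cnj (y' x)) absolutely_integrable_on {0..1}"
    "a absolutely_integrable_on {0..1} \<Longrightarrow> (\<lambda>x. a x * (y x * cnj (y' x))) absolutely_integrable_on {0..1}"
    "(\<lambda>x. u x * cnj (u' x)) absolutely_integrable_on {0..1}"
proof -
  have c: "continuous_on {0..1} (\<lambda>x. y x * cnj (y' x))"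
    using form_pair_y_cont[OF assms(1)] form_pair_y_cont[OF assms(2)] by (intro continuous_on_mult continuous_on_cnj)
  show "(\<lambda>x. y x * cnj (y' x)) absolutely_integrable_on {0..1}" by (rule absolutely_integrable_continuous_real[OF c])
  show "a absolutely_integrable_on {0..1} \<Longrightarrow> (\<lambda>x. a x * (y x * cnj (y' x))) absolutely_integrable_on {0..1}"
    by (rule absolutely_integrable_continuous_mult[OF _ c])
  show "(\<lambda>x. u x * cnj (u' x)) absolutely_integrable_on {0..1}"
    using assms by (intro L2_mult_absolutely_integrable L2_cnj) (auto simp: form_pair_def)
qed

lemma form_ints_diff:
  assumes "form_pair y u" "form_pair y' u'" "a absolutely_integrable_on {0..1}"
  shows "(\<lambda>x. u x * cnj (u' x) - a x * (y x * cnj (y' x))) absolutely_integrable_on {0..1}"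
  by (rule set_integral_diff(1)[OF form_ints(3)[OF assms(1,2)] form_ints(2)[OF assms]])

lemma sesquilinear: "sesquilinear_forms form_space formS (formB mu) (formQ mu)"
proof
  fix f g h :: "real \<times> bool \<Rightarrow> complex" and c :: complex
  show "formS g f = cnj (formS f g)" "formB mu g f = cnj (formB mu f g)" "formQ mu g f = cnj (formQ mu f g)"
    by (simp_all add: formS_def formB_def formQ_def integral_cnj mult.commute pot_def rho_def)
  assume f: "f \<in> form_space"
  then have f': "form_pair (\<lambda>x. f (x, True)) (\<lambda>x. f (x, False))" by (simp add: form_space_def)
  have fL: "(\<lambda>x. f (x, True)) \<in> L2" by (rule L2_continuous[OF form_pair_y_cont[OF f']])
  show "0 \<le> Re (formS f f)"
    using integral_nonneg_01[OF L2_absolutely_integrable(2)[OF fL], of 0 1]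
    by (simp add: formS_def integral_norm_square[OF fL])
  assume g: "g \<in> form_space"
  then have g': "form_pair (\<lambda>x. g (x, True)) (\<lambda>x. g (x, False))" by (simp add: form_space_def)
  show "(\<lambda>t. f t + c * g t) \<in> form_space"
    using form_pair_add[OF f' g', of c] by (simp add: form_space_def)
  show "formS f g = 0 \<and> formB mu f g = 0 \<and> formQ mu f g = 0" if "formS f f = 0"
  proof -
    have "integral {0..1} (\<lambda>x. (norm (f (x, True)))\<^sup>2) = 0"
      using that by (simp add: formS_def integral_norm_square[OF fL])
    then have z: "f (x, True) = 0" if "x \<in> {0..1}" for x
      using integral_norm_square_zero[OF form_pair_y_cont[OF f'] _ that] by blast
    have ae: "AE x in leb01. f (x, False) = 0" by (rule form_pair_zero_u[OF f' z])
    have ae1: "AE x in leb01. f (x, True) = 0" using z by (intro AE_I2) auto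
    have "formS f g = integral {0..1} (\<lambda>x::real. 0)"
      unfolding formS_def by (rule integral_cong_AE01) (use ae1 in \<open>eventually_elim, simp\<close>, simp)
    moreover have "formB mu f g = integral {0..1} (\<lambda>x::real. 0)"
      unfolding formB_def by (rule integral_cong_AE01) (use ae1 in \<open>eventually_elim, simp\<close>, simp)
    moreover have "formQ mu f g = integral {0..1} (\<lambda>x::real. 0)"
      unfolding formQ_def by (rule integral_cong_AE01) (use ae ae1 in \<open>eventually_elim, simp\<close>, simp)
    ultimately show ?thesis by simp
  qed
  assume h: "h \<in> form_space"
  then have h': "form_pair (\<lambda>x. h (x, True)) (\<lambda>x. h (x, False))" by (simp add: form_space_def)
  show "formS (\<lambda>t. f t + c * g t) h = formS f h + c * formS g h"
    using integral_add_cmult_01[OF form_ints(1)[OF f' h'] form_ints(1)[OF g' h'], of c]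
    by (simp add: formS_def algebra_simps)
  show "formB mu (\<lambda>t. f t + c * g t) h = formB mu f h + c * formB mu g h"
    using integral_add_cmult_01[OF form_ints(2)[OF f' h' rho_int[of mu]] form_ints(2)[OF g' h' rho_int[of mu]], where c = c]
    by (simp add: formB_def algebra_simps)
  show "formQ mu (\<lambda>t. f t + c * g t) h = formQ mu f h + c * formQ mu g h"
    using integral_add_cmult_01[OF form_ints_diff[OF f' h' w_int[of "complex_of_real mu"]]
        form_ints_diff[OF g' h' w_int[of "complex_of_real mu"]], where c = c]
    by (simp add: formQ_def algebra_simps)
qed

definition "enc y u = (\<lambda>(x::real, b). if b then y x else u x :: complex)"

lemma enc_simps [simp]: "enc y u (x, True) = y x" "enc y u (x, False) = u x"
  by (simp_all add: enc_def)

lemma enc_in: "form_pair y u \<Longrightarrow> enc y u \<in> form_space"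
  by (simp add: form_space_def)

lemma cnj_hat: "cnj (hat a x) = hat a x" "cnj (ind a x) = ind a x"
proof -
  have e: "cnj (eR x) = eR x" "cnj (eM x) = eM x" for x by (simp_all add: eR_def eM_def exp_cnj)
  then have "cnj (Em x) = Em x" for x by (simp add: Em_def integral_cnj)
  then show "cnj (hat a x) = hat a x" by (simp add: hat_def e)
  show "cnj (ind a x) = ind a x" by (simp add: ind_def)
qed

text \<open>Countably many test points, so that finitely many are used at each stage; density and
  continuity recover all points in the limit.\<close>

definition "qn n = from_nat_into ({0..1} \<inter> \<rat> :: real set) n"

lemma qn: "qn n \<in> {0..1}" "range qn = {0..1} \<inter> \<rat>"
proof -
  have "(0::real) \<in> {0..1} \<inter> \<rat>" by simp
  then have ne: "({0..1} \<inter> \<rat> :: real set) \<noteq> {}" by blast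
  show "qn n \<in> {0..1}" using from_nat_into[OF ne, of n] by (simp add: qn_def)
  have "countable ({0..1} \<inter> \<rat> :: real set)" using countable_rat by (rule countable_Int2)
  then show "range qn = {0..1} \<inter> \<rat>"
    unfolding qn_def[abs_def] by (rule range_from_nat_into[OF ne])
qed

text \<open>The test space is spanned by the given nonpositive vector, which is \<open>h 0\<close>,
  and by hat functions, shifted by one index. The eigenvector is normalised by \<open>u\<close>
  instead of \<open>y\<close>, because the Hoelder bound behind the compactness argument is in terms
  of \<open>u\<close>.\<close>

lemma galerkin_step:
  assumes fp: "form_pair y0 u0" and nz: "integral {0..1} (\<lambda>x. y0 x * cnj (y0 x)) \<noteq> 0"
    and neg: "Re (integral {0..1} (\<lambda>x. u0 x * cnj (u0 x) - w (complex_of_real mu) x * (y0 x * cnj (y0 x)))) \<le> 0"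
  shows "\<exists>\<delta> y u. form_pair y u \<and> integral {0..1} (\<lambda>x. (norm (u x))\<^sup>2) = 1 \<and>
    (\<forall>k<n. integral {0..qn k} u = integral {0..1} (\<lambda>x. w (complex_of_real mu + \<delta>) x * y x * hat (qn k) x)) \<and>
    \<delta>\<^sup>2 * integral {0..1} (\<lambda>x. y x * cnj (y x)) - \<delta> * integral {0..1} (\<lambda>x. rho mu x * (y x * cnj (y x))) =
      1 - integral {0..1} (\<lambda>x. w (complex_of_real mu) x * (y x * cnj (y x))) \<and>
    Re (1 - integral {0..1} (\<lambda>x. w (complex_of_real mu) x * (y x * cnj (y x)))) +
      (norm \<delta>)\<^sup>2 * Re (integral {0..1} (\<lambda>x. y x * cnj (y x))) \<le> 0"
proof -
  interpret sesquilinear_forms form_space formS "formB mu" "formQ mu" by (rule sesquilinear)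
  define h where "h = (\<lambda>k. case k of 0 \<Rightarrow> enc y0 u0 | Suc k \<Rightarrow> enc (hat (qn k)) (ind (qn k)))"
  have h: "h k \<in> form_space" for k
    unfolding h_def by (cases k) (simp_all add: enc_in fp form_pair_hat[OF qn(1)])
  have "formS (h 0) (h 0) \<noteq> 0" "Re (formQ mu (h 0) (h 0)) \<le> 0"
    using nz neg by (simp_all add: h_def formS_def formQ_def)
  then obtain P \<delta> where P: "P \<in> form_space" "formS P P \<noteq> 0"
    "\<And>k. k < Suc n \<Longrightarrow> \<delta>\<^sup>2 * formS P (h k) - \<delta> * formB mu P (h k) - formQ mu P (h k) = 0"
    "\<delta>\<^sup>2 * formS P P - \<delta> * formB mu P P - formQ mu P P = 0" "Re (formQ mu P P) + (norm \<delta>)\<^sup>2 * Re (formS P P) \<le> 0"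
    using galerkin_eigenvector[where h = h and n = "Suc n", OF h] by blast
  define Y where "Y = (\<lambda>x. P (x, True))"
  define U where "U = (\<lambda>x. P (x, False))"
  have YU: "form_pair Y U" using P(1) by (simp add: form_space_def Y_def U_def)
  have UL: "U \<in> L2" using YU by (simp add: form_pair_def)
  define m where "m = integral {0..1} (\<lambda>x. (norm (U x))\<^sup>2)"
  \<comment> \<open>If \<open>U\<close> vanished, the Hoelder bound would make \<open>Y\<close> zero
    as well, contradicting \<open>formS P P \<noteq> 0\<close>.\<close>
  have "m \<noteq> 0"
  proof
    assume m0: "m = 0"
    obtain M where M: "\<And>a b. 0 \<le> a \<Longrightarrow> a \<le> b \<Longrightarrow> b \<le> 1 \<Longrightarrow>
       norm (eM b * Y b - eM a * Y a) \<le> M * sqrt (b - a) * sqrt m"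
      using form_pair_bounds YU unfolding m_def by metis
    have "Y x = 0" if "x \<in> {0..1}" for x
    proof -
      have "norm (eM x * Y x - eM 0 * Y 0) \<le> 0" using M[of 0 x] that m0 by simp
      then have "eM x * Y x = 0" using YU by (simp add: form_pair_def)
      then show ?thesis by (simp add: eM_def)
    qed
    then have "formS P P = integral {0..1} (\<lambda>x::real. 0)"
      unfolding formS_def Y_def by (intro integral_cong) simp
    then show False using P(2) by simp
  qed
  moreover have "0 \<le> m" unfolding m_def using integral_nonneg_01[OF L2_absolutely_integrable(2)[OF UL], of 0 1] by simp
  ultimately have m: "m > 0" by simp
  define s where "s = complex_of_real (1 / sqrt m)"
  have ss: "s * cnj s = complex_of_real (1 / m)" using m by (simp add: s_def flip: of_real_mult)
  define y where "y = (\<lambda>x. s * Y x)"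
  define u where "u = (\<lambda>x. s * U x)"
  have zero: "form_pair (\<lambda>x. 0) (\<lambda>x. 0)"
    using zero_L2 indef_int_const[of 0] by (simp add: form_pair_def)
  have yu: "form_pair y u" using form_pair_add[OF zero YU, of s] by (simp add: y_def u_def)
  have nu: "integral {0..1} (\<lambda>x. (norm (u x))\<^sup>2) = 1"
    using m by (simp add: u_def norm_mult power_mult_distrib s_def norm_divide power_divide flip: m_def)
  have uu: "integral {0..1} (\<lambda>x. u x * cnj (u x)) = 1"
    using integral_norm_square[of u] yu nu by (simp add: form_pair_def)
  define W where "W = integral {0..1} (\<lambda>x. w (complex_of_real mu) x * (y x * cnj (y x)))"
  define N where "N = integral {0..1} (\<lambda>x. y x * cnj (y x))"
  have scale: "integral {0..1} (\<lambda>x. a x * (y x * cnj (y x))) = s * cnj s * integral {0..1} (\<lambda>x. a x * (Y x * cnj (Y x)))" for a :: "real \<Rightarrow> complex"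
    unfolding integral_mult_right[symmetric] by (simp add: y_def mult_ac)
  have NS: "N = s * cnj s * formS P P"
    unfolding N_def formS_def Y_def[symmetric] using scale[of "\<lambda>x. 1"] by (simp add: Y_def)
  have BS: "integral {0..1} (\<lambda>x. rho mu x * (y x * cnj (y x))) = s * cnj s * formB mu P P"
    unfolding formB_def scale Y_def ..
  have "integral {0..1} (\<lambda>x. u x * cnj (u x) - w (complex_of_real mu) x * (y x * cnj (y x))) = s * cnj s * formQ mu P P"
    unfolding formQ_def integral_mult_right[symmetric] by (simp add: y_def u_def Y_def U_def algebra_simps)
  moreover have "integral {0..1} (\<lambda>x. u x * cnj (u x) - w (complex_of_real mu) x * (y x * cnj (y x))) = 1 - W"
    unfolding W_def uu[symmetric] by (rule integral_diff_01[OF form_ints(3)[OF yu yu] form_ints(2)[OF yu yu w_int]])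
  ultimately have QS: "1 - W = s * cnj s * formQ mu P P" by simp
  have "\<delta>\<^sup>2 * N - \<delta> * integral {0..1} (\<lambda>x. rho mu x * (y x * cnj (y x))) - (1 - W)
      = s * cnj s * (\<delta>\<^sup>2 * formS P P - \<delta> * formB mu P P - formQ mu P P)"
    unfolding NS BS QS by (simp add: algebra_simps)
  then have eq3: "\<delta>\<^sup>2 * N - \<delta> * integral {0..1} (\<lambda>x. rho mu x * (y x * cnj (y x))) = 1 - W"
    using P(4) by simp
  have eq4: "Re (1 - W) + (norm \<delta>)\<^sup>2 * Re N \<le> 0"
  proof -
    have "Re (1 - W) + (norm \<delta>)\<^sup>2 * Re N = (1 / m) * (Re (formQ mu P P) + (norm \<delta>)\<^sup>2 * Re (formS P P))"
      unfolding QS NS ss by (simp add: algebra_simps)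
    also have "\<dots> \<le> 0" using P(5) m by (intro mult_nonneg_nonpos) auto
    finally show ?thesis .
  qed
  have eq2: "integral {0..qn k} u = integral {0..1} (\<lambda>x. w (complex_of_real mu + \<delta>) x * y x * hat (qn k) x)" if "k < n" for k
  proof -
    note fh = form_pair_hat[OF qn(1)[of k]]
    have y1: "(\<lambda>x. y x * hat (qn k) x) absolutely_integrable_on {0..1}"
      using form_ints(1)[OF yu fh] by (simp add: cnj_hat)
    have y2: "(\<lambda>x. a x * (y x * hat (qn k) x)) absolutely_integrable_on {0..1}" if "a absolutely_integrable_on {0..1}" for a
      using form_ints(2)[OF yu fh that] by (simp add: cnj_hat)
    have ui: "(\<lambda>x. u x * ind (qn k) x) absolutely_integrable_on {0..1}"
      using form_ints(3)[OF yu fh] by (simp add: cnj_hat)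
    have ua: "u absolutely_integrable_on {0..1}" using yu by (intro L2_absolutely_integrable(1)) (simp add: form_pair_def)
    have "\<delta>\<^sup>2 * formS P (h (Suc k)) - \<delta> * formB mu P (h (Suc k)) - formQ mu P (h (Suc k)) = 0"
      using P(3)[of "Suc k"] that by simp
    then have "s * (\<delta>\<^sup>2 * formS P (h (Suc k)) - \<delta> * formB mu P (h (Suc k)) - formQ mu P (h (Suc k))) = 0" by simp
    then have *: "\<delta>\<^sup>2 * (s * formS P (h (Suc k))) - \<delta> * (s * formB mu P (h (Suc k))) = s * formQ mu P (h (Suc k))"
      by (simp add: algebra_simps)
    have 1: "s * formS P (h (Suc k)) = integral {0..1} (\<lambda>x. y x * hat (qn k) x)"
      unfolding formS_def integral_mult_right[symmetric] by (simp add: h_def y_def Y_def cnj_hat mult_ac)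
    have 2: "s * formB mu P (h (Suc k)) = integral {0..1} (\<lambda>x. rho mu x * (y x * hat (qn k) x))"
      unfolding formB_def integral_mult_right[symmetric] by (simp add: h_def y_def Y_def cnj_hat mult_ac)
    have 3: "s * formQ mu P (h (Suc k)) = integral {0..1} (\<lambda>x. u x * ind (qn k) x - w (complex_of_real mu) x * (y x * hat (qn k) x))"
      unfolding formQ_def integral_mult_right[symmetric] by (simp add: h_def y_def u_def Y_def U_def cnj_hat algebra_simps)
    have 4: "integral {0..1} (\<lambda>x. u x * ind (qn k) x - w (complex_of_real mu) x * (y x * hat (qn k) x)) =
        integral {0..1} (\<lambda>x. u x * ind (qn k) x) - integral {0..1} (\<lambda>x. w (complex_of_real mu) x * (y x * hat (qn k) x))"
      by (rule integral_diff_01[OF ui y2[OF w_int]])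
    have 5: "integral {0..1} (\<lambda>x. u x * ind (qn k) x) = integral {0..qn k} u"
    proof -
      have "indef_int (\<lambda>x. if x \<le> qn k then u x else 0) (\<lambda>x. integral {0..min x (qn k)} u)"
        by (rule indef_int_step[OF qn(1) indef_int_integral_01[OF ua]])
      moreover have "(\<lambda>x. if x \<le> qn k then u x else 0) = (\<lambda>x. u x * ind (qn k) x)" by (auto simp: ind_def)
      ultimately have I: "indef_int (\<lambda>x. u x * ind (qn k) x) (\<lambda>x. integral {0..min x (qn k)} u)" by simp
      have "min 1 (qn k) = qn k" "min 0 (qn k) = 0" using qn(1)[of k] by auto
      then show ?thesis using indef_int_integral[OF I, of 0 1] by simp
    qed
    have "integral {0..1} (\<lambda>x. w (complex_of_real mu + \<delta>) x * y x * hat (qn k) x) =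
        integral {0..1} (\<lambda>x. w (complex_of_real mu) x * (y x * hat (qn k) x) +
          (\<delta>\<^sup>2 * (y x * hat (qn k) x) - \<delta> * (rho mu x * (y x * hat (qn k) x))))"
      by (rule integral_cong) (unfold w_shift, simp add: algebra_simps)
    also have "\<dots> = integral {0..1} (\<lambda>x. w (complex_of_real mu) x * (y x * hat (qn k) x)) +
          (\<delta>\<^sup>2 * integral {0..1} (\<lambda>x. y x * hat (qn k) x) - \<delta> * integral {0..1} (\<lambda>x. rho mu x * (y x * hat (qn k) x)))"
      unfolding integral_mult_right[symmetric]
      by (subst integral_add_01, rule y2[OF w_int], intro set_integral_diff(1) set_integrable_mult_right y1 y2 rho_int,
          subst integral_diff_01) (auto intro!: set_integrable_mult_right y1 y2 rho_int)
    finally show ?thesis using * unfolding 1 2 3 4 5 by simp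
  qed
  show ?thesis
    using yu nu eq2 eq3 eq4 unfolding W_def N_def by blast
qed

end

section \<open>Limit of the Galerkin eigenpairs\<close>

context pencil_data
begin

text \<open>For fixed \<open>k\<close> the tested equation holds for all large \<open>n\<close>. Its
  left side equals \<open>y\<close> minus the integral of \<open>r y\<close>, so uniform convergence
  of \<open>y\<close> is enough to pass to the limit. Density of the test points then shows that the
  function \<open>v\<close> produced by the hat test is the quasi-derivative of \<open>Y\<close>,
  and its value at 1 is 0.\<close>

lemma weak_limit:
  fixes y u :: "nat \<Rightarrow> real \<Rightarrow> complex" and \<delta> :: "nat \<Rightarrow> complex"
  assumes fp: "\<And>n. form_pair (y n) (u n)"
    and hat: "\<And>n k. k < n \<Longrightarrow> integral {0..qn k} (u n) = integral {0..1} (\<lambda>x. w (complex_of_real mu + \<delta> n) x * y n x * hat (qn k) x)"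
    and ul: "uniform_limit {0..1} (\<lambda>n. y (\<kappa> n)) Y sequentially" and Yc: "continuous_on {0..1} Y" and k: "strict_mono (\<kappa> :: nat \<Rightarrow> nat)"
    and dl: "(\<lambda>n. \<delta> (\<kappa> n)) \<longlonglongrightarrow> d"
  obtains v where "qsol r (w (complex_of_real mu + d)) (\<lambda>x. 0) Y v" "Y 0 = 0" "v 1 = 0"
proof -
  note lim = indef_int_weighted_limit[where g = "\<lambda>n. y (\<kappa> n)", OF _ form_pair_y_cont[OF fp] Yc ul]
  define z where "z = complex_of_real mu + d"
  define v where "v = (\<lambda>t. eM t * (integral {0..1} (\<lambda>x. w z x * Y x * eR x) - integral {0..t} (\<lambda>x. w z x * Y x * eR x)))"
  have v: "\<And>a. a \<in> {0..1} \<Longrightarrow> integral {0..a} v = integral {0..1} (\<lambda>x. w z x * Y x * hat a x)"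
    "indef_int (\<lambda>x. - complex_of_real (r x) * v x - w z x * Y x) v" "v 1 = 0"
    unfolding v_def using hat_test[OF w_int[of z] Yc] by blast+
  have rc: "(\<lambda>x. complex_of_real (r x)) absolutely_integrable_on {0..1}" by (rule absolutely_integrable_of_real[OF r_int])
  have rY: "(\<lambda>x. complex_of_real (r x) * Y x) absolutely_integrable_on {0..1}"
    by (rule absolutely_integrable_continuous_mult[OF rc Yc])
  have vc: "continuous_on {0..1} v" by (rule indef_int_continuous[OF v(2)])
  have I: "indef_int (\<lambda>x. complex_of_real (r x) * Y x + v x) (\<lambda>a. integral {0..a} (\<lambda>x. complex_of_real (r x) * Y x) + integral {0..a} v)"
    by (intro indef_int_add indef_int_integral_01 rY absolutely_integrable_continuous_real vc)
  have at_q: "Y (qn k) = integral {0..qn k} (\<lambda>x. complex_of_real (r x) * Y x) + integral {0..qn k} v" for k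
  proof -
    define a where "a = qn k"
    have a: "0 \<le> a" "a \<le> 1" "a \<in> {0..1}" using qn(1)[of k] by (auto simp: a_def)
    have hc: "continuous_on {0..1} (hat a)" by (rule form_pair_y_cont[OF form_pair_hat[OF a(3)]])
    have l1: "(\<lambda>n. y (\<kappa> n) a - integral {0..a} (\<lambda>x. complex_of_real (r x) * y (\<kappa> n) x)) \<longlonglongrightarrow> Y a - integral {0..a} (\<lambda>x. complex_of_real (r x) * Y x)"
      by (intro tendsto_diff tendsto_uniform_limitI[OF ul a(3)] lim[OF rc]) (use a in auto)
    have l2: "(\<lambda>n. integral {0..1} (\<lambda>x. (g x * hat a x) * y (\<kappa> n) x)) \<longlonglongrightarrow> integral {0..1} (\<lambda>x. (g x * hat a x) * Y x)"
      if "g absolutely_integrable_on {0..1}" for g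
      by (intro lim absolutely_integrable_continuous_mult that hc) auto
    have one: "(\<lambda>x::real. 1 :: complex) absolutely_integrable_on {0..1}"
      by (rule absolutely_integrable_continuous_real[OF continuous_on_const])
    have split: "integral {0..1} (\<lambda>x. w (complex_of_real mu + e) x * f x * hat a x) =
        integral {0..1} (\<lambda>x. (w (complex_of_real mu) x * hat a x) * f x) +
        (e\<^sup>2 * integral {0..1} (\<lambda>x. (1 * hat a x) * f x) - e * integral {0..1} (\<lambda>x. (rho mu x * hat a x) * f x))"
      if f: "continuous_on {0..1} f" for e f
    proof -
      have i: "(\<lambda>x. (g x * hat a x) * f x) absolutely_integrable_on {0..1}" if "g absolutely_integrable_on {0..1}" for g
        by (intro absolutely_integrable_continuous_mult that hc f)
      have "integral {0..1} (\<lambda>x. w (complex_of_real mu + e) x * f x * hat a x) =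
        integral {0..1} (\<lambda>x. (w (complex_of_real mu) x * hat a x) * f x +
          (e\<^sup>2 * ((1 * hat a x) * f x) - e * ((rho mu x * hat a x) * f x)))"
        by (rule integral_cong) (unfold w_shift, simp add: algebra_simps)
      also have "\<dots> = integral {0..1} (\<lambda>x. (w (complex_of_real mu) x * hat a x) * f x) +
          (integral {0..1} (\<lambda>x. e\<^sup>2 * ((1 * hat a x) * f x)) - integral {0..1} (\<lambda>x. e * ((rho mu x * hat a x) * f x)))"
        by (subst integral_add_01, rule i[OF w_int],
            rule set_integral_diff(1)[OF set_integrable_mult_right[OF i[OF one]] set_integrable_mult_right[OF i[OF rho_int]]],
            subst integral_diff_01, rule set_integrable_mult_right[OF i[OF one]],
            rule set_integrable_mult_right[OF i[OF rho_int]], rule refl)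
      finally show ?thesis by simp
    qed
    have "(\<lambda>n. integral {0..1} (\<lambda>x. w (complex_of_real mu + \<delta> (\<kappa> n)) x * y (\<kappa> n) x * hat a x)) \<longlonglongrightarrow>
        integral {0..1} (\<lambda>x. w z x * Y x * hat a x)"
      unfolding z_def split[OF Yc] split[OF form_pair_y_cont[OF fp]]
      by (intro tendsto_add tendsto_diff tendsto_mult tendsto_power dl l2 w_int one rho_int)
    moreover have "eventually (\<lambda>n. integral {0..1} (\<lambda>x. w (complex_of_real mu + \<delta> (\<kappa> n)) x * y (\<kappa> n) x * hat a x) =
        y (\<kappa> n) a - integral {0..a} (\<lambda>x. complex_of_real (r x) * y (\<kappa> n) x)) sequentially"
      using eventually_gt_at_top[of k]
    proof eventually_elim
      case (elim n)
      have "k < \<kappa> n" using elim seq_suble[OF k, of n] by simp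
      then have "integral {0..1} (\<lambda>x. w (complex_of_real mu + \<delta> (\<kappa> n)) x * y (\<kappa> n) x * hat a x) = integral {0..a} (u (\<kappa> n))"
        unfolding a_def by (rule hat[symmetric])
      moreover have "integral {0..a} (\<lambda>x. complex_of_real (r x) * y (\<kappa> n) x + u (\<kappa> n) x) = y (\<kappa> n) a"
      proof -
        have "indef_int (\<lambda>x. complex_of_real (r x) * y (\<kappa> n) x + u (\<kappa> n) x) (y (\<kappa> n))" "y (\<kappa> n) 0 = 0"
          using fp[of "\<kappa> n"] by (simp_all add: form_pair_def)
        then show ?thesis using indef_int_integral[of _ "y (\<kappa> n)" 0 a] a by simp
      qed
      moreover have "integral {0..a} (\<lambda>x. complex_of_real (r x) * y (\<kappa> n) x + u (\<kappa> n) x) =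
          integral {0..a} (\<lambda>x. complex_of_real (r x) * y (\<kappa> n) x) + integral {0..a} (u (\<kappa> n))"
      proof -
        have "(\<lambda>x. complex_of_real (r x) * y (\<kappa> n) x) absolutely_integrable_on {0..1}"
          by (rule absolutely_integrable_continuous_mult[OF rc form_pair_y_cont[OF fp]])
        moreover have "u (\<kappa> n) absolutely_integrable_on {0..1}"
          using fp[of "\<kappa> n"] by (intro L2_absolutely_integrable(1)) (simp add: form_pair_def)
        ultimately show ?thesis
          using integrable_01_subinterval a by (intro Henstock_Kurzweil_Integration.integral_add) blast+
      qed
      ultimately show ?case by (simp add: eq_diff_eq add.commute)
    qed
    ultimately have "(\<lambda>n. y (\<kappa> n) a - integral {0..a} (\<lambda>x. complex_of_real (r x) * y (\<kappa> n) x)) \<longlonglongrightarrow>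
        integral {0..1} (\<lambda>x. w z x * Y x * hat a x)"
      by (rule Lim_transform_eventually)
    from LIMSEQ_unique[OF this l1] v(1)[OF a(3)] show ?thesis by (simp add: a_def)
  qed
  have eq: "Y a - (integral {0..a} (\<lambda>x. complex_of_real (r x) * Y x) + integral {0..a} v) = 0" if a: "a \<in> {0..1}" for a
  proof (rule continuous_constant_on_closure[where S = "{0..1} \<inter> \<rat>" and
        f = "\<lambda>a. Y a - (integral {0..a} (\<lambda>x. complex_of_real (r x) * Y x) + integral {0..a} v)"])
    have *: "closure ({0..1::real} \<inter> \<rat>) = {0..1}"
    proof (rule equalityI)
      show "closure ({0..1::real} \<inter> \<rat>) \<subseteq> {0..1}" by (rule closure_minimal) auto
      show "{0..1::real} \<subseteq> closure ({0..1} \<inter> \<rat>)"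
      proof
        fix c :: real assume c: "c \<in> {0..1}"
        show "c \<in> closure ({0..1} \<inter> \<rat>)"
          unfolding closure_approachable
        proof (intro allI impI)
          fix e :: real assume "e > 0"
          then have "max 0 (c - e) < min 1 (c + e)" using c by auto
          then obtain q where "q \<in> \<rat>" "max 0 (c - e) < q" "q < min 1 (c + e)"
            using Rats_dense_in_real by blast
          then show "\<exists>y\<in>{0..1} \<inter> \<rat>. dist y c < e"
            by (intro bexI[of _ q]) (auto simp: dist_real_def)
        qed
      qed
    qed
    show "continuous_on (closure ({0..1} \<inter> \<rat>)) (\<lambda>a. Y a - (integral {0..a} (\<lambda>x. complex_of_real (r x) * Y x) + integral {0..a} v))"
      unfolding * by (rule continuous_on_diff[OF Yc indef_int_continuous[OF I]])
    show "a \<in> closure ({0..1} \<inter> \<rat>)" using a * by simp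
    fix b :: real assume "b \<in> {0..1} \<inter> \<rat>"
    then obtain k where "b = qn k" using qn(2) by (metis imageE)
    then show "Y b - (integral {0..b} (\<lambda>x. complex_of_real (r x) * Y x) + integral {0..b} v) = 0"
      using at_q[of k] by simp
  qed
  have "indef_int (\<lambda>x. complex_of_real (r x) * Y x + v x) Y"
    by (rule indef_int_cong_AE[OF I]) (use eq in auto)
  moreover have "Y 0 = 0" using eq[of 0] by simp
  ultimately show thesis
    using that[of v] v(2,3) unfolding qsol_def z_def by simp
qed

text \<open>Pontryagin's theorem for the pencil: if the form of \<open>- T_M(mu)\<close> is not positive definite, then
  \<open>T_M\<close> has an eigenvalue \<open>mu + d\<close> of nonpositive type.  It is obtained as a limit of
  eigenvalues of Galerkin approximations.\<close>

theorem nonpositive_type_eigenpair: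
  assumes fp: "form_pair y0 u0" and nz: "integral {0..1} (\<lambda>x. y0 x * cnj (y0 x)) \<noteq> 0"
    and neg: "Re (integral {0..1} (\<lambda>x. u0 x * cnj (u0 x) - w (complex_of_real mu) x * (y0 x * cnj (y0 x)))) \<le> 0"
  obtains d y v where "qsol r (w (complex_of_real mu + d)) (\<lambda>x. 0) y v" "y 0 = 0" "v 1 = 0"
    "0 < Re (integral {0..1} (\<lambda>x. y x * cnj (y x)))"
    "Re (d\<^sup>2 * integral {0..1} (\<lambda>x. y x * cnj (y x)) - d * integral {0..1} (\<lambda>x. rho mu x * (y x * cnj (y x)))) +
      (norm d)\<^sup>2 * Re (integral {0..1} (\<lambda>x. y x * cnj (y x))) \<le> 0"
proof -
  define N where "N = (\<lambda>y. integral {0..1} (\<lambda>x::real. y x * cnj (y x) :: complex))"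
  define Bq where "Bq = (\<lambda>y. integral {0..1} (\<lambda>x. rho mu x * (y x * cnj (y x))))"
  define Wq where "Wq = (\<lambda>y. integral {0..1} (\<lambda>x. w (complex_of_real mu) x * (y x * cnj (y x))))"
  define PP where "PP = (\<lambda>n \<delta> y u. form_pair y u \<and> integral {0..1} (\<lambda>x. (norm (u x))\<^sup>2) = 1 \<and>
    (\<forall>k<n. integral {0..qn k} u = integral {0..1} (\<lambda>x. w (complex_of_real mu + \<delta>) x * y x * hat (qn k) x)) \<and>
    \<delta>\<^sup>2 * N y - \<delta> * Bq y = 1 - Wq y \<and> Re (1 - Wq y) + (norm \<delta>)\<^sup>2 * Re (N y) \<le> 0)"
  have "\<forall>n. \<exists>\<delta> y u. PP n \<delta> y u"
    unfolding PP_def N_def Bq_def Wq_def using galerkin_step[OF fp nz neg] by blast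
  then obtain \<delta> y u where PP: "\<And>n. PP n (\<delta> n) (y n) (u n)"
    by metis
  have fpn: "\<And>n. form_pair (y n) (u n)" and un: "\<And>n. integral {0..1} (\<lambda>x. (norm (u n x))\<^sup>2) = 1"
    and hat: "\<And>n k. k < n \<Longrightarrow> integral {0..qn k} (u n) = integral {0..1} (\<lambda>x. w (complex_of_real mu + \<delta> n) x * y n x * hat (qn k) x)"
    and eqn: "\<And>n. (\<delta> n)\<^sup>2 * N (y n) - \<delta> n * Bq (y n) = 1 - Wq (y n)"
    and len: "\<And>n. Re (1 - Wq (y n)) + (norm (\<delta> n))\<^sup>2 * Re (N (y n)) \<le> 0"
    using PP unfolding PP_def by blast+
  obtain M where M: "0 < M" "\<And>x. x \<in> {0..1} \<Longrightarrow> norm (eR x) \<le> M"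
    "\<And>y u a b. form_pair y u \<Longrightarrow> 0 \<le> a \<Longrightarrow> a \<le> b \<Longrightarrow> b \<le> 1 \<Longrightarrow>
       norm (eM b * y b - eM a * y a) \<le> M * sqrt (b - a) * sqrt (integral {0..1} (\<lambda>x. (norm (u x))\<^sup>2))"
    using form_pair_bounds by metis
  \<comment> \<open>Arzela-Ascoli is applied to \<open>eM * y n\<close>, for which the Hoelder bound
    is uniform in \<open>n\<close>; multiplication by \<open>eR\<close> returns to
    \<open>y n\<close>.\<close>
  define G where "G = (\<lambda>n x. eM x * y n x)"
  have Gd: "norm (G n b - G n a) \<le> M * sqrt \<bar>b - a\<bar>" if "a \<in> {0..1}" "b \<in> {0..1}" for n a b
  proof (cases "a \<le> b")
    case True
    then show ?thesis using M(3)[OF fpn[of n], of a b] that un[of n] by (simp add: G_def)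
  next
    case False
    then show ?thesis using M(3)[OF fpn[of n], of b a] that un[of n] by (simp add: G_def norm_minus_commute)
  qed
  have G0: "G n 0 = 0" for n using fpn[of n] by (simp add: G_def form_pair_def)
  obtain G' k0 where G': "continuous_on {0..1} G'" "strict_mono (k0 :: nat \<Rightarrow> nat)"
    "\<And>e. 0 < e \<Longrightarrow> \<exists>N. \<forall>n x. n \<ge> N \<and> x \<in> {0..1} \<longrightarrow> norm (G (k0 n) x - G' x) < e"
  proof (rule Arzela_Ascoli[of "{0..1}" G M])
    show "norm (G n x) \<le> M" if "x \<in> {0..1}" for n x
    proof -
      have "norm (G n x) \<le> M * sqrt \<bar>x - 0\<bar>" using Gd[of 0 x n] G0[of n] that by simp
      also have "\<dots> \<le> M * 1" using that M(1) by (intro mult_left_mono) auto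
      finally show ?thesis by simp
    qed
    show "\<exists>d>0. \<forall>n y. y \<in> {0..1} \<and> norm (x - y) < d \<longrightarrow> norm (G n x - G n y) < e" if "x \<in> {0..1}" "0 < e" for x e
    proof (intro exI[of _ "(e / M)\<^sup>2"] conjI allI impI)
      show "0 < (e / M)\<^sup>2" using that M(1) by simp
      fix n y assume y: "y \<in> {0..1} \<and> norm (x - y) < (e / M)\<^sup>2"
      then have "sqrt \<bar>x - y\<bar> < e / M"
        using that M(1) by (intro real_less_lsqrt) auto
      then have "M * sqrt \<bar>x - y\<bar> < e" using M(1) by (simp add: field_simps)
      then show "norm (G n x - G n y) < e" using Gd[of y x n] that y by simp
    qed
  qed (use compact_Icc in auto)
  define Y where "Y = (\<lambda>x. eR x * G' x)"
  have Yc: "continuous_on {0..1} Y" unfolding Y_def by (intro continuous_on_mult eR_cont G')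
  have ul0: "uniform_limit {0..1} (\<lambda>n. y (k0 n)) Y sequentially"
    unfolding uniform_limit_sequentially_iff
  proof (intro allI impI)
    fix e :: real assume e: "e > 0"
    then have "0 < e / M" using M(1) by simp
    then obtain N where N: "\<And>n x. n \<ge> N \<Longrightarrow> x \<in> {0..1} \<Longrightarrow> norm (G (k0 n) x - G' x) < e / M"
      using G'(3) by blast
    have "dist (y (k0 n) x) (Y x) < e" if "n \<ge> N" "x \<in> {0..1}" for n x
    proof -
      have "y (k0 n) x = eR x * G (k0 n) x" by (simp add: G_def mult.assoc[symmetric] eR_eM)
      then have "norm (y (k0 n) x - Y x) = norm (eR x) * norm (G (k0 n) x - G' x)"
        by (simp add: Y_def right_diff_distrib[symmetric] norm_mult)
      also have "\<dots> \<le> M * norm (G (k0 n) x - G' x)" using M(2)[OF that(2)] by (intro mult_right_mono) auto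
      also have "\<dots> < e" using N[OF that] M(1) by (simp add: field_simps)
      finally show ?thesis by (simp add: dist_norm)
    qed
    then show "\<exists>N. \<forall>n\<ge>N. \<forall>x\<in>{0..1}. dist (y (k0 n) x) (Y x) < e" by blast
  qed
  have bddY: "bounded (Y ` {0..1})" by (rule compact_imp_bounded[OF compact_continuous_image[OF Yc compact_Icc]])
  have bddY': "bounded ((\<lambda>x. cnj (Y x)) ` {0..1})"
    by (rule compact_imp_bounded[OF compact_continuous_image[OF continuous_on_cnj[OF Yc] compact_Icc]])
  have ulc: "uniform_limit {0..1} (\<lambda>n x. cnj (y (k0 n) x)) (\<lambda>x. cnj (Y x)) sequentially"
    using ul0 unfolding uniform_limit_sequentially_iff by (simp add: dist_norm flip: complex_cnj_diff)
  have ul2: "uniform_limit {0..1} (\<lambda>n x. y (k0 n) x * cnj (y (k0 n) x)) (\<lambda>x. Y x * cnj (Y x)) sequentially"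
    by (rule uniform_lim_mult[OF ul0 ulc bddY bddY'])
  have lim: "(\<lambda>n. integral {0..1} (\<lambda>x. a x * (y (k0 n) x * cnj (y (k0 n) x)))) \<longlonglongrightarrow> integral {0..1} (\<lambda>x. a x * (Y x * cnj (Y x)))"
    if "a absolutely_integrable_on {0..1}" for a
  proof (rule indef_int_weighted_limit[OF that _ _ ul2])
    show "continuous_on {0..1} (\<lambda>x. y (k0 n) x * cnj (y (k0 n) x))" for n
      by (intro continuous_on_mult continuous_on_cnj form_pair_y_cont[OF fpn])
    show "continuous_on {0..1} (\<lambda>x. Y x * cnj (Y x))" by (intro continuous_on_mult continuous_on_cnj Yc)
  qed auto
  have limW: "(\<lambda>n. Wq (y (k0 n))) \<longlonglongrightarrow> Wq Y" unfolding Wq_def by (rule lim[OF w_int])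
  have limB: "(\<lambda>n. Bq (y (k0 n))) \<longlonglongrightarrow> Bq Y" unfolding Bq_def by (rule lim[OF rho_int])
  have limN: "(\<lambda>n. N (y (k0 n))) \<longlonglongrightarrow> N Y"
    using lim[of "\<lambda>x. 1"] absolutely_integrable_continuous_real[OF continuous_on_const[of "{0..1}" "1::complex"]]
    by (simp add: N_def)
  have Nre: "N f = complex_of_real (integral {0..1} (\<lambda>x. (norm (f x))\<^sup>2))" "0 \<le> Re (N f)" if "continuous_on {0..1} f" for f
  proof -
    note fL = L2_continuous[OF that]
    show *: "N f = complex_of_real (integral {0..1} (\<lambda>x. (norm (f x))\<^sup>2))"
      unfolding N_def by (rule integral_norm_square[OF fL])
    show "0 \<le> Re (N f)" using integral_nonneg_01[OF L2_absolutely_integrable(2)[OF fL], of 0 1] by (simp add: *)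
  qed
  note yc = form_pair_y_cont[OF fpn]
  \<comment> \<open>Since the integral of \<open>norm (u n) ^ 2\<close> is 1, nonpositivity of the
    form bounds its potential part from below. The bound survives the uniform limit and makes
    \<open>Y\<close> nonzero; this in turn keeps the numbers \<open>\<delta> n\<close> bounded along
    the subsequence.\<close>
  have Wge: "1 \<le> Re (Wq (y n))" for n
  proof -
    have "0 \<le> (norm (\<delta> n))\<^sup>2 * Re (N (y n))"
      by (rule mult_nonneg_nonneg[OF zero_le_power2 Nre(2)[OF yc]])
    moreover have "Re (1 - Wq (y n)) = 1 - Re (Wq (y n))" by simp
    ultimately show ?thesis using len[of n] by linarith
  qed
  have "1 \<le> Re (Wq Y)"
    by (rule tendsto_lowerbound[OF tendsto_Re[OF limW]]) (use Wge in auto)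
  moreover have "Wq Y = 0" if "Re (N Y) = 0"
  proof -
    have "integral {0..1} (\<lambda>x. (norm (Y x))\<^sup>2) = 0" using that Nre(1)[OF Yc] by simp
    then have "Y x = 0" if "x \<in> {0..1}" for x using integral_norm_square_zero[OF Yc _ that] by blast
    then have "Wq Y = integral {0..1} (\<lambda>x::real. 0)" unfolding Wq_def by (intro integral_cong) simp
    then show ?thesis by simp
  qed
  ultimately have NY: "0 < Re (N Y)" using Nre(2)[OF Yc] by fastforce
  have limNr: "(\<lambda>n. Re (N (y (k0 n)))) \<longlonglongrightarrow> Re (N Y)" by (rule tendsto_Re[OF limN])
  have "eventually (\<lambda>n. Re (N Y) / 2 < Re (N (y (k0 n)))) sequentially"
    using NY by (intro order_tendstoD(1)[OF limNr]) auto
  moreover have "eventually (\<lambda>n. Re (Wq (y (k0 n))) < Re (Wq Y) + 1) sequentially"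
    by (intro order_tendstoD(2)[OF tendsto_Re[OF limW]]) auto
  ultimately have "eventually (\<lambda>n. (norm (\<delta> (k0 n)))\<^sup>2 \<le> Re (Wq Y) / (Re (N Y) / 2)) sequentially"
  proof eventually_elim
    case (elim n)
    have "(norm (\<delta> (k0 n)))\<^sup>2 * (Re (N Y) / 2) \<le> (norm (\<delta> (k0 n)))\<^sup>2 * Re (N (y (k0 n)))"
      using elim(1) by (intro mult_left_mono) auto
    also have "\<dots> \<le> Re (Wq Y)" using len[of "k0 n"] elim(2) by simp
    finally show ?case using NY by (simp add: field_simps)
  qed
  then obtain n0 where n0: "\<And>n. n \<ge> n0 \<Longrightarrow> (norm (\<delta> (k0 n)))\<^sup>2 \<le> Re (Wq Y) / (Re (N Y) / 2)"
    by (auto simp: eventually_sequentially)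
  have "norm (\<delta> (k0 (n + n0))) \<le> sqrt (Re (Wq Y) / (Re (N Y) / 2))" for n
    by (rule real_le_rsqrt[OF n0]) simp
  then have "bounded (range (\<lambda>n. \<delta> (k0 (n + n0))))" unfolding bounded_iff by blast
  then obtain d k1 where k1: "strict_mono (k1 :: nat \<Rightarrow> nat)" "((\<lambda>n. \<delta> (k0 (n + n0))) \<circ> k1) \<longlonglongrightarrow> d"
    using bounded_imp_convergent_subsequence by blast
  define s where "s = (\<lambda>n. k1 n + n0)"
  have s: "strict_mono s" using k1(1) by (simp add: s_def strict_mono_def)
  define \<kappa> where "\<kappa> = (\<lambda>n. k0 (s n))"
  have \<kappa>: "strict_mono \<kappa>" using s G'(2) by (simp add: \<kappa>_def strict_mono_def)
  have sub: "(\<lambda>n. f (s n)) \<longlonglongrightarrow> l" if "f \<longlonglongrightarrow> l" for f :: "nat \<Rightarrow> complex" and l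
    using LIMSEQ_subseq_LIMSEQ[OF that s] by (simp add: o_def)
  have ul: "uniform_limit {0..1} (\<lambda>n. y (\<kappa> n)) Y sequentially"
    unfolding \<kappa>_def using ul0 filterlim_subseq[OF s] by (rule filterlim_compose[where f = s and g = "\<lambda>n. y (k0 n)"])
  have dl: "(\<lambda>n. \<delta> (\<kappa> n)) \<longlonglongrightarrow> d" using k1(2) by (simp add: \<kappa>_def s_def o_def)
  obtain v where v: "qsol r (w (complex_of_real mu + d)) (\<lambda>x. 0) Y v" "Y 0 = 0" "v 1 = 0"
    by (rule weak_limit[OF fpn hat ul Yc \<kappa> dl])
  have lN: "(\<lambda>n. N (y (\<kappa> n))) \<longlonglongrightarrow> N Y" unfolding \<kappa>_def by (rule sub[OF limN])
  have lB: "(\<lambda>n. Bq (y (\<kappa> n))) \<longlonglongrightarrow> Bq Y" unfolding \<kappa>_def by (rule sub[OF limB])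
  have "(\<lambda>n. Re ((\<delta> (\<kappa> n))\<^sup>2 * N (y (\<kappa> n)) - \<delta> (\<kappa> n) * Bq (y (\<kappa> n))) + (norm (\<delta> (\<kappa> n)))\<^sup>2 * Re (N (y (\<kappa> n))))
      \<longlonglongrightarrow> Re (d\<^sup>2 * N Y - d * Bq Y) + (norm d)\<^sup>2 * Re (N Y)"
    by (intro tendsto_intros dl lN lB)
  then have "Re (d\<^sup>2 * N Y - d * Bq Y) + (norm d)\<^sup>2 * Re (N Y) \<le> 0"
    by (rule tendsto_upperbound) (use len eqn in auto)
  then show thesis
    using that[OF v] NY unfolding N_def Bq_def by blast
qed

end

subsection \<open>The Pruefer angle\<close>

lemma absolutely_integrable_L2_square:
  fixes f :: "real \<Rightarrow> real"
  assumes "f \<in> L2"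
  shows "(\<lambda>x. (f x)\<^sup>2) absolutely_integrable_on {0..1}"
  using L2_absolutely_integrable(2)[OF assms] by simp

lemma absolutely_integrable_abs_01:
  fixes f :: "real \<Rightarrow> real"
  assumes "f absolutely_integrable_on {0..1}"
  shows "(\<lambda>x. \<bar>f x\<bar>) absolutely_integrable_on {0..1}"
  using absolutely_integrable_norm[OF assms] by (simp add: o_def)

lemma const_int_01: "(\<lambda>x::real. c :: real) absolutely_integrable_on {0..1}"
  by (rule absolutely_integrable_continuous_real[OF continuous_on_const])

context pencil_data
begin

abbreviation "sY l \<equiv> sy (complex_of_real l)"
abbreviation "sU l \<equiv> su (complex_of_real l)"
definition "ys l x = Re (sY l x)"
definition "us l x = Re (sU l x)"

lemma shot_real:
  assumes "x \<in> {0..1}"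
  shows "sY l x = complex_of_real (ys l x)" "sU l x = complex_of_real (us l x)"
proof -
  have "cnj (w (complex_of_real l) x) = w (complex_of_real l) x" for x by (simp add: pot_def)
  then have "qsol r (w (complex_of_real l)) (\<lambda>x. 0) (\<lambda>x. cnj (sY l x)) (\<lambda>x. cnj (sU l x))"
    using qsol_cnj[OF shot(1)[of "complex_of_real l"]] by simp
  from qsol_unique[OF r_int w_int this shot(1) _ _ assms] shot(2,3)
  have "cnj (sY l x) = sY l x" "cnj (sU l x) = sU l x" by simp_all
  then show "sY l x = complex_of_real (ys l x)" "sU l x = complex_of_real (us l x)"
    by (auto simp: ys_def us_def complex_eq_iff)
qed

lemma w_diff: "w z' x - w z x = (z' - z) * (z' + z - 2 * complex_of_real (p x))"
  by (simp add: pot_def power2_eq_square algebra_simps)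

lemma norm_w_le: "norm (w (complex_of_real l) x) \<le> (r x)\<^sup>2 + l\<^sup>2 + 2 * \<bar>l\<bar> * \<bar>p x\<bar>"
proof -
  have "w (complex_of_real l) x = complex_of_real ((r x)\<^sup>2 + l\<^sup>2 - 2 * l * p x)" by (simp add: pot_def)
  then have "norm (w (complex_of_real l) x) = \<bar>(r x)\<^sup>2 + l\<^sup>2 - 2 * l * p x\<bar>" by (simp only: norm_of_real)
  also have "\<dots> \<le> \<bar>(r x)\<^sup>2 + l\<^sup>2\<bar> + \<bar>2 * l * p x\<bar>" by (rule abs_triangle_ineq4)
  also have "\<dots> = (r x)\<^sup>2 + l\<^sup>2 + 2 * \<bar>l\<bar> * \<bar>p x\<bar>" by (simp add: abs_mult)
  finally show ?thesis .
qed

text \<open>The difference of two shooting solutions has zero initial data and solves the system at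
  \<open>l\<close> with a right-hand side of order \<open>l - l0\<close>. For
  \<open>\<bar>l - l0\<bar> \<le> 1\<close> the function \<open>b\<close> bounds the exponent of the
  a priori estimate uniformly.\<close>

lemma shot_lipschitz:
  obtains K where "0 \<le> K" "\<And>l x. \<bar>l - l0\<bar> \<le> 1 \<Longrightarrow> x \<in> {0..1} \<Longrightarrow>
    norm (sY l x - sY l0 x) + norm (sU l x - sU l0 x) \<le> K * \<bar>l - l0\<bar>"
proof -
  obtain M where M: "0 \<le> M" "\<And>x. x \<in> {0..1} \<Longrightarrow> norm (sY l0 x) \<le> M"
    using indef_int_bounded[OF qsol_y[OF shot(1)]] by blast
  note ia = absolutely_integrable_abs_01[OF r_int] absolutely_integrable_abs_01[OF p_int] absolutely_integrable_L2_square[OF r_L2]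
  define b where "b = (\<lambda>t. 2 * \<bar>r t\<bar> + ((r t)\<^sup>2 + (\<bar>l0\<bar> + 1)\<^sup>2 + 2 * (\<bar>l0\<bar> + 1) * \<bar>p t\<bar>) + 1)"
  have b: "b absolutely_integrable_on {0..1}"
    unfolding b_def by (intro set_integral_add set_integrable_mult_right ia const_int_01)
  define g where "g = (\<lambda>t. (2 * \<bar>l0\<bar> + 1 + 2 * \<bar>p t\<bar>) * M)"
  have g: "g absolutely_integrable_on {0..1}"
    unfolding g_def by (intro set_integral_add set_integrable_mult_left set_integrable_mult_right ia const_int_01)
  have g0: "0 \<le> g t" for t using M(1) by (simp add: g_def)
  define K where "K = 2 * integral {0..1} g * exp (2 * integral {0..1} b)"
  have "norm (sY l x - sY l0 x) + norm (sU l x - sU l0 x) \<le> K * \<bar>l - l0\<bar>"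
    if l: "\<bar>l - l0\<bar> \<le> 1" and x: "x \<in> {0..1}" for l x
  proof -
    define f where "f = (\<lambda>t. - ((w (complex_of_real l) t - w (complex_of_real l0) t) * sY l0 t))"
    have q0: "qsol r (w (complex_of_real l)) (\<lambda>t. (w (complex_of_real l) t - w (complex_of_real l0) t) * sY l0 t) (sY l0) (sU l0)"
      using qsol_change_w[OF shot(1)[of "complex_of_real l0"], of "w (complex_of_real l)"] by simp
    have q: "qsol r (w (complex_of_real l)) f (\<lambda>x. sY l x - sY l0 x) (\<lambda>x. sU l x - sU l0 x)"
      using qsol_lincomb[OF shot(1)[of "complex_of_real l"] q0, where c = 1 and d = "-1"] by (simp add: f_def)
    have wl: "(\<lambda>t. w (complex_of_real l) t - w (complex_of_real l0) t) absolutely_integrable_on {0..1}"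
      by (rule set_integral_diff(1)[OF w_int w_int])
    have f: "f absolutely_integrable_on {0..1}"
      using set_integrable_mult_right[of "-1" lebesgue "{0..1}" "\<lambda>t. (w (complex_of_real l) t - w (complex_of_real l0) t) * sY l0 t"]
        absolutely_integrable_continuous_mult[OF wl qsol_cont_y[OF shot(1)]]
      by (simp add: f_def)
    have nf: "(\<lambda>t. norm (f t)) absolutely_integrable_on {0..1}" using absolutely_integrable_norm[OF f] by (simp add: o_def)
    have "integral {0..1} (\<lambda>t. norm (f t)) \<le> integral {0..1} (\<lambda>t. \<bar>l - l0\<bar> * g t)"
    proof (rule integral_le_01[OF nf])
      show "(\<lambda>t. \<bar>l - l0\<bar> * g t) absolutely_integrable_on {0..1}" using g by (intro set_integrable_mult_right)
      fix t :: real assume t: "t \<in> {0..1}"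
      have "norm (complex_of_real l + complex_of_real l0 - 2 * complex_of_real (p t)) = \<bar>l + l0 - 2 * p t\<bar>"
        by (metis (no_types, opaque_lifting) norm_of_real of_real_add of_real_diff of_real_mult of_real_numeral)
      also have "\<dots> \<le> 2 * \<bar>l0\<bar> + 1 + 2 * \<bar>p t\<bar>" using l by linarith
      finally have *: "norm (complex_of_real l + complex_of_real l0 - 2 * complex_of_real (p t)) \<le> 2 * \<bar>l0\<bar> + 1 + 2 * \<bar>p t\<bar>" .
      have "norm (complex_of_real l - complex_of_real l0) = \<bar>l - l0\<bar>" by (metis norm_of_real of_real_diff)
      then have "norm (f t) = \<bar>l - l0\<bar> * (norm (complex_of_real l + complex_of_real l0 - 2 * complex_of_real (p t)) * norm (sY l0 t))"
        by (simp add: f_def w_diff norm_mult mult.assoc)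
      also have "\<dots> \<le> \<bar>l - l0\<bar> * ((2 * \<bar>l0\<bar> + 1 + 2 * \<bar>p t\<bar>) * M)"
        using * M(2)[OF t] by (intro mult_left_mono mult_mono) auto
      finally show "norm (f t) \<le> \<bar>l - l0\<bar> * g t" by (simp add: g_def)
    qed auto
    then have If: "integral {0..1} (\<lambda>t. norm (f t)) \<le> \<bar>l - l0\<bar> * integral {0..1} g" by simp
    have "integral {0..1} (\<lambda>t. 2 * \<bar>r t\<bar> + norm (w (complex_of_real l) t) + 1) \<le> integral {0..1} b"
    proof (rule integral_le_01[OF _ b])
      show "(\<lambda>t. 2 * \<bar>r t\<bar> + norm (w (complex_of_real l) t) + 1) absolutely_integrable_on {0..1}"
        using absolutely_integrable_norm[OF w_int[of "complex_of_real l"]]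
        by (intro set_integral_add set_integrable_mult_right ia const_int_01) (simp add: o_def)
      fix t :: real
      have ll: "\<bar>l\<bar> \<le> \<bar>l0\<bar> + 1" using l by linarith
      then have "l\<^sup>2 \<le> (\<bar>l0\<bar> + 1)\<^sup>2" by (metis abs_ge_zero power2_abs power_mono)
      moreover have "2 * \<bar>l\<bar> * \<bar>p t\<bar> \<le> 2 * (\<bar>l0\<bar> + 1) * \<bar>p t\<bar>" using ll by (intro mult_right_mono) auto
      ultimately show "2 * \<bar>r t\<bar> + norm (w (complex_of_real l) t) + 1 \<le> b t"
        using norm_w_le[of l t] by (simp add: b_def)
    qed auto
    then have ex: "exp (2 * integral {0..1} (\<lambda>t. 2 * \<bar>r t\<bar> + norm (w (complex_of_real l) t) + 1)) \<le> exp (2 * integral {0..1} b)"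
      by simp
    have "norm (sY l x - sY l0 x) + norm (sU l x - sU l0 x) \<le>
        2 * integral {0..1} (\<lambda>t. norm (f t)) * exp (2 * integral {0..1} (\<lambda>t. 2 * \<bar>r t\<bar> + norm (w (complex_of_real l) t) + 1))"
      using qsol_bound[OF r_int w_int f q x] shot(2,3) by simp
    also have "\<dots> \<le> 2 * (\<bar>l - l0\<bar> * integral {0..1} g) * exp (2 * integral {0..1} b)"
      using If ex integral_nonneg_01[OF nf, of 0 1] integral_nonneg_01[OF g, of 0 1] g0
      by (intro mult_mono) auto
    also have "\<dots> = K * \<bar>l - l0\<bar>" by (simp add: K_def)
    finally show ?thesis .
  qed
  moreover have "0 \<le> K" unfolding K_def using integral_nonneg_01[OF g, of 0 1] g0 by simp
  ultimately show thesis using that by blast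
qed

lemma shot_uniform_limit:
  assumes "sq \<longlonglongrightarrow> l"
  shows "uniform_limit {0..1} (\<lambda>n. sY (sq n)) (sY l) sequentially" "uniform_limit {0..1} (\<lambda>n. sU (sq n)) (sU l) sequentially"
proof -
  obtain K where K: "0 \<le> K" "\<And>l' x. \<bar>l' - l\<bar> \<le> 1 \<Longrightarrow> x \<in> {0..1} \<Longrightarrow>
    norm (sY l' x - sY l x) + norm (sU l' x - sU l x) \<le> K * \<bar>l' - l\<bar>"
    using shot_lipschitz[of l] by blast
  have *: "\<exists>N. \<forall>n\<ge>N. \<forall>x\<in>{0..1}. norm (sY (sq n) x - sY l x) + norm (sU (sq n) x - sU l x) < e" if e: "e > 0" for e
  proof -
    have "0 < min 1 (e / (K + 1))" using e K(1) by simp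
    then obtain N where N: "\<And>n. n \<ge> N \<Longrightarrow> norm (sq n - l) < min 1 (e / (K + 1))"
      using LIMSEQ_D[OF assms] by blast
    have "norm (sY (sq n) x - sY l x) + norm (sU (sq n) x - sU l x) < e" if n: "n \<ge> N" and x: "x \<in> {0..1}" for n x
    proof -
      have "norm (sY (sq n) x - sY l x) + norm (sU (sq n) x - sU l x) \<le> K * \<bar>sq n - l\<bar>"
        using K(2)[OF _ x] N[OF n] by simp
      also have "\<dots> \<le> (K + 1) * \<bar>sq n - l\<bar>" by (simp add: distrib_right)
      also have "\<dots> < e" using N[OF n] K(1) by (simp add: field_simps)
      finally show ?thesis .
    qed
    then show ?thesis by blast
  qed
  show "uniform_limit {0..1} (\<lambda>n. sY (sq n)) (sY l) sequentially"
    unfolding uniform_limit_sequentially_iff dist_norm using * by (meson add_increasing2 le_less_trans norm_ge_zero order_refl)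
  show "uniform_limit {0..1} (\<lambda>n. sU (sq n)) (sU l) sequentially"
    unfolding uniform_limit_sequentially_iff dist_norm using * by (meson add_increasing le_less_trans norm_ge_zero order_refl)
qed

section \<open>Boundary values and their Wronskian\<close>

definition "Ye l = ys l 1"
definition "Ue l = us l 1"
text \<open>The Wronskian at 1 of the shooting solutions for \<open>l\<close> and \<open>l'\<close>,
  divided by \<open>l' - l\<close>. On the diagonal it is \<open>Dz\<close>, whose sign decides the
  direction in which the angle crosses.\<close>

definition "DD l l' = Re (integral {0..1} (\<lambda>x. (complex_of_real (l + l') - 2 * complex_of_real (p x)) * (sY l x * sY l' x)))"

lemma bdry_real: "bdry b (sY l) (sU l) = complex_of_real (if b then Ye l else Ue l)"
  using shot_real[of 1 l] by (simp add: bdry_def Ye_def Ue_def)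

lemma wronskian_real: "Ue l * Ye l' - Ye l * Ue l' = (l' - l) * DD l l'"
proof -
  have "indef_int (\<lambda>x. (w (complex_of_real l') x - w (complex_of_real l) x) * (sY l x * sY l' x)) (\<lambda>x. sU l x * sY l' x - sY l x * sU l' x)"
    using qsol_wronskian[OF shot(1)[of "complex_of_real l"] shot(1)[of "complex_of_real l'"]] by simp
  from indef_int_integral[OF this, of 0 1]
  have "integral {0..1} (\<lambda>x. (w (complex_of_real l') x - w (complex_of_real l) x) * (sY l x * sY l' x)) = sU l 1 * sY l' 1 - sY l 1 * sU l' 1"
    using shot by simp
  also have "\<dots> = complex_of_real (Ue l * Ye l' - Ye l * Ue l')"
    using shot_real[of 1 l] shot_real[of 1 l'] by (simp add: Ye_def Ue_def)
  also have "integral {0..1} (\<lambda>x. (w (complex_of_real l') x - w (complex_of_real l) x) * (sY l x * sY l' x)) =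
      integral {0..1} (\<lambda>x. complex_of_real (l' - l) * ((complex_of_real (l + l') - 2 * complex_of_real (p x)) * (sY l x * sY l' x)))"
    by (rule integral_cong) (simp add: w_diff add.commute mult.assoc)
  also have "\<dots> = complex_of_real (l' - l) * integral {0..1} (\<lambda>x. (complex_of_real (l + l') - 2 * complex_of_real (p x)) * (sY l x * sY l' x))"
    by simp
  finally have "Re (complex_of_real (l' - l) * integral {0..1} (\<lambda>x. (complex_of_real (l + l') - 2 * complex_of_real (p x)) * (sY l x * sY l' x)))
      = Ue l * Ye l' - Ye l * Ue l'" by (metis Re_complex_of_real)
  then show ?thesis by (simp add: DD_def)
qed

text \<open>Continuity in the second argument at the diagonal carries the sign of
  \<open>DD l l\<close> over to Wronskians with nearby parameters.\<close>

lemma DD_cont: "isCont (DD l) l"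
  unfolding continuous_at_sequentially
proof (intro allI impI)
  fix sq :: "nat \<Rightarrow> real" assume sq: "sq \<longlonglongrightarrow> l"
  define a where "a = (\<lambda>x. (complex_of_real l - 2 * complex_of_real (p x)) * sY l x)"
  have cY: "continuous_on {0..1} (sY l)" for l by (rule qsol_cont_y[OF shot(1)])
  have "(\<lambda>x. complex_of_real l - 2 * complex_of_real (p x)) absolutely_integrable_on {0..1}"
    by (intro set_integral_diff(1) set_integrable_mult_right absolutely_integrable_of_real[OF p_int]
        absolutely_integrable_continuous_real[OF continuous_on_const])
  then have a: "a absolutely_integrable_on {0..1}" unfolding a_def by (rule absolutely_integrable_continuous_mult[OF _ cY])
  have s: "sY l absolutely_integrable_on {0..1}" by (rule absolutely_integrable_continuous_real[OF cY])
  have eq: "integral {0..1} (\<lambda>x. (complex_of_real (l + l') - 2 * complex_of_real (p x)) * (sY l x * sY l' x)) =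
      integral {0..1} (\<lambda>x. a x * sY l' x) + complex_of_real l' * integral {0..1} (\<lambda>x. sY l x * sY l' x)" for l'
  proof -
    have "(\<lambda>x. (complex_of_real (l + l') - 2 * complex_of_real (p x)) * (sY l x * sY l' x)) =
        (\<lambda>x. a x * sY l' x + complex_of_real l' * (sY l x * sY l' x))"
      by (simp add: a_def algebra_simps)
    then show ?thesis
      using integral_add_cmult_01[OF absolutely_integrable_continuous_mult[OF a cY] absolutely_integrable_continuous_mult[OF s cY]]
      by simp
  qed
  note lim = indef_int_weighted_limit[where g = "\<lambda>n. sY (sq n)", OF _ cY cY shot_uniform_limit(1)[OF sq]]
  have "(\<lambda>n. DD l (sq n)) \<longlonglongrightarrow> DD l l"
    unfolding DD_def eq by (intro tendsto_intros lim a s sq) auto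
  then show "(DD l \<circ> sq) \<longlonglongrightarrow> DD l l" by (simp add: o_def)
qed

lemma Dz_real: "Dz (complex_of_real l) = complex_of_real (DD l l)"
proof -
  have "Dz (complex_of_real l) = integral {0..1} (\<lambda>x. (complex_of_real (l + l) - 2 * complex_of_real (p x)) * (sY l x * sY l x))"
    unfolding Dz_def by (rule integral_cong) (simp add: power2_eq_square)
  moreover have "cnj (integral {0..1} (\<lambda>x. (complex_of_real (l + l) - 2 * complex_of_real (p x)) * (sY l x * sY l x))) =
      integral {0..1} (\<lambda>x. (complex_of_real (l + l) - 2 * complex_of_real (p x)) * (sY l x * sY l x))"
    unfolding integral_cnj by (rule integral_cong) (simp add: shot_real)
  ultimately show ?thesis by (simp add: DD_def complex_eq_iff)
qed

lemma simple_iff_DD: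
  assumes "bdry b (sY l) (sU l) = 0"
  shows "pencil_simple_eigenvalue (dom_bc r b) T (complex_of_real l) \<longleftrightarrow> DD l l \<noteq> 0"
  using simple_imp_Dz_nonzero[OF _ assms] Dz_nonzero_imp_simple[OF assms] by (auto simp: Dz_real)

text \<open>A substitute for \<open>\<bar>l\<bar>\<close> that stays positive at 0. After scaling
  \<open>y\<close> by it the vector \<open>(u, kap l * y)\<close> turns with angular speed
  \<open>kap l\<close> up to an error independent of \<open>l\<close>.\<close>

definition "kap l = sqrt (1 + l\<^sup>2)"

lemma kap: "1 \<le> kap l" "\<bar>l\<bar> \<le> kap l" "(kap l)\<^sup>2 = 1 + l\<^sup>2" "0 < kap l"
proof -
  show "1 \<le> kap l" unfolding kap_def by simp
  then show "0 < kap l" by simp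
  show "(kap l)\<^sup>2 = 1 + l\<^sup>2" unfolding kap_def by (simp add: add_nonneg_nonneg)
  show "\<bar>l\<bar> \<le> kap l" unfolding kap_def by (rule real_le_rsqrt) simp
qed

definition "prd l x = kap l * ((us l x)\<^sup>2 + 2 * r x * us l x * ys l x + ((r x)\<^sup>2 + l\<^sup>2 - 2 * l * p x) * (ys l x)\<^sup>2) /
  ((us l x)\<^sup>2 + (kap l)\<^sup>2 * (ys l x)\<^sup>2)"

definition "Theta l = integral {0..1} (prd l)"

lemma prd_denom: "x \<in> {0..1} \<Longrightarrow> 0 < (us l x)\<^sup>2 + (kap l)\<^sup>2 * (ys l x)\<^sup>2"
proof -
  assume x: "x \<in> {0..1}"
  have "ys l x \<noteq> 0 \<or> us l x \<noteq> 0"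
    using shot_nonvanishing[OF x, of "complex_of_real l"] shot_real[OF x, of l] by auto
  then show ?thesis
    using kap(4)[of l] by (auto intro: add_pos_nonneg add_nonneg_pos)
qed

text \<open>The term \<open>l^2\<close> cancels against \<open>(kap l)^2\<close> up to 1, and the
  term with \<open>l * p\<close> is absorbed because \<open>\<bar>l\<bar> \<le> kap l\<close>. The
  error being independent of \<open>l\<close>, the angle grows like \<open>kap l\<close> in both
  directions.\<close>

lemma prd_bound:
  assumes x: "x \<in> {0..1}"
  shows "\<bar>prd l x - kap l\<bar> \<le> \<bar>r x\<bar> + ((r x)\<^sup>2 + 1 + 2 * \<bar>p x\<bar>)"
proof -
  define u y k where "u = us l x" and "y = ys l x" and "k = kap l"
  define d where "d = u\<^sup>2 + k\<^sup>2 * y\<^sup>2"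
  have d: "0 < d" using prd_denom[OF x] by (simp add: d_def u_def y_def k_def)
  have k: "1 \<le> k" "\<bar>l\<bar> \<le> k" "k\<^sup>2 = 1 + l\<^sup>2" using kap[of l] by (auto simp: k_def)
  have "prd l x - k = (r x * (2 * k * u * y) + k * ((r x)\<^sup>2 - 1 - 2 * l * p x) * y\<^sup>2) / d"
    using d k(3) unfolding prd_def u_def[symmetric] y_def[symmetric] k_def[symmetric] d_def[symmetric]
    by (simp add: field_simps) (simp add: d_def algebra_simps k(3))
  also have "\<bar>\<dots>\<bar> \<le> (\<bar>r x\<bar> * d + ((r x)\<^sup>2 + 1 + 2 * \<bar>p x\<bar>) * d) / d"
    unfolding abs_divide using d
  proof (intro divide_mono)
    have 1: "\<bar>2 * k * u * y\<bar> \<le> d"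
      using sum_squares_bound[of "\<bar>u\<bar>" "\<bar>k * y\<bar>"] by (simp add: d_def abs_mult power_mult_distrib mult_ac)
    have ky: "k * y\<^sup>2 \<le> d" "k\<^sup>2 * y\<^sup>2 \<le> d"
    proof -
      show *: "k\<^sup>2 * y\<^sup>2 \<le> d" by (simp add: d_def)
      have "k \<le> k\<^sup>2" using k(1) by (simp add: power2_eq_square)
      then have "k * y\<^sup>2 \<le> k\<^sup>2 * y\<^sup>2" by (intro mult_right_mono) auto
      then show "k * y\<^sup>2 \<le> d" using * by linarith
    qed
    have "\<bar>k * ((r x)\<^sup>2 - 1 - 2 * l * p x) * y\<^sup>2\<bar> = \<bar>(r x)\<^sup>2 - 1 - 2 * l * p x\<bar> * (k * y\<^sup>2)"
      using k(1) by (simp add: abs_mult)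
    also have "\<dots> \<le> ((r x)\<^sup>2 + 1 + 2 * \<bar>l\<bar> * \<bar>p x\<bar>) * (k * y\<^sup>2)"
    proof (rule mult_right_mono)
      have "\<bar>2 * l * p x\<bar> = 2 * \<bar>l\<bar> * \<bar>p x\<bar>" by (simp add: abs_mult)
      then show "\<bar>(r x)\<^sup>2 - 1 - 2 * l * p x\<bar> \<le> (r x)\<^sup>2 + 1 + 2 * \<bar>l\<bar> * \<bar>p x\<bar>"
        using zero_le_power2[of "r x"] by linarith
    qed (use k in auto)
    also have "\<dots> = ((r x)\<^sup>2 + 1) * (k * y\<^sup>2) + 2 * \<bar>p x\<bar> * (\<bar>l\<bar> * (k * y\<^sup>2))" by (simp add: algebra_simps)
    also have "\<dots> \<le> ((r x)\<^sup>2 + 1) * d + 2 * \<bar>p x\<bar> * d"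
    proof (intro add_mono mult_left_mono)
      have "\<bar>l\<bar> * (k * y\<^sup>2) \<le> k * (k * y\<^sup>2)" using k by (intro mult_right_mono) auto
      then show "\<bar>l\<bar> * (k * y\<^sup>2) \<le> d" using ky(2) by (simp add: power2_eq_square mult.assoc)
    qed (use ky in auto)
    finally have 2: "\<bar>k * ((r x)\<^sup>2 - 1 - 2 * l * p x) * y\<^sup>2\<bar> \<le> ((r x)\<^sup>2 + 1 + 2 * \<bar>p x\<bar>) * d" by (simp add: algebra_simps)
    have "\<bar>r x * (2 * k * u * y)\<bar> \<le> \<bar>r x\<bar> * d" using 1 by (subst abs_mult) (intro mult_left_mono, auto)
    with 2 show "\<bar>r x * (2 * k * u * y) + k * ((r x)\<^sup>2 - 1 - 2 * l * p x) * y\<^sup>2\<bar> \<le> \<bar>r x\<bar> * d + ((r x)\<^sup>2 + 1 + 2 * \<bar>p x\<bar>) * d"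
      by linarith
  qed auto
  also have "\<dots> = \<bar>r x\<bar> + ((r x)\<^sup>2 + 1 + 2 * \<bar>p x\<bar>)" using d by (simp add: add_divide_distrib)
  finally show ?thesis by (simp add: k_def)
qed

text \<open>\<open>Theta\<close> is the (scaled) Pruefer angle at \<open>x = 1\<close>: with \<open>z = u + \<i> \<kappa> y\<close> we have
  \<open>z(1) = exp (\<integral> z'/z)\<close> and \<open>Theta = Im (\<integral> z'/z)\<close>.\<close>

lemma Theta_polar:
  obtains \<rho> where "0 < \<rho>" "kap l * Ye l = \<rho> * sin (Theta l)" "Ue l = \<rho> * cos (Theta l)"
    and "prd l absolutely_integrable_on {0..1}"
proof -
  define k where "k = \<i> * complex_of_real (kap l)"
  define z where "z = (\<lambda>x. sU l x + k * sY l x)"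
  define z' where "z' = (\<lambda>x. (- complex_of_real (r x) * sU l x - w (complex_of_real l) x * sY l x + 0) + k * (complex_of_real (r x) * sY l x + sU l x))"
  have Z: "indef_int z' z"
    unfolding z_def z'_def by (intro indef_int_add indef_int_cmult qsol_y[OF shot(1)] qsol_u[OF shot(1)])
  have zr: "z x = Complex (us l x) (kap l * ys l x)" if "x \<in> {0..1}" for x
    using shot_real[OF that, of l] by (simp add: z_def k_def complex_eq_iff)
  have z'r: "z' x = Complex (- r x * us l x - ((r x)\<^sup>2 + l\<^sup>2 - 2 * l * p x) * ys l x) (kap l * (r x * ys l x + us l x))" if "x \<in> {0..1}" for x
    using shot_real[OF that, of l] by (simp add: z'_def k_def pot_def complex_eq_iff power2_eq_square)
  have nz: "z x \<noteq> 0" if "x \<in> {0..1}" for x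
    using prd_denom[OF that, of l] zr[OF that] kap(4)[of l] by (auto simp: complex_eq_iff)
  have zc: "continuous_on {0..1} (\<lambda>x. inverse (z x))"
    by (intro continuous_on_inverse indef_int_continuous[OF Z]) (use nz in auto)
  define q where "q = (\<lambda>x. z' x * inverse (z x))"
  have q: "q absolutely_integrable_on {0..1}"
    unfolding q_def by (rule absolutely_integrable_continuous_mult[OF indef_int_absolutely_integrable[OF Z] zc])
  define Lq where "Lq = (\<lambda>x. integral {0..x} q)"
  have L: "indef_int q Lq" unfolding Lq_def by (rule indef_int_integral_01[OF q])
  \<comment> \<open>The product of \<open>z\<close> and \<open>exp (- Lq)\<close> has derivative 0.
    This expresses \<open>z\<close> by the integral of \<open>z' / z\<close> without choosing a
    branch of the logarithm along the curve.\<close>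
  have E: "indef_int (\<lambda>x. (-1) * q x * exp ((-1) * Lq x)) (\<lambda>x. exp ((-1) * Lq x))"
    by (rule indef_int_exp[OF indef_int_cmult[OF L]])
  have "indef_int (\<lambda>x. z x * ((-1) * q x * exp ((-1) * Lq x)) + z' x * exp ((-1) * Lq x)) (\<lambda>x. z x * exp ((-1) * Lq x))"
    by (rule indef_int_mult[OF Z E])
  moreover have "AE x in leb01. z x * ((-1) * q x * exp ((-1) * Lq x)) + z' x * exp ((-1) * Lq x) = 0"
  proof (intro AE_I2)
    fix x assume "x \<in> space leb01"
    then have "z x \<noteq> 0" using nz[of x] by auto
    then show "z x * ((-1) * q x * exp ((-1) * Lq x)) + z' x * exp ((-1) * Lq x) = 0" by (simp add: q_def)
  qed
  ultimately have "z 1 * exp ((-1) * Lq 1) = z 0 * exp ((-1) * Lq 0)"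
    by (rule indef_int_zero_const) simp
  also have "\<dots> = 1" using shot(2,3) by (simp add: z_def Lq_def)
  finally have z1: "z 1 = exp (Lq 1)" by (simp add: exp_minus field_simps)
  have imq: "Im (q x) = prd l x" if "x \<in> {0..1}" for x
  proof -
    have "q x = z' x / z x" by (simp add: q_def divide_inverse)
    then show ?thesis
      unfolding zr[OF that] z'r[OF that] prd_def
      by (simp add: Im_divide power_mult_distrib) (simp add: algebra_simps power2_eq_square)
  qed
  have "(\<lambda>x. Im (q x)) absolutely_integrable_on {0..1}"
    using absolutely_integrable_linear[OF q bounded_linear_Im] by (simp add: o_def)
  then have pi: "prd l absolutely_integrable_on {0..1}"
    by (rule absolutely_integrable_spike[OF _ negligible_empty]) (use imq in auto)
  have "Im (Lq 1) = integral {0..1} (\<lambda>x. Im (q x))"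
    using integral_linear[OF integrable_01_subinterval[OF q, of 0 1] bounded_linear_Im] by (simp add: Lq_def o_def)
  also have "\<dots> = Theta l" unfolding Theta_def by (rule integral_cong) (rule imq)
  finally have "Im (Lq 1) = Theta l" .
  then have "Re (z 1) = exp (Re (Lq 1)) * cos (Theta l)" "Im (z 1) = exp (Re (Lq 1)) * sin (Theta l)"
    by (simp_all add: z1 Re_exp Im_exp)
  then show thesis
    using zr[of 1] pi by (intro that[of "exp (Re (Lq 1))"]) (auto simp: Ye_def Ue_def)
qed

lemma prd_int: "prd l absolutely_integrable_on {0..1}"
  using Theta_polar[of l] by blast

lemma Theta_lower: obtains C where "\<And>l. kap l - C \<le> Theta l"
proof -
  define g where "g = (\<lambda>x. \<bar>r x\<bar> + ((r x)\<^sup>2 + 1 + 2 * \<bar>p x\<bar>))"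
  note ia = absolutely_integrable_abs_01[OF r_int] absolutely_integrable_abs_01[OF p_int] absolutely_integrable_L2_square[OF r_L2]
  have g: "g absolutely_integrable_on {0..1}"
    unfolding g_def by (intro set_integral_add set_integrable_mult_right ia const_int_01)
  have "kap l - integral {0..1} g \<le> Theta l" for l
  proof -
    have "kap l - integral {0..1} g = integral {0..1} (\<lambda>x. kap l - g x)"
      using integrable_01_subinterval[OF g, of 0 1] by (subst Henstock_Kurzweil_Integration.integral_diff) auto
    also have "\<dots> \<le> Theta l"
      unfolding Theta_def
    proof (rule integral_le_01[OF set_integral_diff(1)[OF const_int_01 g] prd_int])
      show "kap l - g x \<le> prd l x" if "x \<in> {0..1}" for x
        using prd_bound[OF that, of l] by (auto simp: g_def abs_le_iff)
    qed auto
    finally show ?thesis .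
  qed
  then show thesis by (rule that)
qed

lemma Theta_cont: "isCont Theta l"
  unfolding continuous_at_sequentially
proof (intro allI impI)
  fix sq :: "nat \<Rightarrow> real" assume sq: "sq \<longlonglongrightarrow> l"
  define g where "g = (\<lambda>x. \<bar>r x\<bar> + ((r x)\<^sup>2 + 1 + 2 * \<bar>p x\<bar>))"
  note ia = absolutely_integrable_abs_01[OF r_int] absolutely_integrable_abs_01[OF p_int] absolutely_integrable_L2_square[OF r_L2]
  have g: "g absolutely_integrable_on {0..1}"
    unfolding g_def by (intro set_integral_add set_integrable_mult_right ia const_int_01)
  have kl: "(\<lambda>n. kap (sq n)) \<longlonglongrightarrow> kap l" unfolding kap_def by (intro tendsto_intros sq)
  then have "Bseq (\<lambda>n. kap (sq n))" by (rule convergent_imp_Bseq[OF convergentI])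
  then obtain B where B: "\<And>n. norm (kap (sq n)) \<le> B" by (auto simp: Bseq_def)
  have "(\<lambda>n. integral {0..1} (prd (sq n))) \<longlonglongrightarrow> integral {0..1} (prd l)"
  proof (rule dominated_convergence(2))
    show "prd (sq n) integrable_on {0..1}" for n using integrable_01_subinterval[OF prd_int, of 0 1] by simp
    show "(\<lambda>x. B + g x) integrable_on {0..1}"
      using integrable_01_subinterval[OF set_integral_add(1)[OF const_int_01 g], of 0 1] by simp
    show "norm (prd (sq n) x) \<le> B + g x" if "x \<in> {0..1}" for n x
      using prd_bound[OF that, of "sq n"] B[of n] by (auto simp: g_def)
    show "(\<lambda>n. prd (sq n) x) \<longlonglongrightarrow> prd l x" if x: "x \<in> {0..1}" for x
    proof -
      have "(\<lambda>n. ys (sq n) x) \<longlonglongrightarrow> ys l x" "(\<lambda>n. us (sq n) x) \<longlonglongrightarrow> us l x"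
        unfolding ys_def us_def by (intro tendsto_Re tendsto_uniform_limitI[OF shot_uniform_limit(1)[OF sq] x]
            tendsto_uniform_limitI[OF shot_uniform_limit(2)[OF sq] x])+
      then show ?thesis
        unfolding prd_def using prd_denom[OF x, of l] by (intro tendsto_intros kl sq) auto
    qed
  qed
  then show "(Theta \<circ> sq) \<longlonglongrightarrow> Theta l" by (simp add: Theta_def o_def)
qed

end

subsection \<open>Level crossings\<close>

text \<open>A condition relative to the value at \<open>l\<close> only; nothing is claimed about
  monotonicity near \<open>l\<close>. Downward crossings are expressed by passing to
  \<open>- t\<close>.\<close>

definition up_crossing :: "(real \<Rightarrow> real) \<Rightarrow> real \<Rightarrow> bool" where
  "up_crossing t l \<longleftrightarrow> (\<exists>e>0. \<forall>x. x \<noteq> l \<and> \<bar>x - l\<bar> < e \<longrightarrow> 0 < (t x - t l) * (x - l))"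

lemma up_crossing_right:
  assumes "up_crossing t l" "l < b"
  obtains x where "l < x" "x < b" "t l < t x"
proof -
  obtain e where e: "e > 0" "\<And>x. x \<noteq> l \<Longrightarrow> \<bar>x - l\<bar> < e \<Longrightarrow> 0 < (t x - t l) * (x - l)"
    using assms(1) by (auto simp: up_crossing_def)
  define x where "x = l + min e (b - l) / 2"
  have x: "l < x" "x < b" "\<bar>x - l\<bar> < e" using e(1) assms(2) by (auto simp: x_def min_def field_simps)
  have "0 < (t x - t l) * (x - l)" using e(2)[of x] x by auto
  then have "t l < t x" using x by (simp add: zero_less_mult_iff)
  then show thesis using x that by blast
qed

lemma up_crossing_left:
  assumes "up_crossing t l" "a < l"
  obtains x where "a < x" "x < l" "t x < t l"
proof -
  obtain e where e: "e > 0" "\<And>x. x \<noteq> l \<Longrightarrow> \<bar>x - l\<bar> < e \<Longrightarrow> 0 < (t x - t l) * (x - l)"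
    using assms(1) by (auto simp: up_crossing_def)
  define x where "x = l - min e (l - a) / 2"
  have x: "x < l" "a < x" "\<bar>x - l\<bar> < e" using e(1) assms(2) by (auto simp: x_def min_def field_simps)
  have "0 < (t x - t l) * (x - l)" using e(2)[of x] x by auto
  then have "t x < t l" using x by (simp add: zero_less_mult_iff)
  then show thesis using x that by blast
qed

text \<open>A level that is crossed only upwards cannot be undercut again: at the first return
  \<open>s\<close> to values at most \<open>n\<close> the function equals \<open>n\<close>, and an
  upward crossing there means smaller values just before.\<close>

lemma up_crossing_stays_above:
  assumes cont: "continuous_on UNIV t"
    and up: "\<And>x. a \<le> x \<Longrightarrow> x \<le> b \<Longrightarrow> t x = n \<Longrightarrow> up_crossing t x"
    and ab: "a < b" and ta: "n \<le> t a"
  shows "n < t b"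
proof (rule ccontr)
  assume tb: "\<not> n < t b"
  obtain a' where a': "a \<le> a'" "a' < b" "n < t a'"
  proof (cases "t a = n")
    case True
    then have "up_crossing t a" using up ab by simp
    from up_crossing_right[OF this ab] True show thesis using that by (metis less_imp_le)
  next
    case False
    then show thesis using that[of a] ta ab by simp
  qed
  define S where "S = {a'..b} \<inter> {x. t x \<le> n}"
  have cS: "closed S" unfolding S_def
    by (intro closed_Int closed_atLeastAtMost closed_Collect_le cont continuous_on_const)
  have S: "b \<in> S" "bdd_below S" using a' tb by (auto simp: S_def intro!: bdd_belowI[of _ a'])
  define s where "s = Inf S"
  have s: "s \<in> S" unfolding s_def by (rule closed_contains_Inf) (use S cS in auto)
  have low: "s \<le> x" if "x \<in> S" for x unfolding s_def by (rule cInf_lower[OF that S(2)])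
  have s1: "a' < s" "s \<le> b" "t s \<le> n" using s a' by (auto simp: S_def less_le)
  obtain x where x: "a' \<le> x" "x \<le> s" "t x = n"
    using IVT2'[of t s n a'] s1 a' continuous_on_subset[OF cont] by auto
  have "x \<in> S" using x s1 by (auto simp: S_def)
  from low[OF this] x have ts: "t s = n" by simp
  have "up_crossing t s" using up[OF _ _ ts] s1 a' by simp
  then obtain y where "a' < y" "y < s" "t y < t s" using up_crossing_left s1(1) by blast
  then have "y \<in> S" using s1 ts by (auto simp: S_def)
  from low[OF this] \<open>y < s\<close> show False by simp
qed

text \<open>Unboundedness and the intermediate value theorem give a crossing of each level above the
  initial value; one-way crossing makes it unique and puts the crossings in order. Levels below the
  initial value are never reached, since the level \<open>\<lfloor>t m\<rfloor>\<close> would have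
  to be crossed downwards.\<close>

lemma up_crossing_levels:
  assumes cont: "continuous_on UNIV t" and up: "\<And>x. m < x \<Longrightarrow> t x \<in> \<int> \<Longrightarrow> up_crossing t x"
    and unb: "\<And>C. \<exists>x>m. C < t x" and tm: "t m \<notin> \<int>"
  obtains R :: "nat \<Rightarrow> real" where "strict_mono R" "\<And>n. m < R n"
    "\<And>n. t (R n) = of_int (\<lfloor>t m\<rfloor> + 1 + int n)" "\<And>x. m < x \<Longrightarrow> t x \<in> \<int> \<Longrightarrow> x \<in> range R"
proof -
  define c where "c = \<lfloor>t m\<rfloor>"
  have c: "of_int c < t m" "t m < of_int c + 1"
    using tm of_int_floor_le[of "t m"] real_of_int_floor_add_one_gt[of "t m"] Ints_of_int[of c, where 'a = real]
    by (auto simp: c_def less_le)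
  have "\<exists>x>m. t x = of_int (c + 1 + int n)" for n
  proof -
    obtain b where b: "m < b" "of_int (c + 1 + int n) < t b" using unb by blast
    have "t m \<le> of_int (c + 1 + int n)" using c(2) by simp
    then obtain x where x: "m \<le> x" "x \<le> b" "t x = of_int (c + 1 + int n)"
      using IVT'[of t m "of_int (c + 1 + int n)" b] b continuous_on_subset[OF cont] by auto
    then have "x \<noteq> m" using tm by (metis Ints_of_int)
    with x show ?thesis by (intro exI[of _ x]) auto
  qed
  then obtain R where R: "\<And>n. m < R n" "\<And>n. t (R n) = of_int (c + 1 + int n)" by metis
  have inc: "t x < t y" if "m < x" "x < y" "t x \<in> \<int>" for x y
    by (rule up_crossing_stays_above[OF cont _ that(2) order_refl]) (use up that in auto)
  have "strict_mono R"
  proof (rule strict_monoI)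
    fix i j :: nat assume "i < j"
    then have l: "t (R i) < t (R j)" unfolding R(2) of_int_less_iff by simp
    have "\<not> R j < R i" using inc[of "R j" "R i"] R l by auto
    moreover have "R i \<noteq> R j" using l by auto
    ultimately show "R i < R j" by simp
  qed
  moreover have "x \<in> range R" if x: "m < x" "t x \<in> \<int>" for x
  proof -
    obtain k where k: "t x = of_int k" using x(2) by (auto elim: Ints_cases)
    have "of_int c < t x"
    proof (rule up_crossing_stays_above[OF cont _ x(1)])
      fix y assume "m \<le> y" "t y = of_int c"
      then show "up_crossing t y" using up[of y] tm by (cases "y = m") auto
    qed (use c in auto)
    then have "c < k" by (simp add: k)
    then have "t (R (nat (k - c - 1))) = t x" by (simp add: R(2) k)
    then have "R (nat (k - c - 1)) = x"
      using inc[of x "R (nat (k - c - 1))"] inc[of "R (nat (k - c - 1))" x] x R(1)[of "nat (k - c - 1)"]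
      by (metis less_irrefl linorder_neqE_linordered_idom)
    then show ?thesis by blast
  qed
  ultimately show thesis using that[of R] R by (simp add: c_def)
qed

text \<open>No integer value is taken between neighbouring crossings. An upward crossing followed by
  a downward one would therefore require equal levels at the two points, which \<open>ne\<close>
  excludes, and likewise with the directions exchanged. If all crossings were downwards,
  \<open>t\<close> would be bounded above to the right of \<open>m\<close>.\<close>

lemma interlacing_sequence_up:
  fixes x :: "nat \<Rightarrow> real"
  assumes cont: "continuous_on UNIV t" and unb: "\<And>C. \<exists>x>m. C < t x" and tm: "t m \<notin> \<int>"
    and xm: "strict_mono x" "\<And>n. m < x n" and xr: "\<And>y. m < y \<Longrightarrow> t y \<in> \<int> \<longleftrightarrow> y \<in> range x"
    and ne: "\<And>n. t (x n) \<noteq> t (x (Suc n))"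
    and dich: "\<And>n. up_crossing t (x n) \<or> up_crossing (\<lambda>y. - t y) (x n)"
  shows "up_crossing t (x n)"
proof -
  \<comment> \<open>Stated for a function \<open>s\<close>, because it is used both for
    \<open>t\<close> and for \<open>- t\<close>.\<close>
  have step: "up_crossing s (x (Suc n))"
    if sc: "continuous_on UNIV s" and si: "\<And>y. s y \<in> \<int> \<longleftrightarrow> t y \<in> \<int>"
      and sn: "s (x n) \<noteq> s (x (Suc n))"
      and ch: "up_crossing s (x (Suc n)) \<or> up_crossing (\<lambda>y. - s y) (x (Suc n))" and u: "up_crossing s (x n)" for s n
  proof (rule ccontr)
    assume "\<not> ?thesis"
    then have d: "up_crossing (\<lambda>y. - s y) (x (Suc n))" using ch by blast
    have lt: "x n < x (Suc n)" using xm(1) by (simp add: strict_mono_def)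
    have nonint: "s y \<notin> \<int>" if "x n < y" "y < x (Suc n)" for y
    proof
      assume "s y \<in> \<int>"
      then have "y \<in> range x" using xr[of y] si xm(2)[of n] that by auto
      then obtain k where "y = x k" by blast
      with that xm(1) have "n < k" "k < Suc n" by (simp_all add: strict_mono_less)
      then show False by simp
    qed
    obtain y1 where y1: "x n < y1" "y1 < x (Suc n)" "s (x n) < s y1" using up_crossing_right[OF u lt] .
    obtain y2 where y2: "x n < y2" "y2 < x (Suc n)" "s (x (Suc n)) < s y2" using up_crossing_left[OF d lt] by auto
    obtain j where j: "s (x n) = of_int j" using xr[OF xm(2)[of n]] si[of "x n"] by (auto elim: Ints_cases)
    obtain k where k: "s (x (Suc n)) = of_int k" using xr[OF xm(2)[of "Suc n"]] si[of "x (Suc n)"] by (auto elim: Ints_cases)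
    show False
    proof (cases j k rule: linorder_cases)
      case less
      obtain z where z: "x n \<le> z" "z \<le> y2" "s z = s (x (Suc n))"
        using IVT'[of s "x n" "s (x (Suc n))" y2] y2 less j k continuous_on_subset[OF sc] by auto
      then have "x n < z" "z < x (Suc n)" using sn y2 by (auto simp: less_le)
      then show False using nonint[of z] z k by simp
    next
      case equal then show False using sn j k by simp
    next
      case greater
      obtain z where z: "y1 \<le> z" "z \<le> x (Suc n)" "s z = s (x n)"
        using IVT2'[of s "x (Suc n)" "s (x n)" y1] y1 greater j k continuous_on_subset[OF sc] by auto
      then have "x n < z" "z < x (Suc n)" using sn y1 by (auto simp: less_le)
      then show False using nonint[of z] z j by simp
    qed
  qed
  have "up_crossing t (x 0)"
  proof (rule ccontr)
    assume "\<not> ?thesis"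
    then have d0: "up_crossing (\<lambda>y. - t y) (x 0)" using dich by blast
    have d: "up_crossing (\<lambda>y. - t y) (x n)" for n
    proof (induction n)
      case (Suc n)
      show ?case
        by (rule step[OF _ _ _ _ Suc]) (use cont ne[of n] dich[of "Suc n"] in \<open>auto intro: continuous_on_minus\<close>)
    qed (rule d0)
    have "of_int \<lfloor>- t m\<rfloor> < - t b" if "m < b" for b
    proof (rule up_crossing_stays_above[OF continuous_on_minus[OF cont] _ that])
      fix y assume y: "m \<le> y" "- t y = of_int \<lfloor>- t m\<rfloor>"
      then have "t y \<in> \<int>" by (metis Ints_minus Ints_of_int minus_minus)
      moreover from this have "m \<noteq> y" using tm by auto
      ultimately have "y \<in> range x" using xr[of y] y(1) by simp
      then show "up_crossing (\<lambda>y. - t y) y" using d by auto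
    qed (rule of_int_floor_le)
    moreover obtain b where "m < b" "- of_int \<lfloor>- t m\<rfloor> < t b" using unb by blast
    ultimately show False by (meson less_asym minus_less_iff)
  qed
  then show ?thesis
  proof (induction n)
    case (Suc n)
    show ?case by (rule step[OF cont _ ne dich Suc.IH[OF Suc.prems]]) simp
  qed
qed

text \<open>\<open>R n\<close> and \<open>L n\<close> are the points to the right and to the left of \<open>m\<close> at which the
  \<open>(n+1)\<close>-st level is crossed.\<close>

lemma interlacing_labels:
  fixes R L :: "nat \<Rightarrow> real"
  assumes R: "strict_mono R" "\<And>n. m < R n" and L: "\<And>i j. i < j \<Longrightarrow> L j < L i" "\<And>n. L n < m"
  obtains lam mu :: "int \<Rightarrow> real" where "strict_mono_on (- {0}) lam" "strict_mono mu"
    "lam ` (- {0}) = {x. \<exists>n. odd n \<and> (x = R n \<or> x = L n)}" "range mu = {x. \<exists>n. even n \<and> (x = R n \<or> x = L n)}"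
    "\<forall>k. k \<noteq> 0 \<longrightarrow> mu k < lam k \<and> lam k < mu (k + 1)"
proof -
  \<comment> \<open>Outwards from \<open>m\<close> the crossings alternate between \<open>mu\<close>
    and \<open>lam\<close>, beginning with \<open>mu 1 = R 0\<close> and \<open>lam 1 = R 1\<close>
    on the right and with \<open>mu 0 = L 0\<close> and \<open>lam (-1) = L 1\<close> on the left.
    No \<open>lam\<close> lies between \<open>mu 0\<close> and \<open>mu 1\<close>.\<close>
  define mu where "mu = (\<lambda>k::int. if k \<ge> 1 then R (nat (2 * k - 2)) else L (nat (- 2 * k)))"
  define lam where "lam = (\<lambda>k::int. if k \<ge> 1 then R (nat (2 * k - 1)) else L (nat (- 2 * k - 1)))"
  have RR: "R i < R j \<longleftrightarrow> i < j" for i j using R(1) by (rule strict_mono_less)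
  have LL: "L j < L i \<longleftrightarrow> i < j" for i j using L(1)[of i j] L(1)[of j i] by (cases i j rule: linorder_cases) auto
  have LR: "L i < R j" for i j using R(2)[of j] L(2)[of i] by simp
  have 1: "strict_mono_on (- {0}) lam"
  proof (rule strict_mono_onI)
    fix i j :: int assume "i \<in> - {0}" "j \<in> - {0}" "i < j"
    then show "lam i < lam j" by (auto simp: lam_def RR LL LR)
  qed
  have 2: "strict_mono mu"
  proof (rule strict_monoI)
    fix i j :: int assume "i < j"
    then show "mu i < mu j" by (auto simp: mu_def RR LL LR)
  qed
  have 3: "lam ` (- {0}) = {x. \<exists>n. odd n \<and> (x = R n \<or> x = L n)}" (is "_ = ?A")
  proof (intro equalityI subsetI)
    fix x assume "x \<in> lam ` (- {0})"
    then obtain k where k: "k \<noteq> 0" "x = lam k" by auto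
    show "x \<in> ?A"
    proof (cases "k \<ge> 1")
      case True
      then have "odd (nat (2 * k - 1))" by (simp add: even_nat_iff)
      then show ?thesis using k True by (auto simp: lam_def)
    next
      case False
      then have "odd (nat (- 2 * k - 1))" using k by (subst even_nat_iff) auto
      then show ?thesis using k False by (auto simp: lam_def)
    qed
  next
    fix x assume "x \<in> ?A"
    then obtain q where "x = R (2 * q + 1) \<or> x = L (2 * q + 1)" by (blast elim: oddE)
    then show "x \<in> lam ` (- {0})"
    proof
      assume "x = R (2 * q + 1)"
      moreover have "nat (2 * (int q + 1) - 1) = 2 * q + 1" by simp
      ultimately have "x = lam (int q + 1)" by (simp add: lam_def)
      then show ?thesis by (intro image_eqI[of _ _ "int q + 1"]) auto
    next
      assume "x = L (2 * q + 1)"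
      moreover have "nat (- 2 * (- int q - 1) - 1) = 2 * q + 1" by simp
      ultimately have "x = lam (- int q - 1)" by (simp add: lam_def)
      then show ?thesis by (intro image_eqI[of _ _ "- int q - 1"]) auto
    qed
  qed
  have 4: "range mu = {x. \<exists>n. even n \<and> (x = R n \<or> x = L n)}" (is "_ = ?A")
  proof (intro equalityI subsetI)
    fix x assume "x \<in> range mu"
    then obtain k where k: "x = mu k" by auto
    show "x \<in> ?A"
    proof (cases "k \<ge> 1")
      case True
      then have "even (nat (2 * k - 2))" by (simp add: even_nat_iff)
      then show ?thesis using k True by (auto simp: mu_def)
    next
      case False
      then have "even (nat (- 2 * k))" by (subst even_nat_iff) auto
      then show ?thesis using k False by (auto simp: mu_def)
    qed
  next
    fix x assume "x \<in> ?A"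
    then obtain q where "x = R (2 * q) \<or> x = L (2 * q)" by (blast elim: evenE)
    then show "x \<in> range mu"
    proof
      assume "x = R (2 * q)"
      moreover have "nat (2 * (int q + 1) - 2) = 2 * q" by simp
      ultimately have "x = mu (int q + 1)" by (simp add: mu_def)
      then show ?thesis by blast
    next
      assume "x = L (2 * q)"
      moreover have "nat (- 2 * (- int q)) = 2 * q" by simp
      ultimately have "x = mu (- int q)" by (simp add: mu_def)
      then show ?thesis by blast
    qed
  qed
  have 5: "mu k < lam k \<and> lam k < mu (k + 1)" if "k \<noteq> 0" for k
    using that by (auto simp: mu_def lam_def RR LL LR)
  show thesis using that[OF 1 2 3 4] 5 by blast
qed

subsection \<open>Types of eigenvalues\<close>

context pencil_data
begin

definition "NN y = integral {0..1} (\<lambda>x::real. y x * cnj (y x) :: complex)"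
definition "BB mu y = integral {0..1} (\<lambda>x. rho mu x * (y x * cnj (y x)))"
definition "QQ mu y u = integral {0..1} (\<lambda>x. u x * cnj (u x) - w (complex_of_real mu) x * (y x * cnj (y x)))"

lemma qsol_form_pair:
  assumes "qsol r q f y u" "y 0 = 0"
  shows "form_pair y u"
  unfolding form_pair_def using qsol_y[OF assms(1)] assms(2) L2_continuous[OF qsol_cont_u[OF assms(1)]] by blast

lemma NN_eq: "form_pair y u \<Longrightarrow> NN y = complex_of_real (integral {0..1} (\<lambda>x. (norm (y x))\<^sup>2))"
  unfolding NN_def by (intro integral_norm_square L2_continuous form_pair_y_cont)

lemma NN_pos:
  assumes "form_pair y u" "x \<in> {0..1}" "y x \<noteq> 0"
  shows "0 < Re (NN y)" "NN y \<noteq> 0"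
proof -
  have c: "continuous_on {0..1} y" by (rule form_pair_y_cont[OF assms(1)])
  have "0 \<le> integral {0..1} (\<lambda>x. (norm (y x))\<^sup>2)"
    using integral_nonneg_01[OF L2_absolutely_integrable(2)[OF L2_continuous[OF c]], of 0 1] by simp
  moreover have "integral {0..1} (\<lambda>x. (norm (y x))\<^sup>2) \<noteq> 0"
    using integral_norm_square_zero[OF c _ assms(2)] assms(3) by blast
  ultimately show "0 < Re (NN y)" by (simp add: NN_eq[OF assms(1)])
  then show "NN y \<noteq> 0" by auto
qed

lemma form_reals: "cnj (NN y) = NN y" "cnj (BB mu y) = BB mu y" "cnj (QQ mu y u) = QQ mu y u"
  by (simp_all add: NN_def BB_def QQ_def integral_cnj mult.commute pot_def rho_def)

lemma real_of_cnj: "cnj z = z \<Longrightarrow> z = complex_of_real (Re z)"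
  by (simp add: complex_eq_iff)

lemma shot_form_pair: "form_pair (sy z) (su z)"
  by (rule qsol_form_pair[OF shot(1,2)])

lemma shot_NN_pos: "0 < Re (NN (sy z))"
proof -
  obtain x where "x \<in> {0..1}" "sy z x \<noteq> 0" using shot_nonzero l2_eq_zeroI by blast
  then show ?thesis using NN_pos(1)[OF shot_form_pair] by blast
qed

text \<open>The energy identity at the parameter \<open>mu + d\<close>, expanded around
  \<open>mu\<close>: on solutions the form at \<open>mu\<close> becomes a boundary term plus a
  quadratic polynomial in \<open>d\<close>.\<close>

lemma shifted_energy:
  assumes q: "qsol r (w (complex_of_real mu + d)) (\<lambda>x. 0) y v" and y0: "y 0 = 0"
  shows "QQ mu y v = v 1 * cnj (y 1) + d\<^sup>2 * NN y - d * BB mu y"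
proof -
  have fp: "form_pair y v" by (rule qsol_form_pair[OF q y0])
  note i = form_ints_diff[OF fp fp w_int] form_ints(1)[OF fp fp] form_ints(2)[OF fp fp rho_int]
  have "indef_int (\<lambda>x. v x * cnj (v x) - w (complex_of_real mu + d) x * (y x * cnj (y x))) (\<lambda>x. v x * cnj (y x))"
    using qsol_energy[OF q] by simp
  from indef_int_integral[OF this, of 0 1]
  have "v 1 * cnj (y 1) = integral {0..1} (\<lambda>x. v x * cnj (v x) - w (complex_of_real mu + d) x * (y x * cnj (y x)))"
    using y0 by simp
  also have "\<dots> = integral {0..1} (\<lambda>x. ((v x * cnj (v x) - w (complex_of_real mu) x * (y x * cnj (y x))) +
      (- (d\<^sup>2)) * (y x * cnj (y x))) + d * (rho mu x * (y x * cnj (y x))))"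
    by (rule integral_cong) (unfold w_shift, simp add: algebra_simps)
  also have "\<dots> = QQ mu y v + (- (d\<^sup>2)) * NN y + d * BB mu y"
    unfolding QQ_def NN_def BB_def
    by (subst integral_add_cmult_01, rule set_integral_add(1)[OF i(1) set_integrable_mult_right[OF i(2)]], rule i(3),
        subst integral_add_cmult_01[OF i(1,2)], rule refl)
  finally show ?thesis by (simp add: algebra_simps)
qed

lemma DD_eq: "complex_of_real (DD l l) = 2 * complex_of_real (l - mu) * NN (sY l) - BB mu (sY l)"
proof -
  note fp = shot_form_pair[of "complex_of_real l"]
  have "complex_of_real (DD l l) = integral {0..1} (\<lambda>x. (2 * complex_of_real (l - mu)) * (sY l x * cnj (sY l x)) - rho mu x * (sY l x * cnj (sY l x)))"
    unfolding Dz_real[symmetric] Dz_def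
    by (rule integral_cong) (simp add: shot_real rho_def power2_eq_square algebra_simps)
  also have "\<dots> = 2 * complex_of_real (l - mu) * NN (sY l) - BB mu (sY l)"
    unfolding BB_def NN_def
    by (subst integral_diff_01[OF set_integrable_mult_right[OF form_ints(1)[OF fp fp]] form_ints(2)[OF fp fp rho_int]]) simp
  finally show ?thesis .
qed

text \<open>At an eigenvalue of either pencil the boundary term vanishes, so positivity of the form
  forces \<open>(l - mu) * DD l l\<close> to be positive. At \<open>l = mu\<close> the boundary term
  alone is left.\<close>

lemma type_identity:
  "Re (QQ mu (sY l) (sU l)) = Ue l * Ye l + (l - mu) * DD l l - (l - mu)\<^sup>2 * Re (NN (sY l))"
proof -
  have "qsol r (w (complex_of_real mu + complex_of_real (l - mu))) (\<lambda>x. 0) (sY l) (sU l)" using shot(1) by simp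
  from shifted_energy[OF this shot(2)]
  have "QQ mu (sY l) (sU l) = sU l 1 * cnj (sY l 1) + (complex_of_real (l - mu))\<^sup>2 * NN (sY l) - complex_of_real (l - mu) * BB mu (sY l)" .
  also have "\<dots> = sU l 1 * cnj (sY l 1) + complex_of_real (l - mu) * complex_of_real (DD l l) - (complex_of_real (l - mu))\<^sup>2 * NN (sY l)"
    unfolding DD_eq[of l mu] by (simp add: algebra_simps power2_eq_square)
  also have "sU l 1 * cnj (sY l 1) = complex_of_real (Ue l * Ye l)" using shot_real[of 1 l] by (simp add: Ue_def Ye_def)
  also have "NN (sY l) = complex_of_real (Re (NN (sY l)))" by (rule real_of_cnj[OF form_reals(1)])
  finally have "QQ mu (sY l) (sU l) = complex_of_real (Ue l * Ye l + (l - mu) * DD l l - (l - mu)\<^sup>2 * Re (NN (sY l)))"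
    by simp
  then show ?thesis by simp
qed

text \<open>Positivity of the form of \<open>- T(mu)\<close> on the whole form domain. As no
  condition at 1 is imposed there, it applies to the eigenfunctions of both pencils.\<close>

definition "form_positive mu \<longleftrightarrow> (\<forall>y u. form_pair y u \<and> NN y \<noteq> 0 \<longrightarrow> 0 < Re (QQ mu y u))"

lemma pencil_form:
  assumes y: "y \<in> dom_bc r False"
  shows "form_pair y (quasi_deriv r y)" "l2_inner (T (complex_of_real mu) y) y = - QQ mu y (quasi_deriv r y)"
proof -
  define f where "f = T (complex_of_real mu) y"
  define u where "u = quasi_deriv r y"
  have q: "qsol r (w (complex_of_real mu)) f y u" "y 0 = 0" "u 1 = 0"
    using dom_bcD[OF y, of "complex_of_real mu" f] by (auto simp: f_def u_def bdry_def)
  show fp: "form_pair y (quasi_deriv r y)" using qsol_form_pair[OF q(1,2)] by (simp add: u_def)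
  then have fp': "form_pair y u" by (simp add: u_def)
  have fL: "f \<in> L2" using dom_ell_pencil_L2[OF p_L2] y by (simp add: f_def dom_bc_def)
  have fi: "(\<lambda>x. f x * cnj (y x)) absolutely_integrable_on {0..1}"
    by (intro absolutely_integrable_continuous_mult[OF L2_absolutely_integrable(1)[OF fL]] continuous_on_cnj qsol_cont_y[OF q(1)])
  from indef_int_integral[OF qsol_energy[OF q(1)], of 0 1]
  have "integral {0..1} (\<lambda>x. u x * cnj (u x) - w (complex_of_real mu) x * (y x * cnj (y x)) + f x * cnj (y x)) = 0"
    using q by simp
  then have "QQ mu y u + integral {0..1} (\<lambda>x. f x * cnj (y x)) = 0"
    unfolding QQ_def using integral_add_01[OF form_ints_diff[OF fp' fp' w_int] fi] by simp
  moreover have "l2_inner f y = integral {0..1} (\<lambda>x. f x * cnj (y x))"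
    unfolding l2_inner_def by (rule integral_01_eq[OF fi])
  ultimately show "l2_inner (T (complex_of_real mu) y) y = - QQ mu y (quasi_deriv r y)"
    by (simp add: f_def u_def eq_neg_iff_add_eq_0 add.commute)
qed

text \<open>The substantial direction leads from the operator to the form. A nonpositive vector of
  the form domain is exchanged for an eigenfunction of the pencil on which the form is nonpositive
  too, and eigenfunctions lie in the operator domain.\<close>

theorem negative_iff_form_positive:
  "negative_operator (dom_bc r False) (T (complex_of_real mu)) \<longleftrightarrow> form_positive mu"
proof
  assume pos: "form_positive mu"
  show "negative_operator (dom_bc r False) (T (complex_of_real mu))"
    unfolding negative_operator_def
  proof (intro ballI impI)
    fix y assume y: "y \<in> dom_bc r False" "\<not> l2_eq y (\<lambda>x. 0)"
    note pf = pencil_form(1)[OF y(1)] pencil_form(2)[OF y(1), of mu]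
    obtain x where "x \<in> {0..1}" "y x \<noteq> 0" using y(2) l2_eq_zeroI by blast
    then have "NN y \<noteq> 0" using NN_pos(2)[OF pf(1)] by blast
    then have "0 < Re (QQ mu y (quasi_deriv r y))" using pos pf(1) by (auto simp: form_positive_def)
    moreover have "l2_inner (T (complex_of_real mu) y) y \<in> \<real>"
      unfolding pf(2) by (simp add: Reals_cnj_iff form_reals)
    ultimately show "l2_inner (T (complex_of_real mu) y) y \<in> \<real> \<and> Re (l2_inner (T (complex_of_real mu) y) y) < 0"
      using pf(2) by simp
  qed
next
  assume neg: "negative_operator (dom_bc r False) (T (complex_of_real mu))"
  show "form_positive mu"
    unfolding form_positive_def
  proof (intro allI impI, rule ccontr)
    fix y0 u0 assume 0: "form_pair y0 u0 \<and> NN y0 \<noteq> 0" "\<not> 0 < Re (QQ mu y0 u0)"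
    then have 1: "form_pair y0 u0" "integral {0..1} (\<lambda>x. y0 x * cnj (y0 x)) \<noteq> 0"
      "Re (integral {0..1} (\<lambda>x. u0 x * cnj (u0 x) - w (complex_of_real mu) x * (y0 x * cnj (y0 x)))) \<le> 0"
      by (auto simp: NN_def QQ_def)
    obtain d y v where P: "qsol r (w (complex_of_real mu + d)) (\<lambda>x. 0) y v" "y 0 = 0" "v 1 = 0"
      "0 < Re (NN y)" "Re (d\<^sup>2 * NN y - d * BB mu y) + (norm d)\<^sup>2 * Re (NN y) \<le> 0"
      unfolding NN_def BB_def using nonpositive_type_eigenpair[OF 1] by blast
    have D: "y \<in> dom_bc r False" "\<And>x. x \<in> {0..1} \<Longrightarrow> quasi_deriv r y x = v x"
      using dom_bcI[OF P(1) zero_L2 P(2), of False] P(3) by (auto simp: bdry_def)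
    have "QQ mu y (quasi_deriv r y) = QQ mu y v" unfolding QQ_def by (rule integral_cong) (simp add: D(2))
    also have "\<dots> = d\<^sup>2 * NN y - d * BB mu y" using shifted_energy[OF P(1,2)] P(3) by simp
    finally have "Re (QQ mu y (quasi_deriv r y)) = Re (d\<^sup>2 * NN y - d * BB mu y)" by (rule arg_cong)
    moreover have "0 \<le> (norm d)\<^sup>2 * Re (NN y)" using P(4) by simp
    ultimately have Q: "Re (QQ mu y (quasi_deriv r y)) \<le> 0" using P(5) by linarith
    have "\<not> l2_eq y (\<lambda>x. 0)"
    proof
      assume "l2_eq y (\<lambda>x. 0)"
      then have "AE x in leb01. y x = 0" by (simp add: l2_eq_def)
      then have "y x = 0" if "x \<in> {0..1}" for x using continuous_AE_zero[OF qsol_cont_y[OF P(1)] _ that] by blast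
      then have "NN y = integral {0..1} (\<lambda>x::real. 0)" unfolding NN_def by (intro integral_cong) simp
      then show False using P(4) by simp
    qed
    then have "Re (l2_inner (T (complex_of_real mu) y) y) < 0" using neg D(1) by (simp add: negative_operator_def)
    then show False using Q unfolding pencil_form(2)[OF D(1)] by simp
  qed
qed

text \<open>Testing the eigenvalue equation with the eigenfunction gives
  \<open>d^2 * N - d * B = Q\<close> with real coefficients and positive \<open>N\<close> and
  \<open>Q\<close>. A nonreal solution \<open>d\<close> would have \<open>2 * Re d * N = B\<close>
  and hence \<open>Q = - N * (norm d)^2 < 0\<close>.\<close>

lemma form_positive_eigenvalue:
  assumes pos: "form_positive mu" and b: "bdry b (sy z) (su z) = 0"
  shows "z \<in> \<real>"
proof -
  define N B Q d where "N = Re (NN (sy z))" and "B = Re (BB mu (sy z))" and "Q = Re (QQ mu (sy z) (su z))"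
    and "d = z - complex_of_real mu"
  have N: "0 < N" using shot_NN_pos by (simp add: N_def)
  have "NN (sy z) \<noteq> 0" using N by (auto simp: N_def)
  then have Q: "0 < Q" using pos shot_form_pair by (auto simp: form_positive_def Q_def)
  have "qsol r (w (complex_of_real mu + d)) (\<lambda>x. 0) (sy z) (su z)" using shot(1) by (simp add: d_def)
  from shifted_energy[OF this shot(2)] have "QQ mu (sy z) (su z) = d\<^sup>2 * NN (sy z) - d * BB mu (sy z)"
    using b by (auto simp: bdry_def split: if_splits)
  then have e: "complex_of_real Q = d\<^sup>2 * complex_of_real N - d * complex_of_real B"
    unfolding N_def B_def Q_def real_of_cnj[OF form_reals(1), symmetric]
      real_of_cnj[OF form_reals(2), symmetric] real_of_cnj[OF form_reals(3), symmetric] .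
  have re: "Q = ((Re d)\<^sup>2 - (Im d)\<^sup>2) * N - Re d * B" and im: "0 = Im d * (2 * Re d * N - B)"
    using arg_cong[OF e, of Re] arg_cong[OF e, of Im] by (simp_all add: power2_eq_square algebra_simps)
  have "Im d = 0"
  proof (rule ccontr)
    assume "Im d \<noteq> 0"
    then have "B = 2 * Re d * N" using im by simp
    then have "Q = - (((Re d)\<^sup>2 + (Im d)\<^sup>2) * N)" using re by (simp add: algebra_simps power2_eq_square)
    moreover have "0 \<le> ((Re d)\<^sup>2 + (Im d)\<^sup>2) * N" using N by simp
    ultimately show False using Q by linarith
  qed
  then show ?thesis by (simp add: d_def complex_is_Real_iff)
qed

lemma form_positive_type:
  assumes pos: "form_positive mu"
  shows "0 < Ue mu * Ye mu" "Ue l * Ye l = 0 \<Longrightarrow> 0 < (l - mu) * DD l l"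
proof -
  have Q: "0 < Re (QQ mu (sY l) (sU l))" for l
    using pos shot_form_pair shot_NN_pos[of "complex_of_real l"] by (force simp: form_positive_def)
  show "0 < Ue mu * Ye mu" using Q[of mu] type_identity[of mu mu] by simp
  assume "Ue l * Ye l = 0"
  moreover have "0 \<le> (l - mu)\<^sup>2 * Re (NN (sY l))" using shot_NN_pos[of "complex_of_real l"] by simp
  ultimately show "0 < (l - mu) * DD l l" using Q[of l] type_identity[of mu l] by linarith
qed

text \<open>If the form were not positive, Pontryagin's theorem would provide an eigenvalue of
  \<open>T_M\<close>, which is a real number \<open>l\<close>. The inequality it comes with is
  \<open>(l - mu) * DD l l \<le> 0\<close> up to a positive factor, contrary to
  \<open>ty\<close>.\<close>

lemma form_positiveI:
  assumes re: "\<And>z. bdry False (sy z) (su z) = 0 \<Longrightarrow> z \<in> \<real>"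
    and ty: "\<And>l. Ue l = 0 \<Longrightarrow> 0 < (l - mu) * DD l l"
  shows "form_positive mu"
  unfolding form_positive_def
proof (intro allI impI, rule ccontr)
  fix y0 u0 assume 0: "form_pair y0 u0 \<and> NN y0 \<noteq> 0" "\<not> 0 < Re (QQ mu y0 u0)"
  then have 1: "form_pair y0 u0" "integral {0..1} (\<lambda>x. y0 x * cnj (y0 x)) \<noteq> 0"
    "Re (integral {0..1} (\<lambda>x. u0 x * cnj (u0 x) - w (complex_of_real mu) x * (y0 x * cnj (y0 x)))) \<le> 0"
    by (auto simp: NN_def QQ_def)
  obtain d y v where P: "qsol r (w (complex_of_real mu + d)) (\<lambda>x. 0) y v" "y 0 = 0" "v 1 = 0"
    "0 < Re (NN y)" "Re (d\<^sup>2 * NN y - d * BB mu y) + (norm d)\<^sup>2 * Re (NN y) \<le> 0"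
    unfolding NN_def BB_def using nonpositive_type_eigenpair[OF 1] by blast
  define z c where "z = complex_of_real mu + d" and "c = v 0"
  have s: "y x = c * sy z x" "v x = c * su z x" if "x \<in> {0..1}" for x
    using shot_unique[OF P(1,2) that] by (auto simp: z_def c_def)
  define C where "C = (norm c)\<^sup>2"
  have "NN y = integral {0..1} (\<lambda>x. complex_of_real C * (sy z x * cnj (sy z x)))"
    unfolding NN_def C_def complex_norm_square by (rule integral_cong) (simp add: s mult_ac)
  then have NNy: "NN y = complex_of_real C * NN (sy z)" by (simp add: NN_def)
  have "BB mu y = integral {0..1} (\<lambda>x. complex_of_real C * (rho mu x * (sy z x * cnj (sy z x))))"
    unfolding BB_def C_def complex_norm_square by (rule integral_cong) (simp add: s mult_ac)
  then have BBy: "BB mu y = complex_of_real C * BB mu (sy z)" by (simp add: BB_def)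
  have C: "0 < C" using P(4) by (auto simp: NNy C_def)
  then have "su z 1 = 0" using s(2)[of 1] P(3) by (auto simp: C_def)
  then have "bdry False (sy z) (su z) = 0" by (simp add: bdry_def)
  then obtain l where l: "z = complex_of_real l" using re by (auto elim: Reals_cases)
  then have d: "d = complex_of_real (l - mu)" by (simp add: z_def algebra_simps)
  have Ul: "Ue l = 0" using \<open>su z 1 = 0\<close> by (simp add: l Ue_def us_def)
  have "0 < C * ((l - mu) * DD l l)" using C ty[OF Ul] by simp
  also have "C * ((l - mu) * DD l l) = C * ((l - mu) * Re (2 * complex_of_real (l - mu) * NN (sY l) - BB mu (sY l)))"
    unfolding DD_eq[of l mu, symmetric] by simp
  also have "\<dots> = Re (d\<^sup>2 * NN y - d * BB mu y) + (norm d)\<^sup>2 * Re (NN y)"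
    unfolding d norm_of_real NNy BBy l by (simp add: power2_eq_square algebra_simps)
  finally show False using P(5) by simp
qed

end

subsection \<open>Interlacing\<close>

lemma up_crossing_not_both:
  assumes "up_crossing t l" "up_crossing (\<lambda>x. - t x) l"
  shows False
proof -
  obtain e1 where e1: "e1 > 0" "\<And>x. x \<noteq> l \<Longrightarrow> \<bar>x - l\<bar> < e1 \<Longrightarrow> 0 < (t x - t l) * (x - l)"
    using assms(1) by (auto simp: up_crossing_def)
  obtain e2 where e2: "e2 > 0" "\<And>x. x \<noteq> l \<Longrightarrow> \<bar>x - l\<bar> < e2 \<Longrightarrow> 0 < (- t x - - t l) * (x - l)"
    using assms(2) unfolding up_crossing_def by blast
  define x where "x = l + min e1 e2 / 2"
  have x: "x \<noteq> l" "\<bar>x - l\<bar> < e1" "\<bar>x - l\<bar> < e2" using e1(1) e2(1) by (auto simp: x_def min_def)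
  have "(t x - t l) * (x - l) = - ((- t x - - t l) * (x - l))" by (simp add: algebra_simps)
  then show False using e1(2)[OF x(1,2)] e2(2)[OF x(1,3)] by linarith
qed

text \<open>Lets the half-line to the left of \<open>m\<close> be treated as the one to the right of
  \<open>- m\<close>; reflection reverses the direction of a crossing.\<close>

lemma up_crossing_reflect: "up_crossing (\<lambda>x. t (- x)) l \<longleftrightarrow> up_crossing (\<lambda>x. - t x) (- l)"
proof -
  have *: "(\<forall>x. x \<noteq> l \<and> \<bar>x - l\<bar> < e \<longrightarrow> 0 < (t (- x) - t (- l)) * (x - l)) \<longleftrightarrow>
    (\<forall>x. x \<noteq> - l \<and> \<bar>x - - l\<bar> < e \<longrightarrow> 0 < (- t x - - t (- l)) * (x - - l))" (is "?A \<longleftrightarrow> ?B") for e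
  proof
    assume A: ?A
    show ?B
    proof (intro allI impI)
      fix x assume "x \<noteq> - l \<and> \<bar>x - - l\<bar> < e"
      then have "- x \<noteq> l \<and> \<bar>- x - l\<bar> < e" by linarith
      with A have "0 < (t (- (- x)) - t (- l)) * (- x - l)" by blast
      also have "\<dots> = (- t x - - t (- l)) * (x - - l)" by (simp add: algebra_simps)
      finally show "0 < (- t x - - t (- l)) * (x - - l)" .
    qed
  next
    assume B: ?B
    show ?A
    proof (intro allI impI)
      fix x assume "x \<noteq> l \<and> \<bar>x - l\<bar> < e"
      then have "- x \<noteq> - l \<and> \<bar>- x - - l\<bar> < e" by linarith
      with B have "0 < (- t (- x) - - t (- l)) * (- x - - l)" by blast
      also have "\<dots> = (t (- x) - t (- l)) * (x - l)" by (simp add: algebra_simps)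
      finally show "0 < (t (- x) - t (- l)) * (x - l)" .
    qed
  qed
  show ?thesis unfolding up_crossing_def * ..
qed

text \<open>Merges the labels to the right of \<open>m\<close> into the single sequence
  \<open>mu 1, lam 1, mu 2, lam 2, ...\<close>. Its levels alternate between odd and even, so
  neighbouring levels differ, as the result on sequences of crossings requires.\<close>

lemma interlacing_up_crossing:
  fixes lam mu :: "int \<Rightarrow> real"
  assumes cont: "continuous_on UNIV t" and unb: "\<And>C. \<exists>x>m. C < t x"
    and mono: "strict_mono mu" and il: "\<And>k. k \<noteq> 0 \<Longrightarrow> mu k < lam k \<and> lam k < mu (k + 1)"
    and m: "mu 0 < m" "m < mu 1"
    and mu: "\<And>y. y \<in> range mu \<longleftrightarrow> (\<exists>i::int. odd i \<and> t y = of_int i)"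
    and lam: "\<And>y. y \<in> lam ` (- {0}) \<longleftrightarrow> (\<exists>i::int. even i \<and> t y = of_int i)"
    and dich: "\<And>y. t y \<in> \<int> \<Longrightarrow> up_crossing t y \<or> up_crossing (\<lambda>y. - t y) y"
    and k: "1 \<le> k"
  shows "up_crossing t (mu k)"
proof -
  have mm: "mu i \<le> mu j \<longleftrightarrow> i \<le> j" "mu i < mu j \<longleftrightarrow> i < j" for i j
    using mono by (simp_all add: strict_mono_less_eq strict_mono_less)
  define x where "x = (\<lambda>n::nat. if even n then mu (1 + int (n div 2)) else lam (1 + int (n div 2)))"
  have int_iff: "t y \<in> \<int> \<longleftrightarrow> y \<in> range mu \<or> y \<in> lam ` (- {0})" for y
    unfolding mu lam by (auto elim!: Ints_cases)
  have mono_x: "strict_mono x"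
    unfolding strict_mono_Suc_iff
  proof
    fix n
    show "x n < x (Suc n)"
      using il[of "1 + int (n div 2)"] by (cases "even n") (auto simp: x_def algebra_simps elim!: oddE)
  qed
  have "m < x 0" using m(2) by (simp add: x_def)
  then have mx: "m < x n" for n
    using strict_mono_less_eq[OF mono_x, of 0 n] by simp
  have range_x: "t y \<in> \<int> \<longleftrightarrow> y \<in> range x" if y: "m < y" for y
  proof
    assume "y \<in> range x"
    then show "t y \<in> \<int>" unfolding int_iff by (auto simp: x_def)
  next
    assume "t y \<in> \<int>"
    then consider j where "y = mu j" | j where "j \<noteq> 0" "y = lam j" unfolding int_iff by auto
    then show "y \<in> range x"
    proof cases
      case 1
      have "mu 0 < mu j" using m y 1 by simp
      then have "y = x (2 * nat (j - 1))" using 1 mm by (simp add: x_def)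
      then show ?thesis by blast
    next
      case 2
      have "\<not> j \<le> -1"
      proof
        assume "j \<le> -1"
        then have "mu (j + 1) \<le> mu 0" using mm by simp
        then show False using il[OF 2(1)] 2 y m by simp
      qed
      then have "y = x (2 * nat (j - 1) + 1)" using 2 by (simp add: x_def)
      then show ?thesis by blast
    qed
  qed
  have tm: "t m \<notin> \<int>"
  proof
    assume "t m \<in> \<int>"
    then consider j where "m = mu j" | j where "j \<noteq> 0" "m = lam j" unfolding int_iff by auto
    then show False
    proof cases
      case 1
      then show False using m mm by simp
    next
      case 2
      show False
      proof (cases "j \<le> -1")
        case True
        then have "mu (j + 1) \<le> mu 0" using mm by simp
        then show False using il[OF 2(1)] 2 m by simp
      next
        case False
        then have "mu 1 \<le> mu j" using mm 2 by simp
        then show False using il[OF 2(1)] 2 m by simp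
      qed
    qed
  qed
  have ne: "t (x n) \<noteq> t (x (Suc n))" for n
  proof
    assume e: "t (x n) = t (x (Suc n))"
    have "(\<exists>i::int. odd i \<and> t (x n) = of_int i) \<and> (\<exists>i::int. even i \<and> t (x n) = of_int i)"
    proof (cases "even n")
      case True
      then have "x n \<in> range mu" "x (Suc n) \<in> lam ` (- {0})" by (auto simp: x_def)
      then show ?thesis using e unfolding mu lam by simp
    next
      case False
      then have "x n \<in> lam ` (- {0})" "x (Suc n) \<in> range mu" by (auto simp: x_def)
      then show ?thesis using e unfolding mu lam by simp
    qed
    then show False by auto
  qed
  have "up_crossing t (x (2 * nat (k - 1)))"
  proof (rule interlacing_sequence_up[OF cont unb tm mono_x mx range_x ne])
    show "up_crossing t (x n) \<or> up_crossing (\<lambda>y. - t y) (x n)" for n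
      using dich range_x[OF mx[of n]] by blast
  qed
  then show ?thesis using k by (simp add: x_def)
qed

context pencil_data
begin

definition "quadrant l = Theta l * 2 / pi"

lemma quadrant_cont: "continuous_on UNIV quadrant"
  unfolding quadrant_def[abs_def] by (intro continuous_intros continuous_at_imp_continuous_on ballI Theta_cont) auto

lemma quadrant_unbounded: "\<exists>x>m. C < quadrant x" "\<exists>x<m. C < quadrant x"
proof -
  obtain C0 where C0: "\<And>l. kap l - C0 \<le> Theta l" using Theta_lower by blast
  \<comment> \<open>\<open>Theta\<close> is at least \<open>kap l - C0\<close>, and
    \<open>kap l \<ge> \<bar>l\<bar>\<close>; the summands \<open>\<bar>m\<bar>\<close> and 1 put
    \<open>b\<close> and \<open>- b\<close> beyond \<open>m\<close> on the two sides.\<close>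
  define b where "b = \<bar>m\<bar> + \<bar>C0\<bar> + \<bar>C\<bar> * pi + 1"
  have b: "C < quadrant l" if "\<bar>l\<bar> = b" for l
  proof -
    have "0 \<le> \<bar>C\<bar> * pi" "C * pi \<le> \<bar>C\<bar> * pi" by simp_all
    then have "C * pi < 2 * Theta l" using C0[of l] kap(2)[of l] that unfolding b_def by linarith
    then show ?thesis by (simp add: quadrant_def field_simps)
  qed
  have "0 \<le> \<bar>C\<bar> * pi" by simp
  then have "m < b" "- b < m" "0 < b" unfolding b_def by linarith+
  then show "\<exists>x>m. C < quadrant x" "\<exists>x<m. C < quadrant x" using b[of b] b[of "- b"] by auto
qed

lemma Ye_zero_iff: "Ye l = 0 \<longleftrightarrow> (\<exists>i::int. even i \<and> quadrant l = of_int i)"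
  and Ue_zero_iff: "Ue l = 0 \<longleftrightarrow> (\<exists>i::int. odd i \<and> quadrant l = of_int i)"
proof -
  obtain \<rho> where \<rho>: "0 < \<rho>" "kap l * Ye l = \<rho> * sin (Theta l)" "Ue l = \<rho> * cos (Theta l)" using Theta_polar[of l] by blast
  have q: "quadrant l = of_int i \<longleftrightarrow> Theta l = of_int i * (pi / 2)" for i :: int by (auto simp: quadrant_def field_simps)
  have "Ye l = 0 \<longleftrightarrow> sin (Theta l) = 0" "Ue l = 0 \<longleftrightarrow> cos (Theta l) = 0" using \<rho> kap(4)[of l] by auto
  then show "Ye l = 0 \<longleftrightarrow> (\<exists>i::int. even i \<and> quadrant l = of_int i)" "Ue l = 0 \<longleftrightarrow> (\<exists>i::int. odd i \<and> quadrant l = of_int i)"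
    unfolding q sin_zero_iff_int cos_zero_iff_int by auto
qed

lemma quadrant_int_iff: "quadrant l \<in> \<int> \<longleftrightarrow> Ue l * Ye l = 0"
  unfolding mult_eq_0_iff Ye_zero_iff Ue_zero_iff by (auto elim!: Ints_cases)

text \<open>The angles at \<open>l\<close> and \<open>l'\<close> use different scales, so a
  Wronskian is in general no multiple of the sine of their difference. When \<open>Theta l\<close>
  lies on an axis it is one: \<open>sin\<close> or \<open>cos\<close> of \<open>Theta l\<close>
  vanishes, and only one of the two scales remains.\<close>

lemma wronskian_polar:
  assumes "Ue l * Ye l = 0"
  obtains c where "0 < c" "(l' - l) * DD l l' = c * sin (Theta l' - Theta l)"
proof -
  obtain a where a: "0 < a" "kap l * Ye l = a * sin (Theta l)" "Ue l = a * cos (Theta l)" using Theta_polar[of l] by blast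
  obtain b where b: "0 < b" "kap l' * Ye l' = b * sin (Theta l')" "Ue l' = b * cos (Theta l')" using Theta_polar[of l'] by blast
  have k: "0 < kap l" "0 < kap l'" by (rule kap)+
  have Y: "Ye l = a * sin (Theta l) / kap l" "Ye l' = b * sin (Theta l') / kap l'" using a b k by (simp_all add: field_simps)
  have e: "(l' - l) * DD l l' = a * b * (cos (Theta l) * sin (Theta l') / kap l' - sin (Theta l) * cos (Theta l') / kap l)"
    unfolding wronskian_real[symmetric] a(3) b(3) Y by (simp add: algebra_simps)
  show thesis
  proof (cases "Ye l = 0")
    case True
    then have "sin (Theta l) = 0" using a k by auto
    then have "(l' - l) * DD l l' = a * b / kap l' * sin (Theta l' - Theta l)" using e by (simp add: sin_diff)
    then show thesis using that[of "a * b / kap l'"] a b k by simp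
  next
    case False
    then have "cos (Theta l) = 0" using assms a by auto
    then have "(l' - l) * DD l l' = a * b / kap l * sin (Theta l' - Theta l)" using e by (simp add: sin_diff)
    then show thesis using that[of "a * b / kap l"] a b k by simp
  qed
qed

text \<open>Near \<open>l\<close> the difference of the angles is smaller than \<open>pi\<close> and
  has the sign of its sine, which is the sign of \<open>(x - l) * DD l x\<close>. The number
  \<open>s\<close> treats both directions at once.\<close>

lemma quadrant_crossing:
  assumes z: "Ue l * Ye l = 0" and s: "\<bar>s\<bar> = 1" "0 < s * DD l l"
  shows "up_crossing (\<lambda>x. s * quadrant x) l"
proof -
  have "((\<lambda>x. s * DD l x) \<longlongrightarrow> s * DD l l) (at l)" by (intro tendsto_intros) (use DD_cont[of l] in \<open>simp add: isCont_def\<close>)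
  then have ev1: "\<forall>\<^sub>F x in at l. 0 < s * DD l x" using s(2) by (rule order_tendstoD(1))
  have "(Theta \<longlongrightarrow> Theta l) (at l)" using Theta_cont[of l] by (simp add: isCont_def)
  then have ev2: "\<forall>\<^sub>F x in at l. dist (Theta x) (Theta l) < pi" by (rule tendstoD) simp
  have "\<forall>\<^sub>F x in at l. 0 < s * DD l x \<and> dist (Theta x) (Theta l) < pi" using ev1 ev2 by (rule eventually_conj)
  then obtain e where e: "e > 0" "\<And>x. x \<noteq> l \<Longrightarrow> dist x l < e \<Longrightarrow> 0 < s * DD l x \<and> dist (Theta x) (Theta l) < pi"
    unfolding eventually_at by blast
  have "0 < (s * quadrant x - s * quadrant l) * (x - l)" if x: "x \<noteq> l" "\<bar>x - l\<bar> < e" for x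
  proof -
    define D where "D = Theta x - Theta l"
    obtain c where c: "0 < c" "(x - l) * DD l x = c * sin D" using wronskian_polar[OF z, of x] by (auto simp: D_def)
    have d: "0 < s * DD l x" "\<bar>D\<bar> < pi" using e(2)[of x] x by (auto simp: dist_real_def D_def)
    have "0 < (x - l)\<^sup>2 * (s * DD l x)" using d x by simp
    also have "\<dots> = c * (s * (x - l) * sin D)" using c(2) by (simp add: power2_eq_square mult_ac)
    finally have p: "0 < s * (x - l) * sin D" using c(1) by (simp add: zero_less_mult_iff)
    have "0 < s * (x - l) * D"
    proof (cases "0 \<le> D")
      case True
      then have "0 < sin D" using p sin_ge_zero[of D] d by (cases "sin D = 0") auto
      then show ?thesis using p True by (cases "D = 0") (auto simp: zero_less_mult_iff)
    next
      case False
      then have "0 < sin (- D)" using d by (intro sin_gt_zero) auto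
      then show ?thesis using p False by (auto simp: zero_less_mult_iff mult_less_0_iff)
    qed
    then have "0 < (s * (x - l) * D) * (2 / pi)" by simp
    also have "\<dots> = (s * quadrant x - s * quadrant l) * (x - l)"
      by (simp add: quadrant_def D_def field_simps)
    finally show ?thesis .
  qed
  then show ?thesis unfolding up_crossing_def using e(1) by blast
qed

lemma quadrant_crossing_pos: "Ue l * Ye l = 0 \<Longrightarrow> 0 < DD l l \<Longrightarrow> up_crossing quadrant l"
  using quadrant_crossing[of l 1] by simp

lemma quadrant_crossing_neg: "Ue l * Ye l = 0 \<Longrightarrow> DD l l < 0 \<Longrightarrow> up_crossing (\<lambda>x. - quadrant x) l"
  using quadrant_crossing[of l "-1"] by simp

lemma spectrum_real:
  assumes "\<And>z. bdry b (sy z) (su z) = 0 \<Longrightarrow> z \<in> \<real>"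
  shows "pencil_spectrum (dom_bc r b) T = complex_of_real ` {l. (if b then Ye l else Ue l) = 0}"
  unfolding spectrum_eq
proof (intro equalityI subsetI)
  fix z assume z: "z \<in> {z. bdry b (sy z) (su z) = 0}"
  then obtain l where l: "z = complex_of_real l" using assms by (auto elim: Reals_cases)
  then show "z \<in> complex_of_real ` {l. (if b then Ye l else Ue l) = 0}"
    using z bdry_real[of b l] by simp
next
  fix z assume "z \<in> complex_of_real ` {l. (if b then Ye l else Ue l) = 0}"
  then show "z \<in> {z. bdry b (sy z) (su z) = 0}" using bdry_real[of b] by auto
qed

text \<open>A positive product places the vector in the open first or third quadrant, from which the
  next level above is odd. Hence the eigenvalue met next on either side belongs to
  \<open>T_M\<close>.\<close>

lemma even_floor_quadrant:
  assumes "0 < Ue l * Ye l"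
  shows "even \<lfloor>quadrant l\<rfloor>"
proof (rule ccontr)
  assume odd: "odd \<lfloor>quadrant l\<rfloor>"
  obtain \<rho> where \<rho>: "0 < \<rho>" "kap l * Ye l = \<rho> * sin (Theta l)" "Ue l = \<rho> * cos (Theta l)" using Theta_polar[of l] by blast
  have "0 < kap l * (Ue l * Ye l)" using assms kap(4)[of l] by simp
  also have "\<dots> = \<rho>\<^sup>2 / 2 * sin (2 * Theta l)"
    using \<rho>(2,3) by (simp add: sin_double power2_eq_square mult_ac)
  finally have s: "0 < sin (2 * Theta l)" using \<rho>(1) by (simp add: zero_less_mult_iff)
  define f where "f = quadrant l - \<lfloor>quadrant l\<rfloor>"
  have f: "0 \<le> f" "f < 1" unfolding f_def by linarith+
  have "2 * Theta l = pi * quadrant l" by (simp add: quadrant_def)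
  also have "\<dots> = pi * \<lfloor>quadrant l\<rfloor> + pi * f" by (simp add: f_def algebra_simps)
  finally have "sin (2 * Theta l) = - sin (pi * f)"
    using odd by (simp add: sin_add cos_npi_int sin_npi_int)
  moreover have "0 \<le> sin (pi * f)" using f by (intro sin_ge_zero) (auto simp: mult_left_le)
  ultimately show False using s by simp
qed

theorem form_positive_imp_interlace:
  assumes pos: "form_positive m"
  shows "almost_interlace (dom_bc r True) T (dom_bc r False) T"
proof -
  note ty = form_positive_type[OF pos]
  have spec: "pencil_spectrum (dom_bc r b) T = complex_of_real ` {l. (if b then Ye l else Ue l) = 0}" for b
    by (rule spectrum_real[OF form_positive_eigenvalue[OF pos]])
  have simple: "\<forall>z\<in>pencil_spectrum (dom_bc r b) T. z \<in> \<real> \<and> pencil_simple_eigenvalue (dom_bc r b) T z" for b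
  proof
    fix z assume "z \<in> pencil_spectrum (dom_bc r b) T"
    then obtain l where l: "z = complex_of_real l" "(if b then Ye l else Ue l) = 0" unfolding spec by blast
    then have "Ue l * Ye l = 0" by (auto split: if_splits)
    then have "DD l l \<noteq> 0" using ty(2)[of l] by auto
    moreover have "bdry b (sY l) (sU l) = 0" using bdry_real[of b l] l(2) by simp
    ultimately show "z \<in> \<real> \<and> pencil_simple_eigenvalue (dom_bc r b) T z" using simple_iff_DD l(1) by simp
  qed
  have qm: "quadrant m \<notin> \<int>" using ty(1) unfolding quadrant_int_iff by linarith
  have ev: "even \<lfloor>quadrant m\<rfloor>" by (rule even_floor_quadrant[OF ty(1)])
  define c where "c = \<lfloor>quadrant m\<rfloor>"
  obtain R where R: "strict_mono R" "\<And>n. m < R n" "\<And>n. quadrant (R n) = of_int (c + 1 + int n)"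
    "\<And>x. m < x \<Longrightarrow> quadrant x \<in> \<int> \<Longrightarrow> x \<in> range R"
  proof (rule up_crossing_levels[OF quadrant_cont _ quadrant_unbounded(1) qm])
    fix x assume x: "m < x" "quadrant x \<in> \<int>"
    then have z: "Ue x * Ye x = 0" by (simp add: quadrant_int_iff)
    then have "0 < DD x x" using ty(2)[OF z] x(1) by (simp add: zero_less_mult_iff)
    then show "up_crossing quadrant x" using quadrant_crossing_pos z by blast
  qed (use c_def in auto)
  \<comment> \<open>The reflected angle transfers the result for crossings to the right of
    \<open>m\<close> to the left half-line.\<close>
  define t where "t = (\<lambda>x. quadrant (- x))"
  have tc: "continuous_on UNIV t"
    unfolding t_def by (rule continuous_on_compose2[OF quadrant_cont]) (auto intro: continuous_intros)
  have tunb: "\<exists>x>-m. C < t x" for C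
  proof -
    obtain x where "x < m" "C < quadrant x" using quadrant_unbounded(2) by blast
    then show ?thesis by (intro exI[of _ "- x"]) (simp add: t_def)
  qed
  have tm: "t (- m) = quadrant m" by (simp add: t_def)
  obtain L where L: "strict_mono L" "\<And>n. - m < L n" "\<And>n. t (L n) = of_int (c + 1 + int n)"
    "\<And>x. - m < x \<Longrightarrow> t x \<in> \<int> \<Longrightarrow> x \<in> range L"
  proof (rule up_crossing_levels[OF tc _ tunb])
    show "t (- m) \<notin> \<int>" using qm by (simp add: tm)
    fix x assume x: "- m < x" "t x \<in> \<int>"
    then have z: "Ue (- x) * Ye (- x) = 0" by (simp add: quadrant_int_iff t_def)
    then have "DD (- x) (- x) < 0" using ty(2)[OF z] x(1) by (auto simp: zero_less_mult_iff)
    then show "up_crossing t x" unfolding t_def up_crossing_reflect using quadrant_crossing_neg z by blast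
  qed (use c_def tm in auto)
  \<comment> \<open>The \<open>n\<close>-th crossing on either side has level
    \<open>c + 1 + n\<close>. As \<open>c\<close> is even, odd \<open>n\<close> means an even level,
    that is a zero of \<open>Ye\<close>, and even \<open>n\<close> a zero of
    \<open>Ue\<close>.\<close>
  have level: "(\<exists>n. P (c + 1 + int n) \<and> (x = R n \<or> x = - L n)) \<longleftrightarrow> (\<exists>i::int. P i \<and> quadrant x = of_int i)" for P x
  proof
    assume "\<exists>n. P (c + 1 + int n) \<and> (x = R n \<or> x = - L n)"
    then obtain n where "P (c + 1 + int n)" "x = R n \<or> x = - L n" by blast
    then show "\<exists>i::int. P i \<and> quadrant x = of_int i"
      using R(3)[of n] L(3)[of n] by (intro exI[of _ "c + 1 + int n"]) (auto simp: t_def)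
  next
    assume "\<exists>i::int. P i \<and> quadrant x = of_int i"
    then obtain i :: int where i: "P i" "quadrant x = of_int i" by blast
    then have q: "quadrant x \<in> \<int>" by simp
    then have "x \<noteq> m" using qm by auto
    then consider "m < x" | "- m < - x" by linarith
    then show "\<exists>n. P (c + 1 + int n) \<and> (x = R n \<or> x = - L n)"
    proof cases
      case 1
      then obtain n where "x = R n" using R(4) q by blast
      moreover from this have "i = c + 1 + int n" using R(3)[of n] i(2) by (simp only: of_int_eq_iff)
      ultimately show ?thesis using i(1) by blast
    next
      case 2
      then obtain n where n: "- x = L n" using L(4)[OF 2] q by (auto simp: t_def)
      moreover from this have "i = c + 1 + int n" using L(3)[of n] i(2) by (simp only: t_def n[symmetric] minus_minus of_int_eq_iff)
      moreover have "x = - L n" using n by simp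
      ultimately show ?thesis using i(1) by blast
    qed
  qed
  have L': "- L j < - L i" if "i < j" for i j using L(1) that by (simp add: strict_mono_def)
  have L'': "- L n < m" for n using L(2)[of n] by simp
  obtain lam mu :: "int \<Rightarrow> real" where lm: "strict_mono_on (- {0}) lam" "strict_mono mu"
    "lam ` (- {0}) = {x. \<exists>n. odd n \<and> (x = R n \<or> x = - L n)}" "range mu = {x. \<exists>n. even n \<and> (x = R n \<or> x = - L n)}"
    "\<forall>k. k \<noteq> 0 \<longrightarrow> mu k < lam k \<and> lam k < mu (k + 1)"
  proof (rule interlacing_labels[OF R(1,2), of "\<lambda>n. - L n"])
    show "- L j < - L i" if "i < j" for i j by (rule L'[OF that])
    show "- L n < m" for n by (rule L'')
  qed (rule that)
  have "lam ` (- {0}) = {l. Ye l = 0}"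
    unfolding lm(3) Ye_zero_iff level[of even, symmetric] using ev by (simp add: c_def)
  moreover have "range mu = {l. Ue l = 0}"
    unfolding lm(4) Ue_zero_iff level[of odd, symmetric] using ev by (simp add: c_def)
  ultimately have "pencil_spectrum (dom_bc r True) T = complex_of_real ` lam ` (- {0})"
    "pencil_spectrum (dom_bc r False) T = complex_of_real ` range mu"
    using spec[of True] spec[of False] by simp_all
  then show ?thesis
    unfolding almost_interlace_def by (intro conjI exI[of _ lam] exI[of _ mu] simple lm)
qed

theorem interlace_imp_form_positive:
  assumes "almost_interlace (dom_bc r True) T (dom_bc r False) T"
  shows "\<exists>m. form_positive m"
proof -
  note ai = assms[unfolded almost_interlace_def]
  note simple = ai[THEN conjunct1] ai[THEN conjunct2, THEN conjunct1]
  from ai[THEN conjunct2, THEN conjunct2] obtain lam mu :: "int \<Rightarrow> real" where mono: "strict_mono mu"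
    and il: "\<forall>k. k \<noteq> 0 \<longrightarrow> mu k < lam k \<and> lam k < mu (k + 1)"
    and sT: "pencil_spectrum (dom_bc r True) T = complex_of_real ` lam ` (- {0})"
    and sM: "pencil_spectrum (dom_bc r False) T = complex_of_real ` range mu"
    by (elim exE conjE)
  note lm = mono il[rule_format]
  have re: "z \<in> \<real>" if "bdry b (sy z) (su z) = 0" for b z
    using that simple spectrum_eq[of b] by (cases b) auto
  have "complex_of_real ` lam ` (- {0}) = complex_of_real ` {l. Ye l = 0}"
    using spectrum_real[of True, OF re] sT by simp
  then have lamS: "lam ` (- {0}) = {l. Ye l = 0}" by (rule inj_image_eq_iff[THEN iffD1, rotated]) (rule inj_of_real)
  have "complex_of_real ` range mu = complex_of_real ` {l. Ue l = 0}"
    using spectrum_real[of False, OF re] sM by simp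
  then have muS: "range mu = {l. Ue l = 0}" by (rule inj_image_eq_iff[THEN iffD1, rotated]) (rule inj_of_real)
  have DD0: "DD l l \<noteq> 0" if z: "Ue l * Ye l = 0" for l
  proof -
    obtain b where b: "bdry b (sY l) (sU l) = 0"
      using z bdry_real[of True l] bdry_real[of False l] by (cases "Ye l = 0") auto
    then have "complex_of_real l \<in> pencil_spectrum (dom_bc r b) T" using spectrum_eq by simp
    then have "pencil_simple_eigenvalue (dom_bc r b) T (complex_of_real l)" using simple by (cases b) auto
    then show ?thesis using simple_iff_DD[OF b] by simp
  qed
  have dich: "up_crossing quadrant l \<or> up_crossing (\<lambda>y. - quadrant y) l" if "quadrant l \<in> \<int>" for l
    using DD0[of l] quadrant_crossing_pos[of l] quadrant_crossing_neg[of l] that unfolding quadrant_int_iff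
    by (meson linorder_neqE_linordered_idom)
  \<comment> \<open>The midpoint of the gap between \<open>mu 0\<close> and \<open>mu 1\<close>,
    which contains no eigenvalue of either pencil because the label 0 is missing for
    \<open>lam\<close>.\<close>
  define m where "m = (mu 0 + mu 1) / 2"
  have "mu 0 < mu 1" using lm(1) by (simp add: strict_mono_def)
  then have m: "mu 0 < m" "m < mu 1" by (simp_all add: m_def)
  have right: "up_crossing quadrant (mu k)" if "1 \<le> k" for k
    by (rule interlacing_up_crossing[OF quadrant_cont quadrant_unbounded(1) lm m _ _ dich that])
       (simp_all add: muS lamS Ue_zero_iff Ye_zero_iff)
  define t where "t = (\<lambda>x. quadrant (- x))"
  have tc: "continuous_on UNIV t"
    unfolding t_def by (rule continuous_on_compose2[OF quadrant_cont]) (auto intro: continuous_intros)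
  have tunb: "\<exists>x>-m. C < t x" for C
  proof -
    obtain x where "x < m" "C < quadrant x" using quadrant_unbounded(2) by blast
    then show ?thesis by (intro exI[of _ "- x"]) (simp add: t_def)
  qed
  \<comment> \<open>Reflection at 0 preserves the interlacing pattern if the labels are changed by
    \<open>k \<mapsto> 1 - k\<close> for \<open>mu\<close> and by \<open>k \<mapsto> - k\<close> for
    \<open>lam\<close>.\<close>
  define mu' lam' where "mu' = (\<lambda>k. - mu (1 - k))" and "lam' = (\<lambda>k. - lam (- k))"
  have left: "up_crossing t (mu' k)" if k: "1 \<le> k" for k
  proof (rule interlacing_up_crossing[OF tc tunb, where lam = lam'])
    show "strict_mono mu'" using lm(1) by (simp add: mu'_def strict_mono_def)
    show "mu' k < lam' k \<and> lam' k < mu' (k + 1)" if "k \<noteq> 0" for k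
      using lm(2)[of "- k"] that by (simp add: mu'_def lam'_def)
    show "mu' 0 < - m" "- m < mu' 1" using m by (simp_all add: mu'_def)
    show "up_crossing t y \<or> up_crossing (\<lambda>y. - t y) y" if "t y \<in> \<int>" for y
    proof -
      have "up_crossing quadrant (- y) \<or> up_crossing (\<lambda>y. - quadrant y) (- y)" using dich that by (simp add: t_def)
      moreover have "up_crossing (\<lambda>y. - t y) y \<longleftrightarrow> up_crossing quadrant (- y)"
        using up_crossing_reflect[of "\<lambda>y. - quadrant y" y] by (simp add: t_def)
      moreover have "up_crossing t y \<longleftrightarrow> up_crossing (\<lambda>y. - quadrant y) (- y)"
        unfolding t_def by (rule up_crossing_reflect)
      ultimately show ?thesis by blast
    qed
    show "y \<in> range mu' \<longleftrightarrow> (\<exists>i::int. odd i \<and> t y = of_int i)" for y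
    proof -
      have "y \<in> range mu' \<longleftrightarrow> - y \<in> range mu"
      proof
        assume "- y \<in> range mu"
        then obtain k where "- y = mu k" by blast
        then have "y = mu' (1 - k)" by (simp add: mu'_def)
        then show "y \<in> range mu'" by blast
      qed (auto simp: mu'_def)
      then show ?thesis by (simp add: muS Ue_zero_iff t_def)
    qed
    show "y \<in> lam' ` (- {0}) \<longleftrightarrow> (\<exists>i::int. even i \<and> t y = of_int i)" for y
    proof -
      have "y \<in> lam' ` (- {0}) \<longleftrightarrow> - y \<in> lam ` (- {0})"
      proof
        assume "- y \<in> lam ` (- {0})"
        then obtain k where "k \<noteq> 0" "- y = lam k" by blast
        then have "y = lam' (- k)" "- k \<in> - {0}" by (simp_all add: lam'_def)
        then show "y \<in> lam' ` (- {0})" by blast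
      qed (auto simp: lam'_def)
      then show ?thesis by (simp add: lamS Ye_zero_iff t_def)
    qed
  qed (rule k)
  have "form_positive m"
  proof (rule form_positiveI)
    show "z \<in> \<real>" if "bdry False (sy z) (su z) = 0" for z by (rule re[OF that])
    fix l assume U: "Ue l = 0"
    then have z: "Ue l * Ye l = 0" by simp
    obtain k where k: "l = mu k" using U muS by auto
    \<comment> \<open>The crossing at \<open>l\<close> is upwards to the right of \<open>m\<close>
      and downwards to the left of it. A nonzero \<open>DD l l\<close> of the wrong sign would give
      a crossing in the opposite direction at the same point.\<close>
    show "0 < (l - m) * DD l l"
    proof (cases "1 \<le> k")
      case True
      then have "mu 1 \<le> mu k" using lm(1) by (simp add: strict_mono_less_eq)
      moreover have "\<not> DD l l < 0" using quadrant_crossing_neg[OF z] up_crossing_not_both right[OF True] k by blast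
      ultimately show ?thesis using DD0[OF z] m k by (intro mult_pos_pos) auto
    next
      case False
      then have "mu k \<le> mu 0" using lm(1) by (simp add: strict_mono_less_eq)
      moreover have "up_crossing t (mu' (1 - k))" using left False by simp
      then have "up_crossing (\<lambda>x. - quadrant x) l" unfolding t_def up_crossing_reflect by (simp add: mu'_def k)
      then have "\<not> 0 < DD l l" using quadrant_crossing_pos[OF z] up_crossing_not_both by blast
      ultimately show ?thesis using DD0[OF z] m k by (intro mult_neg_neg) auto
    qed
  qed
  then show ?thesis ..
qed

end

theorem theorem6p1:
  fixes p r :: "real \<Rightarrow> real"
  assumes "p \<in> L2" and "r \<in> L2"
  shows "almost_interlace (dom_A r) (energy_pencil p r) (dom_A_M r) (energy_pencil p r) \<longleftrightarrow>
         (\<exists>mu :: real. negative_operator (dom_A_M r) (energy_pencil p r (complex_of_real mu)))"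
proof -
  interpret pencil_data p r by unfold_locales (use assms in auto)
  show ?thesis
    unfolding dom_A_eq dom_A_M_eq negative_iff_form_positive
    using form_positive_imp_interlace interlace_imp_form_positive by blast
qed

end
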